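(* Let $k$ be a commutative ring and let $\mathcal{H}=(\mathcal{H}_L,\mathcal{H}_R,S)$ be a Hopf algebroid over base $k$-algebras $L$ and $R$ with bijective antipode $S$. Let $\mathcal{C},\mathcal{C}'$ be $\mathcal{H}$-categories and let $\mathcal{F},\mathcal{G}:\mathcal{C}\to\mathcal{C}'$ be $\mathcal{H}$-equivariant functors that are equivalent, i.e. there is a natural isomorphism $\mathcal{F}\to\mathcal{G}$ all of whose components are $\mathcal{H}$-invariant. Let $M$ be a fixed stable left-left $\mathcal{H}$-module/comodule. Then the induced maps $\mathcal{Q}_\bullet(\mathcal{F},M),\ \mathcal{Q}_\bullet(\mathcal{G},M):\mathcal{Q}_\bullet(\mathcal{C},M)\to\mathcal{Q}_\bullet(\mathcal{C}',M)$ of cyclic right $\mathcal{H}$-modules are special homotopic.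
   Context: **Bialgebroids.** A left bialgebroid $\mathcal{H}_L=(H,L,s_L,t_L,\Delta_L,\varepsilon_L)$ consists of $k$-algebras $H$ (total) and $L$ (base), algebra maps $s_L:L\to H$, $t_L:L^{op}\to H$ with commuting images, making $H$ an $L$-$L$-bimodule by $l\cdot h\cdot l'=s_L(l)t_L(l')h$, and an $L$-coring structure $(H,\Delta_L,\varepsilon_L)$, $\Delta_L(h)=h_{(1)}\otimes_L h_{(2)}$, with $h_{(1)}t_L(l)\otimes_L h_{(2)}=h_{(1)}\otimes_L h_{(2)}s_L(l)$, $\Delta_L(1)=1\otimes_L 1$, $\Delta_L(hg)=\Delta_L(h)\Delta_L(g)$, $\varepsilon_L(1)=1$, $\varepsilon_L(hs_L\varepsilon_L(g))=\varepsilon_L(hg)=\varepsilon_L(ht_L\varepsilon_L(g))$. A right bialgebroid $\mathcal{H}_R=(H,R,s_R,t_R,\Delta_R,\varepsilon_R)$ is the mirror notion: $s_R:R\to H$, $t_R:R^{op}\to H$ algebra maps with commuting images, $r\cdot h\cdot r'=h\,t_R(r)s_R(r')$, an $R$-coring $(H,\Delta_R,\varepsilon_R)$, $\Delta_R(h)=h^{(1)}\otimes_R h^{(2)}$, with $s_R(r)h^{(1)}\otimes_R h^{(2)}=h^{(1)}\otimes_R t_R(r)h^{(2)}$, $\Delta_R$ unital and multiplicative, $\varepsilon_R(1)=1$, $\varepsilon_R(s_R\varepsilon_R(h)g)=\varepsilon_R(hg)=\varepsilon_R(t_R\varepsilon_R(h)g)$. **Hopf algebroid.** $\mathcal{H}=(\mathcal{H}_L,\mathcal{H}_R,S)$: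 a left and a right bialgebroid on the same total algebra $H$ and a $k$-linear map $S:H\to H$ with $s_L\varepsilon_Lt_R=t_R$, $t_L\varepsilon_Ls_R=s_R$, $s_R\varepsilon_Rt_L=t_L$, $t_R\varepsilon_Rs_L=s_L$; $(\Delta_L\otimes_R id)\Delta_R=(id\otimes_L\Delta_R)\Delta_L$, $(\Delta_R\otimes_L id)\Delta_L=(id\otimes_R\Delta_L)\Delta_R$; $S(t_L(l)ht_R(r))=s_R(r)S(h)s_L(l)$; $S(h_{(1)})h_{(2)}=s_R\varepsilon_R(h)$, $h^{(1)}S(h^{(2)})=s_L\varepsilon_L(h)$. The algebras $L$ and $R$ are anti-isomorphic. A left (right) $\mathcal{H}$-module is a left (right) $H$-module; a left one is an $L$-$L$-bimodule by $l\cdot m\cdot l'=s_L(l)t_L(l')m$, a right one is an $R$-$R$-bimodule by $r\cdot m\cdot r'=m\,t_R(r)s_R(r')$. **$\mathcal{H}$-categories.** A small $k$-linear category $\mathcal{C}$ is an $\mathcal{H}$-category if each $\mathrm{Hom}_{\mathcal{C}}(X,Y)$ is a left $\mathcal{H}$-module (hence an $L$-$L$-bimodule, $l\cdot f\cdot l'=s_L(l)t_L(l')f$) with $l\cdot id_X=id_X\cdot l$, $h(id_X)=s_L\varepsilon_L(h)id_X=t_L\varepsilon_L(h)id_X$, and $h(fg)=(h_{(1)}f)(h_{(2)}g)$ for composable $f,g$. A morphism $f$ is $\mathcal{H}$-invariant if $h(f)=s_L\varepsilon_L(h)f=t_L\varepsilon_L(h)f$ for all $h$. An $\mathcal{H}$-equivariant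 functor is a $k$-linear functor that is $\mathcal{H}$-linear on Hom-modules. **Coefficients.** A left $\mathcal{H}$-comodule is a $k$-module $M$ that is a left comodule over the $L$-coring $(H,\Delta_L,\varepsilon_L)$, $m\mapsto m_{[-1]}\otimes_L m_{[0]}$, and over the $R$-coring $(H,\Delta_R,\varepsilon_R)$, $m\mapsto m^{[-1]}\otimes_R m^{[0]}$, with $L$-$L$ and $R$-$R$ bimodule structures related by $l\cdot m\cdot l'=\varepsilon_Rs_L(l')\cdot m\cdot\varepsilon_Rs_L(l)$, and $(id\otimes_L\lambda_R)\lambda_L=(\Delta_L\otimes_R id)\lambda_R$, $(id\otimes_R\lambda_L)\lambda_R=(\Delta_R\otimes_L id)\lambda_L$, where $\lambda_L,\lambda_R$ are the two coactions. A left-left $\mathcal{H}$-module/comodule is a left $\mathcal{H}$-module that is also a left $\mathcal{H}$-comodule (no compatibility assumed); it is stable if $m_{[-1]}m_{[0]}=m=m^{[-1]}m^{[0]}$ for all $m$. **Cyclic modules.** A cyclic right $\mathcal{H}$-module is a cyclic object in right $\mathcal{H}$-modules; a para-cyclic one drops only $\tau_n^{n+1}=id$; a pseudo para-cyclic one moreover does not require $\tau_n$ and the last face $d_n:X_n\to X_{n-1}$ to be $\mathcal{H}$-linear. For an $\mathcal{H}$-category $\mathcal{C}$ and a stable left-left $M$, the pseudo para-cyclic right $\mathcal{H}$-module $\mathcal{T}_\bullet(\mathcal{C},M)$ is $$\mathcal{T}_n(\mathcal{C},M)=\bigoplus_{(X_0,\dots,X_n)}\mathrm{Hom}(X_1,X_0)\otimes_L\cdots\otimes_L\mathrm{Hom}(X_n,X_{n-1})\otimes_L\mathrm{Hom}(X_0,X_n)\otimes_L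 M,$$ with $d_i(f_0\otimes\cdots\otimes f_n\otimes m)=f_0\otimes\cdots\otimes f_if_{i+1}\otimes\cdots\otimes f_n\otimes m$ for $0\le i\le n-1$, $d_n(f_0\otimes\cdots\otimes f_n\otimes m)=(m_{[-1]}f_n)f_0\otimes f_1\otimes\cdots\otimes f_{n-1}\otimes m_{[0]}$; $s_i$ inserts $id_{X_{i+1}}$ after $f_i$ for $0\le i\le n-1$, and $s_n$ inserts $id_{X_0}$ after $f_n$; $\tau_n(f_0\otimes\cdots\otimes f_n\otimes m)=m_{[-1]}f_n\otimes f_0\otimes\cdots\otimes f_{n-1}\otimes m_{[0]}$; and right action $(f_0\otimes\cdots\otimes f_n\otimes m)h=S^{-1}(h)_{(1)}f_0\otimes\cdots\otimes S^{-1}(h)_{(n+1)}f_n\otimes S^{-1}(h)_{(n+2)}m$ (tensors over $L$, iterated $\Delta_L$). Let $\rho_n:\mathcal{T}_n\otimes\mathcal{H}\to\mathcal{T}_n$ be the action. $\mathcal{Q}^{\mathcal{H}}_n(\mathcal{C},M)$ is the colimit over $j\in\mathbb{N}$, in $R$-$R$-bimodules, of the coequalizers $\mathcal{T}_n\to\mathcal{T}_n^{j}$ of the pairs $\rho_n(\tau_n^j\otimes id)$, $\tau_n^j\rho_n$ (i.e. the universal quotient of $\mathcal{T}_n$ coequalizing all these pairs); it is a para-cyclic right $\mathcal{H}$-module with induced structure. $\mathcal{Q}_n(\mathcal{C},M)$ is the equalizer of $\tau_n^{n+1}$ and $id$ on $\mathcal{Q}^{\mathcal{H}}_n(\mathcal{C},M)$;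 $\mathcal{Q}_\bullet(\mathcal{C},M)$ is a cyclic right $\mathcal{H}$-module. An $\mathcal{H}$-equivariant functor $\mathcal{F}$ induces $\mathcal{Q}_\bullet(\mathcal{F},M)$ by applying $\mathcal{F}$ to each $f_i$. **Special homotopy.** Let $\mathcal{S}$ be the category with objects $0,1$ and exactly two non-identity morphisms $0\to1$, $1\to0$ (mutually inverse). $L\mathcal{S}$ has the same objects and $\mathrm{Hom}_{L\mathcal{S}}(i,j)$ the free $L$-module on $\mathrm{Hom}_{\mathcal{S}}(i,j)$; it is an $\mathcal{H}$-category via the map $s_L\varepsilon_L$ ($h$ acts as $s_L\varepsilon_L(h)$). Put $CC_\bullet(L\mathcal{S})=\mathcal{T}_\bullet(L\mathcal{S},L)=\mathcal{Q}_\bullet(L\mathcal{S},L)$, a cyclic $\mathcal{H}$-module. A semi-cyclic map of cyclic $\mathcal{H}$-modules is a map of graded $\mathcal{H}$-modules commuting with faces and cyclic operators (not necessarily with degeneracies). Semi-cyclic maps $f,g:X_\bullet\to Y_\bullet$ are special homotopic if there is a semi-cyclic $\mathcal{H}$-module map $\hbar_\bullet:X_\bullet\otimes CC_\bullet(L\mathcal{S})\to Y_\bullet$ (degreewise tensor product, diagonal structure maps) with $\hbar_\bullet\varepsilon_0=f$ and $\hbar_\bullet\varepsilon_1=g$, where $\varepsilon_i(\Phi)=\Phi\otimes_L(id_i,\dots,id_i)$.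
   Formalization: τ_n is not well defined for noncommutative L (τ_0(l⊗m)=ml on L⊗_L L), so τ_n is taken as an additive relation, Q^H as the universal coequalizing quotient of T also closed under faces and τ with d_nτ_n=τ_{n-1}d_{n-1}, and CC(LS) as Q(LS,L). *)

theory Defs
  imports Complex_Main "HOL-Library.Poly_Mapping"
begin

section \<open>Tensor products\<close>

text \<open>
  The free abelian group on \<open>'x\<close> is the type \<open>'x \<Rightarrow>\<^sub>0 int\<close>. Every tensor product is the quotient
  of such a group by the subgroup generated by the usual relations. Sweedler sums
  \<open>\<Sum> a\<^sub>i \<otimes> b\<^sub>i\<close> are lists of pairs (negative terms are absorbed, \<open>- (a \<otimes> b) = (- a) \<otimes> b\<close>); two
  lists are compared by \<open>tens_eq\<close>, that is, as elements of the tensor product.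
\<close>

inductive_set additive_span :: "'a::ab_group_add set \<Rightarrow> 'a set" for S where
  zero: "0 \<in> additive_span S"
| base: "x \<in> S \<Longrightarrow> x \<in> additive_span S"
| diff: "x \<in> additive_span S \<Longrightarrow> y \<in> additive_span S \<Longrightarrow> x - y \<in> additive_span S"

definition formal_sum :: "'x list \<Rightarrow> ('x \<Rightarrow>\<^sub>0 int)" where
  "formal_sum xs = (\<Sum>x\<leftarrow>xs. frag_of x)"

text \<open>\<open>A \<otimes>\<^sub>Q B\<close>, for a right action \<open>ra q a = a \<cdot> q\<close> and a left action \<open>lb q b = q \<cdot> b\<close>.\<close>

definition tens_rel ::
    "('q \<Rightarrow> 'a \<Rightarrow> 'a) \<Rightarrow> ('q \<Rightarrow> 'b \<Rightarrow> 'b) \<Rightarrow> ('a::ab_group_add \<times> 'b::ab_group_add \<Rightarrow>\<^sub>0 int) set" where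
  "tens_rel ra lb = additive_span (
     {frag_of (a + a', b) - frag_of (a, b) - frag_of (a', b) | a a' b. True} \<union>
     {frag_of (a, b + b') - frag_of (a, b) - frag_of (a, b') | a b b'. True} \<union>
     {frag_of (ra q a, b) - frag_of (a, lb q b) | q a b. True})"

definition tens_eq ::
    "('q \<Rightarrow> 'a \<Rightarrow> 'a) \<Rightarrow> ('q \<Rightarrow> 'b \<Rightarrow> 'b) \<Rightarrow> ('a::ab_group_add \<times> 'b::ab_group_add) list \<Rightarrow> ('a \<times> 'b) list \<Rightarrow> bool" where
  "tens_eq ra lb s t \<longleftrightarrow> formal_sum s - formal_sum t \<in> tens_rel ra lb"

text \<open>\<open>A \<otimes>\<^sub>P B \<otimes>\<^sub>Q C\<close>.\<close>

definition tens3_rel ::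
    "('p \<Rightarrow> 'a \<Rightarrow> 'a) \<Rightarrow> ('p \<Rightarrow> 'b \<Rightarrow> 'b) \<Rightarrow> ('q \<Rightarrow> 'b \<Rightarrow> 'b) \<Rightarrow> ('q \<Rightarrow> 'c \<Rightarrow> 'c) \<Rightarrow>
      ('a::ab_group_add \<times> 'b::ab_group_add \<times> 'c::ab_group_add \<Rightarrow>\<^sub>0 int) set" where
  "tens3_rel ra lb rb lc = additive_span (
     {frag_of (a + a', b, c) - frag_of (a, b, c) - frag_of (a', b, c) | a a' b c. True} \<union>
     {frag_of (a, b + b', c) - frag_of (a, b, c) - frag_of (a, b', c) | a b b' c. True} \<union>
     {frag_of (a, b, c + c') - frag_of (a, b, c) - frag_of (a, b, c') | a b c c'. True} \<union>
     {frag_of (ra p a, b, c) - frag_of (a, lb p b, c) | p a b c. True} \<union>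
     {frag_of (a, rb q b, c) - frag_of (a, b, lc q c) | q a b c. True})"

definition tens3_eq where
  "tens3_eq ra lb rb lc s t \<longleftrightarrow> formal_sum s - formal_sum t \<in> tens3_rel ra lb rb lc"


section \<open>Hopf algebroids\<close>

text \<open>
  Algebras are types of sort \<open>{ring, monoid_mult}\<close>: unital rings in which \<open>0 = 1\<close> is allowed.
\<close>

locale k_algebra = module sc
  for sc :: "'k::comm_ring_1 \<Rightarrow> 'a::{ring,monoid_mult} \<Rightarrow> 'a" +
  assumes sc_mult_left: "sc c (x * y) = sc c x * y"
    and sc_mult_right: "sc c (x * y) = x * sc c y"

record ('k, 'l, 'r, 'h) hopf_data =
  kH :: "'k \<Rightarrow> 'h \<Rightarrow> 'h"
  kL :: "'k \<Rightarrow> 'l \<Rightarrow> 'l"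
  kR :: "'k \<Rightarrow> 'r \<Rightarrow> 'r"
  sL :: "'l \<Rightarrow> 'h"
  tL :: "'l \<Rightarrow> 'h"
  DL :: "'h \<Rightarrow> ('h \<times> 'h) list"
  eL :: "'h \<Rightarrow> 'l"
  sR :: "'r \<Rightarrow> 'h"
  tR :: "'r \<Rightarrow> 'h"
  DR :: "'h \<Rightarrow> ('h \<times> 'h) list"
  eR :: "'h \<Rightarrow> 'r"
  anti :: "'h \<Rightarrow> 'h"

text \<open>
  The values of \<open>DL\<close> and \<open>DR\<close> are representatives of elements of \<open>H \<otimes>\<^sub>L H\<close> and \<open>H \<otimes>\<^sub>R H\<close>. The
  bimodule structures on \<open>H\<close> are \<open>l \<cdot> h \<cdot> l' = s\<^sub>L(l) t\<^sub>L(l') h\<close> and \<open>r \<cdot> h \<cdot> r' = h t\<^sub>R(r) s\<^sub>R(r')\<close>.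
\<close>

definition HlL where "HlL \<H> l h = sL \<H> l * h"
definition HrL where "HrL \<H> l h = tL \<H> l * h"
definition HlR where "HlR \<H> r h = h * tR \<H> r"
definition HrR where "HrR \<H> r h = h * sR \<H> r"

locale left_bialgebroid =
  fixes \<H> :: "('k::comm_ring_1, 'l::{ring,monoid_mult}, 'r, 'h::{ring,monoid_mult}) hopf_data"
  assumes algH: "k_algebra (kH \<H>)" and algL: "k_algebra (kL \<H>)"
    and sL_hom: "additive (sL \<H>)" "sL \<H> 1 = 1" "sL \<H> (a * b) = sL \<H> a * sL \<H> b"
      "sL \<H> (kL \<H> c a) = kH \<H> c (sL \<H> a)"
    and tL_antihom: "additive (tL \<H>)" "tL \<H> 1 = 1" "tL \<H> (a * b) = tL \<H> b * tL \<H> a"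
      "tL \<H> (kL \<H> c a) = kH \<H> c (tL \<H> a)"
    and sL_tL_commute: "sL \<H> a * tL \<H> b = tL \<H> b * sL \<H> a"
    and DL_add: "tens_eq (HrL \<H>) (HlL \<H>) (DL \<H> (h + g)) (DL \<H> h @ DL \<H> g)"
    and DL_bimodule: "tens_eq (HrL \<H>) (HlL \<H>)
      (DL \<H> (sL \<H> a * tL \<H> b * h)) [(sL \<H> a * x, tL \<H> b * y). (x, y) \<leftarrow> DL \<H> h]"
    and eL_add: "additive (eL \<H>)"
    and eL_bimodule: "eL \<H> (sL \<H> a * tL \<H> b * h) = a * eL \<H> h * b"
    and DL_coassoc: "tens3_eq (HrL \<H>) (HlL \<H>) (HrL \<H>) (HlL \<H>)
      [(x1, x2, y). (x, y) \<leftarrow> DL \<H> h, (x1, x2) \<leftarrow> DL \<H> x]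
      [(x, y1, y2). (x, y) \<leftarrow> DL \<H> h, (y1, y2) \<leftarrow> DL \<H> y]"
    and eL_counit: "(\<Sum>(x, y)\<leftarrow>DL \<H> h. sL \<H> (eL \<H> x) * y) = h"
      "(\<Sum>(x, y)\<leftarrow>DL \<H> h. tL \<H> (eL \<H> y) * x) = h"
    and DL_takeuchi: "tens_eq (HrL \<H>) (HlL \<H>)
      [(x * tL \<H> a, y). (x, y) \<leftarrow> DL \<H> h] [(x, y * sL \<H> a). (x, y) \<leftarrow> DL \<H> h]"
    and DL_one: "tens_eq (HrL \<H>) (HlL \<H>) (DL \<H> 1) [(1, 1)]"
    and DL_mult: "tens_eq (HrL \<H>) (HlL \<H>)
      (DL \<H> (h * g)) [(x * x', y * y'). (x, y) \<leftarrow> DL \<H> h, (x', y') \<leftarrow> DL \<H> g]"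
    and eL_one: "eL \<H> 1 = 1"
    and eL_mult: "eL \<H> (h * sL \<H> (eL \<H> g)) = eL \<H> (h * g)"
      "eL \<H> (h * tL \<H> (eL \<H> g)) = eL \<H> (h * g)"

locale right_bialgebroid =
  fixes \<H> :: "('k::comm_ring_1, 'l, 'r::{ring,monoid_mult}, 'h::{ring,monoid_mult}) hopf_data"
  assumes algH: "k_algebra (kH \<H>)" and algR: "k_algebra (kR \<H>)"
    and sR_hom: "additive (sR \<H>)" "sR \<H> 1 = 1" "sR \<H> (a * b) = sR \<H> a * sR \<H> b"
      "sR \<H> (kR \<H> c a) = kH \<H> c (sR \<H> a)"
    and tR_antihom: "additive (tR \<H>)" "tR \<H> 1 = 1" "tR \<H> (a * b) = tR \<H> b * tR \<H> a"
      "tR \<H> (kR \<H> c a) = kH \<H> c (tR \<H> a)"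
    and sR_tR_commute: "sR \<H> a * tR \<H> b = tR \<H> b * sR \<H> a"
    and DR_add: "tens_eq (HrR \<H>) (HlR \<H>) (DR \<H> (h + g)) (DR \<H> h @ DR \<H> g)"
    and DR_bimodule: "tens_eq (HrR \<H>) (HlR \<H>)
      (DR \<H> (h * tR \<H> a * sR \<H> b)) [(x * tR \<H> a, y * sR \<H> b). (x, y) \<leftarrow> DR \<H> h]"
    and eR_add: "additive (eR \<H>)"
    and eR_bimodule: "eR \<H> (h * tR \<H> a * sR \<H> b) = a * eR \<H> h * b"
    and DR_coassoc: "tens3_eq (HrR \<H>) (HlR \<H>) (HrR \<H>) (HlR \<H>)
      [(x1, x2, y). (x, y) \<leftarrow> DR \<H> h, (x1, x2) \<leftarrow> DR \<H> x]
      [(x, y1, y2). (x, y) \<leftarrow> DR \<H> h, (y1, y2) \<leftarrow> DR \<H> y]"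
    and eR_counit: "(\<Sum>(x, y)\<leftarrow>DR \<H> h. y * tR \<H> (eR \<H> x)) = h"
      "(\<Sum>(x, y)\<leftarrow>DR \<H> h. x * sR \<H> (eR \<H> y)) = h"
    and DR_takeuchi: "tens_eq (HrR \<H>) (HlR \<H>)
      [(sR \<H> a * x, y). (x, y) \<leftarrow> DR \<H> h] [(x, tR \<H> a * y). (x, y) \<leftarrow> DR \<H> h]"
    and DR_one: "tens_eq (HrR \<H>) (HlR \<H>) (DR \<H> 1) [(1, 1)]"
    and DR_mult: "tens_eq (HrR \<H>) (HlR \<H>)
      (DR \<H> (h * g)) [(x * x', y * y'). (x, y) \<leftarrow> DR \<H> h, (x', y') \<leftarrow> DR \<H> g]"
    and eR_one: "eR \<H> 1 = 1"
    and eR_mult: "eR \<H> (sR \<H> (eR \<H> h) * g) = eR \<H> (h * g)"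
      "eR \<H> (tR \<H> (eR \<H> h) * g) = eR \<H> (h * g)"

locale hopf_algebroid = left_bialgebroid \<H> + right_bialgebroid \<H>
  for \<H> :: "('k::comm_ring_1, 'l::{ring,monoid_mult}, 'r::{ring,monoid_mult},
    'h::{ring,monoid_mult}) hopf_data" +
  assumes units: "sL \<H> (eL \<H> (tR \<H> r)) = tR \<H> r" "tL \<H> (eL \<H> (sR \<H> r)) = sR \<H> r"
      "sR \<H> (eR \<H> (tL \<H> l)) = tL \<H> l" "tR \<H> (eR \<H> (sL \<H> l)) = sL \<H> l"
    and mixed_LR: "tens3_eq (HrL \<H>) (HlL \<H>) (HrR \<H>) (HlR \<H>)
      [(x1, x2, y). (x, y) \<leftarrow> DR \<H> h, (x1, x2) \<leftarrow> DL \<H> x]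
      [(x, y1, y2). (x, y) \<leftarrow> DL \<H> h, (y1, y2) \<leftarrow> DR \<H> y]"
    and mixed_RL: "tens3_eq (HrR \<H>) (HlR \<H>) (HrL \<H>) (HlL \<H>)
      [(x1, x2, y). (x, y) \<leftarrow> DL \<H> h, (x1, x2) \<leftarrow> DR \<H> x]
      [(x, y1, y2). (x, y) \<leftarrow> DR \<H> h, (y1, y2) \<leftarrow> DL \<H> y]"
    and anti_add: "additive (anti \<H>)"
    and anti_scale: "anti \<H> (kH \<H> c h) = kH \<H> c (anti \<H> h)"
    and anti_twist: "anti \<H> (tL \<H> l * h * tR \<H> r) = sR \<H> r * anti \<H> h * sL \<H> l"
    and anti_left: "(\<Sum>(x, y)\<leftarrow>DL \<H> h. anti \<H> x * y) = sR \<H> (eR \<H> h)"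
    and anti_right: "(\<Sum>(x, y)\<leftarrow>DR \<H> h. x * anti \<H> y) = sL \<H> (eL \<H> h)"


section \<open>Coefficients\<close>

record ('r, 'h, 'm) coeff =
  mact :: "'h \<Rightarrow> 'm \<Rightarrow> 'm"
  mlR :: "'r \<Rightarrow> 'm \<Rightarrow> 'm"
  mrR :: "'r \<Rightarrow> 'm \<Rightarrow> 'm"
  lamL :: "'m \<Rightarrow> ('h \<times> 'm) list"
  lamR :: "'m \<Rightarrow> ('h \<times> 'm) list"

text \<open>
  The \<open>L\<close>-\<open>L\<close>-bimodule structure of a left-left module/comodule is \<open>l \<cdot> m \<cdot> l' = s\<^sub>L(l) t\<^sub>L(l') m\<close>; it
  is the one underlying both the module and the comodule, and the \<open>k\<close>-module structure is \<open>c m = (c 1) m\<close>. \<open>mlR r m = r \<cdot> m\<close> and \<open>mrR r m = m \<cdot> r\<close>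
  form the \<open>R\<close>-\<open>R\<close>-bimodule structure. \<open>lamL\<close> and \<open>lamR\<close> give representatives of the coactions.
\<close>

definition MlL where "MlL \<H> M l m = mact M (sL \<H> l) m"
definition MrL where "MrL \<H> M l m = mact M (tL \<H> l) m"

abbreviation "eq_HM_L \<H> M \<equiv> tens_eq (HrL \<H>) (MlL \<H> M)"
abbreviation "eq_HM_R \<H> M \<equiv> tens_eq (HrR \<H>) (mlR M)"

locale module_comodule =
  fixes \<H> :: "('k::comm_ring_1, 'l::{ring,monoid_mult}, 'r::{ring,monoid_mult},
      'h::{ring,monoid_mult}) hopf_data"
    and M :: "('r, 'h, 'm::ab_group_add) coeff"
  assumes mact_add: "mact M h (m + n) = mact M h m + mact M h n"
      "mact M (h + g) m = mact M h m + mact M g m"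
    and mact_mult: "mact M (h * g) m = mact M h (mact M g m)" "mact M 1 m = m"
    and mlR: "additive (mlR M r)" "mlR M (r + r') m = mlR M r m + mlR M r' m"
      "mlR M 1 m = m" "mlR M (r * r') m = mlR M r (mlR M r' m)"
    and mrR: "additive (mrR M r)" "mrR M (r + r') m = mrR M r m + mrR M r' m"
      "mrR M 1 m = m" "mrR M (r * r') m = mrR M r' (mrR M r m)"
    and mR_bimodule: "mlR M r (mrR M r' m) = mrR M r' (mlR M r m)"
    \<comment> \<open>\<open>l \<cdot> m \<cdot> l' = \<epsilon>\<^sub>R s\<^sub>L(l') \<cdot> m \<cdot> \<epsilon>\<^sub>R s\<^sub>L(l)\<close>\<close>
    and bimodules_related: "MlL \<H> M l (MrL \<H> M l' m) =
      mlR M (eR \<H> (sL \<H> l')) (mrR M (eR \<H> (sL \<H> l)) m)"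
    and lamL_add: "eq_HM_L \<H> M (lamL M (m + n)) (lamL M m @ lamL M n)"
    and lamL_linear: "eq_HM_L \<H> M (lamL M (MlL \<H> M l m)) [(HlL \<H> l x, n). (x, n) \<leftarrow> lamL M m]"
    and lamL_counit: "(\<Sum>(x, n)\<leftarrow>lamL M m. MlL \<H> M (eL \<H> x) n) = m"
    and lamL_coassoc: "tens3_eq (HrL \<H>) (HlL \<H>) (HrL \<H>) (MlL \<H> M)
      [(x1, x2, n). (x, n) \<leftarrow> lamL M m, (x1, x2) \<leftarrow> DL \<H> x]
      [(x, y, p). (x, n) \<leftarrow> lamL M m, (y, p) \<leftarrow> lamL M n]"
    and lamR_add: "eq_HM_R \<H> M (lamR M (m + n)) (lamR M m @ lamR M n)"
    and lamR_linear: "eq_HM_R \<H> M (lamR M (mlR M r m)) [(HlR \<H> r x, n). (x, n) \<leftarrow> lamR M m]"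
    and lamR_counit: "(\<Sum>(x, n)\<leftarrow>lamR M m. mlR M (eR \<H> x) n) = m"
    and lamR_coassoc: "tens3_eq (HrR \<H>) (HlR \<H>) (HrR \<H>) (mlR M)
      [(x1, x2, n). (x, n) \<leftarrow> lamR M m, (x1, x2) \<leftarrow> DR \<H> x]
      [(x, y, p). (x, n) \<leftarrow> lamR M m, (y, p) \<leftarrow> lamR M n]"
    \<comment> \<open>Each coaction is linear over the other base algebra; this is what makes
      \<open>id \<otimes>\<^sub>L \<lambda>\<^sub>R\<close> and \<open>id \<otimes>\<^sub>R \<lambda>\<^sub>L\<close> well defined.\<close>
    and lamR_L_linear: "eq_HM_R \<H> M (lamR M (MlL \<H> M l m)) [(HlL \<H> l x, n). (x, n) \<leftarrow> lamR M m]"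
    and lamL_R_linear: "eq_HM_L \<H> M (lamL M (mlR M r m)) [(HlR \<H> r x, n). (x, n) \<leftarrow> lamL M m]"
    and mixed_coassoc_LR: "tens3_eq (HrL \<H>) (HlL \<H>) (HrR \<H>) (mlR M)
      [(x, y, p). (x, n) \<leftarrow> lamL M m, (y, p) \<leftarrow> lamR M n]
      [(x1, x2, n). (x, n) \<leftarrow> lamR M m, (x1, x2) \<leftarrow> DL \<H> x]"
    and mixed_coassoc_RL: "tens3_eq (HrR \<H>) (HlR \<H>) (HrL \<H>) (MlL \<H> M)
      [(x, y, p). (x, n) \<leftarrow> lamR M m, (y, p) \<leftarrow> lamL M n]
      [(x1, x2, n). (x, n) \<leftarrow> lamL M m, (x1, x2) \<leftarrow> DR \<H> x]"

text \<open>
  \<open>h \<otimes> m \<mapsto> h m\<close> need not be balanced over \<open>L\<close> or \<open>R\<close>, so stability asks for representatives of the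
  coactions that multiply out to \<open>m\<close>. For a balanced product this is the condition on all of them.
\<close>

definition is_stable where
  "is_stable \<H> M \<longleftrightarrow> (\<forall>m.
     (\<exists>t. eq_HM_L \<H> M t (lamL M m) \<and> (\<Sum>(x, n)\<leftarrow>t. mact M x n) = m) \<and>
     (\<exists>t. eq_HM_R \<H> M t (lamR M m) \<and> (\<Sum>(x, n)\<leftarrow>t. mact M x n) = m))"


section \<open>Categories with Hopf algebroid action\<close>

text \<open>
  \<open>Comp C X Y Z f g\<close> is \<open>f g\<close> for \<open>g : X \<rightarrow> Y\<close> and \<open>f : Y \<rightarrow> Z\<close>. All Hom-modules are subgroups of one
  abelian group \<open>'f\<close> (such as their direct sum); all other structure may depend on the objects.
\<close>

record ('o, 'f, 'h) hcat =
  Ob :: "'o set"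
  Hom :: "'o \<Rightarrow> 'o \<Rightarrow> 'f set"
  Idm :: "'o \<Rightarrow> 'f"
  Comp :: "'o \<Rightarrow> 'o \<Rightarrow> 'o \<Rightarrow> 'f \<Rightarrow> 'f \<Rightarrow> 'f"
  Act :: "'o \<Rightarrow> 'o \<Rightarrow> 'h \<Rightarrow> 'f \<Rightarrow> 'f"

text \<open>The \<open>k\<close>-module structure on \<open>Hom X Y\<close> is the one induced by \<open>k \<rightarrow> H\<close>, \<open>c \<mapsto> c 1\<close>.\<close>

locale h_category =
  fixes \<H> :: "('k::comm_ring_1, 'l::{ring,monoid_mult}, 'r::{ring,monoid_mult},
      'h::{ring,monoid_mult}) hopf_data"
    and C :: "('o, 'f::ab_group_add, 'h) hcat"
  assumes Hom_subgroup: "\<lbrakk>X \<in> Ob C; Y \<in> Ob C\<rbrakk> \<Longrightarrow> 0 \<in> Hom C X Y"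
      "\<lbrakk>X \<in> Ob C; Y \<in> Ob C; f \<in> Hom C X Y; g \<in> Hom C X Y\<rbrakk> \<Longrightarrow> f - g \<in> Hom C X Y"
    and Id_Hom: "X \<in> Ob C \<Longrightarrow> Idm C X \<in> Hom C X X"
    and Comp_Hom: "\<lbrakk>X \<in> Ob C; Y \<in> Ob C; Z \<in> Ob C; f \<in> Hom C Y Z; g \<in> Hom C X Y\<rbrakk>
      \<Longrightarrow> Comp C X Y Z f g \<in> Hom C X Z"
    and Comp_assoc: "\<lbrakk>W \<in> Ob C; X \<in> Ob C; Y \<in> Ob C; Z \<in> Ob C;
        f \<in> Hom C Y Z; g \<in> Hom C X Y; e \<in> Hom C W X\<rbrakk>
      \<Longrightarrow> Comp C W X Z (Comp C X Y Z f g) e = Comp C W Y Z f (Comp C W X Y g e)"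
    and Comp_Id: "\<lbrakk>X \<in> Ob C; Y \<in> Ob C; f \<in> Hom C X Y\<rbrakk> \<Longrightarrow> Comp C X X Y f (Idm C X) = f"
      "\<lbrakk>X \<in> Ob C; Y \<in> Ob C; f \<in> Hom C X Y\<rbrakk> \<Longrightarrow> Comp C X Y Y (Idm C Y) f = f"
    and Comp_add: "\<lbrakk>X \<in> Ob C; Y \<in> Ob C; Z \<in> Ob C; f \<in> Hom C Y Z; f' \<in> Hom C Y Z; g \<in> Hom C X Y\<rbrakk>
      \<Longrightarrow> Comp C X Y Z (f + f') g = Comp C X Y Z f g + Comp C X Y Z f' g"
      "\<lbrakk>X \<in> Ob C; Y \<in> Ob C; Z \<in> Ob C; f \<in> Hom C Y Z; g \<in> Hom C X Y; g' \<in> Hom C X Y\<rbrakk>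
      \<Longrightarrow> Comp C X Y Z f (g + g') = Comp C X Y Z f g + Comp C X Y Z f g'"
    and Comp_scale: "\<lbrakk>X \<in> Ob C; Y \<in> Ob C; Z \<in> Ob C; f \<in> Hom C Y Z; g \<in> Hom C X Y\<rbrakk>
      \<Longrightarrow> Comp C X Y Z (Act C Y Z (kH \<H> c 1) f) g = Act C X Z (kH \<H> c 1) (Comp C X Y Z f g)"
      "\<lbrakk>X \<in> Ob C; Y \<in> Ob C; Z \<in> Ob C; f \<in> Hom C Y Z; g \<in> Hom C X Y\<rbrakk>
      \<Longrightarrow> Comp C X Y Z f (Act C X Y (kH \<H> c 1) g) = Act C X Z (kH \<H> c 1) (Comp C X Y Z f g)"
    and Act_Hom: "\<lbrakk>X \<in> Ob C; Y \<in> Ob C; f \<in> Hom C X Y\<rbrakk> \<Longrightarrow> Act C X Y h f \<in> Hom C X Y"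
    and Act_add: "\<lbrakk>X \<in> Ob C; Y \<in> Ob C; f \<in> Hom C X Y; g \<in> Hom C X Y\<rbrakk>
      \<Longrightarrow> Act C X Y h (f + g) = Act C X Y h f + Act C X Y h g"
      "\<lbrakk>X \<in> Ob C; Y \<in> Ob C; f \<in> Hom C X Y\<rbrakk>
      \<Longrightarrow> Act C X Y (h + h') f = Act C X Y h f + Act C X Y h' f"
    and Act_mult: "\<lbrakk>X \<in> Ob C; Y \<in> Ob C; f \<in> Hom C X Y\<rbrakk> \<Longrightarrow> Act C X Y 1 f = f"
      "\<lbrakk>X \<in> Ob C; Y \<in> Ob C; f \<in> Hom C X Y\<rbrakk>
      \<Longrightarrow> Act C X Y (h * h') f = Act C X Y h (Act C X Y h' f)"
    and Id_central: "X \<in> Ob C \<Longrightarrow> Act C X X (sL \<H> l) (Idm C X) = Act C X X (tL \<H> l) (Idm C X)"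
    and Act_Id: "X \<in> Ob C \<Longrightarrow> Act C X X h (Idm C X) = Act C X X (sL \<H> (eL \<H> h)) (Idm C X)"
      "X \<in> Ob C \<Longrightarrow> Act C X X h (Idm C X) = Act C X X (tL \<H> (eL \<H> h)) (Idm C X)"
    \<comment> \<open>\<open>h(f g) = (h\<^sub>(\<^sub>1\<^sub>)f)(h\<^sub>(\<^sub>2\<^sub>)g)\<close> for all representatives of \<open>\<Delta>\<^sub>L(h)\<close>: the right-hand side is
      a function of \<open>\<Delta>\<^sub>L(h) \<in> H \<otimes>\<^sub>L H\<close>\<close>
    and Act_Comp: "\<lbrakk>X \<in> Ob C; Y \<in> Ob C; Z \<in> Ob C; f \<in> Hom C Y Z; g \<in> Hom C X Y;
        tens_eq (HrL \<H>) (HlL \<H>) t (DL \<H> h)\<rbrakk>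
      \<Longrightarrow> Act C X Z h (Comp C X Y Z f g) = (\<Sum>(a, b)\<leftarrow>t. Comp C X Y Z (Act C Y Z a f) (Act C X Y b g))"

definition h_invariant where
  "h_invariant \<H> C X Y f \<longleftrightarrow> (\<forall>h.
     Act C X Y h f = Act C X Y (sL \<H> (eL \<H> h)) f \<and>
     Act C X Y h f = Act C X Y (tL \<H> (eL \<H> h)) f)"

record ('o, 'f, 'o1, 'f1) hfunctor =
  FOb :: "'o \<Rightarrow> 'o1"
  FMap :: "'o \<Rightarrow> 'o \<Rightarrow> 'f \<Rightarrow> 'f1"

text \<open>\<open>k\<close>-linearity is the special case \<open>h = c 1\<close> of \<open>FMap_Act\<close>.\<close>

locale equivariant_functor =
  fixes C :: "('o, 'f::ab_group_add, 'h) hcat" and C' :: "('o1, 'f1::ab_group_add, 'h) hcat"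
    and F :: "('o, 'f, 'o1, 'f1) hfunctor"
  assumes FOb: "X \<in> Ob C \<Longrightarrow> FOb F X \<in> Ob C'"
    and FMap_Hom: "\<lbrakk>X \<in> Ob C; Y \<in> Ob C; f \<in> Hom C X Y\<rbrakk>
      \<Longrightarrow> FMap F X Y f \<in> Hom C' (FOb F X) (FOb F Y)"
    and FMap_Id: "X \<in> Ob C \<Longrightarrow> FMap F X X (Idm C X) = Idm C' (FOb F X)"
    and FMap_Comp: "\<lbrakk>X \<in> Ob C; Y \<in> Ob C; Z \<in> Ob C; f \<in> Hom C Y Z; g \<in> Hom C X Y\<rbrakk>
      \<Longrightarrow> FMap F X Z (Comp C X Y Z f g) =
        Comp C' (FOb F X) (FOb F Y) (FOb F Z) (FMap F Y Z f) (FMap F X Y g)"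
    and FMap_add: "\<lbrakk>X \<in> Ob C; Y \<in> Ob C; f \<in> Hom C X Y; g \<in> Hom C X Y\<rbrakk>
      \<Longrightarrow> FMap F X Y (f + g) = FMap F X Y f + FMap F X Y g"
    and FMap_Act: "\<lbrakk>X \<in> Ob C; Y \<in> Ob C; f \<in> Hom C X Y\<rbrakk>
      \<Longrightarrow> FMap F X Y (Act C X Y h f) = Act C' (FOb F X) (FOb F Y) h (FMap F X Y f)"

definition equivalent_functors where
  "equivalent_functors \<H> C C' F G \<longleftrightarrow> (\<exists>\<eta>.
     (\<forall>X\<in>Ob C. \<eta> X \<in> Hom C' (FOb F X) (FOb G X) \<and>
        h_invariant \<H> C' (FOb F X) (FOb G X) (\<eta> X) \<and>
        (\<exists>\<theta>\<in>Hom C' (FOb G X) (FOb F X).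
           Comp C' (FOb F X) (FOb G X) (FOb F X) \<theta> (\<eta> X) = Idm C' (FOb F X) \<and>
           Comp C' (FOb G X) (FOb F X) (FOb G X) (\<eta> X) \<theta> = Idm C' (FOb G X))) \<and>
     (\<forall>X\<in>Ob C. \<forall>Y\<in>Ob C. \<forall>f\<in>Hom C X Y.
        Comp C' (FOb F X) (FOb F Y) (FOb G Y) (\<eta> Y) (FMap F X Y f) =
        Comp C' (FOb F X) (FOb G X) (FOb G Y) (FMap G X Y f) (\<eta> X)))"


section \<open>The pseudo para-cyclic module \<open>\<T>\<close>\<close>

text \<open>
  \<open>(Xs, fs, m)\<close> stands for \<open>f\<^sub>0 \<otimes> \<dots> \<otimes> f\<^sub>n \<otimes> m\<close> in the summand indexed by \<open>(X\<^sub>0, \<dots>, X\<^sub>n)\<close>. Indices are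
  read modulo \<open>n + 1\<close>, so \<open>f\<^sub>i : X\<^sub>i\<^sub>+\<^sub>1 \<rightarrow> X\<^sub>i\<close> for all \<open>i \<le> n\<close>. \<open>\<T>\<^sub>n\<close> is \<open>chains C n\<close> modulo \<open>chain_rel\<close>.
\<close>

type_synonym ('o, 'f, 'm) chain = "('o list \<times> 'f list \<times> 'm) \<Rightarrow>\<^sub>0 int"

definition src :: "nat \<Rightarrow> 'o list \<Rightarrow> nat \<Rightarrow> 'o" where
  "src n Xs i = Xs ! (Suc i mod Suc n)"

definition tensors :: "('o, 'f, 'h) hcat \<Rightarrow> nat \<Rightarrow> ('o list \<times> 'f list \<times> 'm) set" where
  "tensors C n = {(Xs, fs, m). length Xs = Suc n \<and> length fs = Suc n \<and> set Xs \<subseteq> Ob C \<and>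
     (\<forall>i\<le>n. fs ! i \<in> Hom C (src n Xs i) (Xs ! i))}"

definition chains :: "('o, 'f, 'h) hcat \<Rightarrow> nat \<Rightarrow> ('o, 'f, 'm) chain set" where
  "chains C n = {x. Poly_Mapping.keys x \<subseteq> tensors C n}"

definition chain_rel :: "('k, 'l, 'r, 'h) hopf_data \<Rightarrow> ('o, 'f::ab_group_add, 'h) hcat \<Rightarrow>
    ('r, 'h, 'm::ab_group_add) coeff \<Rightarrow> nat \<Rightarrow> ('o, 'f, 'm) chain set" where
  "chain_rel \<H> C M n = additive_span (
     {frag_of (Xs, fs[i := f + g], m) - frag_of (Xs, fs[i := f], m) - frag_of (Xs, fs[i := g], m)
        | Xs fs m i f g. (Xs, fs, m) \<in> tensors C n \<and> i \<le> n \<and>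
            f \<in> Hom C (src n Xs i) (Xs ! i) \<and> g \<in> Hom C (src n Xs i) (Xs ! i)} \<union>
     {frag_of (Xs, fs, m + m') - frag_of (Xs, fs, m) - frag_of (Xs, fs, m')
        | Xs fs m m'. (Xs, fs, m) \<in> tensors C n} \<union>
     {frag_of (Xs, fs[i := Act C (src n Xs i) (Xs ! i) (tL \<H> l) (fs ! i)], m) -
      frag_of (Xs, fs[Suc i := Act C (src n Xs (Suc i)) (Xs ! Suc i) (sL \<H> l) (fs ! Suc i)], m)
        | Xs fs m i l. (Xs, fs, m) \<in> tensors C n \<and> i < n} \<union>
     {frag_of (Xs, fs[n := Act C (src n Xs n) (Xs ! n) (tL \<H> l) (fs ! n)], m) -
      frag_of (Xs, fs, MlL \<H> M l m)
        | Xs fs m l. (Xs, fs, m) \<in> tensors C n})"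

fun iterD :: "('k, 'l, 'r, 'h) hopf_data \<Rightarrow> nat \<Rightarrow> 'h \<Rightarrow> 'h list list" where
  "iterD \<H> 0 h = [[h]]"
| "iterD \<H> (Suc n) h = [x # w. (x, y) \<leftarrow> DL \<H> h, w \<leftarrow> iterD \<H> n y]"

definition chain_act :: "('k, 'l, 'r, 'h) hopf_data \<Rightarrow> ('o, 'f, 'h) hcat \<Rightarrow> ('r, 'h, 'm) coeff \<Rightarrow>
    nat \<Rightarrow> ('o, 'f, 'm) chain \<Rightarrow> 'h \<Rightarrow> ('o, 'f, 'm) chain" where
  "chain_act \<H> C M n x h = frag_extend (\<lambda>(Xs, fs, m).
     \<Sum>w\<leftarrow>iterD \<H> (Suc n) (inv (anti \<H>) h).
       frag_of (Xs, map (\<lambda>i. Act C (src n Xs i) (Xs ! i) (w ! i) (fs ! i)) [0..<Suc n],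
                mact M (w ! Suc n) m)) x"

text \<open>The faces \<open>d\<^sub>i : \<T>\<^sub>n \<rightarrow> \<T>\<^sub>n\<^sub>-\<^sub>1\<close> for \<open>i < n\<close>; \<open>X\<^sub>i\<^sub>+\<^sub>1\<close> disappears.\<close>

definition chain_face :: "('o, 'f, 'h) hcat \<Rightarrow> nat \<Rightarrow> nat \<Rightarrow> ('o, 'f, 'm) chain \<Rightarrow> ('o, 'f, 'm) chain" where
  "chain_face C n i = frag_extend (\<lambda>(Xs, fs, m).
     frag_of (take (Suc i) Xs @ drop (i + 2) Xs,
       take i fs @ Comp C (src n Xs (Suc i)) (Xs ! Suc i) (Xs ! i) (fs ! i) (fs ! Suc i) # drop (i + 2) fs,
       m))"

definition chain_degen :: "('o, 'f, 'h) hcat \<Rightarrow> nat \<Rightarrow> nat \<Rightarrow> ('o, 'f, 'm) chain \<Rightarrow> ('o, 'f, 'm) chain" where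
  "chain_degen C n i = frag_extend (\<lambda>(Xs, fs, m).
     frag_of (take (Suc i) Xs @ src n Xs i # drop (Suc i) Xs,
       take (Suc i) fs @ Idm C (src n Xs i) # drop (Suc i) fs, m))"

text \<open>
  The formula for \<open>\<tau>\<^sub>n\<close> involves a choice of representatives, of the element of \<open>\<T>\<^sub>n\<close> and of
  \<open>m\<^sub>[\<^sub>-\<^sub>1\<^sub>] \<otimes>\<^sub>L m\<^sub>[\<^sub>0\<^sub>]\<close>, on which its value may depend over a general base \<open>L\<close>. \<open>cyc_graph\<close> is the
  additive relation on \<open>\<T>\<^sub>n\<close> that it defines: the graph of \<open>\<tau>\<^sub>n\<close> whenever \<open>\<tau>\<^sub>n\<close> is a map.
\<close>

inductive_set cyc_graph :: "('k, 'l::{ring,monoid_mult}, 'r, 'h::{ring,monoid_mult}) hopf_data \<Rightarrow>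
    ('o, 'f::ab_group_add, 'h) hcat \<Rightarrow> ('r, 'h, 'm::ab_group_add) coeff \<Rightarrow> nat \<Rightarrow>
    (('o, 'f, 'm) chain \<times> ('o, 'f, 'm) chain) set" for \<H> C M n where
  formula: "(Xs, fs, m) \<in> tensors C n \<Longrightarrow> eq_HM_L \<H> M t (lamL M m) \<Longrightarrow>
    (frag_of (Xs, fs, m),
     \<Sum>(h, m')\<leftarrow>t. frag_of (last Xs # butlast Xs,
                          Act C (src n Xs n) (last Xs) h (last fs) # butlast fs, m'))
    \<in> cyc_graph \<H> C M n"
| diff: "(x, y) \<in> cyc_graph \<H> C M n \<Longrightarrow> (x', y') \<in> cyc_graph \<H> C M n \<Longrightarrow>
    (x - x', y - y') \<in> cyc_graph \<H> C M n"
| null: "x \<in> chain_rel \<H> C M n \<Longrightarrow> y \<in> chain_rel \<H> C M n \<Longrightarrow> (x, y) \<in> cyc_graph \<H> C M n"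

text \<open>The last face \<open>(m\<^sub>[\<^sub>-\<^sub>1\<^sub>]f\<^sub>n)f\<^sub>0 \<otimes> f\<^sub>1 \<otimes> \<dots> \<otimes> f\<^sub>n\<^sub>-\<^sub>1 \<otimes> m\<^sub>[\<^sub>0\<^sub>]\<close> is \<open>d\<^sub>0\<close> of the formula for \<open>\<tau>\<^sub>n\<close>.\<close>

definition face_graph where
  "face_graph \<H> C M n i =
     (if i < n then {(x, y). y = chain_face C n i x}
      else {(x, y). \<exists>z. (x, z) \<in> cyc_graph \<H> C M n \<and> y = chain_face C n 0 z})"


section \<open>The cyclic module \<open>\<Q>\<close>\<close>

text \<open>
  \<open>null_chains\<close> is the kernel of \<open>\<T>\<^sub>n \<rightarrow> \<Q>\<^sup>\<H>\<^sub>n\<close> (pulled back to \<open>chains C n\<close>). Clause \<open>coeq\<close> makes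
  \<open>\<rho>\<^sub>n(\<tau>\<^sub>n\<^sup>j \<otimes> id)\<close> and \<open>\<tau>\<^sub>n\<^sup>j\<rho>\<^sub>n\<close> agree for all \<open>j\<close>; in particular (\<open>h = 1\<close>) any two values of
  \<open>\<tau>\<^sub>n\<^sup>j\<close> are identified. The last three clauses let faces and cyclic operators descend to the quotient
  and satisfy \<open>d\<^sub>n\<tau>\<^sub>n = \<tau>\<^sub>n\<^sub>-\<^sub>1d\<^sub>n\<^sub>-\<^sub>1\<close> there: \<open>\<Q>\<^sup>\<H>\<close> is the universal coequalizing quotient on which \<open>\<T>\<close>
  induces a para-cyclic structure. They add nothing if the quotient by the first three clauses has
  these properties already.
\<close>

inductive null_chain :: "('k, 'l::{ring,monoid_mult}, 'r, 'h::{ring,monoid_mult}) hopf_data \<Rightarrow>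
    ('o, 'f::ab_group_add, 'h) hcat \<Rightarrow> ('r, 'h, 'm::ab_group_add) coeff \<Rightarrow> nat \<Rightarrow>
    ('o, 'f, 'm) chain \<Rightarrow> bool" for \<H> C M where
  rel: "x \<in> chain_rel \<H> C M n \<Longrightarrow> null_chain \<H> C M n x"
| diff: "null_chain \<H> C M n x \<Longrightarrow> null_chain \<H> C M n y \<Longrightarrow> null_chain \<H> C M n (x - y)"
| coeq: "x \<in> chains C n \<Longrightarrow> (x, y) \<in> cyc_graph \<H> C M n ^^ j \<Longrightarrow>
    (chain_act \<H> C M n x h, z) \<in> cyc_graph \<H> C M n ^^ j \<Longrightarrow>
    null_chain \<H> C M n (chain_act \<H> C M n y h - z)"
| face: "null_chain \<H> C M (Suc n) x \<Longrightarrow> i \<le> n \<Longrightarrow>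
    null_chain \<H> C M n (chain_face C (Suc n) i x)"
| cyc: "null_chain \<H> C M n x \<Longrightarrow> (x, y) \<in> cyc_graph \<H> C M n \<Longrightarrow> null_chain \<H> C M n y"
| last_face: "x \<in> chains C (Suc n) \<Longrightarrow> (x, y) \<in> cyc_graph \<H> C M (Suc n) \<Longrightarrow>
    (y, z) \<in> face_graph \<H> C M (Suc n) (Suc n) \<Longrightarrow>
    (chain_face C (Suc n) n x, z') \<in> cyc_graph \<H> C M n \<Longrightarrow> null_chain \<H> C M n (z - z')"

definition null_chains where
  "null_chains \<H> C M n = {x. null_chain \<H> C M n x}"

definition coset :: "'x set \<Rightarrow> 'x::ab_group_add \<Rightarrow> 'x set" where
  "coset N x = {x + b | b. b \<in> N}"

text \<open>The map between quotients induced by an additive relation or map, as an operation on cosets.\<close>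

definition induced :: "('x \<times> 'y) set \<Rightarrow> 'y::ab_group_add set \<Rightarrow> 'x set \<Rightarrow> 'y set" where
  "induced R N A = {y + b | x y b. x \<in> A \<and> (x, y) \<in> R \<and> b \<in> N}"

abbreviation graph_of :: "('x \<Rightarrow> 'y) \<Rightarrow> ('x \<times> 'y) set" where
  "graph_of f \<equiv> {(x, y). y = f x}"

text \<open>The data of a cyclic right \<open>\<H>\<close>-module; \<open>cface X n i\<close>, \<open>cdegen X n i\<close> and \<open>ccyc X n\<close> start in degree \<open>n\<close>.\<close>

record ('h, 'x) cyclic_data =
  cmod :: "nat \<Rightarrow> 'x set"
  cplus :: "nat \<Rightarrow> 'x \<Rightarrow> 'x \<Rightarrow> 'x"
  cact :: "nat \<Rightarrow> 'x \<Rightarrow> 'h \<Rightarrow> 'x"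
  cface :: "nat \<Rightarrow> nat \<Rightarrow> 'x \<Rightarrow> 'x"
  cdegen :: "nat \<Rightarrow> nat \<Rightarrow> 'x \<Rightarrow> 'x"
  ccyc :: "nat \<Rightarrow> 'x \<Rightarrow> 'x"

definition QH :: "('k, 'l::{ring,monoid_mult}, 'r, 'h::{ring,monoid_mult}) hopf_data \<Rightarrow>
    ('o, 'f::ab_group_add, 'h) hcat \<Rightarrow> ('r, 'h, 'm::ab_group_add) coeff \<Rightarrow>
    ('h, ('o, 'f, 'm) chain set) cyclic_data" where
  "QH \<H> C M = \<lparr>
     cmod = (\<lambda>n. coset (null_chains \<H> C M n) ` chains C n),
     cplus = (\<lambda>n A B. {a + b | a b. a \<in> A \<and> b \<in> B}),
     cact = (\<lambda>n A h. induced (graph_of (\<lambda>x. chain_act \<H> C M n x h)) (null_chains \<H> C M n) A),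
     cface = (\<lambda>n i. induced (face_graph \<H> C M n i) (null_chains \<H> C M (n - 1))),
     cdegen = (\<lambda>n i. induced (graph_of (chain_degen C n i)) (null_chains \<H> C M (Suc n))),
     ccyc = (\<lambda>n. induced (cyc_graph \<H> C M n) (null_chains \<H> C M n)) \<rparr>"

definition cyclic_Q where
  "cyclic_Q \<H> C M = (QH \<H> C M) \<lparr> cmod :=
     (\<lambda>n. {A \<in> cmod (QH \<H> C M) n. (ccyc (QH \<H> C M) n ^^ Suc n) A = A}) \<rparr>"

definition chain_map :: "('o, 'f, 'o1, 'f1) hfunctor \<Rightarrow> nat \<Rightarrow> ('o, 'f, 'm) chain \<Rightarrow> ('o1, 'f1, 'm) chain" where
  "chain_map F n = frag_extend (\<lambda>(Xs, fs, m).
     frag_of (map (FOb F) Xs, map (\<lambda>i. FMap F (src n Xs i) (Xs ! i) (fs ! i)) [0..<Suc n], m))"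

text \<open>The map \<open>\<Q>\<^sub>\<bullet>(\<F>, M)\<close>; \<open>C'\<close> is the target of \<open>F\<close>.\<close>

definition Q_map where
  "Q_map \<H> C' M F n = induced (graph_of (chain_map F n)) (null_chains \<H> C' M n)"


section \<open>Special homotopy\<close>

definition semicyclic_map :: "('h, 'x) cyclic_data \<Rightarrow> ('h, 'y) cyclic_data \<Rightarrow> (nat \<Rightarrow> 'x \<Rightarrow> 'y) \<Rightarrow> bool" where
  "semicyclic_map X Y \<phi> \<longleftrightarrow>
     (\<forall>n. \<forall>x\<in>cmod X n. \<phi> n x \<in> cmod Y n) \<and>
     (\<forall>n. \<forall>x\<in>cmod X n. \<forall>x'\<in>cmod X n. \<phi> n (cplus X n x x') = cplus Y n (\<phi> n x) (\<phi> n x')) \<and>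
     (\<forall>n. \<forall>x\<in>cmod X n. \<forall>h. \<phi> n (cact X n x h) = cact Y n (\<phi> n x) h) \<and>
     (\<forall>n. \<forall>i\<le>Suc n. \<forall>x\<in>cmod X (Suc n). \<phi> n (cface X (Suc n) i x) = cface Y (Suc n) i (\<phi> (Suc n) x)) \<and>
     (\<forall>n. \<forall>x\<in>cmod X n. \<phi> n (ccyc X n x) = ccyc Y n (\<phi> n x))"

text \<open>
  A right \<open>\<H>\<close>-module is an \<open>R\<close>-\<open>R\<close>-bimodule by \<open>r \<cdot> x \<cdot> r' = x t\<^sub>R(r) s\<^sub>R(r')\<close>, and an \<open>L\<close>-\<open>L\<close>-bimodule by
  \<open>l \<cdot> x \<cdot> l' = \<epsilon>\<^sub>R s\<^sub>L(l') \<cdot> x \<cdot> \<epsilon>\<^sub>R s\<^sub>L(l)\<close>. Because this exchanges left and right, \<open>X \<otimes>\<^sub>L Y\<close> is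
  \<open>Y \<otimes>\<^sub>R X\<close>, and its diagonal action is \<open>(x \<otimes> y)h = x h\<^sup>(\<^sup>2\<^sup>) \<otimes> y h\<^sup>(\<^sup>1\<^sup>)\<close>. As
  \<open>\<Delta>\<^sub>L(S\<^sup>-\<^sup>1(h)) = S\<^sup>-\<^sup>1(h\<^sup>(\<^sup>2\<^sup>)) \<otimes>\<^sub>L S\<^sup>-\<^sup>1(h\<^sup>(\<^sup>1\<^sup>))\<close>, this is the same convention as for the action on \<open>\<T>\<close>.
\<close>

definition cyc_tensor_rel :: "('k, 'l, 'r, 'h) hopf_data \<Rightarrow> ('h, 'x) cyclic_data \<Rightarrow> ('h, 'y) cyclic_data \<Rightarrow>
    nat \<Rightarrow> ('x \<times> 'y \<Rightarrow>\<^sub>0 int) set" where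
  "cyc_tensor_rel \<H> X Y n = additive_span (
     {frag_of (cplus X n x x', y) - frag_of (x, y) - frag_of (x', y)
        | x x' y. x \<in> cmod X n \<and> x' \<in> cmod X n \<and> y \<in> cmod Y n} \<union>
     {frag_of (x, cplus Y n y y') - frag_of (x, y) - frag_of (x, y')
        | x y y'. x \<in> cmod X n \<and> y \<in> cmod Y n \<and> y' \<in> cmod Y n} \<union>
     {frag_of (cact X n x (tR \<H> (eR \<H> (sL \<H> l))), y) - frag_of (x, cact Y n y (sR \<H> (eR \<H> (sL \<H> l))))
        | x y l. x \<in> cmod X n \<and> y \<in> cmod Y n})"

definition cyc_tensor :: "('k, 'l, 'r, 'h) hopf_data \<Rightarrow> ('h, 'x) cyclic_data \<Rightarrow> ('h, 'y) cyclic_data \<Rightarrow>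
    ('h, ('x \<times> 'y \<Rightarrow>\<^sub>0 int) set) cyclic_data" where
  "cyc_tensor \<H> X Y = (let N = cyc_tensor_rel \<H> X Y in \<lparr>
     cmod = (\<lambda>n. coset (N n) ` {z. Poly_Mapping.keys z \<subseteq> cmod X n \<times> cmod Y n}),
     cplus = (\<lambda>n A B. {a + b | a b. a \<in> A \<and> b \<in> B}),
     cact = (\<lambda>n A h. induced (graph_of (frag_extend (\<lambda>(x, y).
       \<Sum>(a, b)\<leftarrow>DR \<H> h. frag_of (cact X n x b, cact Y n y a)))) (N n) A),
     cface = (\<lambda>n i. induced (graph_of (frag_extend (\<lambda>(x, y).
       frag_of (cface X n i x, cface Y n i y)))) (N (n - 1))),
     cdegen = (\<lambda>n i. induced (graph_of (frag_extend (\<lambda>(x, y).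
       frag_of (cdegen X n i x, cdegen Y n i y)))) (N (Suc n))),
     ccyc = (\<lambda>n. induced (graph_of (frag_extend (\<lambda>(x, y).
       frag_of (ccyc X n x, ccyc Y n y)))) (N n)) \<rparr>)"

text \<open>
  \<open>LS\<close> is \<open>L\<S>\<close>: since \<open>\<S>\<close> has exactly one morphism \<open>u\<close> between any two of its objects \<open>0\<close>, \<open>1\<close>, each
  Hom is \<open>L u\<close>, identified with \<open>L\<close>. \<open>h\<close> acts on \<open>u\<close> by \<open>s\<^sub>L\<epsilon>\<^sub>L(h)\<close>, so
  \<open>h(l u) = (h s\<^sub>L(l))(u) = \<epsilon>\<^sub>L(h s\<^sub>L(l)) u\<close>. The coefficients \<open>L\<close> are the unit module/comodule.
\<close>

definition LS :: "('k, 'l::{ring,monoid_mult}, 'r, 'h::{ring,monoid_mult}) hopf_data \<Rightarrow> (nat, 'l, 'h) hcat" where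
  "LS \<H> = \<lparr> Ob = {0, 1}, Hom = (\<lambda>_ _. UNIV), Idm = (\<lambda>_. 1), Comp = (\<lambda>_ _ _ a b. a * b),
     Act = (\<lambda>_ _ h a. eL \<H> (h * sL \<H> a)) \<rparr>"

definition L_coeff :: "('k, 'l::{ring,monoid_mult}, 'r, 'h::{ring,monoid_mult}) hopf_data \<Rightarrow> ('r, 'h, 'l) coeff" where
  "L_coeff \<H> = \<lparr> mact = (\<lambda>h a. eL \<H> (h * sL \<H> a)),
     mlR = (\<lambda>r a. a * eL \<H> (tR \<H> r)), mrR = (\<lambda>r a. eL \<H> (tR \<H> r) * a),
     lamL = (\<lambda>a. [(sL \<H> a, 1)]), lamR = (\<lambda>a. [(sL \<H> a, 1)]) \<rparr>"

definition CC where
  "CC \<H> = cyclic_Q \<H> (LS \<H>) (L_coeff \<H>)"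

definition id_tuple :: "('k, 'l::{ring,monoid_mult}, 'r, 'h::{ring,monoid_mult}) hopf_data \<Rightarrow>
    nat \<Rightarrow> nat \<Rightarrow> (nat, 'l, 'l) chain set" where
  "id_tuple \<H> i n = coset (null_chains \<H> (LS \<H>) (L_coeff \<H>) n)
     (frag_of (replicate (Suc n) i, replicate (Suc n) (Idm (LS \<H>) i), 1))"

text \<open>\<open>\<epsilon>\<^sub>i : X\<^sub>\<bullet> \<rightarrow> X\<^sub>\<bullet> \<otimes> CC\<^sub>\<bullet>(L\<S>)\<close>, \<open>\<Phi> \<mapsto> \<Phi> \<otimes>\<^sub>L (id\<^sub>i, \<dots>, id\<^sub>i)\<close>.\<close>

definition eps where
  "eps \<H> X i n x = coset (cyc_tensor_rel \<H> X (CC \<H>) n) (frag_of (x, id_tuple \<H> i n))"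

definition special_homotopic where
  "special_homotopic \<H> X Y f g \<longleftrightarrow> semicyclic_map X Y f \<and> semicyclic_map X Y g \<and>
     (\<exists>hb. semicyclic_map (cyc_tensor \<H> X (CC \<H>)) Y hb \<and>
        (\<forall>n. \<forall>x\<in>cmod X n. hb n (eps \<H> X 0 n x) = f n x \<and> hb n (eps \<H> X 1 n x) = g n x))"

end

theory Submission
  imports Defs
begin

text \<open>
  Up to the tensor relations, a chain of \<open>L\<S>\<close> with coefficients in \<open>L\<close> is a sequence \<open>a\<close> of objects
  \<open>0\<close>, \<open>1\<close> together with a scalar \<open>p \<in> L\<close>. The homotopy sends \<open>\<Phi> \<otimes> (a, p)\<close> to \<open>\<Phi>\<^sub>a s\<^sub>L(p)\<close>, where
  \<open>\<Phi>\<^sub>a\<close> is the image of \<open>\<Phi>\<close>, placed over \<open>a\<close>, under the functor \<open>\<C> \<times> \<S> \<rightarrow> \<C>'\<close> given by \<open>\<F>\<close>, \<open>\<G>\<close> and the natural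
  isomorphism; the latter is \<open>\<H>\<close>-equivariant because the isomorphism is invariant.

  For this to respect the relations that \<open>\<tau>\<close> imposes on \<open>L\<S>\<close>, commutators of \<open>L\<close> have to act trivially.
  Evaluating \<open>\<tau>\<close> on different representatives shows that \<open>s\<^sub>L(l)\<close> and \<open>s\<^sub>R\<epsilon>\<^sub>Rs\<^sub>L(l)\<close> act equally on \<open>\<Q>\<^sup>\<H>\<close>
  after a power of \<open>\<tau>\<close>, and as \<open>s\<^sub>R\<epsilon>\<^sub>Rs\<^sub>L\<close> reverses products and commutes with \<open>s\<^sub>L\<close>, commutators vanish
  after a power of \<open>\<tau>\<close>. On \<open>\<Q>\<close>, where \<open>\<tau>\<close> has finite order, nothing is lost by applying \<open>\<tau>\<close>.
  Linearity for the diagonal action is the identity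
  \<open>\<Sum> h\<^sup>(\<^sup>2\<^sup>) s\<^sub>L\<epsilon>\<^sub>L(S\<^sup>-\<^sup>1(h\<^sup>(\<^sup>1\<^sup>)) s\<^sub>L(p)) = s\<^sub>L(p) h\<close>.
\<close>

section \<open>Congruences modulo subgroups\<close>

text \<open>The kernel \<open>null\<close> of the quotient is generated inductively, so
  \<open>\<tau>\<close> is not known to be injective modulo it, while several relations read off
  from the coaction only compare images under \<open>\<tau>\<close>. These are stated modulo
  \<open>enull\<close>, where \<open>\<tau>\<close> can be cancelled. That \<open>enull\<close> is
  stable under faces rests on the full rotations: \<open>\<tau>^(n+1)\<close> after a face is that
  face after \<open>\<tau>^(n+2)\<close>. The same kernel on the side of \<open>L\<S>\<close> is the
  second obstacle: there is no explicit description of \<open>CC\<close> from which a map could be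
  read off. Instead \<open>pairing\<close> evaluates a chain of \<open>L\<S>\<close> on a family of
  chains indexed by object sequences, and its vanishing on null chains is proved by induction over
  their clauses. The family has to be arbitrary, since the clauses replace it by one that is
  rotated, shortened or acted upon. The homotopy is defined on representatives of classes; its
  values are periodic, so that identities modulo \<open>enull\<close> on generators become
  equalities in \<open>\<Q>\<close>.\<close>

definition add_subgroup :: "'a::ab_group_add set \<Rightarrow> bool" where
  "add_subgroup N \<longleftrightarrow> 0 \<in> N \<and> (\<forall>x\<in>N. \<forall>y\<in>N. x - y \<in> N)"

text \<open>Quotients are handled without quotient types: an equality in a quotient is a congruence
  between formal sums, so that one calculation can pass from \<open>chain_rel\<close> to
  \<open>null\<close> and on to \<open>enull\<close>. For \<open>N = {0}\<close> the relation is
  equality, which makes exact statements instances of congruence statements.\<close>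

definition cong_mod :: "'a::ab_group_add set \<Rightarrow> 'a \<Rightarrow> 'a \<Rightarrow> bool" where
  "cong_mod N x y \<longleftrightarrow> x - y \<in> N"

lemma add_subgroup_uminus: "add_subgroup N \<Longrightarrow> x \<in> N \<Longrightarrow> - x \<in> N"
  unfolding add_subgroup_def by (metis diff_0)

lemma add_subgroup_add: "add_subgroup N \<Longrightarrow> x \<in> N \<Longrightarrow> y \<in> N \<Longrightarrow> x + y \<in> N"
  using add_subgroup_uminus[of N y] unfolding add_subgroup_def by (metis diff_minus_eq_add)

lemma add_subgroup_sum_list: "add_subgroup N \<Longrightarrow> (\<And>x. x \<in> set xs \<Longrightarrow> f x \<in> N) \<Longrightarrow> (\<Sum>x\<leftarrow>xs. f x) \<in> N"
  by (induction xs) (auto simp: add_subgroup_add, simp add: add_subgroup_def)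

lemma add_subgroup_zero_singleton [simp]: "add_subgroup {0}"
  by (simp add: add_subgroup_def)

lemma add_subgroup_additive_span [simp]: "add_subgroup (additive_span S)"
  by (simp add: add_subgroup_def additive_span.zero additive_span.diff)

lemma cong_mod_zero_singleton [simp]: "cong_mod {0} x y \<longleftrightarrow> x = y"
  by (simp add: cong_mod_def)

lemma cong_mod_refl [simp]: "add_subgroup N \<Longrightarrow> cong_mod N x x"
  by (simp add: cong_mod_def add_subgroup_def)

lemma cong_mod_eq: "add_subgroup N \<Longrightarrow> x = y \<Longrightarrow> cong_mod N x y"
  by simp

lemma cong_mod_sym: "add_subgroup N \<Longrightarrow> cong_mod N x y \<Longrightarrow> cong_mod N y x"
  unfolding cong_mod_def using add_subgroup_uminus[of N "x - y"] by simp

lemma cong_mod_trans: "add_subgroup N \<Longrightarrow> cong_mod N x y \<Longrightarrow> cong_mod N y z \<Longrightarrow> cong_mod N x z"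
  unfolding cong_mod_def using add_subgroup_add[of N "x - y" "y - z"] by simp

lemma cong_mod_add:
  "add_subgroup N \<Longrightarrow> cong_mod N x y \<Longrightarrow> cong_mod N x' y' \<Longrightarrow> cong_mod N (x + x') (y + y')"
  unfolding cong_mod_def using add_subgroup_add[of N "x - y" "x' - y'"] by (simp add: algebra_simps)

lemma cong_mod_diff:
  "add_subgroup N \<Longrightarrow> cong_mod N x y \<Longrightarrow> cong_mod N x' y' \<Longrightarrow> cong_mod N (x - x') (y - y')"
proof -
  assume *: "add_subgroup N" "cong_mod N x y" "cong_mod N x' y'"
  have "(x - x') - (y - y') = (x - y) - (x' - y')" by simp
  then show ?thesis using * unfolding cong_mod_def add_subgroup_def by metis
qed

lemma cong_mod_mono: "N \<subseteq> N' \<Longrightarrow> cong_mod N x y \<Longrightarrow> cong_mod N' x y"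
  unfolding cong_mod_def by blast

lemma cong_mod_sum_list:
  assumes N: "add_subgroup N" and fg: "\<And>x. x \<in> set xs \<Longrightarrow> cong_mod N (f x) (g x)"
  shows "cong_mod N (\<Sum>x\<leftarrow>xs. f x) (\<Sum>x\<leftarrow>xs. g x)"
  using fg by (induction xs) (auto intro!: cong_mod_add N simp: N)

lemma cong_mod_mem: "add_subgroup N \<Longrightarrow> cong_mod N x y \<Longrightarrow> y \<in> N \<Longrightarrow> x \<in> N"
  unfolding cong_mod_def using add_subgroup_add by fastforce

lemma cong_mod_zero_iff: "cong_mod N x 0 \<longleftrightarrow> x \<in> N"
  by (simp add: cong_mod_def)

lemma additive_sum_list: "additive f \<Longrightarrow> f (\<Sum>x\<leftarrow>xs. g x) = (\<Sum>x\<leftarrow>xs. f (g x))"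
  by (induction xs) (simp_all add: additive.zero additive.add)

lemma frag_extend_sum_list: "frag_extend f (\<Sum>x\<leftarrow>xs. g x) = (\<Sum>x\<leftarrow>xs. frag_extend f (g x))"
  by (induction xs) (simp_all add: frag_extend_add)

lemma sum_list_concat_map: "(\<Sum>x\<leftarrow>concat (map f xs). g x) = (\<Sum>x\<leftarrow>xs. \<Sum>y\<leftarrow>f x. g y)"
  by (induction xs) simp_all

lemma sum_list_swap:
  fixes f :: "'a \<Rightarrow> 'b \<Rightarrow> 'c::comm_monoid_add"
  shows "(\<Sum>x\<leftarrow>xs. \<Sum>y\<leftarrow>ys. f x y) = (\<Sum>y\<leftarrow>ys. \<Sum>x\<leftarrow>xs. f x y)"
  by (induction xs) (simp_all add: sum_list_addf)

section \<open>Balanced maps on tensor products\<close>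

text \<open>Integer multiples in an arbitrary abelian group, as a difference of two sums of which at
  most one is nonempty. They serve to define \<open>lin\<close>, the additive extension of a map on
  generators to formal sums; its target is any abelian group, since the Sweedler sums of the
  antipode calculations take values in the ring.\<close>

definition zmul :: "int \<Rightarrow> 'd::ab_group_add \<Rightarrow> 'd" where
  "zmul z d = (\<Sum>i<nat z. d) - (\<Sum>i<nat (- z). d)"

lemma zmul_of_nat_diff: "zmul (int a - int b) d = (\<Sum>i<a. d) - (\<Sum>i<b. d)"
proof -
  have split: "(\<Sum>i<m + n. d) = (\<Sum>i<m. d) + (\<Sum>i<n. d)" for m n :: nat
    by (induction n) (simp_all add: algebra_simps)
  show ?thesis
  proof (cases "a \<le> b")
    case True
    then obtain c where "b = a + c" using le_Suc_ex by blast
    then show ?thesis by (simp add: zmul_def split)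
  next
    case False
    then obtain c where "a = b + c" using le_Suc_ex nat_le_linear by blast
    then show ?thesis by (simp add: zmul_def split)
  qed
qed

lemma zmul_diff: "zmul (y - z) d = zmul y d - zmul z d"
proof -
  have split: "(\<Sum>i<m + n. d) = (\<Sum>i<m. d) + (\<Sum>i<n. d)" for m n :: nat
    by (induction n) (simp_all add: algebra_simps)
  obtain a b where y: "y = int a - int b" using int_diff_cases .
  obtain a' b' where z: "z = int a' - int b'" using int_diff_cases .
  have "y - z = int (a + b') - int (b + a')" by (simp add: y z)
  then have "zmul (y - z) d = (\<Sum>i<a + b'. d) - (\<Sum>i<b + a'. d)" using zmul_of_nat_diff by metis
  then show ?thesis by (simp add: y z zmul_of_nat_diff split)
qed

lemma zmul_0 [simp]: "zmul 0 d = 0" and zmul_1 [simp]: "zmul 1 d = d"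
  by (simp_all add: zmul_def)

definition lin :: "('x \<Rightarrow> 'd::ab_group_add) \<Rightarrow> ('x \<Rightarrow>\<^sub>0 int) \<Rightarrow> 'd" where
  "lin f x = (\<Sum>k\<in>Poly_Mapping.keys x. zmul (Poly_Mapping.lookup x k) (f k))"

lemma lin_superset:
  "finite A \<Longrightarrow> Poly_Mapping.keys x \<subseteq> A \<Longrightarrow> lin f x = (\<Sum>k\<in>A. zmul (Poly_Mapping.lookup x k) (f k))"
  unfolding lin_def by (rule sum.mono_neutral_left) (auto simp: in_keys_iff)

lemma lin_diff: "lin f (x - y) = lin f x - lin f y"
proof -
  let ?A = "Poly_Mapping.keys x \<union> Poly_Mapping.keys y"
  have *: "finite ?A" "Poly_Mapping.keys (x - y) \<subseteq> ?A" by (simp_all add: keys_diff)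
  show ?thesis
    using lin_superset[OF *, of f] lin_superset[OF *(1), of x f] lin_superset[OF *(1), of y f]
    by (simp add: lookup_minus zmul_diff sum_subtractf)
qed

lemma lin_zero [simp]: "lin f 0 = 0"
  by (simp add: lin_def)

lemma lin_add: "lin f (x + y) = lin f x + lin f y"
  using lin_diff[of f x "- y"] lin_diff[of f 0 y] by simp

lemma lin_frag_of [simp]: "lin f (frag_of x) = f x"
  by (simp add: lin_def)

lemma lin_formal_sum: "lin f (formal_sum xs) = (\<Sum>x\<leftarrow>xs. f x)"
  by (induction xs) (simp_all add: formal_sum_def lin_add)

lemma lin_additive_span_mem:
  assumes "x \<in> additive_span S" and N: "add_subgroup N" and S: "\<And>s. s \<in> S \<Longrightarrow> lin f s \<in> N"
  shows "lin f x \<in> N"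
  using assms(1) by induction (use N S in \<open>auto simp: lin_diff add_subgroup_def\<close>)

text \<open>The universal property of the tensor product, relative to \<open>N\<close>: the additive
  extension \<open>lin\<close> sends each of the three kinds of generators of
  \<open>tens_rel\<close> into \<open>N\<close>. Changing the representative of a coproduct or
  coaction inside a biadditive balanced expression is an instance of it.\<close>

lemma tens_eq_cong:
  assumes "tens_eq ra lb s t" and N: "add_subgroup N"
    and "\<And>a a' b. cong_mod N (f (a + a') b) (f a b + f a' b)"
    and "\<And>a b b'. cong_mod N (f a (b + b')) (f a b + f a b')"
    and "\<And>q a b. cong_mod N (f (ra q a) b) (f a (lb q b))"
  shows "cong_mod N (\<Sum>(a, b)\<leftarrow>s. f a b) (\<Sum>(a, b)\<leftarrow>t. f a b)"
proof -
  have "lin (\<lambda>(a, b). f a b) (formal_sum s - formal_sum t) \<in> N"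
    using assms(1) unfolding tens_eq_def tens_rel_def
    by (rule lin_additive_span_mem[OF _ N])
      (use assms(3-5) in \<open>auto simp: cong_mod_def lin_diff lin_add diff_diff_eq\<close>)
  then show ?thesis by (simp add: cong_mod_def lin_diff lin_formal_sum)
qed

lemma tens3_eq_cong:
  assumes "tens3_eq ra lb rb lc s t" and N: "add_subgroup N"
    and "\<And>a a' b c. cong_mod N (f (a + a') b c) (f a b c + f a' b c)"
    and "\<And>a b b' c. cong_mod N (f a (b + b') c) (f a b c + f a b' c)"
    and "\<And>a b c c'. cong_mod N (f a b (c + c')) (f a b c + f a b c')"
    and "\<And>q a b c. cong_mod N (f (ra q a) b c) (f a (lb q b) c)"
    and "\<And>q a b c. cong_mod N (f a (rb q b) c) (f a b (lc q c))"
  shows "cong_mod N (\<Sum>(a, b, c)\<leftarrow>s. f a b c) (\<Sum>(a, b, c)\<leftarrow>t. f a b c)"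
proof -
  have "lin (\<lambda>(a, b, c). f a b c) (formal_sum s - formal_sum t) \<in> N"
    using assms(1) unfolding tens3_eq_def tens3_rel_def
    by (rule lin_additive_span_mem[OF _ N])
      (use assms(3-7) in \<open>auto simp: cong_mod_def lin_diff lin_add diff_diff_eq\<close>)
  then show ?thesis by (simp add: cong_mod_def lin_diff lin_formal_sum)
qed

lemma tens_eq_sum:
  fixes f :: "'a::ab_group_add \<Rightarrow> 'b::ab_group_add \<Rightarrow> 'd::ab_group_add"
  assumes "tens_eq ra lb s t"
    and "\<And>a a' b. f (a + a') b = f a b + f a' b" and "\<And>a b b'. f a (b + b') = f a b + f a b'"
    and "\<And>q a b. f (ra q a) b = f a (lb q b)"
  shows "(\<Sum>(a, b)\<leftarrow>s. f a b) = (\<Sum>(a, b)\<leftarrow>t. f a b)"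
  using tens_eq_cong[OF assms(1), of "{0}" f] assms(2-) by simp

lemma tens3_eq_sum:
  fixes f :: "'a::ab_group_add \<Rightarrow> 'b::ab_group_add \<Rightarrow> 'c::ab_group_add \<Rightarrow> 'd::ab_group_add"
  assumes "tens3_eq ra lb rb lc s t"
    and "\<And>a a' b c. f (a + a') b c = f a b c + f a' b c"
    and "\<And>a b b' c. f a (b + b') c = f a b c + f a b' c"
    and "\<And>a b c c'. f a b (c + c') = f a b c + f a b c'"
    and "\<And>q a b c. f (ra q a) b c = f a (lb q b) c"
    and "\<And>q a b c. f a (rb q b) c = f a b (lc q c)"
  shows "(\<Sum>(a, b, c)\<leftarrow>s. f a b c) = (\<Sum>(a, b, c)\<leftarrow>t. f a b c)"
  using tens3_eq_cong[OF assms(1), of "{0}" f] assms(2-) by simp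

lemma add_subgroup_tens_rel [simp]: "add_subgroup (tens_rel ra lb)"
  by (simp add: tens_rel_def)

lemma formal_sum_simps [simp]: "formal_sum [] = 0" "formal_sum (x # xs) = frag_of x + formal_sum xs"
    "formal_sum (xs @ ys) = formal_sum xs + formal_sum ys"
  by (simp_all add: formal_sum_def)

lemma tens_eq_iff_cong: "tens_eq ra lb s t \<longleftrightarrow> cong_mod (tens_rel ra lb) (formal_sum s) (formal_sum t)"
  by (simp add: tens_eq_def cong_mod_def)

lemma tens_eq_refl [simp]: "tens_eq ra lb s s"
  by (simp add: tens_eq_iff_cong)

lemma tens_eq_sym: "tens_eq ra lb s t \<Longrightarrow> tens_eq ra lb t s"
  by (simp add: tens_eq_iff_cong cong_mod_sym)

lemma tens_eq_trans [trans]: "tens_eq ra lb s t \<Longrightarrow> tens_eq ra lb t u \<Longrightarrow> tens_eq ra lb s u"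
  unfolding tens_eq_iff_cong using add_subgroup_tens_rel cong_mod_trans by blast

lemma tens_eq_append: "tens_eq ra lb s t \<Longrightarrow> tens_eq ra lb s' t' \<Longrightarrow> tens_eq ra lb (s @ s') (t @ t')"
  by (simp add: tens_eq_iff_cong cong_mod_add)

lemma cong_tens_add_left: "cong_mod (tens_rel ra lb) (frag_of (a + a', b)) (frag_of (a, b) + frag_of (a', b))"
  unfolding cong_mod_def tens_rel_def diff_diff_eq by (rule additive_span.base) blast

lemma cong_tens_add_right: "cong_mod (tens_rel ra lb) (frag_of (a, b + b')) (frag_of (a, b) + frag_of (a, b'))"
  unfolding cong_mod_def tens_rel_def diff_diff_eq by (rule additive_span.base) blast

lemma cong_tens_balanced: "cong_mod (tens_rel ra lb) (frag_of (ra q a, b)) (frag_of (a, lb q b))"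
  unfolding cong_mod_def tens_rel_def by (rule additive_span.base) blast

lemma tens_eq_map:
  assumes "tens_eq ra lb s t" and "additive \<alpha>" and "additive \<beta>"
    and "\<And>q a. \<alpha> (ra q a) = ra' q (\<alpha> a)" and "\<And>q b. \<beta> (lb q b) = lb' q (\<beta> b)"
  shows "tens_eq ra' lb' [(\<alpha> a, \<beta> b). (a, b) \<leftarrow> s] [(\<alpha> a, \<beta> b). (a, b) \<leftarrow> t]"
proof -
  have "cong_mod (tens_rel ra' lb') (\<Sum>(a, b)\<leftarrow>s. frag_of (\<alpha> a, \<beta> b)) (\<Sum>(a, b)\<leftarrow>t. frag_of (\<alpha> a, \<beta> b))"
    by (rule tens_eq_cong[OF assms(1)])
      (use assms(2-) in \<open>auto simp: additive.add cong_tens_add_left cong_tens_add_right cong_tens_balanced\<close>)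
  moreover have "formal_sum [(\<alpha> a, \<beta> b). (a, b) \<leftarrow> u] = (\<Sum>(a, b)\<leftarrow>u. frag_of (\<alpha> a, \<beta> b))" for u
    by (induction u) auto
  ultimately show ?thesis by (simp add: tens_eq_iff_cong)
qed

lemma cong_tens_minus: "cong_mod (tens_rel ra lb) (frag_of (- a, b)) (- frag_of (a, b))"
proof -
  let ?N = "tens_rel ra lb"
  have "frag_of (a + - a, b) - (frag_of (a, b) + frag_of (- a, b)) \<in> ?N"
    using cong_tens_add_left[of ra lb a "- a" b] by (simp add: cong_mod_def)
  moreover have "frag_of (0, b) \<in> ?N"
  proof -
    have "- frag_of (0, b) \<in> ?N"
      using cong_tens_add_left[of ra lb 0 0 b] by (simp add: cong_mod_def)
    then show ?thesis using add_subgroup_uminus[of ?N] by fastforce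
  qed
  ultimately have "frag_of (0, b) - (frag_of (0, b) - (frag_of (a, b) + frag_of (- a, b))) \<in> ?N"
    using add_subgroup_tens_rel[of ra lb] unfolding add_subgroup_def
    by (metis (no_types, lifting) add.right_inverse)
  then show ?thesis by (simp add: cong_mod_def algebra_simps)
qed

text \<open>The appended pairs represent \<open>a q \<otimes> b - a \<otimes> q b\<close>, with the
  sign absorbed in the first factor. An axiom that holds for all representatives can thus be
  evaluated on two representatives of one tensor, and the difference of the two values is a new
  balancing relation.\<close>

lemma tens_eq_append_balanced: "tens_eq ra lb (s @ [(ra q a, b), (- a, lb q b)]) s"
proof -
  let ?N = "tens_rel ra lb"
  have "cong_mod ?N (frag_of (ra q a, b) + frag_of (- a, lb q b)) (frag_of (a, lb q b) + - frag_of (a, lb q b))"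
    by (intro cong_mod_add cong_tens_balanced cong_tens_minus) simp
  then have "tens_eq ra lb (s @ [(ra q a, b), (- a, lb q b)]) (s @ [])"
    by (intro tens_eq_append) (simp_all add: tens_eq_iff_cong)
  then show ?thesis by simp
qed

section \<open>The antipode\<close>

lemmas sum_list_pairs = case_prod_unfold comp_def sum_list_concat_map

context hopf_algebroid
begin

abbreviation "S \<equiv> anti \<H>"

lemmas sL_add = additive.add[OF sL_hom(1)] and tL_add = additive.add[OF tL_antihom(1)]
  and sR_add = additive.add[OF sR_hom(1)] and tR_add = additive.add[OF tR_antihom(1)]
  and eL_plus = additive.add[OF eL_add] and eR_plus = additive.add[OF eR_add]
  and S_plus = additive.add[OF anti_add]

lemma eL_sL [simp]: "eL \<H> (sL \<H> a) = a" and eL_tL [simp]: "eL \<H> (tL \<H> a) = a"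
  using eL_bimodule[of a 1 1] eL_bimodule[of 1 a 1] by (simp_all add: sL_hom tL_antihom eL_one)

lemma eR_sR [simp]: "eR \<H> (sR \<H> a) = a" and eR_tR [simp]: "eR \<H> (tR \<H> a) = a"
  using eR_bimodule[of 1 1 a] eR_bimodule[of 1 a 1] by (simp_all add: sR_hom tR_antihom eR_one)

lemma eL_sL_left: "eL \<H> (sL \<H> a * h) = a * eL \<H> h" and eL_tL_left: "eL \<H> (tL \<H> a * h) = eL \<H> h * a"
  using eL_bimodule[of a 1 h] eL_bimodule[of 1 a h] by (simp_all add: sL_hom tL_antihom)

lemma eR_sR_right: "eR \<H> (h * sR \<H> a) = eR \<H> h * a" and eR_tR_right: "eR \<H> (h * tR \<H> a) = a * eR \<H> h"
  using eR_bimodule[of h 1 a] eR_bimodule[of h a 1] by (simp_all add: sR_hom tR_antihom)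

lemma sL_sR_commute: "sL \<H> l * sR \<H> r = sR \<H> r * sL \<H> l"
  by (metis units(4) sR_tR_commute)

lemma S_tL_left: "S (tL \<H> l * h) = S h * sL \<H> l" and S_tR_right: "S (h * tR \<H> r) = sR \<H> r * S h"
  using anti_twist[of l h 1] anti_twist[of 1 h r] by (simp_all add: sL_hom tL_antihom sR_hom tR_antihom)

lemma S_one [simp]: "S 1 = 1"
proof -
  have "(\<Sum>(x, y)\<leftarrow>DL \<H> 1. S x * y) = (\<Sum>(x, y)\<leftarrow>[(1, 1)]. S x * y)"
    by (rule tens_eq_sum[OF DL_one]) (simp_all add: S_plus algebra_simps HrL_def HlL_def S_tL_left mult.assoc)
  then show ?thesis by (simp add: anti_left eR_one sR_hom)
qed

lemma S_tL [simp]: "S (tL \<H> l) = sL \<H> l" and S_tR [simp]: "S (tR \<H> r) = sR \<H> r"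
  using S_tL_left[of l 1] S_tR_right[of 1 r] by simp_all

lemma DL_sL_left: "tens_eq (HrL \<H>) (HlL \<H>) (DL \<H> (sL \<H> a * h)) [(sL \<H> a * x, y). (x, y) \<leftarrow> DL \<H> h]"
  and DL_tL_left: "tens_eq (HrL \<H>) (HlL \<H>) (DL \<H> (tL \<H> a * h)) [(x, tL \<H> a * y). (x, y) \<leftarrow> DL \<H> h]"
  using DL_bimodule[of a 1 h] DL_bimodule[of 1 a h] by (simp_all add: sL_hom tL_antihom)

lemma DR_tR_right: "tens_eq (HrR \<H>) (HlR \<H>) (DR \<H> (h * tR \<H> a)) [(x * tR \<H> a, y). (x, y) \<leftarrow> DR \<H> h]"
  using DR_bimodule[of h a 1] by (simp add: sR_hom)

lemma DL_sL: "tens_eq (HrL \<H>) (HlL \<H>) (DL \<H> (sL \<H> a)) [(sL \<H> a, 1)]"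
proof -
  have "tens_eq (HrL \<H>) (HlL \<H>) [(sL \<H> a * x, y). (x, y) \<leftarrow> DL \<H> 1] [(sL \<H> a * x, y). (x, y) \<leftarrow> [(1, 1)]]"
    by (rule tens_eq_map[OF DL_one])
      (auto simp: additive_def algebra_simps HrL_def sL_tL_commute simp flip: mult.assoc)
  then show ?thesis using tens_eq_trans[OF DL_sL_left[of a 1]] by simp
qed

lemma DL_tL: "tens_eq (HrL \<H>) (HlL \<H>) (DL \<H> (tL \<H> a)) [(1, tL \<H> a)]"
proof -
  have "tens_eq (HrL \<H>) (HlL \<H>) [(x, tL \<H> a * y). (x, y) \<leftarrow> DL \<H> 1] [(x, tL \<H> a * y). (x, y) \<leftarrow> [(1, 1)]]"
    by (rule tens_eq_map[OF DL_one])
      (auto simp: additive_def algebra_simps HlL_def sL_tL_commute simp flip: mult.assoc)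
  then show ?thesis using tens_eq_trans[OF DL_tL_left[of a 1]] by simp
qed

text \<open>The bimodule axiom speaks of left multiplication only. Right multiplication is reached
  through \<open>DL (h * sL a) = DL h * DL (sL a)\<close> and
  \<open>DL (sL a) = sL a \<otimes> 1\<close>; that multiplication by \<open>DL h\<close> respects
  the tensor relation is the Takeuchi condition.\<close>

lemma DL_sL_right: "tens_eq (HrL \<H>) (HlL \<H>) (DL \<H> (h * sL \<H> a)) [(x * sL \<H> a, y). (x, y) \<leftarrow> DL \<H> h]"
proof -
  let ?N = "tens_rel (HrL \<H>) (HlL \<H>)"
  let ?F = "\<lambda>x' y'. \<Sum>(x, y)\<leftarrow>DL \<H> h. frag_of (x * x', y * y')"
  have split: "formal_sum (map (\<lambda>(x, y). (f x, g y)) s) = (\<Sum>(x, y)\<leftarrow>s. frag_of (f x, g y))" for s f g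
    by (induction s) auto
  have "cong_mod ?N (\<Sum>(x', y')\<leftarrow>DL \<H> (sL \<H> a). ?F x' y') (\<Sum>(x', y')\<leftarrow>[(sL \<H> a, 1)]. ?F x' y')"
  proof (rule tens_eq_cong[OF DL_sL])
    fix x' x'' y' y'' q
    show "cong_mod ?N (?F (x' + x'') y') (?F x' y' + ?F x'' y')"
      unfolding sum_list_addf[symmetric] case_prod_unfold
      by (rule cong_mod_sum_list) (auto simp: algebra_simps cong_tens_add_left)
    show "cong_mod ?N (?F x' (y' + y'')) (?F x' y' + ?F x' y'')"
      unfolding sum_list_addf[symmetric] case_prod_unfold
      by (rule cong_mod_sum_list) (auto simp: algebra_simps cong_tens_add_right)
    have "tens_eq (HrL \<H>) (HlL \<H>) [(x * x', y * y'). (x, y) \<leftarrow> [(x * tL \<H> q, y). (x, y) \<leftarrow> DL \<H> h]]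
       [(x * x', y * y'). (x, y) \<leftarrow> [(x, y * sL \<H> q). (x, y) \<leftarrow> DL \<H> h]]"
      by (rule tens_eq_map[OF DL_takeuchi]) (auto simp: additive_def algebra_simps HlL_def HrL_def)
    then show "cong_mod ?N (?F (HrL \<H> q x') y') (?F x' (HlL \<H> q y'))"
      by (simp add: tens_eq_iff_cong HlL_def HrL_def comp_def case_prod_unfold
          split[unfolded case_prod_unfold] mult.assoc formal_sum_def)
  qed simp
  moreover have "formal_sum [(x * x', y * y'). (x, y) \<leftarrow> DL \<H> h, (x', y') \<leftarrow> DL \<H> g]
      = (\<Sum>(x', y')\<leftarrow>DL \<H> g. ?F x' y')" for g
    by (simp add: formal_sum_def sum_list_pairs, rule sum_list_swap)
  moreover have "formal_sum [(x * sL \<H> a, y). (x, y) \<leftarrow> DL \<H> h] = ?F (sL \<H> a) 1"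
    by (simp add: formal_sum_def sum_list_pairs)
  ultimately have "tens_eq (HrL \<H>) (HlL \<H>) [(x * x', y * y'). (x, y) \<leftarrow> DL \<H> h, (x', y') \<leftarrow> DL \<H> (sL \<H> a)]
     [(x * sL \<H> a, y). (x, y) \<leftarrow> DL \<H> h]"
    by (simp add: tens_eq_iff_cong)
  then show ?thesis by (rule tens_eq_trans[OF DL_mult])
qed

lemma S_expand_DL: "S g = (\<Sum>(x, y)\<leftarrow>DL \<H> g. S x * sL \<H> (eL \<H> y))"
proof -
  have "S g = S (\<Sum>(x, y)\<leftarrow>DL \<H> g. tL \<H> (eL \<H> y) * x)" by (simp add: eL_counit)
  then show ?thesis by (simp add: additive_sum_list[OF anti_add] case_prod_unfold S_tL_left)
qed

lemma S_expand_DR: "S g = (\<Sum>(x, y)\<leftarrow>DR \<H> g. sR \<H> (eR \<H> x) * S y)"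
proof -
  have "S g = S (\<Sum>(x, y)\<leftarrow>DR \<H> g. y * tR \<H> (eR \<H> x))" by (simp add: eR_counit)
  then show ?thesis by (simp add: additive_sum_list[OF anti_add] case_prod_unfold S_tR_right)
qed

text \<open>\<open>sL p\<close> lies in the image of \<open>tR\<close>, so
  \<open>DR (k * sL p)\<close> is \<open>DR k\<close> with \<open>sL p\<close> multiplied into the
  first factor. The antipode axiom for \<open>k * sL p\<close> is then the claim.\<close>

lemma sL_eL_sL_right: "sL \<H> (eL \<H> (k * sL \<H> p)) = (\<Sum>(x, y)\<leftarrow>DR \<H> k. x * sL \<H> p * S y)"
proof -
  obtain r where r: "sL \<H> p = tR \<H> r" using units(4) by metis
  have "(\<Sum>(x, y)\<leftarrow>DR \<H> (k * tR \<H> r). x * S y) = (\<Sum>(x, y)\<leftarrow>[(x * tR \<H> r, y). (x, y) \<leftarrow> DR \<H> k]. x * S y)"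
    by (rule tens_eq_sum[OF DR_tR_right])
      (simp_all add: S_plus algebra_simps HrR_def HlR_def S_tR_right mult.assoc)
  then show ?thesis by (simp add: r sum_list_pairs flip: anti_right)
qed

text \<open>Mixed coassociativity moves the left coproduct onto the first leg of the right one,
  where \<open>S x * y\<close> sums to a value of \<open>sR\<close> after \<open>eR\<close>. The
  condition on \<open>\<phi>\<close> makes the triple expression balanced over \<open>R\<close>; it
  holds for \<open>S (tR r * c)\<close> and for \<open>S c * sR r\<close> as functions of
  \<open>c\<close>.\<close>

lemma sum_S_mixed:
  assumes "additive \<phi>" and "\<And>c r. \<phi> (c * tR \<H> r) = sR \<H> r * \<phi> c"
  shows "(\<Sum>(x, y)\<leftarrow>DL \<H> g. \<Sum>(y1, y2)\<leftarrow>DR \<H> y. S x * y1 * \<phi> y2) = (\<Sum>(x, y)\<leftarrow>DR \<H> g. sR \<H> (eR \<H> x) * \<phi> y)"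
proof -
  have "(\<Sum>(x, y, z)\<leftarrow>[(x1, x2, y). (x, y) \<leftarrow> DR \<H> g, (x1, x2) \<leftarrow> DL \<H> x]. S x * y * \<phi> z)
      = (\<Sum>(x, y, z)\<leftarrow>[(x, y1, y2). (x, y) \<leftarrow> DL \<H> g, (y1, y2) \<leftarrow> DR \<H> y]. S x * y * \<phi> z)"
    by (rule tens3_eq_sum[OF mixed_LR])
      (simp_all add: S_plus algebra_simps HrR_def HlR_def HrL_def HlL_def S_tL_left mult.assoc
        assms(2) additive.add[OF assms(1)])
  moreover have "(\<Sum>x\<leftarrow>DL \<H> z. S (fst x) * snd x * c) = sR \<H> (eR \<H> z) * c" for z c
    using anti_left[of z] by (simp add: sum_list_mult_const case_prod_unfold)
  ultimately show ?thesis by (simp add: sum_list_pairs)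
qed

text \<open>The twisting axiom covers \<open>tL\<close> on the left and \<open>tR\<close> on the
  right. For \<open>tR\<close> on the left, both sides are expanded into sums of
  \<open>S x * y1 * S (tR r * y2)\<close> and \<open>S x * y1 * S y2 * sR r\<close>. They agree
  because the sum of \<open>y1 * S y2\<close> lies in the image of \<open>sL\<close>, which commutes
  with \<open>sR r\<close>.\<close>

lemma S_tR_left: "S (tR \<H> r * g) = S g * sR \<H> r"
proof -
  have inner: "(\<Sum>(x, y)\<leftarrow>DR \<H> z. x * S (tR \<H> r * y)) = (\<Sum>(x, y)\<leftarrow>DR \<H> z. x * (S y * sR \<H> r))" for z
  proof -
    have "(\<Sum>(x, y)\<leftarrow>[(sR \<H> r * x, y). (x, y) \<leftarrow> DR \<H> z]. x * S y)
        = (\<Sum>(x, y)\<leftarrow>[(x, tR \<H> r * y). (x, y) \<leftarrow> DR \<H> z]. x * S y)"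
      by (rule tens_eq_sum[OF DR_takeuchi])
        (simp_all add: S_plus algebra_simps HrR_def HlR_def S_tR_right mult.assoc)
    moreover have "(\<Sum>(x, y)\<leftarrow>DR \<H> z. sR \<H> r * (x * S y)) = (\<Sum>(x, y)\<leftarrow>DR \<H> z. (x * S y) * sR \<H> r)"
      using anti_right[of z] sL_sR_commute[of "eL \<H> z" r]
      by (simp add: sum_list_mult_const sum_list_const_mult case_prod_unfold)
    ultimately show ?thesis by (simp add: sum_list_pairs mult.assoc)
  qed
  have "S (tR \<H> r * g) = (\<Sum>(x, y)\<leftarrow>DR \<H> g. sR \<H> (eR \<H> x) * S (tR \<H> r * y))"
  proof -
    have "S (tR \<H> r * g) = S (tR \<H> r * (\<Sum>(x, y)\<leftarrow>DR \<H> g. y * tR \<H> (eR \<H> x)))" by (simp add: eR_counit)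
    also have "\<dots> = S (\<Sum>(x, y)\<leftarrow>DR \<H> g. (tR \<H> r * y) * tR \<H> (eR \<H> x))"
      by (simp add: sum_list_const_mult case_prod_unfold mult.assoc)
    finally show ?thesis by (simp only: additive_sum_list[OF anti_add] case_prod_unfold S_tR_right)
  qed
  also have "\<dots> = (\<Sum>(x, y)\<leftarrow>DL \<H> g. \<Sum>(y1, y2)\<leftarrow>DR \<H> y. S x * y1 * S (tR \<H> r * y2))"
    by (rule sum_S_mixed[symmetric])
      (simp_all add: additive_def algebra_simps S_plus S_tR_right flip: mult.assoc)
  also have "\<dots> = (\<Sum>(x, y)\<leftarrow>DL \<H> g. \<Sum>(y1, y2)\<leftarrow>DR \<H> y. S x * y1 * (S y2 * sR \<H> r))"
    using inner by (simp add: case_prod_unfold sum_list_const_mult mult.assoc)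
  also have "\<dots> = (\<Sum>(x, y)\<leftarrow>DR \<H> g. sR \<H> (eR \<H> x) * (S y * sR \<H> r))"
    by (rule sum_S_mixed) (simp_all add: additive_def algebra_simps S_plus S_tR_right mult.assoc)
  also have "\<dots> = S g * sR \<H> r"
    by (subst (2) S_expand_DR) (simp add: case_prod_unfold sum_list_mult_const flip: mult.assoc)
  finally show ?thesis .
qed

text \<open>Expanding \<open>S (h * g)\<close> by the left counit of \<open>h * g\<close> produces a
  factor \<open>sL (eL (y * sL (eL y')))\<close>, which \<open>sL_eL_sL_right\<close> turns into
  \<open>y1 * sL (eL y') * S y2\<close>. Mixed coassociativity for \<open>h\<close> then splits off
  the second leg of \<open>DR h\<close> as the rightmost factor, under \<open>S\<close>. The same
  device for \<open>g\<close> leaves the left antipode axiom for a product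
  \<open>a * b\<close>.\<close>

lemma S_mult: "S (h * g) = S g * S h"
proof -
  let ?F = "\<lambda>x y1 y2. \<Sum>(x', y')\<leftarrow>DL \<H> g. S (x * x') * y1 * sL \<H> (eL \<H> y') * S y2"
  have "S (h * g) = (\<Sum>(x, y)\<leftarrow>[(x * x', y * y'). (x, y) \<leftarrow> DL \<H> h, (x', y') \<leftarrow> DL \<H> g]. S x * sL \<H> (eL \<H> y))"
    unfolding S_expand_DL[of "h * g"]
    by (rule tens_eq_sum[OF DL_mult])
      (simp_all add: S_plus eL_plus sL_add algebra_simps HrL_def HlL_def S_tL_left eL_sL_left sL_hom mult.assoc)
  also have "\<dots> = (\<Sum>(x, y)\<leftarrow>DL \<H> h. \<Sum>(x', y')\<leftarrow>DL \<H> g. S (x * x') * sL \<H> (eL \<H> (y * sL \<H> (eL \<H> y'))))"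
    by (simp add: sum_list_pairs eL_mult)
  also have "\<dots> = (\<Sum>(x, y)\<leftarrow>DL \<H> h. \<Sum>(y1, y2)\<leftarrow>DR \<H> y. ?F x y1 y2)"
    unfolding sL_eL_sL_right
    by (simp add: case_prod_unfold mult.assoc flip: sum_list_const_mult)
      (rule arg_cong[of _ _ sum_list], rule map_cong[OF refl], rule sum_list_swap)
  also have "\<dots> = (\<Sum>(x, y1, y2)\<leftarrow>[(x, y1, y2). (x, y) \<leftarrow> DL \<H> h, (y1, y2) \<leftarrow> DR \<H> y]. ?F x y1 y2)"
    by (simp add: sum_list_pairs)
  also have "\<dots> = (\<Sum>(x, y1, y2)\<leftarrow>[(x1, x2, y). (x, y) \<leftarrow> DR \<H> h, (x1, x2) \<leftarrow> DL \<H> x]. ?F x y1 y2)"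
  proof (rule tens3_eq_sum[OF mixed_LR, symmetric])
    fix q x y1 y2
    have "sL \<H> (eL \<H> z) * (sR \<H> q * w) = sR \<H> q * (sL \<H> (eL \<H> z) * w)" for z w
      by (metis mult.assoc sL_sR_commute)
    then show "?F x (HrR \<H> q y1) y2 = ?F x y1 (HlR \<H> q y2)"
      by (simp add: HrR_def HlR_def S_tR_right mult.assoc)
  qed (simp_all add: sum_list_addf case_prod_unfold S_plus algebra_simps HrL_def HlL_def S_tL_left mult.assoc)
  also have "\<dots> = (\<Sum>(a, c)\<leftarrow>DR \<H> h. (\<Sum>(x', y')\<leftarrow>DL \<H> g. \<Sum>(a1, a2)\<leftarrow>DL \<H> a. S (a1 * x') * a2 * sL \<H> (eL \<H> y')) * S c)"
    by (simp add: sum_list_pairs flip: sum_list_mult_const)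
      (rule arg_cong[of _ _ sum_list], rule map_cong[OF refl], rule sum_list_swap)
  \<comment> \<open>The inner sum is independent of \<open>c\<close>; it is evaluated for each
    \<open>a\<close> by repeating the argument with \<open>g\<close> in the role of
    \<open>h\<close>.\<close>
  also have "\<dots> = (\<Sum>(a, c)\<leftarrow>DR \<H> h. S g * sR \<H> (eR \<H> a) * S c)"
  proof -
    have "(\<Sum>(x', y')\<leftarrow>DL \<H> g. \<Sum>(a1, a2)\<leftarrow>DL \<H> a. S (a1 * x') * a2 * sL \<H> (eL \<H> y')) = S g * sR \<H> (eR \<H> a)" for a
    proof -
      let ?G = "\<lambda>x' z w. (\<Sum>(a1, a2)\<leftarrow>DL \<H> a. S (a1 * x') * a2 * z) * S w"
      have "(\<Sum>(x', y')\<leftarrow>DL \<H> g. \<Sum>(a1, a2)\<leftarrow>DL \<H> a. S (a1 * x') * a2 * sL \<H> (eL \<H> y'))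
          = (\<Sum>(x', y')\<leftarrow>DL \<H> g. \<Sum>(z, w)\<leftarrow>DR \<H> y'. ?G x' z w)"
        unfolding anti_right[symmetric]
        by (simp add: case_prod_unfold mult.assoc flip: sum_list_mult_const sum_list_const_mult)
          (rule arg_cong[of _ _ sum_list], rule map_cong[OF refl], rule sum_list_swap)
      also have "\<dots> = (\<Sum>(x, y, z)\<leftarrow>[(x, y1, y2). (x, y) \<leftarrow> DL \<H> g, (y1, y2) \<leftarrow> DR \<H> y]. ?G x y z)"
        by (simp add: sum_list_pairs)
      also have "\<dots> = (\<Sum>(x, y, z)\<leftarrow>[(x1, x2, y). (x, y) \<leftarrow> DR \<H> g, (x1, x2) \<leftarrow> DL \<H> x]. ?G x y z)"
      proof (rule tens3_eq_sum[OF mixed_LR, symmetric])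
        fix q x y z
        have "(\<Sum>(a1, a2)\<leftarrow>[(a1 * tL \<H> q, a2). (a1, a2) \<leftarrow> DL \<H> a]. S (a1 * x) * a2 * y)
            = (\<Sum>(a1, a2)\<leftarrow>[(a1, a2 * sL \<H> q). (a1, a2) \<leftarrow> DL \<H> a]. S (a1 * x) * a2 * y)"
          by (rule tens_eq_sum[OF DL_takeuchi])
            (simp_all add: S_plus algebra_simps HrL_def HlL_def S_tL_left mult.assoc)
        then show "?G (HrL \<H> q x) y z = ?G x (HlL \<H> q y) z"
          by (simp add: sum_list_pairs HrL_def HlL_def mult.assoc)
      qed (simp_all add: sum_list_addf case_prod_unfold S_plus algebra_simps HrR_def HlR_def S_tR_right
          mult.assoc flip: sum_list_mult_const)
      also have "\<dots> = (\<Sum>(b, d)\<leftarrow>DR \<H> g. sR \<H> (eR \<H> (a * b)) * S d)"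
      proof -
        have "(\<Sum>(b1, b2)\<leftarrow>DL \<H> b. \<Sum>(a1, a2)\<leftarrow>DL \<H> a. S (a1 * b1) * a2 * b2) = sR \<H> (eR \<H> (a * b))" for b
        proof -
          have "sR \<H> (eR \<H> (a * b)) = (\<Sum>(x, y)\<leftarrow>[(x * x', y * y'). (x, y) \<leftarrow> DL \<H> a, (x', y') \<leftarrow> DL \<H> b]. S x * y)"
            unfolding anti_left[symmetric]
            by (rule tens_eq_sum[OF DL_mult]) (simp_all add: S_plus algebra_simps HrL_def HlL_def S_tL_left mult.assoc)
          then show ?thesis by (simp add: sum_list_pairs mult.assoc) (rule sum_list_swap)
        qed
        then show ?thesis by (simp add: sum_list_pairs sum_list_mult_const)
      qed
      \<comment> \<open>\<open>eR (a * b) = eR (sR (eR a) * b)\<close>. The Takeuchi condition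
        carries this factor to the other leg as \<open>tR (eR a)\<close>, and
        \<open>S_tR_left\<close> brings it out on the right of the antipode.\<close>
      also have "\<dots> = (\<Sum>(b, d)\<leftarrow>[(sR \<H> (eR \<H> a) * x, y). (x, y) \<leftarrow> DR \<H> g]. sR \<H> (eR \<H> b) * S d)"
        by (simp add: sum_list_pairs eR_mult)
      also have "\<dots> = (\<Sum>(b, d)\<leftarrow>[(x, tR \<H> (eR \<H> a) * y). (x, y) \<leftarrow> DR \<H> g]. sR \<H> (eR \<H> b) * S d)"
        by (rule tens_eq_sum[OF DR_takeuchi])
          (simp_all add: S_plus eR_plus sR_add algebra_simps HrR_def HlR_def S_tR_right eR_sR_right sR_hom mult.assoc)
      also have "\<dots> = S g * sR \<H> (eR \<H> a)"
        by (subst (2) S_expand_DR) (simp add: sum_list_pairs S_tR_left mult.assoc flip: sum_list_mult_const)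
      finally show ?thesis .
    qed
    then show ?thesis by simp
  qed
  also have "\<dots> = S g * S h"
    by (subst (3) S_expand_DR) (simp add: case_prod_unfold mult.assoc flip: sum_list_const_mult)
  finally show ?thesis .
qed

end

section \<open>The inverse of the antipode\<close>

locale bijective_hopf_algebroid = hopf_algebroid +
  assumes bij_anti: "bij (anti \<H>)"
begin

abbreviation "Si \<equiv> inv (anti \<H>)"

lemma S_Si [simp]: "S (Si h) = h" and Si_S [simp]: "Si (S h) = h"
  using bij_anti by (simp_all add: bij_is_surj surj_f_inv_f bij_is_inj)

lemma Si_eq_iff: "Si h = g \<longleftrightarrow> h = S g"
  by auto

lemma Si_mult: "Si (h * g) = Si g * Si h" and Si_add: "Si (h + g) = Si h + Si g" and Si_one [simp]: "Si 1 = 1"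
  by (simp_all add: Si_eq_iff S_mult S_plus)

lemma additive_Si: "additive Si"
  by (simp add: additive_def Si_add)

lemma Si_sL [simp]: "Si (sL \<H> l) = tL \<H> l" and Si_sR [simp]: "Si (sR \<H> r) = tR \<H> r"
  by (simp_all add: Si_eq_iff)

text \<open>Applying \<open>Si\<close> to the left antipode axiom writes \<open>tR (eR h)\<close> as
  the sum of \<open>Si y * x\<close>. Under \<open>eL\<close> the factor \<open>x\<close> may be
  replaced by \<open>tL (eL x)\<close>; it enters \<open>Si\<close> as \<open>sL (eL x)\<close> on
  the left of \<open>y\<close>, where the counit absorbs it.\<close>

lemma eL_Si: "eL \<H> (Si h) = eL \<H> (tR \<H> (eR \<H> h))"
proof -
  have "tR \<H> (eR \<H> h) = (\<Sum>(x, y)\<leftarrow>DL \<H> h. Si y * x)"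
    using arg_cong[OF anti_left[of h], of Si]
    by (simp add: additive_sum_list[OF additive_Si] case_prod_unfold Si_mult)
  then have "eL \<H> (tR \<H> (eR \<H> h)) = (\<Sum>(x, y)\<leftarrow>DL \<H> h. eL \<H> (Si y * tL \<H> (eL \<H> x)))"
    by (simp add: additive_sum_list[OF eL_add] case_prod_unfold eL_mult)
  also have "\<dots> = eL \<H> (Si (\<Sum>(x, y)\<leftarrow>DL \<H> h. sL \<H> (eL \<H> x) * y))"
    by (simp add: additive_sum_list[OF eL_add] additive_sum_list[OF additive_Si] case_prod_unfold Si_mult)
  finally show ?thesis by (simp add: eL_counit)
qed

lemma sL_eL_Si: "sL \<H> (eL \<H> (Si h * sL \<H> p)) = tR \<H> (eR \<H> (sR \<H> (eR \<H> (sL \<H> p)) * h))"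
proof -
  have "Si h * sL \<H> p = Si (sR \<H> (eR \<H> (sL \<H> p)) * h)" by (simp add: Si_mult units)
  then show ?thesis by (simp add: eL_Si units)
qed

text \<open>By \<open>sL_eL_Si\<close> each summand is \<open>y * tR (eR (sR r * x))\<close> with
  \<open>r = eR (sL p)\<close>. The Takeuchi condition turns \<open>sR r\<close> into
  \<open>tR r = sL p\<close> on the left of \<open>y\<close>, and the counit removes the
  rest.\<close>

lemma sum_DR_sL_eL_Si: "(\<Sum>(x, y)\<leftarrow>DR \<H> h. y * sL \<H> (eL \<H> (Si x * sL \<H> p))) = sL \<H> p * h"
proof -
  let ?r = "eR \<H> (sL \<H> p)"
  have "(\<Sum>(x, y)\<leftarrow>DR \<H> h. y * sL \<H> (eL \<H> (Si x * sL \<H> p)))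
      = (\<Sum>(x, y)\<leftarrow>[(sR \<H> ?r * x, y). (x, y) \<leftarrow> DR \<H> h]. y * tR \<H> (eR \<H> x))"
    by (simp add: sum_list_pairs sL_eL_Si)
  also have "\<dots> = (\<Sum>(x, y)\<leftarrow>[(x, tR \<H> ?r * y). (x, y) \<leftarrow> DR \<H> h]. y * tR \<H> (eR \<H> x))"
    by (rule tens_eq_sum[OF DR_takeuchi])
      (simp_all add: eR_plus tR_add algebra_simps HrR_def HlR_def eR_sR_right tR_antihom mult.assoc)
  also have "\<dots> = tR \<H> ?r * (\<Sum>(x, y)\<leftarrow>DR \<H> h. y * tR \<H> (eR \<H> x))"
    by (simp add: sum_list_pairs mult.assoc flip: sum_list_const_mult)
  finally show ?thesis by (simp add: eR_counit units)
qed

end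

section \<open>Simplices and chains\<close>

text \<open>Slot \<open>n + 1\<close> is the coefficient. With this convention the relations between
  neighbouring morphisms and the one between the last morphism and \<open>m\<close> form a single
  family, indexed by \<open>i \<le> n\<close>.\<close>

definition upd :: "('o, 'f, 'h) hcat \<Rightarrow> ('r, 'h, 'm) coeff \<Rightarrow> nat \<Rightarrow> nat \<Rightarrow> 'h \<Rightarrow>
    'o list \<times> 'f list \<times> 'm \<Rightarrow> 'o list \<times> 'f list \<times> 'm" where
  "upd C M n i h = (\<lambda>(Xs, fs, m). if i \<le> n
     then (Xs, fs[i := Act C (src n Xs i) (Xs ! i) h (fs ! i)], m) else (Xs, fs, mact M h m))"

definition put :: "nat \<Rightarrow> 'f \<Rightarrow> 'o list \<times> 'f list \<times> 'm \<Rightarrow> 'o list \<times> 'f list \<times> 'm" where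
  "put i f = (\<lambda>(Xs, fs, m). (Xs, fs[i := f], m))"

definition putm :: "'m \<Rightarrow> 'o list \<times> 'f list \<times> 'm \<Rightarrow> 'o list \<times> 'f list \<times> 'm" where
  "putm m = (\<lambda>(Xs, fs, _). (Xs, fs, m))"

definition hom_at :: "('o, 'f, 'h) hcat \<Rightarrow> nat \<Rightarrow> nat \<Rightarrow> 'o list \<times> 'f list \<times> 'm \<Rightarrow> 'f set" where
  "hom_at C n i = (\<lambda>(Xs, fs, m). Hom C (src n Xs i) (Xs ! i))"

definition face_simplex :: "('o, 'f, 'h) hcat \<Rightarrow> nat \<Rightarrow> nat \<Rightarrow>
    'o list \<times> 'f list \<times> 'm \<Rightarrow> 'o list \<times> 'f list \<times> 'm" where
  "face_simplex C n i = (\<lambda>(Xs, fs, m). (take (Suc i) Xs @ drop (i + 2) Xs,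
     take i fs @ Comp C (src n Xs (Suc i)) (Xs ! Suc i) (Xs ! i) (fs ! i) (fs ! Suc i) # drop (i + 2) fs, m))"

text \<open>\<open>tau\<close> is the value of \<open>\<tau>\<^sub>n\<close> on chosen representatives.\<close>

definition tau :: "('o, 'f, 'h) hcat \<Rightarrow> ('r, 'h, 'm) coeff \<Rightarrow> nat \<Rightarrow> ('o, 'f, 'm) chain \<Rightarrow> ('o, 'f, 'm) chain" where
  "tau C M n = frag_extend (\<lambda>(Xs, fs, m). \<Sum>(h, m')\<leftarrow>lamL M m.
     frag_of (last Xs # butlast Xs, Act C (src n Xs n) (last Xs) h (last fs) # butlast fs, m'))"

abbreviation frag_map :: "('a \<Rightarrow> 'b) \<Rightarrow> ('a \<Rightarrow>\<^sub>0 int) \<Rightarrow> ('b \<Rightarrow>\<^sub>0 int)" where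
  "frag_map g \<equiv> frag_extend (frag_of \<circ> g)"

lemma frag_extend_frag_map: "frag_extend f (frag_map g x) = frag_extend (\<lambda>\<sigma>. f (g \<sigma>)) x"
  using frag_extend_compose[of f g x] by (simp add: comp_def)

lemma chain_face_eq: "chain_face C n i = frag_map (face_simplex C n i)"
  by (simp add: chain_face_def face_simplex_def comp_def case_prod_unfold)

lemma chain_act_diff: "chain_act \<H> C M n (x - y) h = chain_act \<H> C M n x h - chain_act \<H> C M n y h"
  by (simp add: chain_act_def frag_extend_diff)

lemma add_subgroup_chains [simp]: "add_subgroup (chains C n)"
  unfolding add_subgroup_def chains_def by (simp, meson keys_diff Un_least order_trans)

lemma frag_of_chains [simp]: "frag_of \<sigma> \<in> chains C n \<longleftrightarrow> \<sigma> \<in> tensors C n"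
  by (simp add: chains_def)

lemma chains_diff: "x \<in> chains C n \<Longrightarrow> y \<in> chains C n \<Longrightarrow> x - y \<in> chains C n"
  using add_subgroup_chains unfolding add_subgroup_def by blast

lemmas chains_add = add_subgroup_add[OF add_subgroup_chains]
  and chains_sum_list = add_subgroup_sum_list[OF add_subgroup_chains]

lemma chains_0 [simp]: "0 \<in> chains C n"
  by (simp add: chains_def)

lemma chains_induct [consumes 1, case_names zero one diff]:
  assumes "x \<in> chains C n" and "P 0" and "\<And>\<sigma>. \<sigma> \<in> tensors C n \<Longrightarrow> P (frag_of \<sigma>)"
    and "\<And>x y. P x \<Longrightarrow> P y \<Longrightarrow> P (x - y)"
  shows "P x"
  using assms(1)[unfolded chains_def, simplified] assms(2-) by (rule frag_induction)

lemma frag_extend_mem: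
  assumes "x \<in> chains C n" and N: "add_subgroup N" and "\<And>\<sigma>. \<sigma> \<in> tensors C n \<Longrightarrow> f \<sigma> \<in> N"
  shows "frag_extend f x \<in> N"
  using assms(1) by (induction rule: chains_induct)
    (use assms(2,3) in \<open>auto simp: frag_extend_diff add_subgroup_def\<close>)

lemma frag_extend_cong_mod:
  assumes "x \<in> chains C n" and N: "add_subgroup N"
    and "\<And>\<sigma>. \<sigma> \<in> tensors C n \<Longrightarrow> cong_mod N (f \<sigma>) (g \<sigma>)"
  shows "cong_mod N (frag_extend f x) (frag_extend g x)"
  using assms(1) by (induction rule: chains_induct)
    (use assms(2,3) in \<open>auto simp: frag_extend_diff intro: cong_mod_diff\<close>)

lemma frag_extend_chains_eq:
  assumes "x \<in> chains C n" and "\<And>\<sigma>. \<sigma> \<in> tensors C n \<Longrightarrow> f \<sigma> = g \<sigma>"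
  shows "frag_extend f x = frag_extend g x"
  using frag_extend_cong_mod[OF assms(1) add_subgroup_zero_singleton, of f g] assms(2) by simp

lemma frag_extend_additive_span_mem:
  assumes "x \<in> additive_span S" and N: "add_subgroup N" and "\<And>s. s \<in> S \<Longrightarrow> frag_extend f s \<in> N"
  shows "frag_extend f x \<in> N"
  using assms(1) by induction (use assms(2,3) in \<open>auto simp: frag_extend_diff add_subgroup_def\<close>)

lemma additive_span_least:
  assumes "x \<in> additive_span S" and "add_subgroup N" and "S \<subseteq> N"
  shows "x \<in> N"
  using assms by (induction) (auto simp: add_subgroup_def)

lemma frag_extend_sum_list_fun:
  fixes f :: "'p \<Rightarrow> 's \<Rightarrow> 'x \<Rightarrow>\<^sub>0 int"
  shows "frag_extend (\<lambda>\<sigma>. \<Sum>p\<leftarrow>ps. f p \<sigma>) x = (\<Sum>p\<leftarrow>ps. frag_extend (f p) x)"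
proof (induction ps)
  case (Cons p ps)
  have "frag_extend (\<lambda>\<sigma>. g \<sigma> + h \<sigma>) x = frag_extend g x + frag_extend h x" for g h :: "'s \<Rightarrow> 'x \<Rightarrow>\<^sub>0 int"
    by (simp add: frag_extend_def frag_cmul_distrib2 sum.distrib)
  then show ?case using Cons by simp
qed (simp add: frag_extend_def)

lemma src_rotate:
  assumes "length Xs = Suc n" and "i \<le> n"
  shows "src n (last Xs # butlast Xs) i = Xs ! i"
proof (cases "i = n")
  case True
  then show ?thesis using assms by (simp add: src_def last_conv_nth flip: length_0_conv)
next
  case False
  then show ?thesis using assms by (simp add: src_def nth_butlast)
qed

lemma nth_rotate: "length Xs = Suc n \<Longrightarrow> (last Xs # butlast Xs) ! 0 = Xs ! n"
    "length Xs = Suc n \<Longrightarrow> i < n \<Longrightarrow> (last Xs # butlast Xs) ! Suc i = Xs ! i"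
  by (auto simp: last_conv_nth nth_butlast simp flip: length_0_conv)

lemma src_less: "i < n \<Longrightarrow> src n Xs i = Xs ! Suc i" and src_last: "src n Xs n = Xs ! 0"
  by (simp_all add: src_def)

lemma nth_skip: "length Xs = Suc (Suc n) \<Longrightarrow> i \<le> n \<Longrightarrow> j \<le> n \<Longrightarrow>
    (take (Suc i) Xs @ drop (i + 2) Xs) ! j = (if j \<le> i then Xs ! j else Xs ! Suc j)"
  by (auto simp: nth_append min_def)

lemma nth_comp_skip: "length fs = Suc (Suc n) \<Longrightarrow> i \<le> n \<Longrightarrow> j \<le> n \<Longrightarrow>
    (take i fs @ f # drop (i + 2) fs) ! j = (if j < i then fs ! j else if j = i then f else fs ! Suc j)"
  by (auto simp: nth_append min_def nth_Cons split: nat.split) (rule arg_cong[of _ _ "(!) fs"], linarith)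

lemma src_skip: 
  assumes "length Xs = Suc (Suc n)" "i \<le> n" "j \<le> n"
  shows "src n (take (Suc i) Xs @ drop (i + 2) Xs) j = (if j < i then src (Suc n) Xs j else src (Suc n) Xs (Suc j))"
proof (cases "j = n")
  case True
  then show ?thesis using assms nth_skip[OF assms(1,2), of 0] by (auto simp: src_last src_less)
next
  case False
  then show ?thesis using assms nth_skip[OF assms(1,2), of "Suc j"] by (auto simp: src_less)
qed

text \<open>That all operations preserve \<open>chains\<close> follows from closure of the Hom-sets
  alone. Isolating this lets the same lemmas serve \<open>LS\<close>, through
  \<open>closed_cat_LS\<close>.\<close>

locale closed_cat =
  fixes C :: "('o, 'f::ab_group_add, 'h::{ring,monoid_mult}) hcat"
  assumes Hom_plus: "\<lbrakk>X \<in> Ob C; Y \<in> Ob C; f \<in> Hom C X Y; g \<in> Hom C X Y\<rbrakk> \<Longrightarrow> f + g \<in> Hom C X Y"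
    and Hom_Act: "\<lbrakk>X \<in> Ob C; Y \<in> Ob C; f \<in> Hom C X Y\<rbrakk> \<Longrightarrow> Act C X Y h f \<in> Hom C X Y"
    and Hom_Comp: "\<lbrakk>X \<in> Ob C; Y \<in> Ob C; Z \<in> Ob C; f \<in> Hom C Y Z; g \<in> Hom C X Y\<rbrakk>
      \<Longrightarrow> Comp C X Y Z f g \<in> Hom C X Z"
begin

lemma tensors_Ob: "(Xs, fs, m) \<in> tensors C n \<Longrightarrow> i \<le> n \<Longrightarrow> Xs ! i \<in> Ob C"
    "(Xs, fs, m) \<in> tensors C n \<Longrightarrow> i \<le> n \<Longrightarrow> src n Xs i \<in> Ob C"
  by (auto simp: tensors_def src_def less_Suc_eq_le)

lemma tensors_hom: "(Xs, fs, m) \<in> tensors C n \<Longrightarrow> i \<le> n \<Longrightarrow> fs ! i \<in> Hom C (src n Xs i) (Xs ! i)"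
  by (simp add: tensors_def)

lemma put_tensors: "\<sigma> \<in> tensors C n \<Longrightarrow> i \<le> n \<Longrightarrow> f \<in> hom_at C n i \<sigma> \<Longrightarrow> put i f \<sigma> \<in> tensors C n"
  by (cases \<sigma>) (auto simp: tensors_def put_def hom_at_def nth_list_update)

lemma hom_at_plus: "\<sigma> \<in> tensors C n \<Longrightarrow> i \<le> n \<Longrightarrow> f \<in> hom_at C n i \<sigma> \<Longrightarrow> g \<in> hom_at C n i \<sigma> \<Longrightarrow> f + g \<in> hom_at C n i \<sigma>"
  by (cases \<sigma>) (auto simp: hom_at_def tensors_Ob Hom_plus)

lemma upd_tensors: "\<sigma> \<in> tensors C n \<Longrightarrow> upd C M n i h \<sigma> \<in> tensors C n"
  by (cases \<sigma>) (auto simp: upd_def tensors_def nth_list_update src_def less_Suc_eq_le intro!: Hom_Act)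

lemma face_tensors:
  assumes "\<sigma> \<in> tensors C (Suc n)" and "i \<le> n"
  shows "face_simplex C (Suc n) i \<sigma> \<in> tensors C n"
proof (cases \<sigma>)
  case (fields Xs fs m)
  then have T: "(Xs, fs, m) \<in> tensors C (Suc n)" using assms by simp
  then have l: "length Xs = Suc (Suc n)" "length fs = Suc (Suc n)" "set Xs \<subseteq> Ob C" by (auto simp: tensors_def)
  have c: "Comp C (src (Suc n) Xs (Suc i)) (Xs ! Suc i) (Xs ! i) (fs ! i) (fs ! Suc i)
      \<in> Hom C (src (Suc n) Xs (Suc i)) (Xs ! i)"
    using tensors_hom[OF T, of i] tensors_hom[OF T, of "Suc i"] tensors_Ob[OF T] assms(2)
    by (intro Hom_Comp) (auto simp: src_less)
  have "set (take (Suc i) Xs) \<subseteq> Ob C" "set (drop (i + 2) Xs) \<subseteq> Ob C"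
    using l(3) by (auto dest!: in_set_takeD in_set_dropD)
  then show ?thesis
    using l assms(2) c tensors_hom[OF T]
    by (simp add: fields face_simplex_def tensors_def nth_comp_skip[OF l(2) assms(2), simplified]
        src_skip[OF l(1) assms(2), simplified] nth_skip[OF l(1) assms(2), simplified])
qed

lemma rotate_tensors:
  assumes T: "(Xs, fs, m) \<in> tensors C n" and f: "f \<in> Hom C (src n Xs n) (last Xs)"
  shows "(last Xs # butlast Xs, f # butlast fs, m') \<in> tensors C n"
proof -
  have l: "length Xs = Suc n" "length fs = Suc n" "set Xs \<subseteq> Ob C" using T by (auto simp: tensors_def)
  have "set (last Xs # butlast Xs) \<subseteq> Ob C"
    using l in_set_butlastD[of _ Xs] last_in_set[of Xs] by fastforce
  moreover have "(f # butlast fs) ! i \<in> Hom C (Xs ! i) ((last Xs # butlast Xs) ! i)" if "i \<le> n" for i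
  proof (cases i)
    case 0
    then show ?thesis using f by (simp add: src_last)
  next
    case (Suc j)
    then show ?thesis using that l tensors_hom[OF T, of j]
      by (auto simp: nth_rotate nth_butlast src_less)
  qed
  ultimately show ?thesis using l by (simp add: tensors_def src_rotate)
qed

lemma rotate_Act_tensors:
  "(Xs, fs, m) \<in> tensors C n \<Longrightarrow>
    (last Xs # butlast Xs, Act C (src n Xs n) (last Xs) h (last fs) # butlast fs, m') \<in> tensors C n"
  by (rule rotate_tensors, assumption, rule Hom_Act)
    (auto simp: tensors_def src_def last_conv_nth simp flip: length_0_conv)

lemma chain_face_chains: "x \<in> chains C (Suc n) \<Longrightarrow> i \<le> n \<Longrightarrow> chain_face C (Suc n) i x \<in> chains C n"
  unfolding chain_face_eq by (rule frag_extend_mem) (auto simp: face_tensors)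

lemma cyc_value_chains:
  "(Xs, fs, m) \<in> tensors C n \<Longrightarrow> (\<Sum>(h, m')\<leftarrow>t. frag_of (last Xs # butlast Xs,
      Act C (src n Xs n) (last Xs) h (last fs) # butlast fs, m')) \<in> chains C n"
  by (rule chains_sum_list) (auto simp: rotate_Act_tensors)

lemma tau_chains: "x \<in> chains C n \<Longrightarrow> tau C M n x \<in> chains C n"
  unfolding tau_def by (rule frag_extend_mem) (auto simp: cyc_value_chains)

lemma chain_act_chains: "x \<in> chains C n \<Longrightarrow> chain_act \<H> C M n x h \<in> chains C n"
  unfolding chain_act_def
  by (rule frag_extend_mem, auto split: prod.splits intro!: chains_sum_list Hom_Act
      simp: tensors_def src_def less_Suc_eq_le nth_append simp del: iterD.simps upt_Suc,
      (metis subsetD nth_mem mod_less_divisor zero_less_Suc less_Suc_eq_le)+)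

lemma chain_rel_chains: "x \<in> chain_rel \<H> C M n \<Longrightarrow> x \<in> chains C n"
  unfolding chain_rel_def
proof (erule additive_span_least[OF _ add_subgroup_chains], safe, goal_cases)
  case (1 x Xs fs m i f g)
  then show ?case using Hom_plus[of "src n Xs i" "Xs ! i" f g] tensors_Ob[OF 1(1)]
    by (intro chains_diff) (auto simp: tensors_def nth_list_update)
next
  case (2 x Xs fs m m')
  then show ?case by (intro chains_diff) (auto simp: tensors_def)
next
  case (3 x Xs fs m i l)
  then show ?case using upd_tensors[OF 3(1), of undefined i] upd_tensors[OF 3(1), of undefined "Suc i"]
    by (intro chains_diff) (auto simp: upd_def)
next
  case (4 x Xs fs m l)
  then show ?case using upd_tensors[OF 4(1), of undefined n]
    by (intro chains_diff) (auto simp: upd_def tensors_def)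
qed

lemma cyc_graph_chains:
  "(x, y) \<in> cyc_graph \<H> C M n \<Longrightarrow> x \<in> chains C n \<and> y \<in> chains C n"
  by (induction rule: cyc_graph.induct) (auto simp: cyc_value_chains chain_rel_chains chains_diff)

lemma cyc_graph_pow_chains:
  "(x, y) \<in> cyc_graph \<H> C M n ^^ j \<Longrightarrow> x \<in> chains C n \<Longrightarrow> y \<in> chains C n"
  by (cases j) (auto dest: cyc_graph_chains)

lemma null_chain_chains: "null_chain \<H> C M n x \<Longrightarrow> x \<in> chains C n"
proof (induction rule: null_chain.induct)
  case (coeq x n y j h z)
  then show ?case by (auto intro!: chains_diff chain_act_chains dest: cyc_graph_pow_chains)
next
  case (last_face x n y z z')
  then show ?case
    by (auto intro!: chains_diff chain_face_chains simp: face_graph_def dest: cyc_graph_chains)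
qed (auto simp: chain_rel_chains chains_diff chain_face_chains dest: cyc_graph_chains)

lemma cyc_graph_tau: "x \<in> chains C n \<Longrightarrow> (x, tau C M n x) \<in> cyc_graph \<H> C M n"
proof (induction rule: chains_induct)
  case zero
  then show ?case by (simp add: tau_def chain_rel_def additive_span.zero cyc_graph.null)
next
  case (one \<sigma>)
  then show ?case by (cases \<sigma>) (auto simp: tau_def intro: cyc_graph.formula)
next
  case (diff x y)
  then show ?case using cyc_graph.diff[OF diff] by (simp add: tau_def frag_extend_diff)
qed

lemma tau_pow_chains: "x \<in> chains C n \<Longrightarrow> (tau C M n ^^ j) x \<in> chains C n"
  by (induction j) (auto simp: tau_chains)

lemma cyc_graph_tau_pow: "x \<in> chains C n \<Longrightarrow> (x, (tau C M n ^^ j) x) \<in> cyc_graph \<H> C M n ^^ j"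
  by (induction j) (auto intro!: cyc_graph_tau tau_pow_chains)

end

section \<open>The action on chains\<close>

lemma upd_upd_commute: "i \<noteq> j \<Longrightarrow> i \<le> Suc n \<Longrightarrow> j \<le> Suc n \<Longrightarrow>
    upd C M n i h (upd C M n j g \<sigma>) = upd C M n j g (upd C M n i h \<sigma>)"
  by (cases \<sigma>) (auto simp: upd_def list_update_swap)

lemma upd_put_commute: "i \<noteq> j \<Longrightarrow> j \<le> n \<Longrightarrow> upd C M n i h (put j f \<sigma>) = put j f (upd C M n i h \<sigma>)"
  by (cases \<sigma>) (auto simp: upd_def put_def list_update_swap)

lemma upd_putm_commute: "i \<le> n \<Longrightarrow> upd C M n i h (putm m \<sigma>) = putm m (upd C M n i h \<sigma>)"
  by (cases \<sigma>) (auto simp: upd_def putm_def)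

lemma hom_at_upd [simp]: "hom_at C n i (upd C M n j h \<sigma>) = hom_at C n i \<sigma>"
  by (cases \<sigma>) (auto simp: upd_def hom_at_def)

text \<open>The coproduct of \<open>h\<close> with \<open>r + 1\<close> factors acts on the slots
  \<open>n + 1 - r\<close> to \<open>n + 1\<close>, that is, on the last \<open>r\<close> morphisms
  and the coefficient. Splitting off one factor at a time turns statements about the full action,
  \<open>r = n + 1\<close>, into inductions on \<open>r\<close>; \<open>suffix_act_iterD\<close> is
  the link with the action defined through \<open>iterD\<close>.\<close>

primrec suffix_act :: "('k, 'l, 'r, 'h) hopf_data \<Rightarrow> ('o, 'f, 'h) hcat \<Rightarrow> ('r, 'h, 'm) coeff \<Rightarrow> nat \<Rightarrow>
    nat \<Rightarrow> 'h \<Rightarrow> 'o list \<times> 'f list \<times> 'm \<Rightarrow> ('o, 'f, 'm) chain" where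
  "suffix_act \<H> C M n 0 h \<sigma> = frag_of (upd C M n (Suc n) h \<sigma>)"
| "suffix_act \<H> C M n (Suc r) h \<sigma> = (\<Sum>(x, y)\<leftarrow>DL \<H> h. suffix_act \<H> C M n r y (upd C M n (n - r) x \<sigma>))"

lemma suffix_act_iterD:
  assumes "length fs = Suc n" "r \<le> Suc n"
  shows "suffix_act \<H> C M n r h (Xs, fs, m) = (\<Sum>w\<leftarrow>iterD \<H> r h. frag_of (Xs,
    map (\<lambda>i. if i < Suc n - r then fs ! i
             else Act C (src n Xs i) (Xs ! i) (w ! (i - (Suc n - r))) (fs ! i)) [0..<Suc n],
    mact M (w ! r) m))"
  using assms
proof (induction r arbitrary: h fs)
  case 0
  then have "map (\<lambda>i. if i < Suc n then fs ! i else z i) [0..<Suc n] = fs" for z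
    by (intro nth_equalityI) (auto simp del: upt_Suc)
  then show ?case by (simp add: upd_def del: upt_Suc)
next
  case (Suc r)
  have eq: "map (\<lambda>i. if i < Suc n - r then fs[n - r := Act C (src n Xs (n - r)) (Xs ! (n - r)) x (fs ! (n - r))] ! i
             else Act C (src n Xs i) (Xs ! i) (w ! (i - (Suc n - r)))
               (fs[n - r := Act C (src n Xs (n - r)) (Xs ! (n - r)) x (fs ! (n - r))] ! i)) [0..<Suc n]
    = map (\<lambda>i. if i < Suc n - Suc r then fs ! i
             else Act C (src n Xs i) (Xs ! i) ((x # w) ! (i - (Suc n - Suc r))) (fs ! i)) [0..<Suc n]" for x w
  proof (rule map_cong[OF refl], goal_cases)
    case (1 i)
    consider "i < n - r" | "i = n - r" | "i > n - r" by linarith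
    then show ?case
    proof cases
      case 3
      then have "i - (n - r) = Suc (i - (Suc n - r))" using Suc.prems by linarith
      then show ?thesis using 3 Suc.prems by auto
    qed (use Suc.prems in auto)
  qed
  have "suffix_act \<H> C M n (Suc r) h (Xs, fs, m) = (\<Sum>(x, y)\<leftarrow>DL \<H> h. \<Sum>w\<leftarrow>iterD \<H> r y. frag_of (Xs,
    map (\<lambda>i. if i < Suc n - r then fs[n - r := Act C (src n Xs (n - r)) (Xs ! (n - r)) x (fs ! (n - r))] ! i
             else Act C (src n Xs i) (Xs ! i) (w ! (i - (Suc n - r)))
               (fs[n - r := Act C (src n Xs (n - r)) (Xs ! (n - r)) x (fs ! (n - r))] ! i)) [0..<Suc n],
    mact M (w ! r) m))"
    using Suc.prems by (simp add: upd_def Suc.IH del: upt_Suc)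
  then show ?case unfolding eq by (simp add: sum_list_pairs del: upt_Suc)
qed

section \<open>The action modulo the tensor relations\<close>

locale hcat_coeff = bijective_hopf_algebroid \<H> + h_category \<H> C + module_comodule \<H> M
  for \<H> :: "('k::comm_ring_1, 'l::{ring,monoid_mult}, 'r::{ring,monoid_mult},
      'h::{ring,monoid_mult}) hopf_data"
    and C :: "('o, 'f::ab_group_add, 'h) hcat"
    and M :: "('r, 'h, 'm::ab_group_add) coeff"
begin

abbreviation "K \<equiv> chain_rel \<H> C M"
abbreviation "U \<equiv> upd C M"
abbreviation "G \<equiv> suffix_act \<H> C M"

sublocale closed_cat C
proof
  fix X Y f g assume *: "X \<in> Ob C" "Y \<in> Ob C" "f \<in> Hom C X Y" "g \<in> Hom C X Y"
  then show "f + g \<in> Hom C X Y"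
    using Hom_subgroup(2)[OF *(1,2,3) Hom_subgroup(2)[OF *(1,2) Hom_subgroup(1)[OF *(1,2)] *(4)]] by simp
qed (auto intro: Act_Hom Comp_Hom)

lemma add_subgroup_K [simp]: "add_subgroup (K n)"
  by (simp add: chain_rel_def)

lemma K_trans [trans]: "cong_mod (K n) x y \<Longrightarrow> cong_mod (K n) y z \<Longrightarrow> cong_mod (K n) x z"
  by (rule cong_mod_trans[OF add_subgroup_K])

lemma K_sym: "cong_mod (K n) x y \<Longrightarrow> cong_mod (K n) y x"
  by (rule cong_mod_sym[OF add_subgroup_K])

lemma chain_act_eq: "x \<in> chains C n \<Longrightarrow> chain_act \<H> C M n x h = frag_extend (G n (Suc n) (Si h)) x"
  unfolding chain_act_def
  by (erule frag_extend_chains_eq)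
    (auto simp: suffix_act_iterD tensors_def simp del: upt_Suc iterD.simps suffix_act.simps)

text \<open>\<open>Act_Comp\<close> holds for every representative of the coproduct. For
  \<open>h = 1\<close> it is evaluated on \<open>DL 1\<close> and on \<open>DL 1\<close> with
  \<open>tL q \<otimes> 1 - 1 \<otimes> sL q\<close> appended; the values must agree.\<close>

lemma Comp_balanced:
  assumes "X \<in> Ob C" "Y \<in> Ob C" "Z \<in> Ob C" "f \<in> Hom C Y Z" "g \<in> Hom C X Y"
  shows "Comp C X Y Z (Act C Y Z (tL \<H> q) f) g = Comp C X Y Z f (Act C X Y (sL \<H> q) g)"
proof -
  let ?t = "DL \<H> 1 @ [(tL \<H> q, 1), (- 1, sL \<H> q)]"
  have t: "tens_eq (HrL \<H>) (HlL \<H>) ?t (DL \<H> 1)"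
    using tens_eq_append_balanced[of "HrL \<H>" "HlL \<H>" "DL \<H> 1" q 1 1] by (simp add: HrL_def HlL_def)
  have minus: "Act C Y Z (- 1) f = - f"
    using Act_add(2)[OF assms(2,3,4), of 1 "- 1"] Act_add(2)[OF assms(2,3,4), of 0 0] Act_mult(1)[OF assms(2,3,4)]
    by (simp add: eq_neg_iff_add_eq_0 add.commute)
  have cm: "Comp C X Y Z (- f) (Act C X Y (sL \<H> q) g) = - Comp C X Y Z f (Act C X Y (sL \<H> q) g)"
    using Comp_add(1)[OF assms(1-4), of "- f" "Act C X Y (sL \<H> q) g"] Comp_add(1)[OF assms(1-3), of 0 0 "Act C X Y (sL \<H> q) g"]
      Act_Hom[OF assms(1,2,5)] Hom_subgroup(1)[OF assms(2,3)] Hom_subgroup(2)[OF assms(2,3) _ assms(4), of 0]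
    by (simp add: eq_neg_iff_add_eq_0 add.commute)
  show ?thesis
    using Act_Comp[OF assms t] Act_Comp[OF assms tens_eq_refl, of 1] assms Act_mult(1)
    by (simp add: minus cm)
qed

lemma Act_tL_Comp:
  assumes "X \<in> Ob C" "Y \<in> Ob C" "Z \<in> Ob C" "f \<in> Hom C Y Z" "g \<in> Hom C X Y"
  shows "Act C X Z (tL \<H> q) (Comp C X Y Z f g) = Comp C X Y Z f (Act C X Y (tL \<H> q) g)"
  using Act_Comp[OF assms tens_eq_sym[OF DL_tL]] assms by (simp add: Act_mult)

lemma upd_mult: "\<sigma> \<in> tensors C n \<Longrightarrow> i \<le> Suc n \<Longrightarrow> U n i (h * g) \<sigma> = U n i h (U n i g \<sigma>)"
  by (cases \<sigma>) (auto simp: upd_def tensors_def Act_mult mact_mult src_def less_Suc_eq_le subset_iff)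

lemma upd_one [simp]: "\<sigma> \<in> tensors C n \<Longrightarrow> U n i 1 \<sigma> = \<sigma>"
  by (cases \<sigma>) (auto simp: upd_def tensors_def Act_mult mact_mult src_def less_Suc_eq_le subset_iff)

lemma Act_hom_at: "\<sigma> \<in> tensors C n \<Longrightarrow> i \<le> n \<Longrightarrow> f \<in> hom_at C n i \<sigma> \<Longrightarrow>
    Act C (src n (fst \<sigma>) i) (fst \<sigma> ! i) h f \<in> hom_at C n i \<sigma>"
  by (cases \<sigma>) (auto simp: hom_at_def tensors_Ob Hom_Act)

lemma upd_put: "\<sigma> \<in> tensors C n \<Longrightarrow> i \<le> n \<Longrightarrow>
    U n i h (put i f \<sigma>) = put i (Act C (src n (fst \<sigma>) i) (fst \<sigma> ! i) h f) \<sigma>"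
  by (cases \<sigma>) (auto simp: upd_def put_def tensors_def)

lemma upd_as_put: "\<sigma> \<in> tensors C n \<Longrightarrow> i \<le> n \<Longrightarrow>
    U n i h \<sigma> = put i (Act C (src n (fst \<sigma>) i) (fst \<sigma> ! i) h (fst (snd \<sigma>) ! i)) \<sigma>"
  by (cases \<sigma>) (auto simp: upd_def put_def tensors_def)

lemma tensors_hom_at: "\<sigma> \<in> tensors C n \<Longrightarrow> i \<le> n \<Longrightarrow> fst (snd \<sigma>) ! i \<in> hom_at C n i \<sigma>"
  by (cases \<sigma>) (auto simp: hom_at_def tensors_def)

lemma Act_hom_at_plus: "\<sigma> \<in> tensors C n \<Longrightarrow> i \<le> n \<Longrightarrow> f \<in> hom_at C n i \<sigma> \<Longrightarrow>  g \<in> hom_at C n i \<sigma> \<Longrightarrow>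
    Act C (src n (fst \<sigma>) i) (fst \<sigma> ! i) h (f + g) =
    Act C (src n (fst \<sigma>) i) (fst \<sigma> ! i) h f + Act C (src n (fst \<sigma>) i) (fst \<sigma> ! i) h g"
    "\<sigma> \<in> tensors C n \<Longrightarrow> i \<le> n \<Longrightarrow> f \<in> hom_at C n i \<sigma> \<Longrightarrow> 
    Act C (src n (fst \<sigma>) i) (fst \<sigma> ! i) (h + h') f =
    Act C (src n (fst \<sigma>) i) (fst \<sigma> ! i) h f + Act C (src n (fst \<sigma>) i) (fst \<sigma> ! i) h' f"
  by (cases \<sigma>; auto simp: hom_at_def tensors_Ob Act_add)+

lemma K_put:
  assumes "\<sigma> \<in> tensors C n" "i \<le> n" "f \<in> hom_at C n i \<sigma>" "g \<in> hom_at C n i \<sigma>"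
  shows "cong_mod (K n) (frag_of (put i (f + g) \<sigma>)) (frag_of (put i f \<sigma>) + frag_of (put i g \<sigma>))"
proof (cases \<sigma>)
  case (fields Xs fs m)
  then have a: "(Xs, fs, m) \<in> tensors C n" "f \<in> Hom C (src n Xs i) (Xs ! i)" "g \<in> Hom C (src n Xs i) (Xs ! i)"
    using assms by (auto simp: hom_at_def)
  show ?thesis
    unfolding fields put_def prod.case cong_mod_def chain_rel_def diff_diff_eq[symmetric]
    by (rule additive_span.base) (use a assms(2) in blast)
qed

lemma K_putm:
  assumes "\<sigma> \<in> tensors C n"
  shows "cong_mod (K n) (frag_of (putm (m + m') \<sigma>)) (frag_of (putm m \<sigma>) + frag_of (putm m' \<sigma>))"
proof (cases \<sigma>)
  case (fields Xs fs m0)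
  then have a: "(Xs, fs, m) \<in> tensors C n" using assms by (auto simp: tensors_def)
  show ?thesis
    unfolding fields cong_mod_def chain_rel_def diff_diff_eq[symmetric] putm_def prod.case
    by (rule additive_span.base) (use a in blast)
qed

lemma K_balanced:
  assumes "\<sigma> \<in> tensors C n" "i \<le> n"
  shows "cong_mod (K n) (frag_of (U n i (tL \<H> l) \<sigma>)) (frag_of (U n (Suc i) (sL \<H> l) \<sigma>))"
proof (cases \<sigma>)
  case (fields Xs fs m)
  then have T: "(Xs, fs, m) \<in> tensors C n" using assms by simp
  show ?thesis
  proof (cases "i < n")
    case True
    then have "U n i (tL \<H> l) \<sigma> = (Xs, fs[i := Act C (src n Xs i) (Xs ! i) (tL \<H> l) (fs ! i)], m)"
      "U n (Suc i) (sL \<H> l) \<sigma> = (Xs, fs[Suc i := Act C (src n Xs (Suc i)) (Xs ! Suc i) (sL \<H> l) (fs ! Suc i)], m)"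
      by (auto simp: upd_def fields)
    then show ?thesis using T True
      unfolding cong_mod_def chain_rel_def
      by (intro additive_span.base) (simp only:, blast)
  next
    case False
    then have "U n i (tL \<H> l) \<sigma> = (Xs, fs[n := Act C (src n Xs n) (Xs ! n) (tL \<H> l) (fs ! n)], m)"
      "U n (Suc i) (sL \<H> l) \<sigma> = (Xs, fs, MlL \<H> M l m)"
      using assms(2) by (auto simp: upd_def fields MlL_def)
    then show ?thesis using T
      unfolding cong_mod_def chain_rel_def
      by (intro additive_span.base) (simp only:, blast)
  qed
qed

lemma G_commute:
  assumes "r \<le> Suc n" and "\<And>j x \<sigma>. Suc n - r \<le> j \<Longrightarrow> j \<le> Suc n \<Longrightarrow> \<phi> (U n j x \<sigma>) = U n j x (\<phi> \<sigma>)"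
  shows "frag_map \<phi> (G n r h \<sigma>) = G n r h (\<phi> \<sigma>)"
  using assms
proof (induction r arbitrary: h \<sigma>)
  case (Suc r)
  have "Suc n - r = Suc (n - r)" using Suc.prems by simp
  then show ?case using Suc by (simp add: frag_extend_sum_list sum_list_pairs)
qed simp

lemma G_put:
  assumes "r \<le> Suc n" "\<sigma> \<in> tensors C n" "i \<le> n" "f \<in> hom_at C n i \<sigma>" "g \<in> hom_at C n i \<sigma>"
  shows "cong_mod (K n) (G n r h (put i (f + g) \<sigma>)) (G n r h (put i f \<sigma>) + G n r h (put i g \<sigma>))"
  using assms
proof (induction r arbitrary: h \<sigma> f g)
  case 0
  then show ?case using K_put[OF upd_tensors[OF 0(2), of M "Suc n" h], of i f g] by (simp add: upd_put_commute)
next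
  case (Suc r)
  have "cong_mod (K n) (G n r y (U n (n - r) x (put i (f + g) \<sigma>)))
      (G n r y (U n (n - r) x (put i f \<sigma>)) + G n r y (U n (n - r) x (put i g \<sigma>)))" for x y
  proof (cases "i = n - r")
    case True
    then show ?thesis using Suc by (simp add: upd_put Act_hom_at_plus Act_hom_at)
  next
    case False
    then show ?thesis using Suc by (simp add: upd_put_commute upd_tensors)
  qed
  then show ?case
    by (simp add: case_prod_unfold cong_mod_sum_list flip: sum_list_addf)
qed

lemma G_putm:
  assumes "r \<le> Suc n" "\<sigma> \<in> tensors C n"
  shows "cong_mod (K n) (G n r h (putm (m + m') \<sigma>)) (G n r h (putm m \<sigma>) + G n r h (putm m' \<sigma>))"
  using assms
proof (induction r arbitrary: h \<sigma>)
  case 0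
  have "U n (Suc n) h (putm m \<sigma>) = putm (mact M h m) \<sigma>" for m
    by (cases \<sigma>) (simp add: upd_def putm_def)
  then show ?case using K_putm[OF 0(2)] by (simp add: mact_add)
next
  case (Suc r)
  then show ?case
    by (simp add: case_prod_unfold cong_mod_sum_list upd_putm_commute upd_tensors flip: sum_list_addf)
qed

lemma G_balanced_prefix:
  assumes "r \<le> Suc n" "\<sigma> \<in> tensors C n" "Suc i < Suc n - r"
  shows "cong_mod (K n) (G n r h (U n i (tL \<H> l) \<sigma>)) (G n r h (U n (Suc i) (sL \<H> l) \<sigma>))"
  using assms
proof (induction r arbitrary: h \<sigma>)
  case 0
  then show ?case using K_balanced[OF upd_tensors[OF 0(2), of M "Suc n" h], of i l]
    by (simp add: upd_upd_commute[where i="Suc n"])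
next
  case (Suc r)
  then show ?case
    by (simp add: case_prod_unfold cong_mod_sum_list upd_upd_commute[where i="n - r"] upd_tensors)
qed

text \<open>One step of the recursion depends only on the class of the coproduct as soon as the
  action on the remaining suffix is additive in \<open>h\<close> and converts \<open>sL l\<close> on
  the left of \<open>h\<close> into \<open>tL l\<close> on the slot before the suffix. These two
  facts appear as the assumptions \<open>add\<close> and \<open>left\<close> because they are
  themselves proved by an induction that uses this statement.\<close>

lemma G_tens_aux:
  assumes t: "tens_eq (HrL \<H>) (HlL \<H>) t s" and r: "r \<le> n" and \<sigma>: "\<sigma> \<in> tensors C n"
    and add: "\<And>h g \<sigma>. \<sigma> \<in> tensors C n \<Longrightarrow> cong_mod (K n) (G n r (h + g) \<sigma>) (G n r h \<sigma> + G n r g \<sigma>)"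
    and left: "\<And>l h \<sigma>. \<sigma> \<in> tensors C n \<Longrightarrow>
      cong_mod (K n) (G n r (sL \<H> l * h) \<sigma>) (G n r h (U n (n - r) (tL \<H> l) \<sigma>))"
  shows "cong_mod (K n) (\<Sum>(x, y)\<leftarrow>t. G n r y (U n (n - r) x \<sigma>)) (\<Sum>(x, y)\<leftarrow>s. G n r y (U n (n - r) x \<sigma>))"
proof (rule tens_eq_cong[OF t])
  fix a a' b
  show "cong_mod (K n) (G n r b (U n (n - r) (a + a') \<sigma>)) (G n r b (U n (n - r) a \<sigma>) + G n r b (U n (n - r) a' \<sigma>))"
    using r \<sigma> by (simp add: upd_as_put Act_hom_at_plus tensors_hom_at G_put Act_hom_at)
next
  fix q a b
  show "cong_mod (K n) (G n r b (U n (n - r) (HrL \<H> q a) \<sigma>)) (G n r (HlL \<H> q b) (U n (n - r) a \<sigma>))"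
    using K_sym[OF left[OF upd_tensors[OF \<sigma>, of M "n - r" a], of q b]] \<sigma> r
    by (simp add: HrL_def HlL_def upd_mult)
qed (simp_all add: add upd_tensors \<sigma>)

text \<open>Joint induction: the two claims for \<open>r\<close> make the next step of the recursion
  independent of representatives, and this in turn yields both claims for \<open>r + 1\<close>. The
  restriction \<open>r \<le> n\<close> ensures that there is a slot before the suffix.\<close>

lemma G_add_left:
  assumes "r \<le> Suc n" "\<sigma> \<in> tensors C n"
  shows "cong_mod (K n) (G n r (h + g) \<sigma>) (G n r h \<sigma> + G n r g \<sigma>) \<and>
    (r \<le> n \<longrightarrow> cong_mod (K n) (G n r (sL \<H> l * h) \<sigma>) (G n r h (U n (n - r) (tL \<H> l) \<sigma>)))"
  using assms
proof (induction r arbitrary: h g l \<sigma>)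
  case 0
  have "U n (Suc n) h \<sigma> = putm (mact M h (snd (snd \<sigma>))) \<sigma>" for h
    by (cases \<sigma>) (simp add: upd_def putm_def)
  then have "cong_mod (K n) (G n 0 (h + g) \<sigma>) (G n 0 h \<sigma> + G n 0 g \<sigma>)"
    using K_putm[OF 0(2)] by (simp add: mact_add)
  moreover have "cong_mod (K n) (G n 0 (sL \<H> l * h) \<sigma>) (G n 0 h (U n n (tL \<H> l) \<sigma>))"
    using K_sym[OF K_balanced[OF upd_tensors[OF 0(2), of M "Suc n" h], of n l]] 0
      upd_upd_commute[of "Suc n" n n C M h "tL \<H> l" \<sigma>]
    by (simp add: upd_mult)
  ultimately show ?case by simp
next
  case (Suc r)
  then have r: "r \<le> n" "r \<le> Suc n" by auto
  note tens = G_tens_aux[OF _ r(1) _ conjunct1[OF Suc.IH[OF r(2)]] mp[OF conjunct2[OF Suc.IH[OF r(2)]] r(1)]]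
  have "cong_mod (K n) (G n (Suc r) (h + g) \<sigma>) (G n (Suc r) h \<sigma> + G n (Suc r) g \<sigma>)"
    using tens[OF DL_add Suc.prems(2)] by simp
  moreover have "cong_mod (K n) (G n (Suc r) (sL \<H> l * h) \<sigma>) (G n (Suc r) h (U n (n - Suc r) (tL \<H> l) \<sigma>))"
    if "Suc r \<le> n"
  proof -
    have nr: "n - r = Suc (n - Suc r)" using that by simp
    have "cong_mod (K n) (G n (Suc r) (sL \<H> l * h) \<sigma>)
        (\<Sum>(x, y)\<leftarrow>[(sL \<H> l * x, y). (x, y) \<leftarrow> DL \<H> h]. G n r y (U n (n - r) x \<sigma>))"
      using tens[OF DL_sL_left Suc.prems(2)] by simp
    also have "cong_mod (K n) \<dots> (G n (Suc r) h (U n (n - Suc r) (tL \<H> l) \<sigma>))"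
      unfolding suffix_act.simps sum_list_pairs list.map_comp prod.sel
    proof (rule cong_mod_sum_list[OF add_subgroup_K])
      fix p :: "'h \<times> 'h"
      show "cong_mod (K n) (G n r (snd p) (U n (n - r) (sL \<H> l * fst p) \<sigma>))
        (G n r (snd p) (U n (n - r) (fst p) (U n (n - Suc r) (tL \<H> l) \<sigma>)))"
        using K_sym[OF G_balanced_prefix[OF r(2) upd_tensors[OF Suc.prems(2), of M "n - r" "fst p"], of "n - Suc r" "snd p" l]]
          nr that Suc.prems upd_upd_commute[of "n - r" "n - Suc r" n C M "fst p" "tL \<H> l" \<sigma>]
        by (simp add: upd_mult)
    qed
    finally show ?thesis .
  qed
  ultimately show ?case by simp
qed

lemmas G_add = conjunct1[OF G_add_left]
  and G_left = mp[OF conjunct2[OF G_add_left[OF le_SucI]]]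

lemma G_tens:
  assumes "tens_eq (HrL \<H>) (HlL \<H>) t s" and "r \<le> n" and "\<sigma> \<in> tensors C n"
  shows "cong_mod (K n) (\<Sum>(x, y)\<leftarrow>t. G n r y (U n (n - r) x \<sigma>)) (\<Sum>(x, y)\<leftarrow>s. G n r y (U n (n - r) x \<sigma>))"
  using assms by (intro G_tens_aux) (auto intro: G_add G_left)

lemma G_right:
  assumes "r \<le> Suc n" and "\<sigma> \<in> tensors C n"
  shows "cong_mod (K n) (G n r (h * sL \<H> l) \<sigma>) (G n r h (U n (Suc n - r) (sL \<H> l) \<sigma>))"
proof (cases r)
  case 0
  then show ?thesis using assms by (simp add: upd_mult)
next
  case (Suc s)
  then show ?thesis using G_tens[OF DL_sL_right, of s n \<sigma> h l] assms
    by (simp add: sum_list_pairs upd_mult)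
qed

lemma G_one: "r \<le> Suc n \<Longrightarrow> \<sigma> \<in> tensors C n \<Longrightarrow> cong_mod (K n) (G n r 1 \<sigma>) (frag_of \<sigma>)"
proof (induction r)
  case (Suc r)
  then show ?case using K_trans[OF G_tens[OF DL_one, of r n \<sigma>]] by simp
qed simp

text \<open>As \<open>DL (sL l) = sL l \<otimes> 1\<close>, all of \<open>sL l\<close> falls on the
  first slot of the suffix. Dually, \<open>tL l\<close> is passed on to the coefficient in
  \<open>G_tL\<close>. These two lemmas determine the action of the base algebra on chains.\<close>

lemma G_sL:
  assumes "r \<le> Suc n" and "\<sigma> \<in> tensors C n"
  shows "cong_mod (K n) (G n r (sL \<H> l) \<sigma>) (frag_of (U n (Suc n - r) (sL \<H> l) \<sigma>))"
proof (cases r)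
  case (Suc s)
  have "cong_mod (K n) (G n r (sL \<H> l) \<sigma>) (G n s 1 (U n (n - s) (sL \<H> l) \<sigma>))"
    using G_tens[OF DL_sL, of s n \<sigma> l] assms Suc by simp
  also have "cong_mod (K n) \<dots> (frag_of (U n (n - s) (sL \<H> l) \<sigma>))"
    using assms Suc by (intro G_one upd_tensors) auto
  finally show ?thesis using Suc by simp
qed simp

lemma G_tL:
  assumes "r \<le> Suc n" and "\<sigma> \<in> tensors C n"
  shows "cong_mod (K n) (G n r (tL \<H> l) \<sigma>) (frag_of (U n (Suc n) (tL \<H> l) \<sigma>))"
  using assms
proof (induction r)
  case (Suc r)
  then show ?case using K_trans[OF G_tens[OF DL_tL, of r n \<sigma> l]] by simp
qed simp

text \<open>The factor acting on slot \<open>n - r\<close> commutes with the action on the later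
  slots, by \<open>G_commute\<close>, so that two successive actions can be merged slot by
  slot.\<close>

lemma G_mult:
  assumes "r \<le> Suc n" and "\<sigma> \<in> tensors C n"
  shows "cong_mod (K n) (G n r (h * g) \<sigma>) (frag_extend (G n r h) (G n r g \<sigma>))"
  using assms
proof (induction r arbitrary: h g \<sigma>)
  case 0
  then show ?case by (simp add: upd_mult)
next
  case (Suc r)
  then have r: "r \<le> Suc n" "r \<le> n" by auto
  have "cong_mod (K n) (G n (Suc r) (h * g) \<sigma>) (\<Sum>p\<leftarrow>DL \<H> h. \<Sum>p'\<leftarrow>DL \<H> g.
      G n r (snd p * snd p') (U n (n - r) (fst p * fst p') \<sigma>))"
    using G_tens[OF DL_mult r(2) Suc.prems(2), of h g] by (simp add: sum_list_pairs)
  also have "cong_mod (K n) \<dots> (\<Sum>p\<leftarrow>DL \<H> h. \<Sum>p'\<leftarrow>DL \<H> g.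
      frag_extend (G n r (snd p)) (G n r (snd p') (U n (n - r) (fst p * fst p') \<sigma>)))"
    by (intro cong_mod_sum_list add_subgroup_K Suc.IH r upd_tensors Suc.prems)
  also have "cong_mod (K n) \<dots> (frag_extend (G n (Suc r) h) (G n (Suc r) g \<sigma>))"
  proof (rule cong_mod_eq[OF add_subgroup_K])
    have "frag_extend (G n r y) (G n r y' (U n (n - r) (x * x') \<sigma>))
      = frag_extend (\<lambda>\<sigma>. G n r y (U n (n - r) x \<sigma>)) (G n r y' (U n (n - r) x' \<sigma>))" for x x' y y'
    proof -
      have "frag_extend (G n r y) (G n r y' (U n (n - r) (x * x') \<sigma>)) =
          frag_extend (G n r y) (frag_map (U n (n - r) x) (G n r y' (U n (n - r) x' \<sigma>)))"
        using Suc.prems r by (subst G_commute) (auto simp: upd_mult intro!: upd_upd_commute)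
      then show ?thesis by (simp add: frag_extend_frag_map)
    qed
    moreover have "G n (Suc r) h = (\<lambda>\<sigma>. \<Sum>(x, y)\<leftarrow>DL \<H> h. G n r y (U n (n - r) x \<sigma>))"
      by (rule ext) simp
    ultimately show "(\<Sum>p\<leftarrow>DL \<H> h. \<Sum>p'\<leftarrow>DL \<H> g.
          frag_extend (G n r (snd p)) (G n r (snd p') (U n (n - r) (fst p * fst p') \<sigma>)))
        = frag_extend (G n (Suc r) h) (G n (Suc r) g \<sigma>)"
      by (simp add: frag_extend_sum_list frag_extend_sum_list_fun case_prod_unfold)
  qed
  finally show ?case .
qed

text \<open>When slot \<open>i\<close> is the first of the suffix, the Takeuchi condition exchanges
  \<open>tL l\<close> on the right of the first factor for \<open>sL l\<close> on the right of the
  remaining one, and \<open>G_right\<close> hands the latter to slot \<open>i + 1\<close>. Relations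
  further to the right are covered by induction.\<close>

lemma G_balanced_suffix:
  assumes "r \<le> Suc n" "\<sigma> \<in> tensors C n" "Suc n - r \<le> i" "i \<le> n"
  shows "cong_mod (K n) (G n r h (U n i (tL \<H> l) \<sigma>)) (G n r h (U n (Suc i) (sL \<H> l) \<sigma>))"
  using assms
proof (induction r arbitrary: h \<sigma>)
  case (Suc r)
  show ?case
  proof (cases "i = n - r")
    case True
    have "cong_mod (K n) (G n (Suc r) h (U n i (tL \<H> l) \<sigma>))
        (\<Sum>(x, y)\<leftarrow>[(x, y * sL \<H> l). (x, y) \<leftarrow> DL \<H> h]. G n r y (U n (n - r) x \<sigma>))"
      using G_tens[OF DL_takeuchi, of r n \<sigma> l h] Suc.prems True by (simp add: sum_list_pairs upd_mult)
    also have "cong_mod (K n) \<dots> (G n (Suc r) h (U n (Suc i) (sL \<H> l) \<sigma>))"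
      unfolding suffix_act.simps sum_list_pairs list.map_comp prod.sel
    proof (rule cong_mod_sum_list[OF add_subgroup_K])
      fix p :: "'h \<times> 'h"
      show "cong_mod (K n) (G n r (snd p * sL \<H> l) (U n (n - r) (fst p) \<sigma>))
        (G n r (snd p) (U n (n - r) (fst p) (U n (Suc i) (sL \<H> l) \<sigma>)))"
        using G_right[OF _ upd_tensors[OF Suc.prems(2), of M "n - r" "fst p"], of r "snd p" l] Suc.prems True
        by (simp add: upd_upd_commute[where i="n - r"] Suc_diff_le)
    qed
    finally show ?thesis .
  next
    case False
    then have "Suc n - r \<le> i" using Suc.prems by linarith
    then show ?thesis using Suc False
      by (simp add: case_prod_unfold cong_mod_sum_list upd_upd_commute[where i="n - r"] upd_tensors)
  qed
qed simp

text \<open>For \<open>r = n + 1\<close> every slot belongs to the suffix, so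
  \<open>G_balanced_suffix\<close> covers all balancing relations. The action is therefore well
  defined on the tensor product.\<close>

lemma G_chain_rel: "x \<in> K n \<Longrightarrow> frag_extend (G n (Suc n) h) x \<in> K n"
proof (subst (asm) chain_rel_def, erule frag_extend_additive_span_mem[OF _ add_subgroup_K], safe, goal_cases)
  case (1 s Xs fs m i f g)
  then show ?case using G_put[OF order_refl 1(1,2), of f g h]
    by (simp add: hom_at_def put_def frag_extend_diff frag_extend_add cong_mod_def diff_diff_eq del: suffix_act.simps)
next
  case (2 s Xs fs m m')
  then show ?case using G_putm[OF order_refl 2, of h m m']
    by (simp add: putm_def frag_extend_diff frag_extend_add cong_mod_def diff_diff_eq del: suffix_act.simps)
next
  case (3 s Xs fs m i l)
  then show ?case using G_balanced_suffix[OF order_refl 3(1), of i h l]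
    by (simp add: upd_def frag_extend_diff cong_mod_def del: suffix_act.simps)
next
  case (4 s Xs fs m l)
  then show ?case using G_balanced_suffix[OF order_refl 4, of n h l]
    by (simp add: upd_def MlL_def frag_extend_diff cong_mod_def del: suffix_act.simps)
qed

end

section \<open>Faces and the action\<close>

lemma chain_face_sum_list: "chain_face C n i (\<Sum>x\<leftarrow>xs. f x) = (\<Sum>x\<leftarrow>xs. chain_face C n i (f x))"
  by (simp add: chain_face_eq frag_extend_sum_list)

context closed_cat
begin

lemma face_upd_less:
  assumes "\<sigma> \<in> tensors C (Suc n)" "i \<le> n" "j < i"
  shows "face_simplex C (Suc n) i (upd C M (Suc n) j x \<sigma>) = upd C M n j x (face_simplex C (Suc n) i \<sigma>)"
proof (cases \<sigma>)
  case (fields Xs fs m)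
  then have l: "length Xs = Suc (Suc n)" "length fs = Suc (Suc n)" using assms by (auto simp: tensors_def)
  note s = nth_comp_skip[OF _ assms(2)] src_skip[OF l(1) assms(2)] nth_skip[OF l(1) assms(2)]
  show ?thesis unfolding fields face_simplex_def upd_def using assms(2,3) l
    by (auto simp del: add_2_eq_Suc' take_update_cancel drop_update_cancel intro!: nth_equalityI
        simp: s nth_list_update)
qed

lemma face_upd_greater:
  assumes "\<sigma> \<in> tensors C (Suc n)" "i \<le> n" "i < j" "j \<le> Suc n"
  shows "face_simplex C (Suc n) i (upd C M (Suc n) (Suc j) x \<sigma>) = upd C M n j x (face_simplex C (Suc n) i \<sigma>)"
proof (cases \<sigma>)
  case (fields Xs fs m)
  then have l: "length Xs = Suc (Suc n)" "length fs = Suc (Suc n)" using assms by (auto simp: tensors_def)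
  note s = nth_comp_skip[OF _ assms(2)] src_skip[OF l(1) assms(2)] nth_skip[OF l(1) assms(2)]
  show ?thesis unfolding fields face_simplex_def upd_def using assms(2-) l
    by (auto simp del: add_2_eq_Suc' take_update_cancel drop_update_cancel intro!: nth_equalityI
        simp: s nth_list_update)
qed

lemma face_upd_upd:
  assumes "(Xs, fs, m) \<in> tensors C (Suc n)" "i \<le> n"
  shows "face_simplex C (Suc n) i (upd C M (Suc n) (Suc i) y (upd C M (Suc n) i x (Xs, fs, m)))
    = put i (Comp C (src (Suc n) Xs (Suc i)) (Xs ! Suc i) (Xs ! i)
         (Act C (Xs ! Suc i) (Xs ! i) x (fs ! i)) (Act C (src (Suc n) Xs (Suc i)) (Xs ! Suc i) y (fs ! Suc i)))
        (face_simplex C (Suc n) i (Xs, fs, m))"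
proof -
  have l: "length Xs = Suc (Suc n)" "length fs = Suc (Suc n)" using assms by (auto simp: tensors_def)
  note s = nth_comp_skip[OF _ assms(2)]
  show ?thesis unfolding face_simplex_def upd_def put_def using assms(2-) l
    by (auto simp del: add_2_eq_Suc' take_update_cancel drop_update_cancel intro!: nth_equalityI simp: s nth_list_update src_less)
qed

end

context hcat_coeff
begin

text \<open>The suffix lies strictly to the right of the composed pair, so that the face merely
  renumbers its slots from \<open>j + 1\<close> to \<open>j\<close>.\<close>

lemma G_face_suffix:
  assumes "\<sigma> \<in> tensors C (Suc n)" "i \<le> n" "r \<le> n - i"
  shows "chain_face C (Suc n) i (G (Suc n) r h \<sigma>) = G n r h (face_simplex C (Suc n) i \<sigma>)"
  using assms
proof (induction r arbitrary: h \<sigma>)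
  case 0
  then show ?case by (simp add: chain_face_eq face_upd_greater)
next
  case (Suc r)
  then have "Suc n - r = Suc (n - r)" "i < n - r" by auto
  then show ?case using Suc
    by (simp add: chain_face_eq frag_extend_sum_list case_prod_unfold comp_def upd_tensors face_upd_greater)
qed

lemma G_put_sum_list:
  assumes "r \<le> Suc n" "\<sigma> \<in> tensors C n" "i \<le> n" "\<And>p. p \<in> set ps \<Longrightarrow> f p \<in> hom_at C n i \<sigma>"
  shows "cong_mod (K n) (G n r h (put i (\<Sum>p\<leftarrow>ps. f p) \<sigma>)) (\<Sum>p\<leftarrow>ps. G n r h (put i (f p) \<sigma>))"
proof -
  have zero: "0 \<in> hom_at C n i \<sigma>"
    using assms(2,3) by (cases \<sigma>) (auto simp: hom_at_def intro!: Hom_subgroup(1) intro: tensors_Ob)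
  have "(\<Sum>p\<leftarrow>ps. f p) \<in> hom_at C n i \<sigma> \<and> ?thesis"
    using assms(4)
  proof (induction ps)
    case Nil
    have "cong_mod (K n) (G n r h (put i 0 \<sigma>)) (G n r h (put i 0 \<sigma>) + G n r h (put i 0 \<sigma>))"
      using G_put[OF assms(1-3) zero zero, of h] by simp
    then have "- G n r h (put i 0 \<sigma>) \<in> K n" by (simp add: cong_mod_def)
    then show ?case using add_subgroup_uminus[OF add_subgroup_K] zero by (fastforce simp: cong_mod_def)
  next
    case (Cons p ps)
    then have IH: "(\<Sum>p\<leftarrow>ps. f p) \<in> hom_at C n i \<sigma>"
      "cong_mod (K n) (G n r h (put i (\<Sum>p\<leftarrow>ps. f p) \<sigma>)) (\<Sum>p\<leftarrow>ps. G n r h (put i (f p) \<sigma>))" by auto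
    have "cong_mod (K n) (G n r h (put i (f p + (\<Sum>p\<leftarrow>ps. f p)) \<sigma>))
        (G n r h (put i (f p) \<sigma>) + G n r h (put i (\<Sum>p\<leftarrow>ps. f p) \<sigma>))"
      using Cons.prems IH(1) by (intro G_put assms(1-3)) auto
    also have "cong_mod (K n) \<dots> (G n r h (put i (f p) \<sigma>) + (\<Sum>p\<leftarrow>ps. G n r h (put i (f p) \<sigma>)))"
      by (intro cong_mod_add IH) auto
    finally show ?case using hom_at_plus[OF assms(2,3) _ IH(1)] Cons.prems by simp
  qed
  then show ?thesis by simp
qed

text \<open>The suffix starts at slot \<open>i\<close>, so both composed morphisms are acted upon,
  through two successive coproducts. Coassociativity regroups these so that the pair receives the
  coproduct of a single factor, which is the action of that factor on the composite. The lengths of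
  the suffixes differ by one because the face removes a slot.\<close>

lemma G_face_middle:
  assumes T: "(Xs, fs, m) \<in> tensors C (Suc n)" and i: "i \<le> n"
  shows "cong_mod (K n) (chain_face C (Suc n) i (G (Suc n) (Suc (Suc (n - i))) h (Xs, fs, m)))
    (G n (Suc (n - i)) h (face_simplex C (Suc n) i (Xs, fs, m)))"
proof -
  let ?X = "src (Suc n) Xs (Suc i)" and ?Y = "Xs ! Suc i" and ?Z = "Xs ! i"
  let ?f = "fs ! i" and ?g = "fs ! Suc i"
  let ?\<sigma> = "(Xs, fs, m)" and ?d = "face_simplex C (Suc n) i (Xs, fs, m)"
  let ?c = "\<lambda>x y. Comp C ?X ?Y ?Z (Act C ?Y ?Z x ?f) (Act C ?X ?Y y ?g)"
  let ?T = "\<lambda>x y z. G n (n - i) z (put i (?c x y) ?d)"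
  have obs: "?X \<in> Ob C" "?Y \<in> Ob C" "?Z \<in> Ob C" using tensors_Ob[OF T] i by auto
  have homs: "?f \<in> Hom C ?Y ?Z" "?g \<in> Hom C ?X ?Y"
    using tensors_hom[OF T, of i] tensors_hom[OF T, of "Suc i"] i by (auto simp: src_less)
  have l: "length Xs = Suc (Suc n)" "length fs = Suc (Suc n)" using T by (auto simp: tensors_def)
  have dT: "?d \<in> tensors C n" by (rule face_tensors[OF T i])
  have at: "hom_at C n i ?d = Hom C ?X ?Z"
    using nth_skip[OF l(1) i i] src_skip[OF l(1) i i] by (simp add: face_simplex_def hom_at_def)
  have actd: "Act C (src n (fst ?d) i) (fst ?d ! i) = Act C ?X ?Z"
    using nth_skip[OF l(1) i i] src_skip[OF l(1) i i] by (simp add: face_simplex_def)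
  have compd: "fst (snd ?d) ! i = Comp C ?X ?Y ?Z ?f ?g"
    using nth_comp_skip[OF l(2) i i] by (simp add: face_simplex_def)
  have c: "?c x y \<in> hom_at C n i ?d" for x y
    unfolding at using obs homs by (intro Hom_Comp Hom_Act) auto
  have expand: "chain_face C (Suc n) i (G (Suc n) (Suc (Suc (n - i))) h ?\<sigma>)
      = (\<Sum>(x, y, z)\<leftarrow>[(x, y1, y2). (x, y) \<leftarrow> DL \<H> h, (y1, y2) \<leftarrow> DL \<H> y]. ?T x y z)"
  proof -
    have "Suc n - (n - i) = Suc i" using i by simp
    moreover have "chain_face C (Suc n) i (G (Suc n) (n - i) z (U (Suc n) (Suc i) y (U (Suc n) i x ?\<sigma>))) = ?T x y z" for x y z
      by (simp add: G_face_suffix[OF upd_tensors[OF upd_tensors[OF T]] i order_refl] face_upd_upd[OF T i])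
    ultimately show ?thesis
      using i by (simp add: chain_face_sum_list sum_list_pairs)
  qed
  have "cong_mod (K n) (\<Sum>(x, y, z)\<leftarrow>[(x, y1, y2). (x, y) \<leftarrow> DL \<H> h, (y1, y2) \<leftarrow> DL \<H> y]. ?T x y z)
    (\<Sum>(x, y, z)\<leftarrow>[(x1, x2, y). (x, y) \<leftarrow> DL \<H> h, (x1, x2) \<leftarrow> DL \<H> x]. ?T x y z)"
  proof (rule K_sym, rule tens3_eq_cong[OF DL_coassoc add_subgroup_K])
    fix x x' y z
    show "cong_mod (K n) (?T (x + x') y z) (?T x y z + ?T x' y z)"
      using G_put[OF _ dT i c[of x y] c[of x' y], of "n - i" z] obs homs
      by (simp add: Act_add Comp_add Act_Hom)
  next
    fix x y y' z
    show "cong_mod (K n) (?T x (y + y') z) (?T x y z + ?T x y' z)"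
      using G_put[OF _ dT i c[of x y] c[of x y'], of "n - i" z] obs homs
      by (simp add: Act_add Comp_add Act_Hom)
  next
    fix x y z z'
    show "cong_mod (K n) (?T x y (z + z')) (?T x y z + ?T x y z')"
      using put_tensors[OF dT i c] by (intro G_add) auto
  next
    fix q x y z
    show "cong_mod (K n) (?T (HrL \<H> q x) y z) (?T x (HlL \<H> q y) z)"
      using obs homs by (simp add: HrL_def HlL_def Act_mult Comp_balanced Act_Hom)
  next
    fix q x y z
    \<comment> \<open>\<open>tL q\<close> on the composite acts on its right factor, as
      \<open>DL (tL q) = 1 \<otimes> tL q\<close>; from there \<open>G_left\<close> transfers it to
      the remaining suffix as \<open>sL q\<close>.\<close>
    have "U n i (tL \<H> q) (put i (?c x y) ?d) = put i (?c x (tL \<H> q * y)) ?d"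
      using obs homs dT i by (simp add: upd_put actd Act_tL_Comp Act_Hom Act_mult)
    then show "cong_mod (K n) (?T x (HrL \<H> q y) z) (?T x y (HlL \<H> q z))"
      using K_sym[OF G_left[OF _ put_tensors[OF dT i c[of x y]], of "n - i" q z]] i
      by (simp add: HrL_def HlL_def)
  qed
  also have "cong_mod (K n) \<dots> (G n (Suc (n - i)) h ?d)"
  proof -
    have "cong_mod (K n) (G n (n - i) y (U n i x ?d)) (\<Sum>p\<leftarrow>DL \<H> x. ?T (fst p) (snd p) y)" for x y
    proof -
      have "U n i x ?d = put i (\<Sum>p\<leftarrow>DL \<H> x. ?c (fst p) (snd p)) ?d"
        unfolding upd_as_put[OF dT i] actd compd
        using Act_Comp[OF obs homs tens_eq_refl, of x] by (simp add: case_prod_unfold)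
      then show ?thesis using G_put_sum_list[OF _ dT i c, of "n - i" y fst snd "DL \<H> x"] by simp
    qed
    then have "cong_mod (K n) (\<Sum>p\<leftarrow>DL \<H> h. \<Sum>q\<leftarrow>DL \<H> (fst p). ?T (fst q) (snd q) (snd p))
        (\<Sum>p\<leftarrow>DL \<H> h. G n (n - i) (snd p) (U n i (fst p) ?d))"
      by (intro cong_mod_sum_list add_subgroup_K) (rule K_sym)
    then show ?thesis using i by (simp add: sum_list_pairs)
  qed
  finally show ?thesis unfolding expand .
qed

text \<open>The \<open>k\<close> additional slots lie to the left of the composed pair, where the
  face changes nothing.\<close>

lemma G_face:
  assumes "\<sigma> \<in> tensors C (Suc n)" "i \<le> n" "k \<le> i"
  shows "cong_mod (K n) (chain_face C (Suc n) i (G (Suc n) (Suc (Suc (n - i)) + k) h \<sigma>))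
    (G n (Suc (n - i) + k) h (face_simplex C (Suc n) i \<sigma>))"
  using assms
proof (induction k arbitrary: h \<sigma>)
  case 0
  then show ?case using G_face_middle by (cases \<sigma>) (simp del: suffix_act.simps)
next
  case (Suc k)
  have n1: "Suc n - (Suc (Suc (n - i)) + k) = i - Suc k" "n - (Suc (n - i) + k) = i - Suc k" using Suc.prems by auto
  have "cong_mod (K n) (chain_face C (Suc n) i (G (Suc n) (Suc (Suc (n - i)) + k) y (U (Suc n) (i - Suc k) x \<sigma>)))
    (G n (Suc (n - i) + k) y (U n (i - Suc k) x (face_simplex C (Suc n) i \<sigma>)))" for x y
    using Suc.IH[OF upd_tensors[OF Suc.prems(1), of M "i - Suc k" x], of y] Suc.prems
    by (simp add: face_upd_less del: suffix_act.simps)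
  then show ?case
    unfolding add_Suc_right suffix_act.simps(2) n1 case_prod_unfold chain_face_sum_list
    by (intro cong_mod_sum_list add_subgroup_K) simp
qed

lemma chain_face_chain_act:
  assumes "x \<in> chains C (Suc n)" "i \<le> n"
  shows "cong_mod (K n) (chain_face C (Suc n) i (chain_act \<H> C M (Suc n) x h)) (chain_act \<H> C M n (chain_face C (Suc n) i x) h)"
proof -
  have *: "cong_mod (K n) (frag_extend (\<lambda>\<sigma>. chain_face C (Suc n) i (G (Suc n) (Suc (Suc n)) (Si h) \<sigma>)) x)
    (frag_extend (\<lambda>\<sigma>. G n (Suc n) (Si h) (face_simplex C (Suc n) i \<sigma>)) x)"
    using G_face[OF _ assms(2) order_refl] assms(2)
    by (intro frag_extend_cong_mod[OF assms(1)] add_subgroup_K) (simp del: suffix_act.simps)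
  have comm: "frag_extend (\<lambda>\<sigma>. chain_face C (Suc n) i (g \<sigma>)) x = chain_face C (Suc n) i (frag_extend g x)"
    for g :: "'o list \<times> 'f list \<times> 'm \<Rightarrow> ('o, 'f, 'm) chain"
    using assms(1) by (induction rule: chains_induct) (simp_all add: chain_face_eq frag_extend_diff)
  show ?thesis
    using *[unfolded comm] assms chain_face_chains[OF assms]
    by (simp add: chain_act_eq chain_face_eq frag_extend_frag_map del: suffix_act.simps)
qed

section \<open>The kernel of the projection onto the para-cyclic quotient\<close>

abbreviation "act n x h \<equiv> chain_act \<H> C M n x h"
abbreviation "null n \<equiv> null_chains \<H> C M n"
abbreviation "\<tau> \<equiv> tau C M"
abbreviation "d \<equiv> chain_face C"
abbreviation "cyc \<equiv> cyc_graph \<H> C M"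

lemma add_subgroup_null [simp]: "add_subgroup (null n)"
  using add_subgroup_K[of n] unfolding add_subgroup_def null_chains_def
  by (auto intro: null_chain.diff null_chain.rel)

lemma K_null: "K n \<subseteq> null n"
  by (auto simp: null_chains_def null_chain.rel)

lemmas K_imp_null = cong_mod_mono[OF K_null]

lemma null_trans [trans]: "cong_mod (null n) x y \<Longrightarrow> cong_mod (null n) y z \<Longrightarrow> cong_mod (null n) x z"
  by (rule cong_mod_trans[OF add_subgroup_null])

lemma null_sym: "cong_mod (null n) x y \<Longrightarrow> cong_mod (null n) y x"
  by (rule cong_mod_sym[OF add_subgroup_null])

lemma null_chains_chains: "x \<in> null n \<Longrightarrow> x \<in> chains C n"
  by (simp add: null_chains_def null_chain_chains)

lemma cyc_null: "x \<in> null n \<Longrightarrow> (x, y) \<in> cyc n \<Longrightarrow> y \<in> null n"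
  by (auto simp: null_chains_def intro: null_chain.cyc)

text \<open>The relation \<open>cyc\<close> is additive, so the difference of two pairs is again a
  pair, to which the closure of \<open>null\<close> under \<open>cyc\<close> applies. In particular
  any two values of the cyclic formula on one chain agree modulo \<open>null\<close>, so
  \<open>\<tau>\<close> may replace them all.\<close>

lemma cyc_cong: "(x, y) \<in> cyc n \<Longrightarrow> (x', y') \<in> cyc n \<Longrightarrow> cong_mod (null n) x x' \<Longrightarrow> cong_mod (null n) y y'"
  unfolding cong_mod_def by (rule cyc_null) (auto intro: cyc_graph.diff)

lemma cyc_pow_cong:
  "(x, y) \<in> cyc n ^^ j \<Longrightarrow> (x', y') \<in> cyc n ^^ j \<Longrightarrow> cong_mod (null n) x x' \<Longrightarrow> cong_mod (null n) y y'"
proof (induction j arbitrary: y y')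
  case (Suc j)
  then obtain z z' where "(x, z) \<in> cyc n ^^ j" "(z, y) \<in> cyc n" "(x', z') \<in> cyc n ^^ j" "(z', y') \<in> cyc n" by auto
  then show ?case using Suc cyc_cong by blast
qed simp

lemma cyc_tau: "x \<in> chains C n \<Longrightarrow> (x, \<tau> n x) \<in> cyc n"
  by (rule cyc_graph_tau)

lemma tau_cong: "x \<in> chains C n \<Longrightarrow> y \<in> chains C n \<Longrightarrow> cong_mod (null n) x y \<Longrightarrow> cong_mod (null n) (\<tau> n x) (\<tau> n y)"
  by (rule cyc_cong[OF cyc_tau cyc_tau])

lemma cyc_tau_cong: "(x, y) \<in> cyc n \<Longrightarrow> cong_mod (null n) y (\<tau> n x)"
  using cyc_cong[OF _ cyc_tau] cyc_graph_chains by fastforce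

lemma tau_null: "x \<in> null n \<Longrightarrow> \<tau> n x \<in> null n"
  using cyc_null cyc_tau null_chains_chains by blast

lemma face_null: "x \<in> null (Suc n) \<Longrightarrow> i \<le> n \<Longrightarrow> d (Suc n) i x \<in> null n"
  by (simp add: null_chains_def null_chain.face)

lemma tau_diff: "\<tau> n (x - y) = \<tau> n x - \<tau> n y"
  by (simp add: tau_def frag_extend_diff)

lemma d_diff: "d n i (x - y) = d n i x - d n i y"
  by (simp add: chain_face_eq frag_extend_diff)

lemma face_cong: "i \<le> n \<Longrightarrow> cong_mod (null (Suc n)) x y \<Longrightarrow> cong_mod (null n) (d (Suc n) i x) (d (Suc n) i y)"
  unfolding cong_mod_def d_diff[symmetric] by (rule face_null)

lemmas act_diff = chain_act_diff[of \<H> C M]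

lemma act_chains: "x \<in> chains C n \<Longrightarrow> act n x h \<in> chains C n"
  by (rule chain_act_chains)

lemma act_add_null: "x \<in> chains C n \<Longrightarrow> cong_mod (null n) (act n x (h + g)) (act n x h + act n x g)"
proof (rule K_imp_null)
  assume x: "x \<in> chains C n"
  have "cong_mod (K n) (frag_extend (G n (Suc n) (Si h + Si g)) x) (frag_extend (\<lambda>\<sigma>. \<Sum>p\<leftarrow>[h, g]. G n (Suc n) (Si p) \<sigma>) x)"
    using G_add by (intro frag_extend_cong_mod[OF x] add_subgroup_K) (simp del: suffix_act.simps)
  then show "cong_mod (K n) (act n x (h + g)) (act n x h + act n x g)"
    unfolding frag_extend_sum_list_fun using x by (simp add: chain_act_eq Si_add del: suffix_act.simps)
qed

lemma act_one: "x \<in> chains C n \<Longrightarrow> cong_mod (null n) (act n x 1) x"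
proof (rule K_imp_null)
  assume x: "x \<in> chains C n"
  have "cong_mod (K n) (frag_extend (G n (Suc n) 1) x) (frag_extend frag_of x)"
    using G_one by (intro frag_extend_cong_mod[OF x] add_subgroup_K) (simp del: suffix_act.simps)
  then show "cong_mod (K n) (act n x 1) x"
    using x by (simp add: chain_act_eq del: suffix_act.simps flip: frag_expansion)
qed

lemma act_mult_K: "x \<in> chains C n \<Longrightarrow> cong_mod (K n) (act n x (h * g)) (act n (act n x h) g)"
proof -
  assume x: "x \<in> chains C n"
  have "cong_mod (K n) (frag_extend (G n (Suc n) (Si g * Si h)) x)
      (frag_extend (\<lambda>\<sigma>. frag_extend (G n (Suc n) (Si g)) (G n (Suc n) (Si h) \<sigma>)) x)"
    using G_mult by (intro frag_extend_cong_mod[OF x] add_subgroup_K) (simp del: suffix_act.simps)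
  moreover have "frag_extend (\<lambda>\<sigma>. frag_extend f (g \<sigma>)) x = frag_extend f (frag_extend g x)"
    for f g :: "'o list \<times> 'f list \<times> 'm \<Rightarrow> ('o, 'f, 'm) chain"
    using x by (induction rule: chains_induct) (simp_all add: frag_extend_diff)
  ultimately show "cong_mod (K n) (act n x (h * g)) (act n (act n x h) g)"
    using x act_chains[OF x] by (simp add: chain_act_eq Si_mult del: suffix_act.simps)
qed

lemmas act_mult = K_imp_null[OF act_mult_K]

lemma act_K: "x \<in> K n \<Longrightarrow> act n x h \<in> K n"
  using G_chain_rel chain_act_eq chain_rel_chains by metis

lemma cyc_pow_tau: "x \<in> chains C n \<Longrightarrow> (x, (\<tau> n ^^ j) x) \<in> cyc n ^^ j"
  by (rule cyc_graph_tau_pow)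

lemma act_cyc_pow:
  "x \<in> chains C n \<Longrightarrow> (x, y) \<in> cyc n ^^ j \<Longrightarrow> (act n x h, z) \<in> cyc n ^^ j \<Longrightarrow> cong_mod (null n) (act n y h) z"
  by (simp add: cong_mod_def null_chains_def null_chain.coeq)

lemma act_cyc: "(x, y) \<in> cyc n \<Longrightarrow> (act n x h, z) \<in> cyc n \<Longrightarrow> cong_mod (null n) (act n y h) z"
  using act_cyc_pow[of x n y 1 h z] cyc_graph_chains by fastforce

text \<open>The last face is \<open>d_0 \<tau>\<close>; hence the last-face clause reads
  \<open>d_0 \<tau>^2 = \<tau> d_n\<close> for the chosen values.\<close>

lemma tau_last_face: "x \<in> chains C (Suc n) \<Longrightarrow>
    cong_mod (null n) (d (Suc n) 0 (\<tau> (Suc n) (\<tau> (Suc n) x))) (\<tau> n (d (Suc n) n x))"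
proof -
  assume x: "x \<in> chains C (Suc n)"
  have "(\<tau> (Suc n) x, d (Suc n) 0 (\<tau> (Suc n) (\<tau> (Suc n) x))) \<in> face_graph \<H> C M (Suc n) (Suc n)"
    using cyc_tau[OF tau_chains[OF x]] by (auto simp: face_graph_def)
  then show ?thesis
    unfolding cong_mod_def null_chains_def
    using null_chain.last_face[OF x cyc_tau[OF x] _ cyc_tau[OF chain_face_chains[OF x]]] by simp
qed

text \<open>Induction over the clauses. In \<open>coeq\<close> both terms, acted on by
  \<open>h\<close>, reduce to a power of \<open>\<tau>\<close> applied to the action of
  \<open>h' * h\<close> on \<open>x\<close>. In \<open>cyc\<close> and \<open>last_face\<close> the
  action is moved past one or two cyclic operators by the instances \<open>j = 1\<close> and
  \<open>j = 2\<close> of \<open>coeq\<close>.\<close>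

lemma act_cong_aux: "null_chain \<H> C M n x \<Longrightarrow> null_chain \<H> C M n (act n x h)"
proof (induction arbitrary: h rule: null_chain.induct)
  case (rel x n)
  then show ?case using act_K null_chain.rel by blast
next
  case (diff n x y)
  then show ?case by (simp add: act_diff null_chain.diff)
next
  case (coeq x n y j h' z)
  have c: "y \<in> chains C n" "z \<in> chains C n" "act n x h' \<in> chains C n"
    using cyc_graph_pow_chains[OF coeq(2,1)] cyc_graph_pow_chains[OF coeq(3) act_chains[OF coeq(1)]]
      act_chains[OF coeq(1)] by auto
  let ?w = "(\<tau> n ^^ j) (act n x (h' * h))" and ?w' = "(\<tau> n ^^ j) (act n (act n x h') h)"
  have "cong_mod (null n) (act n (act n y h') h) (act n y (h' * h))"
    by (rule null_sym[OF act_mult[OF c(1)]])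
  also have "cong_mod (null n) \<dots> ?w"
    by (rule act_cyc_pow[OF coeq(1,2) cyc_pow_tau[OF act_chains[OF coeq(1)]]])
  also have "cong_mod (null n) \<dots> ?w'"
    by (rule cyc_pow_cong[OF cyc_pow_tau cyc_pow_tau act_mult]) (use coeq c act_chains in auto)
  also have "cong_mod (null n) \<dots> (act n z h)"
    by (rule null_sym[OF act_cyc_pow[OF c(3) coeq(3) cyc_pow_tau[OF act_chains[OF c(3)]]]])
  finally show ?case by (simp add: cong_mod_def null_chains_def act_diff)
next
  case (face n x i)
  have "cong_mod (null n) (act n (d (Suc n) i x) h) (d (Suc n) i (act (Suc n) x h))"
    by (rule null_sym[OF K_imp_null[OF chain_face_chain_act]]) (use face null_chain_chains in auto)
  moreover have "d (Suc n) i (act (Suc n) x h) \<in> null n"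
    using face face_null by (simp add: null_chains_def)
  ultimately show ?case using cong_mod_mem[OF add_subgroup_null] by (fastforce simp: null_chains_def)
next
  case (cyc n x y)
  have x: "x \<in> chains C n" using cyc cyc_graph_chains by blast
  have "cong_mod (null n) (act n y h) (\<tau> n (act n x h))"
    using act_cyc cyc cyc_tau[OF act_chains[OF x]] by blast
  moreover have "\<tau> n (act n x h) \<in> null n"
    using cyc by (intro tau_null) (simp add: null_chains_def)
  ultimately show ?case using cong_mod_mem[OF add_subgroup_null] by (fastforce simp: null_chains_def)
next
  case (last_face x n y z z')
  obtain w where w: "(y, w) \<in> cyc (Suc n)" "z = d (Suc n) 0 w"
    using last_face by (auto simp: face_graph_def)
  let ?N = "null (Suc n)" and ?xh = "act (Suc n) x h"
  note c = chain_face_chains[OF last_face(1)] act_chains[OF last_face(1)]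
  have "w \<in> chains C (Suc n)" using w cyc_graph_chains by blast
  then have "cong_mod (null n) (act n z h) (d (Suc n) 0 (act (Suc n) w h))"
    unfolding w by (rule null_sym[OF K_imp_null[OF chain_face_chain_act]]) auto
  also have "cong_mod (null n) \<dots> (d (Suc n) 0 (\<tau> (Suc n) (\<tau> (Suc n) ?xh)))"
  proof (rule face_cong)
    show "cong_mod (null (Suc n)) (act (Suc n) w h) (\<tau> (Suc n) (\<tau> (Suc n) ?xh))"
      using act_cyc_pow[OF last_face(1), of w 2 h "\<tau> (Suc n) (\<tau> (Suc n) ?xh)"] w last_face(2)
        cyc_pow_tau[OF c(2), of h 2]
      by (auto simp: numeral_2_eq_2)
  qed simp
  also have "cong_mod (null n) \<dots> (\<tau> n (d (Suc n) n ?xh))"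
    by (rule tau_last_face[OF c(2)])
  also have "cong_mod (null n) \<dots> (\<tau> n (act n (d (Suc n) n x) h))"
    using c last_face(1) by (intro tau_cong K_imp_null chain_face_chain_act chain_face_chains act_chains) auto
  also have "cong_mod (null n) \<dots> (act n z' h)"
    using act_cyc[OF last_face(4) cyc_tau[OF act_chains[OF chain_face_chains[OF last_face(1)]]]]
    by (auto intro: null_sym)
  finally show ?case by (simp add: cong_mod_def null_chains_def act_diff)
qed

lemma act_null: "x \<in> null n \<Longrightarrow> act n x h \<in> null n"
  by (simp add: null_chains_def act_cong_aux)

lemma act_cong: "cong_mod (null n) x y \<Longrightarrow> cong_mod (null n) (act n x h) (act n y h)"
  unfolding cong_mod_def act_diff[symmetric] by (rule act_null)

lemma act_tau: "x \<in> chains C n \<Longrightarrow> cong_mod (null n) (act n (\<tau> n x) h) (\<tau> n (act n x h))"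
  by (rule act_cyc[OF cyc_tau cyc_tau[OF act_chains]])

lemma act_face: "x \<in> chains C (Suc n) \<Longrightarrow> i \<le> n \<Longrightarrow>
    cong_mod (null n) (act n (d (Suc n) i x) h) (d (Suc n) i (act (Suc n) x h))"
  by (rule null_sym[OF K_imp_null[OF chain_face_chain_act]])

end

context hcat_coeff
begin

section \<open>Eventually null chains\<close>

text \<open>The kernel of the map from the para-cyclic quotient to its localization at the cyclic operators.\<close>

definition enull :: "nat \<Rightarrow> ('o, 'f, 'm) chain set" where
  "enull n = {x \<in> chains C n. \<exists>j. (\<tau> n ^^ j) x \<in> null n}"

lemma pow_chains: "x \<in> chains C n \<Longrightarrow> (\<tau> n ^^ j) x \<in> chains C n"
  by (rule tau_pow_chains)

lemma tau_pow_diff: "(\<tau> n ^^ j) (x - y) = (\<tau> n ^^ j) x - (\<tau> n ^^ j) y"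
  by (induction j) (simp_all add: tau_diff)

lemma tau_pow_null: "x \<in> null n \<Longrightarrow> (\<tau> n ^^ j) x \<in> null n"
  by (induction j) (simp_all add: tau_null)

lemma tau_pow_cong: "cong_mod (null n) x y \<Longrightarrow> cong_mod (null n) ((\<tau> n ^^ j) x) ((\<tau> n ^^ j) y)"
  unfolding cong_mod_def tau_pow_diff[symmetric] by (rule tau_pow_null)

lemma tau_pow_null_mono: "(\<tau> n ^^ j) x \<in> null n \<Longrightarrow> j \<le> k \<Longrightarrow> (\<tau> n ^^ k) x \<in> null n"
  using tau_pow_null[of "(\<tau> n ^^ j) x" n "k - j"] funpow_add[of "k - j" j "\<tau> n"] by simp

lemma add_subgroup_enull [simp]: "add_subgroup (enull n)"
  unfolding add_subgroup_def
proof safe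
  show "0 \<in> enull n" using add_subgroup_null by (auto simp: enull_def add_subgroup_def intro!: exI[of _ 0])
  fix x y assume "x \<in> enull n" "y \<in> enull n"
  then obtain i j where *: "x \<in> chains C n" "y \<in> chains C n" "(\<tau> n ^^ i) x \<in> null n" "(\<tau> n ^^ j) y \<in> null n"
    by (auto simp: enull_def)
  have "(\<tau> n ^^ max i j) (x - y) \<in> null n"
    using tau_pow_null_mono[OF *(3), of "max i j"] tau_pow_null_mono[OF *(4), of "max i j"] add_subgroup_null
    unfolding tau_pow_diff add_subgroup_def by auto
  then show "x - y \<in> enull n" using * by (auto simp: enull_def chains_diff)
qed

lemma null_enull: "null n \<subseteq> enull n"
  by (auto simp: enull_def null_chains_chains intro: exI[of _ 0])

lemmas null_imp_enull = cong_mod_mono[OF null_enull]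

lemma enull_trans [trans]: "cong_mod (enull n) x y \<Longrightarrow> cong_mod (enull n) y z \<Longrightarrow> cong_mod (enull n) x z"
  by (rule cong_mod_trans[OF add_subgroup_enull])

lemma enull_sym: "cong_mod (enull n) x y \<Longrightarrow> cong_mod (enull n) y x"
  by (rule cong_mod_sym[OF add_subgroup_enull])

lemma enull_null_trans [trans]: "cong_mod (enull n) x y \<Longrightarrow> cong_mod (null n) y z \<Longrightarrow> cong_mod (enull n) x z"
  and null_enull_trans [trans]: "cong_mod (null n) x y \<Longrightarrow> cong_mod (enull n) y z \<Longrightarrow> cong_mod (enull n) x z"
  using null_imp_enull enull_trans by blast+

lemma tau_enull: "x \<in> enull n \<Longrightarrow> \<tau> n x \<in> enull n"
proof -
  assume "x \<in> enull n"
  then obtain j where x: "x \<in> chains C n" "(\<tau> n ^^ j) x \<in> null n" by (auto simp: enull_def)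
  have "(\<tau> n ^^ j) (\<tau> n x) \<in> null n" using tau_null[OF x(2)] by (simp add: funpow_swap1)
  then show ?thesis using tau_chains[OF x(1)] by (auto simp: enull_def)
qed

text \<open>This is the gain over \<open>null\<close>: modulo \<open>enull\<close> the cyclic
  operator can be cancelled. In the form \<open>cyc_enull_congD\<close> it allows two chains to be
  identified by computing one common value of the cyclic formula.\<close>

lemma tau_pow_enullD: "x \<in> chains C n \<Longrightarrow> (\<tau> n ^^ k) x \<in> enull n \<Longrightarrow> x \<in> enull n"
proof -
  assume "x \<in> chains C n" "(\<tau> n ^^ k) x \<in> enull n"
  moreover from this obtain j where "(\<tau> n ^^ j) ((\<tau> n ^^ k) x) \<in> null n" by (auto simp: enull_def)
  then have "(\<tau> n ^^ (j + k)) x \<in> null n" by (simp add: funpow_add)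
  ultimately show ?thesis unfolding enull_def by blast
qed

lemma cyc_enull: "(x, y) \<in> cyc n \<Longrightarrow> x \<in> enull n \<Longrightarrow> y \<in> enull n"
  using cong_mod_mem[OF add_subgroup_enull null_imp_enull[OF cyc_tau_cong] tau_enull] by blast

lemma cyc_enullD: "(x, y) \<in> cyc n \<Longrightarrow> y \<in> enull n \<Longrightarrow> x \<in> enull n"
proof -
  assume a: "(x, y) \<in> cyc n" "y \<in> enull n"
  then have "\<tau> n x \<in> enull n"
    using cong_mod_mem[OF add_subgroup_enull null_imp_enull[OF null_sym[OF cyc_tau_cong]]] by blast
  then show ?thesis using tau_pow_enullD[of x n 1] a cyc_graph_chains by fastforce
qed

lemma cyc_enull_cong: "(x, y) \<in> cyc n \<Longrightarrow> (x', y') \<in> cyc n \<Longrightarrow> cong_mod (enull n) x x' \<Longrightarrow> cong_mod (enull n) y y'"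
  unfolding cong_mod_def by (rule cyc_enull) (auto intro: cyc_graph.diff)

lemma cyc_enull_congD: "(x, y) \<in> cyc n \<Longrightarrow> (x', y') \<in> cyc n \<Longrightarrow> cong_mod (enull n) y y' \<Longrightarrow> cong_mod (enull n) x x'"
  unfolding cong_mod_def by (rule cyc_enullD) (auto intro: cyc_graph.diff)

lemma act_tau_pow: "x \<in> chains C n \<Longrightarrow> cong_mod (null n) (act n ((\<tau> n ^^ j) x) h) ((\<tau> n ^^ j) (act n x h))"
  by (rule act_cyc_pow[OF _ cyc_pow_tau cyc_pow_tau[OF act_chains]])

lemma act_enull: "x \<in> enull n \<Longrightarrow> act n x h \<in> enull n"
proof -
  assume "x \<in> enull n"
  then obtain j where x: "x \<in> chains C n" "(\<tau> n ^^ j) x \<in> null n" by (auto simp: enull_def)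
  have "(\<tau> n ^^ j) (act n x h) \<in> null n"
    by (rule cong_mod_mem[OF add_subgroup_null null_sym[OF act_tau_pow[OF x(1)]] act_null[OF x(2)]])
  then show ?thesis using x act_chains by (auto simp: enull_def)
qed

lemma act_enull_cong: "cong_mod (enull n) x y \<Longrightarrow> cong_mod (enull n) (act n x h) (act n y h)"
  unfolding cong_mod_def act_diff[symmetric] by (rule act_enull)

section \<open>Faces and cyclic operators\<close>

text \<open>An equality of chains and not only a congruence: for \<open>i < n\<close> the face
  \<open>d_i\<close> in degree \<open>n + 1\<close> does not touch the last morphism, the one moved
  by \<open>\<tau>\<close>, and the rotation shifts the index of the face by one.\<close>

lemma face_tau:
  assumes "x \<in> chains C (Suc n)" "i < n"
  shows "d (Suc n) (Suc i) (\<tau> (Suc n) x) = \<tau> n (d (Suc n) i x)"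
  using assms(1)
proof (induction rule: chains_induct)
  case (one \<sigma>)
  obtain Xs fs m where \<sigma>: "\<sigma> = (Xs, fs, m)" by (cases \<sigma>)
  then have l: "length Xs = Suc (Suc n)" "length fs = Suc (Suc n)" using one by (auto simp: tensors_def)
  obtain Ys Z where Xs: "Xs = Ys @ [Z]" using l by (cases Xs rule: rev_cases) auto
  obtain gs e where fs: "fs = gs @ [e]" using l by (cases fs rule: rev_cases) auto
  have ly: "length Ys = Suc n" "length gs = Suc n" using l Xs fs by auto
  have s: "src (Suc n) (Z # Ys) (Suc (Suc i)) = src (Suc n) Xs (Suc i)"
    using src_rotate[OF l(1), of "Suc (Suc i)"] assms(2) by (simp add: Xs src_less)
  have s': "src n (take (Suc i) Xs @ drop (i + 2) Xs) n = src (Suc n) Xs (Suc n)"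
    using src_skip[OF l(1), of i n] assms(2) by simp
  have t0: "take (Suc i) Xs @ drop (i + 2) Xs = (take (Suc i) Ys @ drop (i + 2) Ys) @ [Z]"
    using assms(2) ly by (simp add: Xs)
  note t = t0 s'[unfolded t0]
  have t': "take i fs @ c # drop (i + 2) fs = (take i gs @ c # drop (i + 2) gs) @ [e]" for c
    using assms(2) ly by (simp add: fs)
  have f: "face_simplex C (Suc n) (Suc i) (Z # Ys, g # gs, m')
      = (Z # (take (Suc i) Ys @ drop (i + 2) Ys),
         g # (take i gs @ Comp C (src (Suc n) Xs (Suc i)) (Xs ! Suc i) (Xs ! i) (fs ! i) (fs ! Suc i) # drop (i + 2) gs), m')"
    for g m'
    using assms(2) ly s by (simp add: face_simplex_def Xs fs nth_append)
  show ?case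
    unfolding \<sigma> tau_def chain_face_eq frag_extend_of prod.case frag_extend_sum_list comp_def face_simplex_def[of C "Suc n" i]
      t t'
    by (simp add: case_prod_unfold f Xs fs del: append_assoc)
next
  case (diff x y)
  then show ?case by (simp add: tau_diff d_diff)
qed (simp add: tau_def chain_face_eq)

lemma face_tau_pow:
  "x \<in> chains C (Suc n) \<Longrightarrow> i + k \<le> n \<Longrightarrow> d (Suc n) (i + k) ((\<tau> (Suc n) ^^ k) x) = (\<tau> n ^^ k) (d (Suc n) i x)"
  by (induction k) (simp_all add: face_tau pow_chains)

text \<open>\<open>n - i\<close> rotations raise the index of the face to \<open>n\<close>; one more
  in the lower degree costs two in the upper degree and returns the index to \<open>0\<close>, by
  \<open>tau_last_face\<close>; \<open>i\<close> further ones bring it back to \<open>i\<close>.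
  Altogether this is one full rotation in either degree.\<close>

lemma tau_pow_face:
  assumes "x \<in> chains C (Suc n)" "i \<le> n"
  shows "cong_mod (null n) ((\<tau> n ^^ Suc n) (d (Suc n) i x)) (d (Suc n) i ((\<tau> (Suc n) ^^ Suc (Suc n)) x))"
proof -
  let ?y = "(\<tau> (Suc n) ^^ (n - i)) x" and ?T = "\<tau> (Suc n)"
  have n: "Suc n = i + (1 + (n - i))" "Suc (Suc n) = i + (2 + (n - i))" using assms(2) by auto
  have y: "?y \<in> chains C (Suc n)" using assms pow_chains by blast
  have "(\<tau> n ^^ Suc n) (d (Suc n) i x) = (\<tau> n ^^ i) (\<tau> n ((\<tau> n ^^ (n - i)) (d (Suc n) i x)))"
    by (subst n(1)) (simp add: funpow_add funpow_swap1)
  also have "\<dots> = (\<tau> n ^^ i) (\<tau> n (d (Suc n) n ?y))"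
    using face_tau_pow[OF assms(1), of i "n - i"] assms(2) by simp
  also have "cong_mod (null n) \<dots> ((\<tau> n ^^ i) (d (Suc n) 0 (?T (?T ?y))))"
    by (rule tau_pow_cong[OF null_sym[OF tau_last_face[OF y]]])
  also have "(\<tau> n ^^ i) (d (Suc n) 0 (?T (?T ?y))) = d (Suc n) i ((?T ^^ i) (?T (?T ?y)))"
    using face_tau_pow[of "?T (?T ?y)" n 0 i] y assms(2) by (simp add: tau_chains)
  also have "(?T ^^ i) (?T (?T ?y)) = (?T ^^ Suc (Suc n)) x"
    by (subst n(2)) (simp add: funpow_add numeral_2_eq_2 funpow_swap1)
  finally show ?thesis .
qed

lemma tau_pow_mult_face:
  assumes "x \<in> chains C (Suc n)" "i \<le> n"
  shows "cong_mod (null n) ((\<tau> n ^^ (Suc n * k)) (d (Suc n) i x)) (d (Suc n) i ((\<tau> (Suc n) ^^ (Suc (Suc n) * k)) x))"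
proof (induction k)
  case (Suc k)
  let ?y = "(\<tau> (Suc n) ^^ (Suc (Suc n) * k)) x"
  have "(\<tau> n ^^ (Suc n * Suc k)) (d (Suc n) i x) = (\<tau> n ^^ Suc n) ((\<tau> n ^^ (Suc n * k)) (d (Suc n) i x))"
    unfolding mult_Suc_right funpow_add by simp
  also have "cong_mod (null n) \<dots> ((\<tau> n ^^ Suc n) (d (Suc n) i ?y))"
    by (rule tau_pow_cong[OF Suc.IH])
  also have "cong_mod (null n) \<dots> (d (Suc n) i ((\<tau> (Suc n) ^^ Suc (Suc n)) ?y))"
    by (rule tau_pow_face[OF pow_chains[OF assms(1)] assms(2)])
  also have "(\<tau> (Suc n) ^^ Suc (Suc n)) ?y = (\<tau> (Suc n) ^^ (Suc (Suc n) * Suc k)) x"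
    unfolding mult_Suc_right funpow_add by simp
  finally show ?case .
qed simp

text \<open>The exponent \<open>j\<close> is first enlarged to \<open>(n + 2) j\<close>, a multiple
  of the full rotation, which can be moved past the face with its index unchanged.\<close>

lemma face_enull:
  assumes "x \<in> enull (Suc n)" "i \<le> n"
  shows "d (Suc n) i x \<in> enull n"
proof -
  from assms obtain j where x: "x \<in> chains C (Suc n)" "(\<tau> (Suc n) ^^ j) x \<in> null (Suc n)" by (auto simp: enull_def)
  have "(\<tau> (Suc n) ^^ (Suc (Suc n) * j)) x \<in> null (Suc n)" using x(2) by (rule tau_pow_null_mono) simp
  then have "(\<tau> n ^^ (Suc n * j)) (d (Suc n) i x) \<in> null n"
    by (intro cong_mod_mem[OF add_subgroup_null tau_pow_mult_face[OF x(1) assms(2)]] face_null assms(2))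
  then show ?thesis using chain_face_chains[OF x(1) assms(2)] unfolding enull_def by blast
qed

lemma face_enull_cong: "i \<le> n \<Longrightarrow> cong_mod (enull (Suc n)) x y \<Longrightarrow> cong_mod (enull n) (d (Suc n) i x) (d (Suc n) i y)"
  unfolding cong_mod_def d_diff[symmetric] by (rule face_enull)

section \<open>Chains on which the cyclic operator has finite order\<close>

definition periodic :: "nat \<Rightarrow> ('o, 'f, 'm) chain set" where
  "periodic n = {x \<in> chains C n. cong_mod (null n) ((\<tau> n ^^ Suc n) x) x}"

lemma periodic_chains: "x \<in> periodic n \<Longrightarrow> x \<in> chains C n"
  by (simp add: periodic_def)

lemma null_periodic: "x \<in> null n \<Longrightarrow> x \<in> periodic n"
  using tau_pow_null[of x n "Suc n"] add_subgroup_null[of n] null_chains_chains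
  by (auto simp: periodic_def cong_mod_def add_subgroup_def)

lemma add_subgroup_periodic [simp]: "add_subgroup (periodic n)"
  unfolding add_subgroup_def periodic_def mem_Collect_eq
  using tau_pow_diff[of "Suc n" n] tau_pow_diff[of "Suc n" n 0 0] cong_mod_diff[OF add_subgroup_null]
  by (auto simp del: funpow.simps simp: chains_diff)

lemma periodic_cong: "x \<in> periodic n \<Longrightarrow> y \<in> chains C n \<Longrightarrow> cong_mod (null n) y x \<Longrightarrow> y \<in> periodic n"
  using add_subgroup_add[OF add_subgroup_periodic _ null_periodic, of x n "y - x"] by (simp add: cong_mod_def)

lemma act_periodic:
  assumes "x \<in> periodic n" shows "act n x h \<in> periodic n"
proof -
  have x: "x \<in> chains C n" "cong_mod (null n) ((\<tau> n ^^ Suc n) x) x" using assms by (auto simp: periodic_def)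
  show ?thesis
    using null_trans[OF null_sym[OF act_tau_pow[OF x(1)]] act_cong[OF x(2)]] act_chains[OF x(1)]
    by (simp add: periodic_def del: funpow.simps)
qed

lemma tau_periodic: "x \<in> periodic n \<Longrightarrow> \<tau> n x \<in> periodic n"
  using tau_chains tau_cong[OF pow_chains, of x n x "Suc n"] unfolding periodic_def
  by (auto simp: funpow_swap1)

lemma face_periodic:
  assumes "x \<in> periodic (Suc n)" "i \<le> n" shows "d (Suc n) i x \<in> periodic n"
proof -
  have x: "x \<in> chains C (Suc n)" "cong_mod (null (Suc n)) ((\<tau> (Suc n) ^^ Suc (Suc n)) x) x"
    using assms by (auto simp: periodic_def)
  show ?thesis
    using null_trans[OF tau_pow_face[OF x(1) assms(2)] face_cong[OF assms(2) x(2)]] chain_face_chains[OF x(1) assms(2)]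
    by (simp add: periodic_def del: funpow.simps)
qed

text \<open>Modulo \<open>null\<close> the chain \<open>x\<close> equals its image under
  \<open>\<tau>^((n+1)j)\<close>, and this is null once the image under \<open>\<tau>^j\<close>
  is.\<close>

lemma periodic_enull_null:
  assumes "x \<in> periodic n" "x \<in> enull n" shows "x \<in> null n"
proof -
  from assms obtain j where j: "(\<tau> n ^^ j) x \<in> null n" by (auto simp: enull_def)
  have "cong_mod (null n) ((\<tau> n ^^ (Suc n * k)) x) x" for k
  proof (induction k)
    case (Suc k)
    have "(\<tau> n ^^ (Suc n * Suc k)) x = (\<tau> n ^^ Suc n) ((\<tau> n ^^ (Suc n * k)) x)"
      unfolding mult_Suc_right funpow_add by simp
    also have "cong_mod (null n) \<dots> ((\<tau> n ^^ Suc n) x)" by (rule tau_pow_cong[OF Suc.IH])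
    also have "cong_mod (null n) \<dots> x" using assms(1) by (simp add: periodic_def)
    finally show ?case .
  qed simp
  moreover have "(\<tau> n ^^ (Suc n * j)) x \<in> null n" using j by (rule tau_pow_null_mono) simp
  ultimately show ?thesis using cong_mod_mem[OF add_subgroup_null null_sym] by blast
qed

lemma periodic_cong_null:
  "x \<in> periodic n \<Longrightarrow> y \<in> periodic n \<Longrightarrow> cong_mod (enull n) x y \<Longrightarrow> cong_mod (null n) x y"
  unfolding cong_mod_def using add_subgroup_periodic periodic_enull_null by (auto simp: add_subgroup_def)

section \<open>The base algebra acts commutatively up to eventually null chains\<close>

text \<open>This element is \<open>S (sL l)\<close>, by \<open>Si_lam\<close>. Since the action
  involves \<open>Si\<close>, it acts through \<open>sL l\<close>, on the first morphism, whereas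
  \<open>sL l\<close> itself acts through \<open>Si (sL l) = tL l\<close>, on the
  coefficient.\<close>

abbreviation "lam l \<equiv> sR \<H> (eR \<H> (sL \<H> l))"

lemma Si_lam: "Si (lam l) = sL \<H> l"
  by (simp add: units)

lemma act_sL_eq: "x \<in> chains C n \<Longrightarrow> cong_mod (null n) (act n x (sL \<H> l)) (frag_map (U n (Suc n) (tL \<H> l)) x)"
  using G_tL[OF order_refl] by (simp add: chain_act_eq, intro K_imp_null frag_extend_cong_mod add_subgroup_K)
    (simp_all del: suffix_act.simps)

lemma act_lam_eq: "x \<in> chains C n \<Longrightarrow> cong_mod (null n) (act n x (lam l)) (frag_map (U n 0 (sL \<H> l)) x)"
  using G_sL[OF order_refl] by (simp add: chain_act_eq Si_lam del: Si_sR, intro K_imp_null frag_extend_cong_mod add_subgroup_K)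
    (simp_all del: suffix_act.simps)

text \<open>Both sides have a common value under the cyclic formula. On \<open>M\<close>,
  \<open>tL l\<close> is the left \<open>R\<close>-action of \<open>r = eR (sL l)\<close>; as the
  coaction is linear over \<open>R\<close> and \<open>tR r = sL l\<close>, it sends
  \<open>tL l m\<close> to \<open>x * sL l \<otimes> n\<close>, summed over the coaction of
  \<open>m\<close>. The same element results from applying \<open>sL l\<close> to the last morphism
  instead.\<close>

lemma act_sL_last: 
  assumes "x \<in> chains C n"
  shows "cong_mod (enull n) (act n x (sL \<H> l)) (frag_map (U n n (sL \<H> l)) x)"
proof -
  have "cong_mod (enull n) (frag_map (U n (Suc n) (tL \<H> l)) x) (frag_map (U n n (sL \<H> l)) x)"
  proof (rule frag_extend_cong_mod[OF assms add_subgroup_enull])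
    fix \<sigma> :: "'o list \<times> 'f list \<times> 'm" assume \<sigma>: "\<sigma> \<in> tensors C n"
    obtain Xs fs m where s: "\<sigma> = (Xs, fs, m)" by (cases \<sigma>)
    have T: "(Xs, fs, m) \<in> tensors C n" "U n (Suc n) (tL \<H> l) \<sigma> = (Xs, fs, mact M (tL \<H> l) m)"
      using \<sigma> s by (auto simp: upd_def)
    have l: "length Xs = Suc n" "length fs = Suc n" using T by (auto simp: tensors_def)
    have ends: "last Xs = Xs ! n" "last fs = fs ! n" using l by (auto simp: last_conv_nth simp flip: length_0_conv)
    let ?g = "Act C (src n Xs n) (Xs ! n) (sL \<H> l) (fs ! n)"
    have un: "U n n (sL \<H> l) \<sigma> = (Xs, fs[n := ?g], m)" by (simp add: s upd_def)
    have e: "MrL \<H> M l m = mlR M (eR \<H> (sL \<H> l)) m"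
      using bimodules_related[of 1 l m] mrR(3) by (simp add: MlL_def sL_hom mact_mult eR_one)
    have "eq_HM_L \<H> M (lamL M (mact M (tL \<H> l) m)) [(x * sL \<H> l, n). (x, n) \<leftarrow> lamL M m]"
      using lamL_R_linear[of "eR \<H> (sL \<H> l)" m] e by (simp add: HlR_def MrL_def units)
    from cyc_graph.formula[OF upd_tensors[OF \<sigma>, of M "Suc n" "tL \<H> l", unfolded T(2)] tens_eq_sym[OF this]]
    have c1: "(frag_of (U n (Suc n) (tL \<H> l) \<sigma>), \<Sum>(h, m')\<leftarrow>lamL M m. frag_of (last Xs # butlast Xs,
        Act C (src n Xs n) (last Xs) (h * sL \<H> l) (last fs) # butlast fs, m')) \<in> cyc n"
      by (simp add: T(2) sum_list_pairs)
    have "Act C (src n Xs n) (last Xs) h ?g = Act C (src n Xs n) (last Xs) (h * sL \<H> l) (last fs)" for h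
      using tensors_Ob[OF T(1)] tensors_hom[OF T(1)] ends by (simp add: Act_mult)
    moreover have "last (fs[n := ?g]) = ?g" "butlast (fs[n := ?g]) = butlast fs"
      using l by (simp_all add: last_list_update butlast_list_update flip: length_0_conv)
    ultimately have c2: "(frag_of (U n n (sL \<H> l) \<sigma>), \<Sum>(h, m')\<leftarrow>lamL M m. frag_of (last Xs # butlast Xs,
        Act C (src n Xs n) (last Xs) (h * sL \<H> l) (last fs) # butlast fs, m')) \<in> cyc n"
      using cyc_graph.formula[OF upd_tensors[OF \<sigma>, of M n "sL \<H> l", unfolded un] tens_eq_refl]
      by (simp add: un)
    show "cong_mod (enull n) ((frag_of \<circ> U n (Suc n) (tL \<H> l)) \<sigma>) ((frag_of \<circ> U n n (sL \<H> l)) \<sigma>)"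
      unfolding comp_apply by (rule cyc_enull_congD[OF c1 c2]) simp
  qed
  then show ?thesis using null_enull_trans[OF act_sL_eq[OF assms]] by blast
qed

text \<open>The coaction is linear over \<open>L\<close>, so the cyclic formula moves
  \<open>sL l\<close> from the coefficient to slot \<open>0\<close> of the rotated chain. There it
  is the action of \<open>lam l\<close>, which commutes with \<open>\<tau>\<close>; the rotation is
  then cancelled.\<close>

lemma act_lam_coeff:
  assumes "x \<in> chains C n"
  shows "cong_mod (enull n) (frag_map (U n (Suc n) (sL \<H> l)) x) (act n x (lam l))"
  using assms
proof (induction rule: chains_induct)
  case (one \<sigma>)
  obtain Xs fs m where s: "\<sigma> = (Xs, fs, m)" by (cases \<sigma>)
  have T: "(Xs, fs, m) \<in> tensors C n" "U n (Suc n) (sL \<H> l) \<sigma> = (Xs, fs, mact M (sL \<H> l) m)"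
    using one s by (auto simp: upd_def)
  have l: "length Xs = Suc n" "length fs = Suc n" using T by (auto simp: tensors_def)
  have ends: "last Xs = Xs ! n" "last fs = fs ! n" using l by (auto simp: last_conv_nth simp flip: length_0_conv)
  have "eq_HM_L \<H> M (lamL M (mact M (sL \<H> l) m)) [(sL \<H> l * x, n). (x, n) \<leftarrow> lamL M m]"
    using lamL_linear[of l m] by (simp add: HlL_def MlL_def)
  from cyc_graph.formula[OF upd_tensors[OF one, of M "Suc n" "sL \<H> l", unfolded T(2)] tens_eq_sym[OF this]]
  have c1: "(frag_of (U n (Suc n) (sL \<H> l) \<sigma>), \<Sum>(h, m')\<leftarrow>lamL M m. frag_of (last Xs # butlast Xs,
      Act C (src n Xs n) (last Xs) (sL \<H> l * h) (last fs) # butlast fs, m')) \<in> cyc n"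
    by (simp add: T(2) sum_list_pairs)
  have obs: "Xs ! 0 \<in> Ob C" "Xs ! n \<in> Ob C" "fs ! n \<in> Hom C (Xs ! 0) (Xs ! n)"
    using tensors_Ob[OF T(1)] tensors_hom[OF T(1), of n] by (auto simp: src_last)
  have "U n 0 (sL \<H> l) (last Xs # butlast Xs, Act C (src n Xs n) (last Xs) h (last fs) # butlast fs, m')
      = (last Xs # butlast Xs, Act C (src n Xs n) (last Xs) (sL \<H> l * h) (last fs) # butlast fs, m')" for h m'
    using obs ends src_rotate[OF l(1), of 0] src_last[of n Xs]
    by (simp add: upd_def Act_mult)
  then have e: "frag_map (U n 0 (sL \<H> l)) (\<tau> n (frag_of \<sigma>)) = (\<Sum>(h, m')\<leftarrow>lamL M m. frag_of (last Xs # butlast Xs,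
      Act C (src n Xs n) (last Xs) (sL \<H> l * h) (last fs) # butlast fs, m'))"
    by (simp add: s tau_def frag_extend_sum_list case_prod_unfold)
  have x: "frag_of \<sigma> \<in> chains C n" using one by simp
  have "cong_mod (null n) (frag_map (U n 0 (sL \<H> l)) (\<tau> n (frag_of \<sigma>))) (\<tau> n (act n (frag_of \<sigma>) (lam l)))"
    using null_trans[OF null_sym[OF act_lam_eq[OF tau_chains[OF x]]] act_tau[OF x]] .
  then show ?case
    using cyc_enull_congD[OF c1 cyc_tau[OF act_chains[OF x]]] null_imp_enull e by simp
next
  case (diff x y)
  then show ?case by (simp add: frag_extend_diff act_diff cong_mod_diff)
qed (simp add: chain_act_def)

lemma K_put_minus:
  assumes \<sigma>: "\<sigma> \<in> tensors C n" and i: "i \<le> n" and f: "f \<in> hom_at C n i \<sigma>"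
  shows "cong_mod (K n) (frag_of (put i (- f) \<sigma>)) (- frag_of (put i f \<sigma>))"
proof -
  have z: "0 \<in> hom_at C n i \<sigma>" and m: "- f \<in> hom_at C n i \<sigma>"
    using \<sigma> i f Hom_subgroup(2)[of _ _ 0 f]
    by (cases \<sigma>; auto simp: hom_at_def intro!: Hom_subgroup(1) intro: tensors_Ob dest: tensors_Ob)+
  have "- frag_of (put i 0 \<sigma>) \<in> K n" using K_put[OF \<sigma> i z z] by (simp add: cong_mod_def)
  moreover have "frag_of (put i 0 \<sigma>) - (frag_of (put i f \<sigma>) + frag_of (put i (- f) \<sigma>)) \<in> K n"
    using K_put[OF \<sigma> i f m] by (simp add: cong_mod_def)
  ultimately have "- frag_of (put i 0 \<sigma>) - - (frag_of (put i 0 \<sigma>) - (frag_of (put i f \<sigma>) + frag_of (put i (- f) \<sigma>))) \<in> K n"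
    using add_subgroup_K[of n] add_subgroup_uminus unfolding add_subgroup_def by blast
  then have "- (frag_of (put i f \<sigma>) + frag_of (put i (- f) \<sigma>)) \<in> K n" by (simp add: algebra_simps)
  from add_subgroup_uminus[OF add_subgroup_K this] show ?thesis by (simp add: cong_mod_def algebra_simps)
qed

lemma rotate1_tensors:
  assumes "(Xs, fs, m) \<in> tensors C n"
  shows "(rotate1 Xs, rotate1 fs, m) \<in> tensors C n"
  using assms by (auto simp: tensors_def src_def nth_rotate1)

text \<open>This closes the cycle of balancing relations, from the first morphism back to the
  coefficient. It compares two values of the cyclic formula on one chain, for the representatives
  \<open>lamL m\<close> and \<open>lamL m\<close> with
  \<open>tL l \<otimes> m - 1 \<otimes> sL l m\<close> appended; their difference is null.\<close>

lemma null_balanced_first: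
  assumes \<sigma>: "\<sigma> \<in> tensors C n"
  shows "cong_mod (null n) (frag_of (U n 0 (tL \<H> l) \<sigma>)) (frag_of (U n (Suc n) (sL \<H> l) \<sigma>))"
proof -
  obtain Xs fs m where s: "\<sigma> = (Xs, fs, m)" by (cases \<sigma>)
  have T: "(Xs, fs, m) \<in> tensors C n" using \<sigma> s by auto
  have l: "length Xs = Suc n" "length fs = Suc n" using T by (auto simp: tensors_def)
  obtain Z Ys where Xs: "Xs = Z # Ys" using l by (cases Xs) auto
  obtain e gs where fs: "fs = e # gs" using l by (cases fs) auto
  let ?A = "Act C (src n Xs 0) Z"
  have s0: "src n (Ys @ [Z]) n = src n Xs 0"
    using l nth_rotate1[of 0 Xs] by (simp add: src_def Xs)
  \<comment> \<open>The simplex is rotated backwards, so that the cyclic formula returns it to its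
    original position with the first morphism acted upon.\<close>
  note c = cyc_graph.formula[OF rotate1_tensors[OF T], where \<H>=\<H> and M=M]
  have val: "(\<Sum>(h, m')\<leftarrow>t. frag_of (last (rotate1 Xs) # butlast (rotate1 Xs),
      Act C (src n (rotate1 Xs) n) (last (rotate1 Xs)) h (last (rotate1 fs)) # butlast (rotate1 fs), m'))
     = (\<Sum>(h, m')\<leftarrow>t. frag_of (Xs, ?A h e # gs, m'))" for t :: "('h \<times> 'm) list"
    by (simp add: Xs fs s0[unfolded Xs])
  have "eq_HM_L \<H> M (lamL M m @ [(tL \<H> l, m), (- 1, mact M (sL \<H> l) m)]) (lamL M m)"
    using tens_eq_append_balanced[of "HrL \<H>" "MlL \<H> M" "lamL M m" l 1 m] by (simp add: HrL_def MlL_def)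
  from cyc_graph.diff[OF c[OF this] c[OF tens_eq_refl]]
  have "(0, frag_of (Xs, ?A (tL \<H> l) e # gs, m) + frag_of (Xs, ?A (- 1) e # gs, mact M (sL \<H> l) m)) \<in> cyc n"
    unfolding val by simp
  then have n: "frag_of (Xs, ?A (tL \<H> l) e # gs, m) + frag_of (Xs, ?A (- 1) e # gs, mact M (sL \<H> l) m) \<in> null n"
    using cyc_null add_subgroup_null unfolding add_subgroup_def by blast
  have obs: "src n Xs 0 \<in> Ob C" "Z \<in> Ob C" "e \<in> Hom C (src n Xs 0) Z"
    using tensors_Ob(1)[OF T, of 0] tensors_Ob(2)[OF T, of 0] tensors_hom[OF T, of 0] by (auto simp: Xs fs)
  have "?A (- 1) e = - e"
    using Act_add(2)[OF obs, of 1 "- 1"] Act_add(2)[OF obs, of 0 0] Act_mult(1)[OF obs]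
    by (simp add: eq_neg_iff_add_eq_0 add.commute)
  then have "cong_mod (null n) (frag_of (Xs, ?A (- 1) e # gs, mact M (sL \<H> l) m)) (- frag_of (U n (Suc n) (sL \<H> l) \<sigma>))"
    using K_imp_null[OF K_put_minus[where i=0 and f=e, OF upd_tensors[OF \<sigma>, of M "Suc n" "sL \<H> l"]]] obs
    by (simp add: s upd_def put_def hom_at_def fs Xs)
  moreover have "U n 0 (tL \<H> l) \<sigma> = (Xs, ?A (tL \<H> l) e # gs, m)" by (simp add: s upd_def Xs fs)
  ultimately have "cong_mod (null n) (frag_of (U n 0 (tL \<H> l) \<sigma>) + frag_of (Xs, ?A (- 1) e # gs, mact M (sL \<H> l) m)
      - frag_of (Xs, ?A (- 1) e # gs, mact M (sL \<H> l) m)) (0 - (- frag_of (U n (Suc n) (sL \<H> l) \<sigma>)))"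
    using n by (intro cong_mod_diff) (simp_all add: cong_mod_def)
  then show ?thesis by simp
qed

text \<open>\<open>sL l\<close> on slot \<open>1\<close> is \<open>tL l\<close> on slot
  \<open>0\<close> by balancing, hence \<open>sL l\<close> on the coefficient by
  \<open>null_balanced_first\<close>, hence the action of \<open>lam l\<close>.\<close>

lemma act_lam_second:
  assumes "x \<in> chains C n" "0 < n"
  shows "cong_mod (enull n) (frag_map (U n (Suc 0) (sL \<H> l)) x) (act n x (lam l))"
proof -
  have "cong_mod (null n) (frag_map (U n (Suc 0) (sL \<H> l)) x) (frag_map (U n (Suc n) (sL \<H> l)) x)"
  proof (rule frag_extend_cong_mod[OF assms(1) add_subgroup_null], unfold comp_apply)
    fix \<sigma> :: "'o list \<times> 'f list \<times> 'm" assume "\<sigma> \<in> tensors C n"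
    then show "cong_mod (null n) (frag_of (U n (Suc 0) (sL \<H> l) \<sigma>)) (frag_of (U n (Suc n) (sL \<H> l) \<sigma>))"
      by - (rule null_trans[OF null_sym[OF K_imp_null[OF K_balanced]] null_balanced_first], simp_all)
  qed
  then show ?thesis using act_lam_coeff[OF assms(1)] null_enull_trans by blast
qed

lemma frag_map_upd_tau:
  assumes "x \<in> chains C n" "i < n"
  shows "frag_map (U n (Suc i) h) (\<tau> n x) = \<tau> n (frag_map (U n i h) x)"
  using assms(1)
proof (induction rule: chains_induct)
  case (one \<sigma>)
  obtain Xs fs m where s: "\<sigma> = (Xs, fs, m)" by (cases \<sigma>)
  have T: "(Xs, fs, m) \<in> tensors C n" using one s by auto
  have l: "length Xs = Suc n" "length fs = Suc n" using T by (auto simp: tensors_def)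
  have "U n (Suc i) h (last Xs # butlast Xs, g # butlast fs, m')
    = (last Xs # butlast Xs, g # butlast (fs[i := Act C (src n Xs i) (Xs ! i) h (fs ! i)]), m')" for g m'
    using l assms(2) src_rotate[OF l(1), of "Suc i"]
    by (simp add: upd_def nth_butlast src_less butlast_list_update)
  moreover have "last (fs[i := e]) = last fs" for e
    using l assms(2) by (simp add: last_list_update flip: length_0_conv)
  ultimately show ?case
    using assms(2) by (simp add: s tau_def frag_extend_sum_list case_prod_unfold upd_def[of C M n i])
next
  case (diff x y)
  then show ?case by (simp add: tau_diff frag_extend_diff)
qed (simp add: tau_def)

lemma frag_map_upd_chains: "x \<in> chains C n \<Longrightarrow> frag_map (U n i h) x \<in> chains C n"
  by (rule frag_extend_mem) (auto simp: upd_tensors)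

text \<open>Each rotation carries the statement for slot \<open>1\<close> one slot further to the
  right. For \<open>j = n - 1\<close> it reaches slot \<open>n\<close>, the one of
  \<open>act_sL_last\<close>.\<close>

lemma act_lam_all:
  assumes "x \<in> chains C n" "j < n"
  shows "cong_mod (enull n) (frag_map (U n (Suc j) (sL \<H> l)) ((\<tau> n ^^ j) x)) (act n ((\<tau> n ^^ j) x) (lam l))"
  using assms(2)
proof (induction j)
  case 0
  then show ?case using act_lam_second[OF assms(1)] by (simp only: funpow_0)
next
  case (Suc j)
  let ?y = "(\<tau> n ^^ j) x"
  have y: "?y \<in> chains C n" by (rule pow_chains[OF assms(1)])
  have "cong_mod (enull n) (\<tau> n (frag_map (U n (Suc j) (sL \<H> l)) ?y)) (\<tau> n (act n ?y (lam l)))"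
    by (rule cyc_enull_cong[OF cyc_tau[OF frag_map_upd_chains[OF y]] cyc_tau[OF act_chains[OF y]] Suc.IH[OF Suc_lessD[OF Suc.prems]]])
  moreover have "(\<tau> n ^^ Suc j) x = \<tau> n ?y" by simp
  ultimately show ?case
    unfolding \<open>(\<tau> n ^^ Suc j) x = \<tau> n ?y\<close> frag_map_upd_tau[OF y Suc.prems]
    using enull_null_trans[OF _ null_sym[OF act_tau[OF y]]] by blast
qed

lemma act_sL_lam:
  assumes "x \<in> chains C n"
  shows "cong_mod (enull n) (act n x (sL \<H> l)) (act n x (lam l))"
proof (cases n)
  case 0
  then show ?thesis using enull_null_trans[OF act_sL_last null_sym[OF act_lam_eq]] assms by blast
next
  case (Suc k)
  \<comment> \<open>After \<open>k = n - 1\<close> rotations both descriptions concern slot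
    \<open>n\<close>; the rotations are cancelled at the end by
    \<open>tau_pow_enullD\<close>.\<close>
  let ?y = "(\<tau> n ^^ k) x"
  have y: "?y \<in> chains C n" by (rule pow_chains[OF assms])
  have "cong_mod (enull n) ((\<tau> n ^^ k) (act n x (sL \<H> l))) (act n ?y (sL \<H> l))"
    by (rule null_imp_enull[OF null_sym[OF act_tau_pow[OF assms]]])
  also have "cong_mod (enull n) \<dots> (act n ?y (lam l))"
    using enull_trans[OF act_sL_last[OF y]] act_lam_all[OF assms, of k] Suc by simp
  also have "cong_mod (null n) \<dots> ((\<tau> n ^^ k) (act n x (lam l)))"
    by (rule act_tau_pow[OF assms])
  finally have "(\<tau> n ^^ k) (act n x (sL \<H> l) - act n x (lam l)) \<in> enull n"
    by (simp add: cong_mod_def tau_pow_diff)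
  then show ?thesis
    unfolding cong_mod_def using tau_pow_enullD chains_diff act_chains assms by blast
qed

lemma lam_mult: "lam (a * b) = lam b * lam a"
proof -
  have "eR \<H> (sL \<H> (a * b)) = eR \<H> (tR \<H> (eR \<H> (sL \<H> b) * eR \<H> (sL \<H> a)))"
    by (simp add: tR_antihom units sL_hom del: eR_tR)
  then show ?thesis by (simp add: sR_hom)
qed

lemma act_sL_commute:
  assumes x: "x \<in> chains C n"
  shows "cong_mod (enull n) (act n x (sL \<H> (a * b))) (act n x (sL \<H> (b * a)))"
proof -
  have "cong_mod (null n) (act n x (sL \<H> (a * b))) (act n (act n x (sL \<H> a)) (sL \<H> b))"
    using act_mult[OF x] by (simp add: sL_hom)
  also have "cong_mod (enull n) \<dots> (act n (act n x (sL \<H> a)) (lam b))"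
    by (rule act_sL_lam[OF act_chains[OF x]])
  also have "cong_mod (enull n) \<dots> (act n (act n x (lam a)) (lam b))"
    by (rule act_enull_cong[OF act_sL_lam[OF x]])
  also have "cong_mod (null n) \<dots> (act n x (lam (b * a)))"
    using null_sym[OF act_mult[OF x]] by (simp add: lam_mult)
  also have "cong_mod (enull n) \<dots> (act n x (sL \<H> (b * a)))"
    by (rule enull_sym[OF act_sL_lam[OF x]])
  finally show ?thesis .
qed

lemma act_sL_commute_middle:
  assumes x: "x \<in> chains C n"
  shows "cong_mod (enull n) (act n x (sL \<H> (p * (a * b) * q))) (act n x (sL \<H> (p * (b * a) * q)))"
proof -
  have e: "cong_mod (null n) (act n x (sL \<H> (p * c * q))) (act n (act n (act n x (sL \<H> p)) (sL \<H> c)) (sL \<H> q))" for c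
    unfolding sL_hom by (rule null_trans[OF act_mult[OF x] act_cong[OF act_mult[OF x]]])
  have "cong_mod (enull n) (act n (act n (act n x (sL \<H> p)) (sL \<H> (a * b))) (sL \<H> q))
      (act n (act n (act n x (sL \<H> p)) (sL \<H> (b * a))) (sL \<H> q))"
    by (intro act_enull_cong act_sL_commute act_chains x)
  then show ?thesis using null_enull_trans[OF e enull_null_trans[OF _ null_sym[OF e]]] by blast
qed

end

section \<open>Pairing with chains of \<open>L\<S>\<close>\<close>

abbreviation rot :: "'a list \<Rightarrow> 'a list" where
  "rot xs \<equiv> last xs # butlast xs"

abbreviation skip :: "nat \<Rightarrow> 'a list \<Rightarrow> 'a list" where
  "skip i xs \<equiv> take (Suc i) xs @ drop (i + 2) xs"

text \<open>The shadow on object sequences of \<open>d_0 \<tau>^2 = \<tau> d_n\<close>.\<close>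

lemma skip_rot_rot: "length a = Suc (Suc n) \<Longrightarrow> skip 0 (rot (rot a)) = rot (skip n a)"
proof -
  assume l: "length a = Suc (Suc n)"
  then obtain b y where a: "a = b @ [y]" by (cases a rule: rev_cases) auto
  with l obtain c x where b: "b = c @ [x]" by (cases b rule: rev_cases) auto
  show ?thesis using l by (simp add: a b butlast_append)
qed

lemma closed_cat_LS: "closed_cat (LS \<H>)"
  by unfold_locales (simp_all add: LS_def)

lemma LS_simps [simp]: "Act (LS \<H>) X Y h a = eL \<H> (h * sL \<H> a)" "Comp (LS \<H>) X Y Z a b = a * b"
    "Idm (LS \<H>) X = 1"
    "mact (L_coeff \<H>) h a = eL \<H> (h * sL \<H> a)" "lamL (L_coeff \<H>) a = [(sL \<H> a, 1)]"
  by (simp_all add: LS_def L_coeff_def)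

lemma tensors_LS: "(a, ls, l) \<in> tensors (LS \<H>) n \<longleftrightarrow> length a = Suc n \<and> length ls = Suc n \<and> set a \<subseteq> {0, 1}"
  by (auto simp: tensors_def LS_def)

lemma prod_list_update:
  "i < length xs \<Longrightarrow> prod_list (xs[i := x]) = prod_list (take i xs) * (x * prod_list (drop (Suc i) xs))"
  for x :: "'a::monoid_mult"
  by (simp add: upd_conv_take_nth_drop)

lemma prod_list_drop: "i < length xs \<Longrightarrow> prod_list (drop i xs) = xs ! i * prod_list (drop (Suc i) xs)"
  for xs :: "'a::monoid_mult list"
  by (simp flip: Cons_nth_drop_Suc)

lemma prod_list_take: "i < length xs \<Longrightarrow> prod_list (take (Suc i) xs) = prod_list (take i xs) * xs ! i"
  for xs :: "'a::monoid_mult list"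
  by (simp add: take_Suc_conv_app_nth)

section \<open>The action on products of labels\<close>

context hopf_algebroid
begin

text \<open>The compatibility of the action with composition in \<open>LS\<close>. Since
  \<open>DL (k * sL z)\<close> is \<open>DL k\<close> with \<open>sL z\<close> multiplied into the
  first factor, the claim is the counit identity for \<open>k * sL z\<close>.\<close>

lemma eL_split: "(\<Sum>(x, y)\<leftarrow>DL \<H> k. eL \<H> (x * sL \<H> z) * eL \<H> (y * sL \<H> p)) = eL \<H> (k * sL \<H> (z * p))"
proof -
  have "eL \<H> (k * sL \<H> (z * p)) = eL \<H> ((\<Sum>(x, y)\<leftarrow>DL \<H> (k * sL \<H> z). sL \<H> (eL \<H> x) * y) * sL \<H> p)"
    by (simp add: eL_counit sL_hom mult.assoc)
  also have "\<dots> = (\<Sum>(x, y)\<leftarrow>DL \<H> (k * sL \<H> z). eL \<H> x * eL \<H> (y * sL \<H> p))"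
    by (simp add: additive_sum_list[OF eL_add] case_prod_unfold eL_sL_left mult.assoc flip: sum_list_mult_const)
  also have "\<dots> = (\<Sum>(x, y)\<leftarrow>[(x * sL \<H> z, y). (x, y) \<leftarrow> DL \<H> k]. eL \<H> x * eL \<H> (y * sL \<H> p))"
    by (rule tens_eq_sum[OF DL_sL_right])
      (simp_all add: eL_plus algebra_simps HrL_def HlL_def eL_tL_left eL_sL_left mult.assoc)
  finally show ?thesis by (simp add: sum_list_pairs)
qed

text \<open>Iterating \<open>eL_split\<close> shows that acting on all labels and the coefficient
  and multiplying the results is the same as acting on the total product.\<close>

lemma sum_iterD_eL:
  "(\<Sum>w\<leftarrow>iterD \<H> (length ls) k. prod_list (map (\<lambda>i. eL \<H> (w ! i * sL \<H> (ls ! i))) [0..<length ls]) * eL \<H> (w ! length ls * sL \<H> l))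
    = eL \<H> (k * sL \<H> (prod_list ls * l))"
proof (induction ls arbitrary: k)
  case (Cons z ls)
  have "(\<Sum>w\<leftarrow>iterD \<H> (length (z # ls)) k. prod_list (map (\<lambda>i. eL \<H> (w ! i * sL \<H> ((z # ls) ! i))) [0..<length (z # ls)]) *
        eL \<H> (w ! length (z # ls) * sL \<H> l))
    = (\<Sum>(x, y)\<leftarrow>DL \<H> k. eL \<H> (x * sL \<H> z) * (\<Sum>w\<leftarrow>iterD \<H> (length ls) y.
        prod_list (map (\<lambda>i. eL \<H> (w ! i * sL \<H> (ls ! i))) [0..<length ls]) * eL \<H> (w ! length ls * sL \<H> l)))"
    by (simp add: sum_list_pairs map_upt_Suc mult.assoc del: upt_Suc flip: sum_list_const_mult)
  also have "\<dots> = eL \<H> (k * sL \<H> (prod_list (z # ls) * l))"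
    unfolding Cons.IH using eL_split by (simp add: mult.assoc)
  finally show ?case .
qed simp

end

context hcat_coeff
begin

abbreviation "chainsLS \<equiv> chains (LS \<H>)"
abbreviation "actLS \<equiv> chain_act \<H> (LS \<H>) (L_coeff \<H>)"
abbreviation "dLS \<equiv> chain_face (LS \<H>)"
abbreviation "tauLS \<equiv> tau (LS \<H>) (L_coeff \<H>)"
abbreviation "cycLS \<equiv> cyc_graph \<H> (LS \<H>) (L_coeff \<H>)"
abbreviation "face_graphLS \<equiv> face_graph \<H> (LS \<H>) (L_coeff \<H>)"
abbreviation "nullLS \<equiv> null_chains \<H> (LS \<H>) (L_coeff \<H>)"

text \<open>A simplex of \<open>LS\<close> enters only through its object sequence and the product
  of its labels and coefficient, taken in the order of the tensor factors. In the homotopy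
  \<open>\<Psi> a\<close> is the image of a fixed chain over \<open>a\<close>. The degree
  \<open>n\<close> of the values is independent of the degree of the chain of \<open>LS\<close>, as
  the treatment of faces requires.\<close>

definition pairing :: "nat \<Rightarrow> (nat list \<Rightarrow> ('o, 'f, 'm) chain) \<Rightarrow> (nat, 'l, 'l) chain \<Rightarrow> ('o, 'f, 'm) chain" where
  "pairing n \<Psi> = frag_extend (\<lambda>(a, ls, l). act n (\<Psi> a) (sL \<H> (prod_list ls * l)))"

lemma act_zero_null: "x \<in> chains C n \<Longrightarrow> act n x 0 \<in> null n"
  using act_add_null[of x n 0 0] add_subgroup_uminus[OF add_subgroup_null] by (fastforce simp: cong_mod_def)

lemma act_sum_list: "x \<in> chains C n \<Longrightarrow> cong_mod (null n) (act n x (\<Sum>p\<leftarrow>ps. f p)) (\<Sum>p\<leftarrow>ps. act n x (f p))"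
proof (induction ps)
  case Nil
  then show ?case by (simp add: cong_mod_zero_iff act_zero_null)
next
  case (Cons p ps)
  then show ?case
    using null_trans[OF act_add_null cong_mod_add[OF add_subgroup_null cong_mod_refl[OF add_subgroup_null]]]
    by simp
qed

lemma act_sL_add: "x \<in> chains C n \<Longrightarrow> cong_mod (null n) (act n x (sL \<H> (p + q))) (act n x (sL \<H> p) + act n x (sL \<H> q))"
  using act_add_null by (simp add: sL_add)

lemma pairing_diff: "pairing n \<Psi> (x - y) = pairing n \<Psi> x - pairing n \<Psi> y"
  by (simp add: pairing_def frag_extend_diff)

lemma pairing_add: "pairing n \<Psi> (x + y) = pairing n \<Psi> x + pairing n \<Psi> y"
  by (simp add: pairing_def frag_extend_add)

lemma pairing_sum_list: "pairing n \<Psi> (\<Sum>x\<leftarrow>xs. f x) = (\<Sum>x\<leftarrow>xs. pairing n \<Psi> (f x))"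
  by (simp add: pairing_def frag_extend_sum_list)

lemma pairing_frag_of: "pairing n \<Psi> (frag_of (a, ls, l)) = act n (\<Psi> a) (sL \<H> (prod_list ls * l))"
  by (simp add: pairing_def)

lemma pairing_mem:
  assumes "\<omega> \<in> chainsLS k" and "add_subgroup N"
    and "\<And>a p. length a = Suc k \<Longrightarrow> act n (\<Psi> a) (sL \<H> p) \<in> N"
  shows "pairing n \<Psi> \<omega> \<in> N"
  unfolding pairing_def by (rule frag_extend_mem[OF assms(1,2)]) (auto simp: tensors_LS intro: assms(3))

lemma pairing_cong_aux:
  assumes "\<omega> \<in> chainsLS k" and "add_subgroup N"
    and "\<And>a p. length a = Suc k \<Longrightarrow> cong_mod N (act n (\<Psi> a) (sL \<H> p)) (act n (\<Psi>' a) (sL \<H> p))"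
  shows "cong_mod N (pairing n \<Psi> \<omega>) (pairing n \<Psi>' \<omega>)"
  unfolding pairing_def by (rule frag_extend_cong_mod[OF assms(1,2)]) (auto simp: tensors_LS intro: assms(3))

lemma pairing_cong:
  assumes "\<omega> \<in> chainsLS k" and "\<And>a. length a = Suc k \<Longrightarrow> cong_mod (null n) (\<Psi> a) (\<Psi>' a)"
  shows "cong_mod (null n) (pairing n \<Psi> \<omega>) (pairing n \<Psi>' \<omega>)"
  by (rule pairing_cong_aux[OF assms(1) add_subgroup_null]) (intro act_cong assms(2))

lemma pairing_eq:
  assumes "\<omega> \<in> chainsLS k" and "\<And>a. length a = Suc k \<Longrightarrow> \<Psi> a = \<Psi>' a"
  shows "pairing n \<Psi> \<omega> = pairing n \<Psi>' \<omega>"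
  unfolding pairing_def by (rule frag_extend_chains_eq[OF assms(1)]) (auto simp: tensors_LS assms(2))

lemma pairing_diff_left:
  "\<omega> \<in> chainsLS k \<Longrightarrow> pairing n (\<lambda>a. \<Psi> a - \<Psi>' a) \<omega> = pairing n \<Psi> \<omega> - pairing n \<Psi>' \<omega>"
proof (induction rule: chains_induct)
  case (one \<sigma>)
  then show ?case by (cases \<sigma>) (simp add: pairing_frag_of act_diff)
next
  case (diff x y)
  then show ?case by (simp add: pairing_diff)
qed (simp add: pairing_def)

text \<open>The tensor relations preserve the product: \<open>tL l\<close> multiplies a label by
  \<open>l\<close> on the right, and \<open>sL l\<close> multiplies the next factor by
  \<open>l\<close> on the left.\<close>

lemma pairing_chain_rel:
  assumes "\<omega> \<in> chain_rel \<H> (LS \<H>) (L_coeff \<H>) k" and \<Psi>: "\<And>a. length a = Suc k \<Longrightarrow> \<Psi> a \<in> chains C n"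
  shows "pairing n \<Psi> \<omega> \<in> null n"
  using assms(1) unfolding pairing_def chain_rel_def
proof (rule frag_extend_additive_span_mem[OF _ add_subgroup_null], safe, fold pairing_def, goal_cases)
  case (1 s Xs fs m i f g)
  then have *: "length Xs = Suc k" "i < length fs" by (auto simp: tensors_LS)
  show ?case using act_sL_add[OF \<Psi>[OF *(1)]] * 
    by (simp add: pairing_diff pairing_add pairing_frag_of prod_list_update algebra_simps cong_mod_def diff_diff_eq)
next
  case (2 s Xs fs m m')
  then have *: "length Xs = Suc k" by (auto simp: tensors_LS)
  show ?case using act_sL_add[OF \<Psi>[OF *(1)]] * 
    by (simp add: pairing_diff pairing_add pairing_frag_of distrib_left cong_mod_def diff_diff_eq)
next
  case (3 s Xs fs m i l)
  then have *: "length Xs = Suc k" "i < length fs" "Suc i < length fs" by (auto simp: tensors_LS)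
  have e: "eL \<H> (tL \<H> l * sL \<H> q) = q * l" "eL \<H> (sL \<H> l * sL \<H> q) = l * q" for q
    by (simp_all add: eL_tL_left eL_sL_left)
  show ?case using * add_subgroup_null
    by (simp add: pairing_diff pairing_frag_of prod_list_update prod_list_take prod_list_drop[of "Suc i"] e mult.assoc
        add_subgroup_def)
next
  case (4 s Xs fs m l)
  then have *: "length Xs = Suc k" "k < length fs" "length fs = Suc k" by (auto simp: tensors_LS)
  have e: "eL \<H> (tL \<H> l * sL \<H> q) = q * l" "MlL \<H> (L_coeff \<H>) l q = l * q" for q
    by (simp_all add: eL_tL_left eL_sL_left MlL_def)
  have "prod_list fs = prod_list (take k fs) * fs ! k"
    using prod_list_take[OF *(2)] *(3) by simp
  then show ?case using * add_subgroup_null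
    by (simp add: pairing_diff pairing_frag_of prod_list_update e mult.assoc add_subgroup_def)
qed

text \<open>If the labels other than the last multiply to \<open>P\<close>, the rotation turns the
  product \<open>P z m\<close> into \<open>m z P\<close>, which differs from it by commutators of
  \<open>L\<close>. Commutators also account for the choice of representative of the coaction,
  because the two places between which a scalar is balanced are separated by
  \<open>P\<close>.\<close>

lemma pairing_cyc:
  assumes "(\<omega>, \<omega>') \<in> cycLS k" and \<Psi>: "\<And>a. length a = Suc k \<Longrightarrow> \<Psi> a \<in> chains C n"
  shows "cong_mod (enull n) (pairing n \<Psi> \<omega>') (pairing n (\<lambda>a. \<Psi> (rot a)) \<omega>)"
  using assms(1)
proof (induction rule: cyc_graph.induct)
  case (formula Xs fs m t)
  then have l: "length Xs = Suc k" "length fs = Suc k" by (auto simp: tensors_LS)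
  let ?x = "\<Psi> (rot Xs)" and ?z = "last fs" and ?P = "prod_list (butlast fs)"
  let ?f = "\<lambda>h m'. act n ?x (sL \<H> (eL \<H> (h * sL \<H> ?z) * (?P * m')))"
  have x: "?x \<in> chains C n" using \<Psi>[of "rot Xs"] l by simp
  have fs: "prod_list fs = ?P * ?z"
    using l prod_list.append[of "butlast fs" "[last fs]"] append_butlast_last_id[of fs] by fastforce
  have "cong_mod (enull n) (\<Sum>(h, m')\<leftarrow>t. ?f h m') (\<Sum>(h, m')\<leftarrow>[(sL \<H> m, 1)]. ?f h m')"
  proof (rule tens_eq_cong[OF formula(2)[simplified]])
    fix q h m'
    have "eL \<H> (HrL \<H> q h * sL \<H> ?z) * (?P * m') = eL \<H> (h * sL \<H> ?z) * (q * ?P) * m'"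
      by (simp add: HrL_def mult.assoc eL_tL_left)
    moreover have "eL \<H> (h * sL \<H> ?z) * (?P * MlL \<H> (L_coeff \<H>) q m') = eL \<H> (h * sL \<H> ?z) * (?P * q) * m'"
      by (simp add: MlL_def mult.assoc eL_sL_left)
    ultimately show "cong_mod (enull n) (?f (HrL \<H> q h) m') (?f h (MlL \<H> (L_coeff \<H>) q m'))"
      using act_sL_commute_middle[OF x] by simp
  next
    fix h h' m' m''
    show "cong_mod (enull n) (?f (h + h') m') (?f h m' + ?f h' m')"
      "cong_mod (enull n) (?f h (m' + m'')) (?f h m' + ?f h m'')"
      using null_imp_enull[OF act_sL_add[OF x]] by (simp_all add: algebra_simps eL_plus)
  qed simp
  also have "(\<Sum>(h, m')\<leftarrow>[(sL \<H> m, 1)]. ?f h m') = act n ?x (sL \<H> ((m * ?z) * ?P))"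
    by (simp add: eL_sL_left)
  also have "cong_mod (enull n) \<dots> (act n ?x (sL \<H> (?P * (m * ?z))))"
    by (rule act_sL_commute[OF x])
  also have "cong_mod (enull n) \<dots> (act n ?x (sL \<H> (?P * (?z * m))))"
    using act_sL_commute_middle[OF x, of ?P m ?z 1] by simp
  finally show ?case
    by (simp add: pairing_sum_list case_prod_unfold pairing_frag_of fs mult.assoc)
next
  case (diff x y x' y')
  then show ?case by (simp add: pairing_diff cong_mod_diff)
next
  case (null x y)
  have "pairing n \<Psi> y \<in> null n" "pairing n (\<lambda>a. \<Psi> (rot a)) x \<in> null n"
    using null by (auto intro!: pairing_chain_rel \<Psi>)
  then show ?case
    using null_imp_enull add_subgroup_null by (auto simp: cong_mod_def add_subgroup_def)
qed

lemma pairing_cyc_pow: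
  assumes "(\<omega>, \<omega>') \<in> cycLS k ^^ j" and "\<And>a. length a = Suc k \<Longrightarrow> \<Psi> a \<in> chains C n"
  shows "cong_mod (enull n) (pairing n \<Psi> \<omega>') (pairing n (\<lambda>a. \<Psi> ((rot ^^ j) a)) \<omega>)"
  using assms
proof (induction j arbitrary: \<omega>' \<Psi>)
  case (Suc j)
  then obtain z where z: "(\<omega>, z) \<in> cycLS k ^^ j" "(z, \<omega>') \<in> cycLS k" by auto
  have "cong_mod (enull n) (pairing n (\<lambda>a. \<Psi> (rot a)) z) (pairing n (\<lambda>a. \<Psi> (rot ((rot ^^ j) a))) \<omega>)"
    by (rule Suc.IH[OF z(1)]) (simp add: Suc.prems(2))
  then show ?case using enull_trans[OF pairing_cyc[OF z(2) Suc.prems(2)]] by simp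
qed simp

lemma pairing_act_simplex:
  assumes T: "(a, ls, l) \<in> tensors (LS \<H>) k" and x: "\<Psi> a \<in> chains C n"
  shows "cong_mod (null n) (pairing n \<Psi> (actLS k (frag_of (a, ls, l)) h))
    (act n (\<Psi> a) (sL \<H> (eL \<H> (Si h * sL \<H> (prod_list ls * l)))))"
proof -
  have len: "length a = Suc k" "length ls = Suc k" using T by (auto simp: tensors_LS)
  let ?w = "\<lambda>w. prod_list (map (\<lambda>i. eL \<H> (w ! i * sL \<H> (ls ! i))) [0..<Suc k]) * eL \<H> (w ! Suc k * sL \<H> l)"
  have "pairing n \<Psi> (actLS k (frag_of (a, ls, l)) h)
      = (\<Sum>w\<leftarrow>iterD \<H> (Suc k) (Si h). act n (\<Psi> a) (sL \<H> (?w w)))"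
    by (simp add: chain_act_def pairing_sum_list pairing_frag_of del: upt_Suc iterD.simps)
  moreover have "(\<Sum>w\<leftarrow>iterD \<H> (Suc k) (Si h). sL \<H> (?w w)) = sL \<H> (eL \<H> (Si h * sL \<H> (prod_list ls * l)))"
    using sum_iterD_eL[where ls=ls and k="Si h" and l=l] len
    by (simp add: additive_sum_list[OF sL_hom(1), symmetric] del: upt_Suc iterD.simps)
  ultimately show ?thesis
    using null_sym[OF act_sum_list[OF x, of "\<lambda>w. sL \<H> (?w w)" "iterD \<H> (Suc k) (Si h)"]]
    by (simp only:)
qed

text \<open>The key point is \<open>s\<^sub>L\<epsilon>\<^sub>L(k s\<^sub>L(p)) = \<Sum> k\<^sup>(\<^sup>1\<^sup>) s\<^sub>L(p) S(k\<^sup>(\<^sup>2\<^sup>))\<close>.\<close>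

lemma pairing_act:
  assumes "\<omega> \<in> chainsLS k" and \<Psi>: "\<And>a. length a = Suc k \<Longrightarrow> \<Psi> a \<in> chains C n"
  shows "cong_mod (null n) (pairing n \<Psi> (actLS k \<omega> h))
    (\<Sum>(x, y)\<leftarrow>DR \<H> (Si h). act n (pairing n (\<lambda>a. act n (\<Psi> a) x) \<omega>) (S y))"
  using assms(1)
proof (induction rule: chains_induct)
  case (one \<sigma>)
  obtain Xs fs m where s: "\<sigma> = (Xs, fs, m)" by (cases \<sigma>)
  then have l: "length Xs = Suc k" "length fs = Suc k" using one by (auto simp: tensors_LS)
  let ?x = "\<Psi> Xs" and ?P = "prod_list fs * m"
  note x = \<Psi>[OF l(1)]
  have "cong_mod (null n) (pairing n \<Psi> (actLS k (frag_of \<sigma>) h))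
      (act n ?x (sL \<H> (eL \<H> (Si h * sL \<H> ?P))))"
    using one x unfolding s by (rule pairing_act_simplex)
  also have "sL \<H> (eL \<H> (Si h * sL \<H> ?P)) = (\<Sum>p\<leftarrow>DR \<H> (Si h). fst p * sL \<H> ?P * S (snd p))"
    by (simp add: sL_eL_sL_right case_prod_unfold)
  also have "cong_mod (null n) (act n ?x \<dots>) (\<Sum>p\<leftarrow>DR \<H> (Si h). act n ?x (fst p * sL \<H> ?P * S (snd p)))"
    by (rule act_sum_list[OF x])
  also have "cong_mod (null n) \<dots> (\<Sum>p\<leftarrow>DR \<H> (Si h). act n (act n (act n ?x (fst p)) (sL \<H> ?P)) (S (snd p)))"
    by (intro cong_mod_sum_list add_subgroup_null null_trans[OF act_mult[OF x] act_cong[OF act_mult[OF x]]])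
  finally show ?case by (simp add: s pairing_frag_of case_prod_unfold)
next
  case (diff x y)
  then show ?case using cong_mod_diff[OF add_subgroup_null diff]
    by (simp add: pairing_diff act_diff chain_act_diff case_prod_unfold sum_list_subtractf)
qed (simp add: chain_act_def pairing_def case_prod_unfold)

lemma pairing_face_right:
  assumes "\<omega> \<in> chainsLS (Suc k)" and "i \<le> k"
  shows "pairing n \<Psi> (dLS (Suc k) i \<omega>) = pairing n (\<lambda>a. \<Psi> (skip i a)) \<omega>"
  using assms(1)
proof (induction rule: chains_induct)
  case (one \<sigma>)
  obtain Xs fs m where s: "\<sigma> = (Xs, fs, m)" by (cases \<sigma>)
  then have l: "length fs = Suc (Suc k)" using one by (auto simp: tensors_LS)
  have "prod_list fs = prod_list (take i fs) * prod_list (drop i fs)"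
    by (simp flip: prod_list.append)
  also have "\<dots> = prod_list (take i fs) * (fs ! i * fs ! Suc i * prod_list (drop (Suc (Suc i)) fs))"
    using l assms(2) by (simp add: prod_list_drop[of i] prod_list_drop[of "Suc i"] mult.assoc)
  finally show ?case by (simp add: s chain_face_def pairing_frag_of)
next
  case (diff x y)
  then show ?case by (simp add: pairing_diff chain_face_def frag_extend_diff)
qed (simp add: chain_face_def pairing_def)

text \<open>Induction over the clauses for all families at once. In \<open>coeq\<close> the action
  on the chain of \<open>LS\<close> is traded, by \<open>pairing_act\<close>, for one action on the
  family and one on the value; the rotations are then moved to the family inside, and the action is
  reassembled.\<close>

lemma pairing_null_chain_aux:
  "null_chain \<H> (LS \<H>) (L_coeff \<H>) k \<omega> \<Longrightarrow> (\<And>a. length a = Suc k \<Longrightarrow> \<Psi> a \<in> chains C n) \<Longrightarrow> pairing n \<Psi> \<omega> \<in> enull n"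
proof (induction arbitrary: \<Psi> rule: null_chain.induct)
  case (rel x k)
  then show ?case using pairing_chain_rel null_enull by blast
next
  case (diff k x y)
  then show ?case using add_subgroup_enull unfolding pairing_diff add_subgroup_def by blast
next
  case (coeq x k y j h z)
  have c: "x \<in> chainsLS k" "y \<in> chainsLS k"
    using coeq closed_cat.cyc_graph_pow_chains[OF closed_cat_LS] by auto
  have rc: "length a = Suc k \<Longrightarrow> \<Psi> ((rot ^^ j) a) \<in> chains C n" for a
  proof -
    assume "length a = Suc k"
    then have "length ((rot ^^ j) a) = Suc k" by (induction j) auto
    then show ?thesis by (rule coeq.prems)
  qed
  have "cong_mod (null n) (pairing n \<Psi> (actLS k y h))
    (\<Sum>(x', y')\<leftarrow>DR \<H> (Si h). act n (pairing n (\<lambda>a. act n (\<Psi> a) x') y) (S y'))"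
    by (rule pairing_act[OF c(2) coeq.prems])
  also have "cong_mod (enull n) \<dots> (\<Sum>(x', y')\<leftarrow>DR \<H> (Si h). act n (pairing n (\<lambda>a. act n (\<Psi> ((rot ^^ j) a)) x') x) (S y'))"
    unfolding case_prod_unfold
    by (intro cong_mod_sum_list add_subgroup_enull act_enull_cong pairing_cyc_pow[OF coeq(2)] act_chains coeq.prems)
  also have "cong_mod (null n) \<dots> (pairing n (\<lambda>a. \<Psi> ((rot ^^ j) a)) (actLS k x h))"
    by (rule null_sym[OF pairing_act[OF c(1) rc]])
  also have "cong_mod (enull n) \<dots> (pairing n \<Psi> z)"
    by (rule enull_sym[OF pairing_cyc_pow[OF coeq(3) coeq.prems]])
  finally show ?case by (simp add: cong_mod_def pairing_diff)
next
  case (face k x i)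
  have "x \<in> chainsLS (Suc k)" using closed_cat.null_chain_chains[OF closed_cat_LS face(1)] .
  then show ?case using face by (simp add: pairing_face_right)
next
  case (cyc k x y)
  have "pairing n (\<lambda>a. \<Psi> (rot a)) x \<in> enull n" by (rule cyc.IH) (simp add: cyc.prems)
  then show ?case using cong_mod_mem[OF add_subgroup_enull pairing_cyc[OF cyc(2), of \<Psi> n]] cyc.prems by blast
next
  case (last_face x k y z z')
  obtain w where w: "(y, w) \<in> cycLS (Suc k)" "z = dLS (Suc k) 0 w"
    using last_face by (auto simp: face_graph_def)
  have wc: "w \<in> chainsLS (Suc k)"
    using w closed_cat.cyc_graph_chains[OF closed_cat_LS] by blast
  have x2: "(x, w) \<in> cycLS (Suc k) ^^ 2" using last_face(2) w(1) by (auto simp: numeral_2_eq_2)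
  have "cong_mod (enull n) (pairing n (\<lambda>a. \<Psi> (skip 0 a)) w) (pairing n (\<lambda>a. \<Psi> (skip 0 ((rot ^^ 2) a))) x)"
    by (rule pairing_cyc_pow[OF x2]) (simp add: last_face.prems)
  also have "pairing n (\<lambda>a. \<Psi> (skip 0 ((rot ^^ 2) a))) x = pairing n (\<lambda>a. \<Psi> (rot (skip k a))) x"
  proof (rule pairing_eq[OF last_face(1)])
    fix a :: "nat list" assume "length a = Suc (Suc k)"
    moreover have "(rot ^^ 2) a = rot (rot a)" by (simp add: numeral_2_eq_2)
    ultimately show "\<Psi> (skip 0 ((rot ^^ 2) a)) = \<Psi> (rot (skip k a))" by (simp only: skip_rot_rot)
  qed
  also have "\<dots> = pairing n (\<lambda>a. \<Psi> (rot a)) (dLS (Suc k) k x)"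
    by (simp add: pairing_face_right[OF last_face(1)])
  also have "cong_mod (enull n) \<dots> (pairing n \<Psi> z')"
    by (rule enull_sym[OF pairing_cyc[OF last_face(4) last_face.prems]])
  finally show ?case by (simp add: cong_mod_def pairing_diff w pairing_face_right[OF wc])
qed

lemma pairing_null_right:
  "\<omega> \<in> nullLS k \<Longrightarrow> (\<And>a. length a = Suc k \<Longrightarrow> \<Psi> a \<in> chains C n) \<Longrightarrow> pairing n \<Psi> \<omega> \<in> enull n"
  by (rule pairing_null_chain_aux) (auto simp: null_chains_def)

lemma pairing_cong_right:
  assumes "cong_mod (nullLS k) \<omega> \<omega>'" and "\<And>a. length a = Suc k \<Longrightarrow> \<Psi> a \<in> chains C n"
  shows "cong_mod (enull n) (pairing n \<Psi> \<omega>) (pairing n \<Psi> \<omega>')"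
  using pairing_null_right[of "\<omega> - \<omega>'" k \<Psi> n] assms by (simp add: cong_mod_def pairing_diff)

lemma pairing_tau:
  assumes "\<omega> \<in> chainsLS k" and \<Psi>: "\<And>a. length a = Suc k \<Longrightarrow> \<Psi> a \<in> chains C n"
  shows "cong_mod (null n) (\<tau> n (pairing n \<Psi> \<omega>)) (pairing n (\<lambda>a. \<tau> n (\<Psi> a)) \<omega>)"
  using assms(1)
proof (induction rule: chains_induct)
  case (one \<sigma>)
  then show ?case using null_sym[OF act_tau[OF \<Psi>]]
    by (cases \<sigma>) (simp add: pairing_frag_of tensors_LS)
next
  case (diff x y)
  then show ?case by (simp add: pairing_diff tau_diff cong_mod_diff)
qed (simp add: pairing_def tau_def)

lemma pairing_face_left:
  assumes "\<omega> \<in> chainsLS k" and \<Psi>: "\<And>a. length a = Suc k \<Longrightarrow> \<Psi> a \<in> chains C (Suc n)" and "i \<le> n"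
  shows "cong_mod (null n) (d (Suc n) i (pairing (Suc n) \<Psi> \<omega>)) (pairing n (\<lambda>a. d (Suc n) i (\<Psi> a)) \<omega>)"
  using assms(1)
proof (induction rule: chains_induct)
  case (one \<sigma>)
  then show ?case using null_sym[OF act_face[OF \<Psi> assms(3)]]
    by (cases \<sigma>) (simp add: pairing_frag_of tensors_LS)
next
  case (diff x y)
  then show ?case by (simp add: pairing_diff d_diff cong_mod_diff)
qed (simp add: pairing_def chain_face_def)

text \<open>On a simplex with label product \<open>p\<close>, the summands act on the member of the
  family by \<open>y * sL (eL (Si g * sL p))\<close>, and these elements sum to
  \<open>sL p * h\<close>. As in \<open>cyc_tensor\<close>, the first factor of the right coproduct
  acts on \<open>LS\<close> and the second on the other side.\<close>

lemma pairing_diagonal: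
  assumes "\<omega> \<in> chainsLS k" and \<Psi>: "\<And>a. length a = Suc k \<Longrightarrow> \<Psi> a \<in> chains C n"
  shows "cong_mod (null n)
    (\<Sum>(x, y)\<leftarrow>DR \<H> h. pairing n (\<lambda>a. act n (\<Psi> a) y) (actLS k \<omega> x))
    (act n (pairing n \<Psi> \<omega>) h)"
  using assms(1)
proof (induction rule: chains_induct)
  case (one \<sigma>)
  obtain Xs fs m where s: "\<sigma> = (Xs, fs, m)" by (cases \<sigma>)
  then have l: "length Xs = Suc k" "length fs = Suc k" using one by (auto simp: tensors_LS)
  let ?x = "\<Psi> Xs" and ?P = "prod_list fs * m"
  note x = \<Psi>[OF l(1)]
  have step: "cong_mod (null n) (pairing n (\<lambda>a. act n (\<Psi> a) y) (actLS k (frag_of \<sigma>) g))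
      (act n ?x (y * sL \<H> (eL \<H> (Si g * sL \<H> ?P))))" for y g
    using one x act_chains unfolding s
    by (intro null_trans[OF pairing_act_simplex null_sym[OF act_mult]]) auto
  have 1: "cong_mod (null n) (\<Sum>(g, y)\<leftarrow>DR \<H> h. pairing n (\<lambda>a. act n (\<Psi> a) y) (actLS k (frag_of \<sigma>) g))
     (\<Sum>(g, y)\<leftarrow>DR \<H> h. act n ?x (y * sL \<H> (eL \<H> (Si g * sL \<H> ?P))))"
    unfolding case_prod_unfold by (intro cong_mod_sum_list add_subgroup_null step)
  have 2: "cong_mod (null n) (\<Sum>(g, y)\<leftarrow>DR \<H> h. act n ?x (y * sL \<H> (eL \<H> (Si g * sL \<H> ?P)))) (act n ?x (sL \<H> ?P * h))"
    unfolding sum_DR_sL_eL_Si[symmetric] case_prod_unfold by (rule null_sym[OF act_sum_list[OF x]])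
  have 3: "cong_mod (null n) (act n ?x (sL \<H> ?P * h)) (act n (pairing n \<Psi> (frag_of \<sigma>)) h)"
    using act_mult[OF x] by (simp add: s pairing_frag_of)
  show ?case by (rule null_trans[OF 1 null_trans[OF 2 3]])
next
  case (diff x y)
  then show ?case using cong_mod_diff[OF add_subgroup_null diff]
    by (simp add: pairing_diff act_diff chain_act_diff case_prod_unfold sum_list_subtractf)
qed (simp add: chain_act_def pairing_def case_prod_unfold)

lemma pairing_periodic:
  assumes "\<omega> \<in> chainsLS k" and \<Psi>: "\<And>a. length a = Suc k \<Longrightarrow> \<Psi> a \<in> periodic n"
  shows "pairing n \<Psi> \<omega> \<in> periodic n"
  by (rule pairing_mem[OF assms(1) add_subgroup_periodic]) (intro act_periodic \<Psi>)

end

section \<open>Functors on \<open>\<C> \<times> \<S>\<close>\<close>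

text \<open>\<open>KO\<close> and \<open>KM\<close> encode an \<open>\<H>\<close>-equivariant functor \<open>\<C> \<times> \<S> \<rightarrow> \<C>'\<close>: \<open>KO a X\<close> is the image of the
  object \<open>(X, a)\<close>, and \<open>KM b a X Y f : KO b X \<rightarrow> KO a Y\<close> that of \<open>(f, b \<rightarrow> a)\<close>.\<close>

locale cylinder_functor =
  C: hcat_coeff \<H> C M + C': hcat_coeff \<H> C' M
  for \<H> :: "('k::comm_ring_1, 'l::{ring,monoid_mult}, 'r::{ring,monoid_mult},
      'h::{ring,monoid_mult}) hopf_data"
    and C :: "('o, 'f::ab_group_add, 'h) hcat"
    and C' :: "('o1, 'f1::ab_group_add, 'h) hcat"
    and M :: "('r, 'h, 'm::ab_group_add) coeff" +
  fixes KO :: "nat \<Rightarrow> 'o \<Rightarrow> 'o1" and KM :: "nat \<Rightarrow> nat \<Rightarrow> 'o \<Rightarrow> 'o \<Rightarrow> 'f \<Rightarrow> 'f1"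
  assumes KO_Ob: "X \<in> Ob C \<Longrightarrow> KO a X \<in> Ob C'"
    and KM_Hom: "\<lbrakk>X \<in> Ob C; Y \<in> Ob C; f \<in> Hom C X Y\<rbrakk> \<Longrightarrow> KM b a X Y f \<in> Hom C' (KO b X) (KO a Y)"
    and KM_Comp: "\<lbrakk>X \<in> Ob C; Y \<in> Ob C; Z \<in> Ob C; f \<in> Hom C Y Z; g \<in> Hom C X Y\<rbrakk> \<Longrightarrow>
      KM c a X Z (Comp C X Y Z f g) = Comp C' (KO c X) (KO b Y) (KO a Z) (KM b a Y Z f) (KM c b X Y g)"
    and KM_add: "\<lbrakk>X \<in> Ob C; Y \<in> Ob C; f \<in> Hom C X Y; g \<in> Hom C X Y\<rbrakk> \<Longrightarrow>
      KM b a X Y (f + g) = KM b a X Y f + KM b a X Y g"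
    and KM_Act: "\<lbrakk>X \<in> Ob C; Y \<in> Ob C; f \<in> Hom C X Y\<rbrakk> \<Longrightarrow>
      KM b a X Y (Act C X Y h f) = Act C' (KO b X) (KO a Y) h (KM b a X Y f)"
begin

text \<open>The \<open>i\<close>-th morphism runs from object \<open>i + 1\<close> to object
  \<open>i\<close>, cyclically, so it is combined with the morphism of \<open>\<S>\<close> from
  entry \<open>i + 1\<close> to entry \<open>i\<close> of \<open>a\<close>.\<close>

definition hsimplex :: "nat \<Rightarrow> nat list \<Rightarrow> 'o list \<times> 'f list \<times> 'm \<Rightarrow> 'o1 list \<times> 'f1 list \<times> 'm" where
  "hsimplex n a = (\<lambda>(Xs, fs, m). (map (\<lambda>i. KO (a ! i) (Xs ! i)) [0..<Suc n],
     map (\<lambda>i. KM (src n a i) (a ! i) (src n Xs i) (Xs ! i) (fs ! i)) [0..<Suc n], m))"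

abbreviation "hmap n a \<equiv> frag_map (hsimplex n a)"

lemma src_map: "i \<le> n \<Longrightarrow> src n (map f [0..<Suc n]) i = f (Suc i mod Suc n)"
  by (simp add: src_def less_Suc_eq_le del: upt_Suc)

lemma nth_map_upt': "i \<le> n \<Longrightarrow> map f [0..<Suc n] ! i = f i"
  by (simp del: upt_Suc)

lemma hsimplex_tensors: "\<sigma> \<in> tensors C n \<Longrightarrow> hsimplex n a \<sigma> \<in> tensors C' n"
  using C.tensors_Ob KO_Ob
  by (cases \<sigma>) (auto simp: hsimplex_def tensors_def src_map nth_map_upt' src_def less_Suc_eq_le
      simp del: upt_Suc intro!: KO_Ob KM_Hom)

lemma hmap_chains: "x \<in> chains C n \<Longrightarrow> hmap n a x \<in> chains C' n"
  by (rule frag_extend_mem) (auto simp: hsimplex_tensors)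

lemma hsimplex_put:
  assumes "\<sigma> \<in> tensors C n" "i \<le> n"
  shows "hsimplex n a (put i f \<sigma>) = put i (KM (src n a i) (a ! i) (src n (fst \<sigma>) i) (fst \<sigma> ! i) f) (hsimplex n a \<sigma>)"
  using assms by (cases \<sigma>)
    (auto simp: hsimplex_def put_def tensors_def nth_list_update simp del: upt_Suc intro!: nth_equalityI)

lemma hsimplex_putm: "hsimplex n a (putm m \<sigma>) = putm m (hsimplex n a \<sigma>)"
  by (cases \<sigma>) (simp add: hsimplex_def putm_def)

lemma hom_at_hsimplex:
  assumes "\<sigma> \<in> tensors C n" "i \<le> n" "f \<in> hom_at C n i \<sigma>"
  shows "KM (src n a i) (a ! i) (src n (fst \<sigma>) i) (fst \<sigma> ! i) f \<in> hom_at C' n i (hsimplex n a \<sigma>)"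
proof (cases \<sigma>)
  case (fields Xs fs m)
  then show ?thesis
    using assms KM_Hom[of "src n Xs i" "Xs ! i" f "src n a i" "a ! i"] C.tensors_Ob[of Xs fs m n i]
    by (simp add: hom_at_def hsimplex_def src_map nth_map_upt' src_def del: upt_Suc)
qed

lemma hsimplex_upd:
  assumes "\<sigma> \<in> tensors C n" "i \<le> Suc n"
  shows "hsimplex n a (upd C M n i h \<sigma>) = upd C' M n i h (hsimplex n a \<sigma>)"
proof (cases "i \<le> n")
  case True
  obtain Xs fs m where s: "\<sigma> = (Xs, fs, m)" by (cases \<sigma>)
  have T: "(Xs, fs, m) \<in> tensors C n" using assms s by simp
  have e: "src n (fst (hsimplex n a \<sigma>)) i = KO (src n a i) (src n Xs i)"
      "fst (hsimplex n a \<sigma>) ! i = KO (a ! i) (Xs ! i)"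
      "fst (snd (hsimplex n a \<sigma>)) ! i = KM (src n a i) (a ! i) (src n Xs i) (Xs ! i) (fs ! i)"
    using True by (simp_all add: s hsimplex_def src_map nth_map_upt' src_def del: upt_Suc)
  show ?thesis
    unfolding C.upd_as_put[OF assms(1) True] C'.upd_as_put[OF hsimplex_tensors[OF assms(1)] True]
      hsimplex_put[OF assms(1) True] e
    using KM_Act[OF C.tensors_Ob(2,1)[OF T True] C.tensors_hom[OF T True]] by (simp add: s)
next
  case False
  then show ?thesis by (cases \<sigma>) (simp add: upd_def hsimplex_def)
qed

lemma hmap_frag_of: "hmap n a (frag_of \<sigma>) = frag_of (hsimplex n a \<sigma>)"
  by simp

lemma hmap_diff: "hmap n a (x - y) = hmap n a x - hmap n a y"
  by (rule frag_extend_diff)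

lemma hmap_chain_rel: "x \<in> chain_rel \<H> C M n \<Longrightarrow> hmap n a x \<in> chain_rel \<H> C' M n"
proof (subst (asm) chain_rel_def, erule frag_extend_additive_span_mem[OF _ C'.add_subgroup_K], safe, goal_cases)
  case (1 s Xs fs m i f g)
  then have at: "f \<in> hom_at C n i (Xs, fs, m)" "g \<in> hom_at C n i (Xs, fs, m)" by (simp_all add: hom_at_def)
  have "KM (src n a i) (a ! i) (src n Xs i) (Xs ! i) (f + g) =
      KM (src n a i) (a ! i) (src n Xs i) (Xs ! i) f + KM (src n a i) (a ! i) (src n Xs i) (Xs ! i) g"
    using 1 C.tensors_Ob[OF 1(1)] by (intro KM_add) auto
  then have "cong_mod (chain_rel \<H> C' M n) (frag_of (hsimplex n a (put i (f + g) (Xs, fs, m))))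
      (frag_of (hsimplex n a (put i f (Xs, fs, m))) + frag_of (hsimplex n a (put i g (Xs, fs, m))))"
    using C'.K_put[OF hsimplex_tensors[OF 1(1)] 1(2) hom_at_hsimplex[OF 1(1,2) at(1)] hom_at_hsimplex[OF 1(1,2) at(2)]]
    by (simp add: hsimplex_put[OF 1(1,2)])
  then show ?case by (simp add: hmap_diff put_def cong_mod_def diff_diff_eq frag_extend_add)
next
  case (2 s Xs fs m m')
  have "cong_mod (chain_rel \<H> C' M n) (frag_of (hsimplex n a (putm (m + m') (Xs, fs, m))))
      (frag_of (hsimplex n a (putm m (Xs, fs, m))) + frag_of (hsimplex n a (putm m' (Xs, fs, m))))"
    using C'.K_putm[OF hsimplex_tensors[OF 2]] by (simp add: hsimplex_putm)
  then show ?case by (simp add: hmap_diff putm_def cong_mod_def diff_diff_eq frag_extend_add)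
next
  case (3 s Xs fs m i l)
  have "cong_mod (chain_rel \<H> C' M n) (frag_of (hsimplex n a (upd C M n i (tL \<H> l) (Xs, fs, m))))
      (frag_of (hsimplex n a (upd C M n (Suc i) (sL \<H> l) (Xs, fs, m))))"
    using C'.K_balanced[OF hsimplex_tensors[OF 3(1)], of i l] 3 by (simp add: hsimplex_upd)
  then show ?case using 3 by (simp add: hmap_diff upd_def cong_mod_def)
next
  case (4 s Xs fs m l)
  have "cong_mod (chain_rel \<H> C' M n) (frag_of (hsimplex n a (upd C M n n (tL \<H> l) (Xs, fs, m))))
      (frag_of (hsimplex n a (upd C M n (Suc n) (sL \<H> l) (Xs, fs, m))))"
    using C'.K_balanced[OF hsimplex_tensors[OF 4(1)], of n l] 4 by (simp add: hsimplex_upd)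
  then show ?case using 4 by (simp add: hmap_diff upd_def cong_mod_def MlL_def)
qed

lemma hmap_suffix_act:
  assumes "r \<le> Suc n" "\<sigma> \<in> tensors C n"
  shows "hmap n a (suffix_act \<H> C M n r h \<sigma>) = suffix_act \<H> C' M n r h (hsimplex n a \<sigma>)"
  using assms
  by (induction r arbitrary: h \<sigma>)
    (simp_all add: hsimplex_upd frag_extend_sum_list case_prod_unfold comp_def C.upd_tensors)

lemma hmap_act: "x \<in> chains C n \<Longrightarrow> hmap n a (chain_act \<H> C M n x h) = chain_act \<H> C' M n (hmap n a x) h"
proof (induction rule: chains_induct)
  case (one \<sigma>)
  then have "frag_of \<sigma> \<in> chains C n" "frag_of (hsimplex n a \<sigma>) \<in> chains C' n"
    by (simp_all add: hsimplex_tensors)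
  then show ?case
    unfolding hmap_frag_of by (simp only: C.chain_act_eq C'.chain_act_eq frag_extend_of
        hmap_suffix_act[OF order_refl one])
next
  case (diff x y)
  then show ?case by (simp only: hmap_diff C.act_diff C'.act_diff)
qed (simp add: chain_act_def)

text \<open>At the composed slot this is functoriality with middle index \<open>a ! Suc i\<close>,
  the entry that \<open>skip i\<close> deletes together with the object.\<close>

lemma hsimplex_face:
  assumes "\<sigma> \<in> tensors C (Suc n)" "i \<le> n" "length a = Suc (Suc n)"
  shows "hsimplex n (skip i a) (face_simplex C (Suc n) i \<sigma>) = face_simplex C' (Suc n) i (hsimplex (Suc n) a \<sigma>)"
proof -
  obtain Xs fs m where s: "\<sigma> = (Xs, fs, m)" by (cases \<sigma>)
  have T: "(Xs, fs, m) \<in> tensors C (Suc n)" using assms s by simp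
  have l: "length Xs = Suc (Suc n)" "length fs = Suc (Suc n)" using T by (auto simp: tensors_def)
  let ?Ys = "map (\<lambda>i. KO (a ! i) (Xs ! i)) [0..<Suc (Suc n)]"
  let ?gs = "map (\<lambda>i. KM (src (Suc n) a i) (a ! i) (src (Suc n) Xs i) (Xs ! i) (fs ! i)) [0..<Suc (Suc n)]"
  have ly: "length ?Ys = Suc (Suc n)" "length ?gs = Suc (Suc n)" by simp_all
  have srcY: "src (Suc n) ?Ys j = KO (src (Suc n) a j) (src (Suc n) Xs j)" if "j \<le> Suc n" for j
    using that by (simp only: src_map) (simp add: src_def)
  have comp: "KM (src (Suc n) a (Suc i)) (a ! i) (src (Suc n) Xs (Suc i)) (Xs ! i)
      (Comp C (src (Suc n) Xs (Suc i)) (Xs ! Suc i) (Xs ! i) (fs ! i) (fs ! Suc i))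
    = Comp C' (src (Suc n) ?Ys (Suc i)) (?Ys ! Suc i) (?Ys ! i) (?gs ! i) (?gs ! Suc i)"
    using KM_Comp[of "src (Suc n) Xs (Suc i)" "Xs ! Suc i" "Xs ! i" "fs ! i" "fs ! Suc i" "src (Suc n) a (Suc i)" "a ! i" "a ! Suc i"]
      C.tensors_Ob[OF T] C.tensors_hom[OF T, of i] C.tensors_hom[OF T, of "Suc i"] assms(2)
    by (simp add: srcY nth_map_upt' src_less del: upt_Suc)
  have "map (\<lambda>j. KO (skip i a ! j) (skip i Xs ! j)) [0..<Suc n] = skip i ?Ys"
  proof (rule nth_equalityI)
    fix j assume "j < length (map (\<lambda>j. KO (skip i a ! j) (skip i Xs ! j)) [0..<Suc n])"
    then have j: "j \<le> n" by simp
    show "map (\<lambda>j. KO (skip i a ! j) (skip i Xs ! j)) [0..<Suc n] ! j = skip i ?Ys ! j"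
      using j assms(2) by (simp only: nth_map_upt'[OF j] nth_skip[OF ly(1) assms(2) j] nth_skip[OF l(1) assms(2) j] nth_skip[OF assms(3,2) j])
        (simp add: nth_map_upt' del: upt_Suc)
  qed (use assms(2) in simp)
  moreover have "map (\<lambda>j. KM (src n (skip i a) j) (skip i a ! j) (src n (skip i Xs) j) (skip i Xs ! j)
      ((take i fs @ Comp C (src (Suc n) Xs (Suc i)) (Xs ! Suc i) (Xs ! i) (fs ! i) (fs ! Suc i) # drop (i + 2) fs) ! j)) [0..<Suc n]
    = take i ?gs @ Comp C' (src (Suc n) ?Ys (Suc i)) (?Ys ! Suc i) (?Ys ! i) (?gs ! i) (?gs ! Suc i) # drop (i + 2) ?gs"
    (is "?lhs = ?rhs")
  proof (rule nth_equalityI)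
    fix j assume "j < length ?lhs"
    then have j: "j \<le> n" by simp
    show "?lhs ! j = ?rhs ! j"
      unfolding nth_map_upt'[OF j] nth_comp_skip[OF ly(2) assms(2) j] nth_comp_skip[OF l(2) assms(2) j]
        nth_skip[OF l(1) assms(2) j] nth_skip[OF assms(3,2) j] src_skip[OF l(1) assms(2) j] src_skip[OF assms(3,2) j]
        comp[symmetric]
      using j assms(2) by (auto simp: nth_map_upt' simp del: upt_Suc)
  qed (use assms(2) in simp)
  ultimately show ?thesis
    by (simp only: s hsimplex_def face_simplex_def prod.case)
qed

lemma hmap_face:
  assumes "x \<in> chains C (Suc n)" "i \<le> n" "length a = Suc (Suc n)"
  shows "hmap n (skip i a) (chain_face C (Suc n) i x) = chain_face C' (Suc n) i (hmap (Suc n) a x)"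
proof -
  have "frag_extend (\<lambda>\<sigma>. frag_of (hsimplex n (skip i a) (face_simplex C (Suc n) i \<sigma>))) x
      = frag_extend (\<lambda>\<sigma>. frag_of (face_simplex C' (Suc n) i (hsimplex (Suc n) a \<sigma>))) x"
    using hsimplex_face[OF _ assms(2,3)] by (intro frag_extend_chains_eq[OF assms(1)]) simp
  then show ?thesis by (simp add: chain_face_eq frag_extend_frag_map del: add_2_eq_Suc')
qed

lemma hsimplex_rot:
  assumes T: "(Xs, fs, m) \<in> tensors C n" and a: "length a = Suc n"
    and H: "hsimplex n a (Xs, fs, m) = (Ys, gs, m)"
  shows "hsimplex n (rot a) (rot Xs, Act C (src n Xs n) (last Xs) h (last fs) # butlast fs, m')
    = (rot Ys, Act C' (src n Ys n) (last Ys) h (last gs) # butlast gs, m')"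
proof -
  have l: "length Xs = Suc n" "length fs = Suc n" using T by (auto simp: tensors_def)
  have YG: "Ys = map (\<lambda>i. KO (a ! i) (Xs ! i)) [0..<Suc n]"
     "gs = map (\<lambda>i. KM (src n a i) (a ! i) (src n Xs i) (Xs ! i) (fs ! i)) [0..<Suc n]"
    using H by (simp_all add: hsimplex_def)
  have ly: "length Ys = Suc n" "length gs = Suc n" using YG by simp_all
  have ends: "last Xs = Xs ! n" "last fs = fs ! n" "last Ys = Ys ! n" "last gs = gs ! n" "last a = a ! n"
    using l ly a by (auto simp: last_conv_nth simp flip: length_0_conv)
  have nY: "Ys ! i = KO (a ! i) (Xs ! i)" "gs ! i = KM (src n a i) (a ! i) (src n Xs i) (Xs ! i) (fs ! i)" if "i \<le> n" for i
    using that unfolding YG by (simp_all only: nth_map_upt')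
  have obs: "Xs ! 0 \<in> Ob C" "Xs ! n \<in> Ob C" "fs ! n \<in> Hom C (Xs ! 0) (Xs ! n)"
    using C.tensors_Ob[OF T] C.tensors_hom[OF T, of n] by (auto simp: src_last)
  let ?e = "Act C (src n Xs n) (last Xs) h (last fs)" and ?e' = "Act C' (src n Ys n) (last Ys) h (last gs)"
  have e: "KM (a ! 0) (a ! n) (Xs ! 0) (Xs ! n) ?e = ?e'"
    using KM_Act[OF obs] by (simp add: ends src_last nY)
  have "map (\<lambda>i. KO (rot a ! i) (rot Xs ! i)) [0..<Suc n] = rot Ys"
  proof (rule nth_equalityI)
    fix j assume "j < length (map (\<lambda>i. KO (rot a ! i) (rot Xs ! i)) [0..<Suc n])"
    then have j: "j \<le> n" by simp
    show "map (\<lambda>i. KO (rot a ! i) (rot Xs ! i)) [0..<Suc n] ! j = rot Ys ! j"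
      unfolding nth_map_upt'[OF j] using j l ly a nth_rotate
      by (cases j) (auto simp: nth_butlast nY ends)
  qed (use ly in simp)
  moreover have "map (\<lambda>i. KM (src n (rot a) i) (rot a ! i) (src n (rot Xs) i) (rot Xs ! i) ((?e # butlast fs) ! i)) [0..<Suc n]
    = ?e' # butlast gs" (is "?lhs = ?rhs")
  proof (rule nth_equalityI)
    fix j assume "j < length ?lhs"
    then have j: "j \<le> n" by simp
    show "?lhs ! j = ?rhs ! j"
      unfolding nth_map_upt'[OF j] src_rotate[OF l(1) j] src_rotate[OF a j]
      using j l ly a e by (cases j) (auto simp: nth_butlast nY ends src_less)
  qed (use ly in simp)
  ultimately show ?thesis by (simp only: hsimplex_def prod.case)
qed

text \<open>The index sequence rotates along with the objects, and \<open>KM_Act\<close> carries the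
  action of the coaction element across, so a value of the formula over \<open>a\<close> goes to a
  value over \<open>rot a\<close>.\<close>

lemma hmap_cyc:
  assumes "(x, y) \<in> cyc_graph \<H> C M n" "length a = Suc n"
  shows "(hmap n a x, hmap n (rot a) y) \<in> cyc_graph \<H> C' M n"
  using assms(1)
proof (induction rule: cyc_graph.induct)
  case (formula Xs fs m t)
  obtain Ys gs where H: "hsimplex n a (Xs, fs, m) = (Ys, gs, m)" by (auto simp: hsimplex_def)
  have "(Ys, gs, m) \<in> tensors C' n" using hsimplex_tensors[OF formula(1), of a] H by simp
  from cyc_graph.formula[OF this formula(2)] show ?case
    using H hsimplex_rot[OF formula(1) assms(2) H]
    by (simp add: frag_extend_sum_list case_prod_unfold)
next
  case (diff x y x' y')
  show ?case unfolding hmap_diff by (rule cyc_graph.diff[OF diff.IH])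
next
  case (null x y)
  then show ?case by (intro cyc_graph.null hmap_chain_rel)
qed

lemma hmap_cyc_pow:
  "(x, y) \<in> cyc_graph \<H> C M n ^^ j \<Longrightarrow> length a = Suc n \<Longrightarrow>
    (hmap n a x, hmap n ((rot ^^ j) a) y) \<in> cyc_graph \<H> C' M n ^^ j"
proof (induction j arbitrary: y)
  case (Suc j)
  then obtain z where z: "(x, z) \<in> cyc_graph \<H> C M n ^^ j" "(z, y) \<in> cyc_graph \<H> C M n" by auto
  have "length ((rot ^^ j) a) = Suc n" using Suc.prems(2) by (induction j) auto
  then have "(hmap n ((rot ^^ j) a) z, hmap n (rot ((rot ^^ j) a)) y) \<in> cyc_graph \<H> C' M n"
    by (rule hmap_cyc[OF z(2)])
  moreover have "(hmap n a x, hmap n ((rot ^^ j) a) z) \<in> cyc_graph \<H> C' M n ^^ j" by (rule Suc.IH[OF z(1) Suc.prems(2)])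
  ultimately show ?case unfolding relpow.simps(2) funpow.simps(2) comp_apply by (rule relcompI[rotated])
qed simp

lemma rot_rotate1: "xs \<noteq> [] \<Longrightarrow> rot (rotate1 xs) = xs"
  by (cases xs) simp_all

text \<open>Provides the index sequence for the argument of a clause of \<open>null_chain\<close>
  when the one for its result is prescribed.\<close>

lemma rot_pow_surj: "length a = Suc n \<Longrightarrow> \<exists>b. length b = Suc n \<and> (rot ^^ j) b = a"
proof (induction j arbitrary: a)
  case (Suc j)
  then obtain b where "length b = Suc n" "(rot ^^ j) b = rotate1 a" using length_rotate1 by metis
  moreover have "rot (rotate1 a) = a" using Suc.prems by (intro rot_rotate1) auto
  ultimately show ?case by auto
qed simp

text \<open>On sequences of length \<open>n + 1\<close>, \<open>rot\<close> is
  \<open>rotate n\<close>; hence \<open>n + 1\<close> applications rotate by a multiple of the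
  length.\<close>

lemma rot_pow_length:
  assumes "length a = Suc n" shows "(rot ^^ Suc n) a = a"
proof -
  have r: "rot xs = rotate (length xs - 1) xs" if ne: "xs \<noteq> []" for xs :: "'x list"
  proof -
    obtain ys y where xs: "xs = ys @ [y]" using ne by (cases xs rule: rev_cases) auto
    then show ?thesis using rotate_append[of ys "[y]"] by simp
  qed
  have "(rot ^^ j) a = rotate (n * j) a" for j
  proof (induction j)
    case (Suc j)
    have "rotate (n * j) a \<noteq> []" using assms by auto
    then show ?case using Suc r[of "rotate (n * j) a"] assms by (simp add: rotate_rotate)
  qed simp
  moreover have "rotate (n * Suc n) a = a" by (rule rotate_id) (simp only: assms mod_mult_self2_is_0)
  ultimately show ?thesis by (simp only:)
qed

text \<open>Induction for all index sequences: that of the result is given, and for the argument one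
  is chosen which the rotations or the face of the clause carry to it.\<close>

lemma hmap_null_aux: "null_chain \<H> C M n x \<Longrightarrow> length a = Suc n \<Longrightarrow> null_chain \<H> C' M n (hmap n a x)"
proof (induction arbitrary: a rule: null_chain.induct)
  case (rel x n)
  then show ?case using hmap_chain_rel null_chain.rel by blast
next
  case (diff n x y)
  show ?case unfolding hmap_diff
    by (rule null_chain.diff[OF diff.IH(1)[OF diff.prems] diff.IH(2)[OF diff.prems]])
next
  case (coeq x n y j h z)
  obtain b where b: "length b = Suc n" "(rot ^^ j) b = a" using rot_pow_surj coeq.prems by blast
  have y: "y \<in> chains C n" using coeq C.cyc_graph_pow_chains by blast
  show ?case
    unfolding hmap_diff hmap_act[OF y]
    using hmap_cyc_pow[OF coeq(2) b(1)] hmap_cyc_pow[OF coeq(3) b(1)]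
    unfolding b(2) hmap_act[OF coeq(1)] by (rule null_chain.coeq[OF hmap_chains[OF coeq(1)]])
next
  case (face n x i)
  \<comment> \<open>The face deletes the entry at position \<open>i + 1\<close>, so the value
    inserted there is arbitrary.\<close>
  let ?b = "take (Suc i) a @ 0 # drop (Suc i) a"
  have b: "length ?b = Suc (Suc n)" "skip i ?b = a" using face by auto
  have "x \<in> chains C (Suc n)" using face C.null_chain_chains by blast
  from hmap_face[OF this face(2) b(1)] show ?case
    unfolding b(2) by (simp only: null_chain.face[OF face.IH[OF b(1)] face(2)])
next
  case (cyc n x y)
  have a: "rot (rotate1 a) = a" "length (rotate1 a) = Suc n"
    using cyc.prems by (auto intro: rot_rotate1)
  show ?case
    using null_chain.cyc[OF cyc.IH[OF a(2)] hmap_cyc[OF cyc(2) a(2)]] unfolding a(1) .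
next
  case (last_face x n y z z')
  obtain w where w: "(y, w) \<in> cyc_graph \<H> C M (Suc n)" "z = chain_face C (Suc n) 0 w"
    using last_face by (auto simp: face_graph_def)
  have wc: "w \<in> chains C (Suc n)" using w C.cyc_graph_chains by blast
  \<comment> \<open>\<open>z\<close> comes from \<open>w\<close> by \<open>d_0\<close>, which
    deletes the entry at position \<open>1\<close>; here too the inserted value is arbitrary. As
    \<open>w\<close> is two rotations away from \<open>x\<close>, the chain \<open>x\<close> is
    mapped over a sequence \<open>b\<close> that two rotations carry to this one.\<close>
  let ?c = "hd a # 0 # tl a"
  have c: "length ?c = Suc (Suc n)" "skip 0 ?c = a" using last_face.prems by (cases a; auto)+
  obtain b where b: "length b = Suc (Suc n)" "(rot ^^ 2) b = ?c" using rot_pow_surj[OF c(1)] by blast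
  then have rr: "rot (rot b) = ?c" by (simp add: numeral_2_eq_2)
  have ra: "rot (skip n b) = a" using skip_rot_rot[OF b(1)] unfolding rr c(2) by simp
  have c1: "(hmap (Suc n) b x, hmap (Suc n) (rot b) y) \<in> cyc_graph \<H> C' M (Suc n)"
    by (rule hmap_cyc[OF last_face(2) b(1)])
  have c2: "(hmap (Suc n) (rot b) y, hmap (Suc n) ?c w) \<in> cyc_graph \<H> C' M (Suc n)"
    using hmap_cyc[OF w(1), of "rot b"] b(1) unfolding rr by simp
  have "hmap n a z = chain_face C' (Suc n) 0 (hmap (Suc n) ?c w)"
    using hmap_face[OF wc _ c(1), of 0] unfolding c(2) w by simp
  with c2 have f: "(hmap (Suc n) (rot b) y, hmap n a z) \<in> face_graph \<H> C' M (Suc n) (Suc n)"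
    by (auto simp: face_graph_def)
  have "(hmap n (skip n b) (chain_face C (Suc n) n x), hmap n (rot (skip n b)) z') \<in> cyc_graph \<H> C' M n"
    using b(1) by (intro hmap_cyc last_face(4)) simp
  then have "(chain_face C' (Suc n) n (hmap (Suc n) b x), hmap n a z') \<in> cyc_graph \<H> C' M n"
    unfolding ra hmap_face[OF last_face(1) order_refl b(1)] .
  then show ?case
    unfolding hmap_diff by (rule null_chain.last_face[OF hmap_chains[OF last_face(1)] c1 f])
qed

lemma hmap_null: "x \<in> C.null n \<Longrightarrow> length a = Suc n \<Longrightarrow> hmap n a x \<in> C'.null n"
  by (simp add: null_chains_def hmap_null_aux)

lemma hmap_cong: "cong_mod (C.null n) x y \<Longrightarrow> length a = Suc n \<Longrightarrow> cong_mod (C'.null n) (hmap n a x) (hmap n a y)"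
  unfolding cong_mod_def hmap_diff[symmetric] by (rule hmap_null)

lemma hmap_tau: "x \<in> chains C n \<Longrightarrow> length a = Suc n \<Longrightarrow>
    cong_mod (C'.null n) (hmap n (rot a) (C.\<tau> n x)) (C'.\<tau> n (hmap n a x))"
  by (rule C'.cyc_tau_cong[OF hmap_cyc[OF C.cyc_tau]])

lemma hmap_tau_pow: "x \<in> chains C n \<Longrightarrow> length a = Suc n \<Longrightarrow>
    cong_mod (C'.null n) (hmap n ((rot ^^ j) a) ((C.\<tau> n ^^ j) x)) ((C'.\<tau> n ^^ j) (hmap n a x))"
  by (rule C'.cyc_pow_cong[OF hmap_cyc_pow[OF C.cyc_pow_tau] C'.cyc_pow_tau]) (auto simp: hmap_chains)

lemma hmap_periodic:
  assumes "x \<in> C.periodic n" "length a = Suc n" shows "hmap n a x \<in> C'.periodic n"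
proof -
  have x: "x \<in> chains C n" "cong_mod (C.null n) ((C.\<tau> n ^^ Suc n) x) x"
    using assms(1) by (auto simp: C.periodic_def)
  have "cong_mod (C'.null n) ((C'.\<tau> n ^^ Suc n) (hmap n a x)) (hmap n a ((C.\<tau> n ^^ Suc n) x))"
    using C'.null_sym[OF hmap_tau_pow[OF x(1) assms(2), of "Suc n"]] unfolding rot_pow_length[OF assms(2)] .
  also have "cong_mod (C'.null n) \<dots> (hmap n a x)" by (rule hmap_cong[OF x(2) assms(2)])
  finally show ?thesis using hmap_chains[OF x(1)] by (simp add: C'.periodic_def del: funpow.simps)
qed

end

section \<open>Cosets and induced maps\<close>

lemma coset_mem_iff: "add_subgroup N \<Longrightarrow> y \<in> coset N x \<longleftrightarrow> cong_mod N y x"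
  unfolding coset_def cong_mod_def by (auto intro: exI[of _ "y - x"])

lemma coset_eq_iff: "add_subgroup N \<Longrightarrow> coset N x = coset N y \<longleftrightarrow> cong_mod N x y"
  by (auto simp: coset_mem_iff set_eq_iff intro: cong_mod_trans cong_mod_sym)

lemma coset_self: "add_subgroup N \<Longrightarrow> x \<in> coset N x"
  by (simp add: coset_mem_iff)

lemma coset_plus:
  assumes N: "add_subgroup N"
  shows "{a + b | a b. a \<in> coset N x \<and> b \<in> coset N y} = coset N (x + y)"
proof safe
  fix a b assume "a \<in> coset N x" "b \<in> coset N y"
  then show "a + b \<in> coset N (x + y)" using N by (simp add: coset_mem_iff cong_mod_add)
next
  fix c assume "c \<in> coset N (x + y)"
  then have "c - y \<in> coset N x" using N by (simp add: coset_mem_iff cong_mod_def algebra_simps)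
  moreover have "y \<in> coset N y" using N by (rule coset_self)
  ultimately show "\<exists>a b. c = a + b \<and> a \<in> coset N x \<and> b \<in> coset N y"
    by (intro exI[of _ "c - y"] exI[of _ y]) simp
qed

lemma induced_memI: "x \<in> A \<Longrightarrow> (x, y) \<in> R \<Longrightarrow> add_subgroup N \<Longrightarrow> y \<in> induced R N A"
  unfolding induced_def add_subgroup_def by (metis (mono_tags, lifting) add.right_neutral mem_Collect_eq)

lemma induced_memE:
  assumes "z \<in> induced R N A" and "add_subgroup N"
  obtains x y where "x \<in> A" "(x, y) \<in> R" "cong_mod N z y"
  using assms unfolding induced_def cong_mod_def by (auto simp: algebra_simps)

lemma induced_eq_coset:
  assumes N: "add_subgroup N" and "x0 \<in> A" "(x0, y0) \<in> R"
    and "\<And>x y. x \<in> A \<Longrightarrow> (x, y) \<in> R \<Longrightarrow> cong_mod N y z"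
  shows "induced R N A = coset N z"
proof (rule set_eqI)
  fix w
  show "w \<in> induced R N A \<longleftrightarrow> w \<in> coset N z"
  proof
    assume "w \<in> induced R N A"
    then show "w \<in> coset N z"
      using assms by (elim induced_memE[OF _ N]) (auto simp: coset_mem_iff intro: cong_mod_trans)
  next
    assume "w \<in> coset N z"
    then have "cong_mod N w y0"
      using cong_mod_trans[OF N _ cong_mod_sym[OF N assms(4)[OF assms(2,3)]]] by (simp add: coset_mem_iff N)
    then show "w \<in> induced R N A"
      unfolding induced_def cong_mod_def using assms(2,3)
      by - (rule CollectI, rule exI[of _ x0], rule exI[of _ y0], rule exI[of _ "w - y0"], simp)
  qed
qed

lemma add_subgroup_null_chains [simp]: "add_subgroup (null_chains \<H> C M n)"
  unfolding add_subgroup_def null_chains_def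
  by (auto intro: null_chain.diff null_chain.rel simp: chain_rel_def additive_span.zero)

abbreviation cls where "cls \<H> C M n \<equiv> coset (null_chains \<H> C M n)"

lemma cong_null_iff: "cong_mod (null_chains \<H> C M n) x y \<longleftrightarrow> null_chain \<H> C M n (x - y)"
  by (simp add: cong_mod_def null_chains_def)

lemma cls_mem_iff: "y \<in> cls \<H> C M n x \<longleftrightarrow> null_chain \<H> C M n (y - x)"
  by (simp add: coset_mem_iff cong_null_iff)

context closed_cat
begin

lemma cls_chains: "x \<in> chains C n \<Longrightarrow> y \<in> cls \<H> C M n x \<Longrightarrow> y \<in> chains C n"
  using null_chain_chains[of \<H> M n "y - x"] chains_add[of "y - x" C n x]
  by (auto simp: cls_mem_iff cong_null_iff)

lemma cyc_cls:
  assumes x: "x \<in> chains C n"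
  shows "induced (cyc_graph \<H> C M n) (null_chains \<H> C M n) (cls \<H> C M n x) = cls \<H> C M n (tau C M n x)"
proof (rule induced_eq_coset[OF _ coset_self cyc_graph_tau[OF x]])
  fix x' y assume "x' \<in> cls \<H> C M n x" "(x', y) \<in> cyc_graph \<H> C M n"
  then show "cong_mod (null_chains \<H> C M n) y (tau C M n x)"
    using null_chain.cyc[OF _ cyc_graph.diff[OF _ cyc_graph_tau[OF x]]]
    by (auto simp: cls_mem_iff cong_null_iff)
qed simp_all

lemma face_cls:
  assumes x: "x \<in> chains C (Suc n)" and i: "i \<le> n"
  shows "induced (face_graph \<H> C M (Suc n) i) (null_chains \<H> C M n) (cls \<H> C M (Suc n) x) =
    cls \<H> C M n (chain_face C (Suc n) i x)"
proof (rule induced_eq_coset[OF _ coset_self])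
  fix x' y assume "x' \<in> cls \<H> C M (Suc n) x" "(x', y) \<in> face_graph \<H> C M (Suc n) i"
  then show "cong_mod (null_chains \<H> C M n) y (chain_face C (Suc n) i x)"
    using null_chain.face[OF _ i, of \<H> C M "x' - x"] i
    by (simp add: cls_mem_iff cong_null_iff face_graph_def chain_face_eq frag_extend_diff)
qed (use i in \<open>simp_all add: face_graph_def\<close>)

lemma last_face_cls:
  assumes x: "x \<in> chains C (Suc n)"
  shows "induced (face_graph \<H> C M (Suc n) (Suc n)) (null_chains \<H> C M n) (cls \<H> C M (Suc n) x) =
    cls \<H> C M n (chain_face C (Suc n) 0 (tau C M (Suc n) x))"
proof (rule induced_eq_coset[OF _ coset_self])
  show "(x, chain_face C (Suc n) 0 (tau C M (Suc n) x)) \<in> face_graph \<H> C M (Suc n) (Suc n)"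
    using cyc_graph_tau[OF x] by (auto simp: face_graph_def)
  fix x' y assume "x' \<in> cls \<H> C M (Suc n) x" "(x', y) \<in> face_graph \<H> C M (Suc n) (Suc n)"
  then obtain w where "null_chain \<H> C M (Suc n) (x' - x)" "(x', w) \<in> cyc_graph \<H> C M (Suc n)" "y = chain_face C (Suc n) 0 w"
    by (auto simp: face_graph_def cls_mem_iff cong_null_iff)
  then show "cong_mod (null_chains \<H> C M n) y (chain_face C (Suc n) 0 (tau C M (Suc n) x))"
    using null_chain.face[OF null_chain.cyc[OF _ cyc_graph.diff[OF _ cyc_graph_tau[OF x]]], of \<H> M x' w 0]
    by (simp add: cong_null_iff chain_face_eq frag_extend_diff)
qed simp_all

end

section \<open>The cyclic module \<open>\<Q>\<close>\<close>

lemma Q_simps: "cplus (cyclic_Q \<H> C M) n A B = {a + b | a b. a \<in> A \<and> b \<in> B}"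
  "cact (cyclic_Q \<H> C M) n A h = induced (graph_of (\<lambda>x. chain_act \<H> C M n x h)) (null_chains \<H> C M n) A"
  "cface (cyclic_Q \<H> C M) (Suc n) i A = induced (face_graph \<H> C M (Suc n) i) (null_chains \<H> C M n) A"
  "ccyc (cyclic_Q \<H> C M) n A = induced (cyc_graph \<H> C M n) (null_chains \<H> C M n) A"
  by (simp_all add: cyclic_Q_def QH_def)

lemma Q_cmodE:
  assumes "A \<in> cmod (cyclic_Q \<H> C M) n" obtains x where "x \<in> chains C n" "A = cls \<H> C M n x"
  using assms by (auto simp: cyclic_Q_def QH_def)

context hcat_coeff
begin

abbreviation "Q \<equiv> cyclic_Q \<H> C M"
abbreviation "cl \<equiv> cls \<H> C M"

lemma Q_plus: "cplus Q n (cl n x) (cl n y) = cl n (x + y)"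
  unfolding Q_simps by (rule coset_plus) simp

lemma Q_act: "cact Q n (cl n x) h = cl n (act n x h)"
  unfolding Q_simps
  by (rule induced_eq_coset[OF add_subgroup_null coset_self]) (auto simp: coset_mem_iff intro: act_cong)

lemma Q_face: "x \<in> chains C (Suc n) \<Longrightarrow> i \<le> n \<Longrightarrow> cface Q (Suc n) i (cl (Suc n) x) = cl n (d (Suc n) i x)"
  unfolding Q_simps by (rule face_cls)

lemma Q_last_face: "x \<in> chains C (Suc n) \<Longrightarrow>
    cface Q (Suc n) (Suc n) (cl (Suc n) x) = cl n (d (Suc n) 0 (\<tau> (Suc n) x))"
  unfolding Q_simps by (rule last_face_cls)

lemma Q_cyc: "x \<in> chains C n \<Longrightarrow> ccyc Q n (cl n x) = cl n (\<tau> n x)"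
  unfolding Q_simps by (rule cyc_cls)

text \<open>On classes the powers of the cyclic operator are computed by those of
  \<open>\<tau>\<close>, so the equalizer condition says that a representative is periodic.\<close>

lemma Q_cmod: "cmod Q n = cl n ` periodic n"
proof -
  have cyc: "(ccyc (QH \<H> C M) n ^^ j) (cl n x) = cl n ((\<tau> n ^^ j) x)" if "x \<in> chains C n" for j x
    using that by (induction j) (simp_all add: QH_def cyc_cls pow_chains)
  have "A \<in> cmod Q n \<longleftrightarrow> A \<in> cl n ` periodic n" for A
  proof
    assume "A \<in> cmod Q n"
    then obtain x where x: "x \<in> chains C n" "A = cl n x" "(ccyc (QH \<H> C M) n ^^ Suc n) A = A"
      by (auto simp: cyclic_Q_def QH_def)
    then have "cong_mod (null n) ((\<tau> n ^^ Suc n) x) x"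
      using cyc[OF x(1), of "Suc n"] coset_eq_iff[OF add_subgroup_null] by metis
    then show "A \<in> cl n ` periodic n" using x by (auto simp: periodic_def)
  next
    assume "A \<in> cl n ` periodic n"
    then obtain x where x: "x \<in> chains C n" "A = cl n x" "cong_mod (null n) ((\<tau> n ^^ Suc n) x) x"
      by (auto simp: periodic_def)
    then have "(ccyc (QH \<H> C M) n ^^ Suc n) A = A"
      unfolding x(2) cyc[OF x(1)] coset_eq_iff[OF add_subgroup_null] by simp
    then show "A \<in> cmod Q n" using x by (auto simp: cyclic_Q_def QH_def)
  qed
  then show ?thesis by blast
qed

lemma cl_eq_iff: "cl n x = cl n y \<longleftrightarrow> cong_mod (null n) x y"
  by (rule coset_eq_iff) simp

section \<open>The pairing on classes of chains of \<open>LS\<close>\<close>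

lemma pairing_add_left:
  "\<omega> \<in> chainsLS k \<Longrightarrow> pairing n (\<lambda>a. \<Psi> a + \<Psi>' a) \<omega> = pairing n \<Psi> \<omega> + pairing n \<Psi>' \<omega>"
  using pairing_diff_left[of \<omega> k n \<Psi> "\<lambda>a. 0 - \<Psi>' a"] pairing_diff_left[of \<omega> k n "\<lambda>a. 0" "\<lambda>a. \<Psi>' a"]
    pairing_diff_left[of \<omega> k n "\<lambda>a. 0" "\<lambda>a. 0"] by simp

text \<open>The source of the balancing of the homotopy over \<open>L\<close>: as
  \<open>Si (lam l) = sL l\<close>, the element \<open>lam l\<close> multiplies the label product by
  \<open>l\<close> on the left, which is the effect of letting \<open>sL l\<close> act on the family
  beforehand.\<close>

lemma pairing_lam:
  assumes "\<omega> \<in> chainsLS k" and \<Psi>: "\<And>a. length a = Suc k \<Longrightarrow> \<Psi> a \<in> chains C n"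
  shows "cong_mod (null n) (pairing n (\<lambda>a. act n (\<Psi> a) (sL \<H> l)) \<omega>)
    (pairing n \<Psi> (actLS k \<omega> (lam l)))"
  using assms(1)
proof (induction rule: chains_induct)
  case (one \<sigma>)
  obtain a ls m where s: "\<sigma> = (a, ls, m)" by (cases \<sigma>)
  then have x: "\<Psi> a \<in> chains C n" using one \<Psi> by (auto simp: tensors_LS)
  have "cong_mod (null n) (act n (act n (\<Psi> a) (sL \<H> l)) (sL \<H> (prod_list ls * m))) (act n (\<Psi> a) (sL \<H> l * sL \<H> (prod_list ls * m)))"
    by (rule null_sym[OF act_mult[OF x]])
  moreover have "sL \<H> (eL \<H> (Si (lam l) * sL \<H> (prod_list ls * m))) = sL \<H> l * sL \<H> (prod_list ls * m)"
    unfolding Si_lam by (simp add: eL_sL_left sL_hom)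
  ultimately show ?case
    using null_sym[OF pairing_act_simplex[where \<Psi>=\<Psi>, OF one[unfolded s] x, of "lam l"]] null_trans
    by (simp only: s pairing_frag_of)
next
  case (diff x y)
  then show ?case using cong_mod_diff[OF add_subgroup_null diff] by (simp add: pairing_diff chain_act_diff)
qed (simp add: chain_act_def pairing_def)

text \<open>Working up to \<open>pairing_eqv\<close> avoids a proof that the null chains of \<open>L\<S>\<close> are closed under the action of \<open>\<H>\<close>.\<close>

definition pairing_eqv :: "nat \<Rightarrow> (nat, 'l, 'l) chain \<Rightarrow> (nat, 'l, 'l) chain \<Rightarrow> bool" where
  "pairing_eqv k \<omega> \<omega>' \<longleftrightarrow> (\<forall>n \<Psi>. (\<forall>a. length a = Suc k \<longrightarrow> \<Psi> a \<in> chains C n) \<longrightarrow>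
     cong_mod (enull n) (pairing n \<Psi> \<omega>) (pairing n \<Psi> \<omega>'))"

text \<open>A structure map of \<open>CC\<close> is evaluated on a whole set of chains, and its
  result is shown only to be a nonempty set of chains with equal pairings up to
  \<open>enull\<close>. This weaker property passes through all structure maps and suffices to
  evaluate the homotopy.\<close>

definition good :: "nat \<Rightarrow> (nat, 'l, 'l) chain set \<Rightarrow> bool" where
  "good k V \<longleftrightarrow> V \<noteq> {} \<and> V \<subseteq> chainsLS k \<and> (\<forall>\<omega>\<in>V. \<forall>\<omega>'\<in>V. pairing_eqv k \<omega> \<omega>')"

abbreviation "clLS \<equiv> cls \<H> (LS \<H>) (L_coeff \<H>)"

lemma pairing_eqvD: "pairing_eqv k \<omega> \<omega>' \<Longrightarrow> (\<And>a. length a = Suc k \<Longrightarrow> \<Psi> a \<in> chains C n) \<Longrightarrow>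
    cong_mod (enull n) (pairing n \<Psi> \<omega>) (pairing n \<Psi> \<omega>')"
  by (simp add: pairing_eqv_def)

lemma pairing_eqv_null: "cong_mod (nullLS k) \<omega> \<omega>' \<Longrightarrow> pairing_eqv k \<omega> \<omega>'"
  unfolding pairing_eqv_def by (auto intro: pairing_cong_right)

lemma pairing_eqv_trans: "pairing_eqv k \<omega> \<omega>' \<Longrightarrow> pairing_eqv k \<omega>' \<omega>'' \<Longrightarrow> pairing_eqv k \<omega> \<omega>''"
  unfolding pairing_eqv_def by (meson enull_trans)

lemma pairing_eqv_sym: "pairing_eqv k \<omega> \<omega>' \<Longrightarrow> pairing_eqv k \<omega>' \<omega>"
  unfolding pairing_eqv_def by (meson enull_sym)

lemma pairing_eqv_act:
  assumes "pairing_eqv k \<omega> \<omega>'" "\<omega> \<in> chainsLS k" "\<omega>' \<in> chainsLS k"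
  shows "pairing_eqv k (actLS k \<omega> h) (actLS k \<omega>' h)"
  unfolding pairing_eqv_def
proof safe
  fix n and \<Psi> :: "nat list \<Rightarrow> ('o, 'f, 'm) chain" assume "\<forall>a. length a = Suc k \<longrightarrow> \<Psi> a \<in> chains C n"
  then have \<Psi>: "\<And>a. length a = Suc k \<Longrightarrow> \<Psi> a \<in> chains C n" by blast
  have "cong_mod (null n) (pairing n \<Psi> (actLS k \<omega> h)) (\<Sum>(x, y)\<leftarrow>DR \<H> (Si h). act n (pairing n (\<lambda>a. act n (\<Psi> a) x) \<omega>) (S y))"
    by (rule pairing_act[OF assms(2) \<Psi>])
  also have "cong_mod (enull n) \<dots> (\<Sum>(x, y)\<leftarrow>DR \<H> (Si h). act n (pairing n (\<lambda>a. act n (\<Psi> a) x) \<omega>') (S y))"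
    unfolding case_prod_unfold
    by (intro cong_mod_sum_list add_subgroup_enull act_enull_cong pairing_eqvD[OF assms(1)] act_chains \<Psi>)
  also have "cong_mod (null n) \<dots> (pairing n \<Psi> (actLS k \<omega>' h))"
    by (rule null_sym[OF pairing_act[OF assms(3) \<Psi>]])
  finally show "cong_mod (enull n) (pairing n \<Psi> (actLS k \<omega> h)) (pairing n \<Psi> (actLS k \<omega>' h))" .
qed

lemma pairing_eqv_face:
  assumes "pairing_eqv (Suc k) \<omega> \<omega>'" "\<omega> \<in> chainsLS (Suc k)" "\<omega>' \<in> chainsLS (Suc k)" "i \<le> k"
  shows "pairing_eqv k (dLS (Suc k) i \<omega>) (dLS (Suc k) i \<omega>')"
  using assms(1,4) unfolding pairing_eqv_def pairing_face_right[OF assms(2,4)] pairing_face_right[OF assms(3,4)] by simp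

lemma pairing_eqv_cyc:
  assumes "pairing_eqv k \<omega> \<omega>'" "(\<omega>, \<zeta>) \<in> cycLS k" "(\<omega>', \<zeta>') \<in> cycLS k"
  shows "pairing_eqv k \<zeta> \<zeta>'"
  unfolding pairing_eqv_def
proof safe
  fix n and \<Psi> :: "nat list \<Rightarrow> ('o, 'f, 'm) chain" assume "\<forall>a. length a = Suc k \<longrightarrow> \<Psi> a \<in> chains C n"
  then have \<Psi>: "\<And>a. length a = Suc k \<Longrightarrow> \<Psi> a \<in> chains C n" by blast
  have "cong_mod (enull n) (pairing n \<Psi> \<zeta>) (pairing n (\<lambda>a. \<Psi> (rot a)) \<omega>)" by (rule pairing_cyc[OF assms(2) \<Psi>])
  also have "cong_mod (enull n) \<dots> (pairing n (\<lambda>a. \<Psi> (rot a)) \<omega>')" by (rule pairing_eqvD[OF assms(1)]) (simp add: \<Psi>)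
  also have "cong_mod (enull n) \<dots> (pairing n \<Psi> \<zeta>')" by (rule enull_sym[OF pairing_cyc[OF assms(3) \<Psi>]])
  finally show "cong_mod (enull n) (pairing n \<Psi> \<zeta>) (pairing n \<Psi> \<zeta>')" .
qed

lemma LS_null_chains: "\<omega> \<in> chainsLS k \<Longrightarrow> cong_mod (nullLS k) \<omega>' \<omega> \<Longrightarrow> \<omega>' \<in> chainsLS k"
  using closed_cat.cls_chains[OF closed_cat_LS] by (auto simp: coset_mem_iff)

lemma good_induced:
  assumes V: "good k V" and R: "\<And>\<omega>. \<omega> \<in> V \<Longrightarrow> \<exists>\<zeta>. (\<omega>, \<zeta>) \<in> R"
    and c: "\<And>\<omega> \<zeta>. \<omega> \<in> V \<Longrightarrow> (\<omega>, \<zeta>) \<in> R \<Longrightarrow> \<zeta> \<in> chainsLS k'"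
    and e: "\<And>\<omega> \<zeta> \<omega>' \<zeta>'. \<omega> \<in> V \<Longrightarrow> \<omega>' \<in> V \<Longrightarrow> (\<omega>, \<zeta>) \<in> R \<Longrightarrow> (\<omega>', \<zeta>') \<in> R \<Longrightarrow> pairing_eqv k' \<zeta> \<zeta>'"
  shows "good k' (induced R (nullLS k') V)"
  unfolding good_def
proof (intro conjI ballI subsetI)
  obtain \<omega> where "\<omega> \<in> V" using V by (auto simp: good_def)
  moreover obtain \<zeta> where "(\<omega>, \<zeta>) \<in> R" using R calculation by blast
  ultimately show "induced R (nullLS k') V \<noteq> {}" using induced_memI[of \<omega> V \<zeta> R "nullLS k'"] by auto
next
  fix \<zeta> assume "\<zeta> \<in> induced R (nullLS k') V"
  then show "\<zeta> \<in> chainsLS k'" by (elim induced_memE) (auto intro: LS_null_chains c)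
next
  fix \<zeta> \<zeta>' assume a: "\<zeta> \<in> induced R (nullLS k') V" "\<zeta>' \<in> induced R (nullLS k') V"
  obtain \<omega> \<xi> where 1: "\<omega> \<in> V" "(\<omega>, \<xi>) \<in> R" "cong_mod (nullLS k') \<zeta> \<xi>" using a(1) by (elim induced_memE) auto
  obtain \<omega>' \<xi>' where 2: "\<omega>' \<in> V" "(\<omega>', \<xi>') \<in> R" "cong_mod (nullLS k') \<zeta>' \<xi>'" using a(2) by (elim induced_memE) auto
  show "pairing_eqv k' \<zeta> \<zeta>'"
    by (rule pairing_eqv_trans[OF pairing_eqv_null[OF 1(3)] pairing_eqv_trans[OF e[OF 1(1) 2(1) 1(2) 2(2)]
        pairing_eqv_sym[OF pairing_eqv_null[OF 2(3)]]]])
qed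

lemma good_clLS: "\<omega> \<in> chainsLS k \<Longrightarrow> good k (clLS k \<omega>)"
  unfolding good_def
proof (intro conjI ballI subsetI)
  show "clLS k \<omega> \<noteq> {}" using coset_self[of "nullLS k" \<omega>] by auto
  fix \<omega>' assume 1: "\<omega>' \<in> clLS k \<omega>"
  show "\<omega> \<in> chainsLS k \<Longrightarrow> \<omega>' \<in> chainsLS k" using 1 by (simp add: coset_mem_iff LS_null_chains)
  fix \<omega>'' assume "\<omega>'' \<in> clLS k \<omega>"
  then show "pairing_eqv k \<omega>' \<omega>''"
    using 1 pairing_eqv_trans[OF pairing_eqv_null pairing_eqv_sym[OF pairing_eqv_null]] by (simp add: coset_mem_iff)
qed

lemma good_act:
  assumes V: "good k V" shows "good k (cact (CC \<H>) k V h)"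
  unfolding CC_def Q_simps
proof (rule good_induced[OF V])
  have c: "\<omega> \<in> V \<Longrightarrow> \<omega> \<in> chainsLS k" for \<omega> using V by (auto simp: good_def)
  fix \<omega> \<zeta> \<omega>' \<zeta>'
  show "\<omega> \<in> V \<Longrightarrow> (\<omega>, \<zeta>) \<in> graph_of (\<lambda>x. actLS k x h) \<Longrightarrow> \<zeta> \<in> chainsLS k"
    using c by (auto intro: closed_cat.chain_act_chains[OF closed_cat_LS])
  show "\<omega> \<in> V \<Longrightarrow> \<omega>' \<in> V \<Longrightarrow> (\<omega>, \<zeta>) \<in> graph_of (\<lambda>x. actLS k x h) \<Longrightarrow>
      (\<omega>', \<zeta>') \<in> graph_of (\<lambda>x. actLS k x h) \<Longrightarrow> pairing_eqv k \<zeta> \<zeta>'"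
    using V c pairing_eqv_act by (auto simp: good_def)
qed simp

lemma good_face: "good (Suc k) V \<Longrightarrow> i \<le> Suc k \<Longrightarrow> good k (cface (CC \<H>) (Suc k) i V)"
proof -
  assume V: "good (Suc k) V" and i: "i \<le> Suc k"
  have c: "\<omega> \<in> V \<Longrightarrow> \<omega> \<in> chainsLS (Suc k)" for \<omega> using V by (auto simp: good_def)
  show ?thesis
    unfolding CC_def Q_simps
  proof (cases "i \<le> k")
    case True
    then show "good k (induced (face_graphLS (Suc k) i) (nullLS k) V)"
      using V c by (intro good_induced[OF V])
        (auto simp: good_def face_graph_def intro!: pairing_eqv_face closed_cat.chain_face_chains[OF closed_cat_LS])
  next
    case False
    then have i: "i = Suc k" using i by simp
    show "good k (induced (face_graphLS (Suc k) i) (nullLS k) V)"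
    proof (rule good_induced[OF V])
      fix \<omega> assume "\<omega> \<in> V"
      then show "\<exists>\<zeta>. (\<omega>, \<zeta>) \<in> face_graphLS (Suc k) i"
        using closed_cat.cyc_graph_tau[OF closed_cat_LS c] by (auto simp: face_graph_def i)
    next
      fix \<omega> \<zeta> assume "\<omega> \<in> V" "(\<omega>, \<zeta>) \<in> face_graphLS (Suc k) i"
      then show "\<zeta> \<in> chainsLS k"
        using closed_cat.cyc_graph_chains[OF closed_cat_LS] closed_cat.chain_face_chains[OF closed_cat_LS]
        by (fastforce simp: face_graph_def i)
    next
      fix \<omega> \<zeta> \<omega>' \<zeta>' assume "\<omega> \<in> V" "\<omega>' \<in> V" "(\<omega>, \<zeta>) \<in> face_graphLS (Suc k) i"
        "(\<omega>', \<zeta>') \<in> face_graphLS (Suc k) i"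
      then obtain \<xi> \<xi>' where x: "(\<omega>, \<xi>) \<in> cycLS (Suc k)" "(\<omega>', \<xi>') \<in> cycLS (Suc k)" "pairing_eqv (Suc k) \<omega> \<omega>'"
        "\<zeta> = dLS (Suc k) 0 \<xi>" "\<zeta>' = dLS (Suc k) 0 \<xi>'"
        using V by (auto simp: face_graph_def i good_def)
      show "pairing_eqv k \<zeta> \<zeta>'"
        unfolding x using pairing_eqv_cyc[OF x(3,1,2)] closed_cat.cyc_graph_chains[OF closed_cat_LS x(1)]
          closed_cat.cyc_graph_chains[OF closed_cat_LS x(2)]
        by (intro pairing_eqv_face) auto
    qed
  qed
qed

lemma good_cyc:
  assumes V: "good k V" shows "good k (ccyc (CC \<H>) k V)"
  unfolding CC_def Q_simps
proof (rule good_induced[OF V])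
  fix \<omega> \<omega>' \<zeta> \<zeta>'
  show "\<omega> \<in> V \<Longrightarrow> \<exists>\<zeta>. (\<omega>, \<zeta>) \<in> cycLS k"
    using closed_cat.cyc_graph_tau[OF closed_cat_LS] V by (fastforce simp: good_def)
  show "(\<omega>, \<zeta>) \<in> cycLS k \<Longrightarrow> \<zeta> \<in> chainsLS k"
    using closed_cat.cyc_graph_chains[OF closed_cat_LS] by blast
  show "\<omega> \<in> V \<Longrightarrow> \<omega>' \<in> V \<Longrightarrow> (\<omega>, \<zeta>) \<in> cycLS k \<Longrightarrow> (\<omega>', \<zeta>') \<in> cycLS k \<Longrightarrow> pairing_eqv k \<zeta> \<zeta>'"
    using V by (auto simp: good_def intro: pairing_eqv_cyc)
qed

lemma CC_mem:
  assumes "\<omega> \<in> V"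
  shows "actLS k \<omega> h \<in> cact (CC \<H>) k V h"
    and "i \<le> k \<Longrightarrow> dLS (Suc k) i \<omega> \<in> cface (CC \<H>) (Suc k) i V"
    and "\<omega> \<in> chainsLS (Suc k) \<Longrightarrow> dLS (Suc k) 0 (tauLS (Suc k) \<omega>) \<in> cface (CC \<H>) (Suc k) (Suc k) V"
    and "\<omega> \<in> chainsLS k \<Longrightarrow> tauLS k \<omega> \<in> ccyc (CC \<H>) k V"
  unfolding CC_def Q_simps
proof -
  note t = closed_cat.cyc_graph_tau[OF closed_cat_LS, of _ _ _ "L_coeff \<H>" \<H>]
  show "actLS k \<omega> h \<in> induced (graph_of (\<lambda>x. actLS k x h)) (nullLS k) V"
    by (rule induced_memI[OF assms]) simp_all
  show "i \<le> k \<Longrightarrow> dLS (Suc k) i \<omega> \<in> induced (face_graphLS (Suc k) i) (nullLS k) V"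
    by (rule induced_memI[OF assms]) (simp_all add: face_graph_def)
  show "\<omega> \<in> chainsLS (Suc k) \<Longrightarrow> dLS (Suc k) 0 (tauLS (Suc k) \<omega>)
      \<in> induced (face_graphLS (Suc k) (Suc k)) (nullLS k) V"
    by (rule induced_memI[OF assms]) (use t in \<open>auto simp: face_graph_def\<close>)
  show "\<omega> \<in> chainsLS k \<Longrightarrow> tauLS k \<omega> \<in> induced (cycLS k) (nullLS k) V"
    by (rule induced_memI[OF assms]) (use t in auto)
qed

lemma CC_good: "V \<in> cmod (CC \<H>) k \<Longrightarrow> good k V"
  unfolding CC_def by (erule Q_cmodE) (simp add: good_clLS)

lemma CC_plus: "cplus (CC \<H>) k (clLS k \<omega>) (clLS k \<omega>') = clLS k (\<omega> + \<omega>')"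
  unfolding CC_def Q_simps by (rule coset_plus) simp

end

section \<open>The homotopy\<close>

context cylinder_functor
begin

abbreviation "QC \<equiv> cyclic_Q \<H> C M"
abbreviation "QC' \<equiv> cyclic_Q \<H> C' M"

definition hpair :: "nat \<Rightarrow> ('o, 'f, 'm) chain \<Rightarrow> (nat, 'l, 'l) chain \<Rightarrow> ('o1, 'f1, 'm) chain" where
  "hpair n x \<omega> = C'.pairing n (\<lambda>a. hmap n a x) \<omega>"

lemma hpair_add_right: "hpair n x (\<omega> + \<omega>') = hpair n x \<omega> + hpair n x \<omega>'"
  by (simp only: hpair_def C'.pairing_add)

lemma hpair_add_left: "\<omega> \<in> C'.chainsLS n \<Longrightarrow> hpair n (x + x') \<omega> = hpair n x \<omega> + hpair n x' \<omega>"
  by (simp only: hpair_def C'.pairing_add_left[symmetric] frag_extend_add)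

lemma hpair_cong:
  assumes "x \<in> chains C n" "cong_mod (C.null n) x x'" "\<omega> \<in> C'.chainsLS n" "C'.pairing_eqv n \<omega> \<omega>'"
    and "\<omega>' \<in> C'.chainsLS n"
  shows "cong_mod (C'.enull n) (hpair n x \<omega>) (hpair n x' \<omega>')"
proof -
  have "cong_mod (C'.enull n) (hpair n x \<omega>) (hpair n x \<omega>')"
    unfolding hpair_def by (rule C'.pairing_eqvD[OF assms(4)]) (rule hmap_chains[OF assms(1)])
  also have "cong_mod (C'.null n) \<dots> (hpair n x' \<omega>')"
    unfolding hpair_def by (rule C'.pairing_cong[OF assms(5)]) (rule hmap_cong[OF assms(2)])
  finally show ?thesis .
qed

lemma hpair_periodic: "x \<in> C.periodic n \<Longrightarrow> \<omega> \<in> C'.chainsLS n \<Longrightarrow> hpair n x \<omega> \<in> C'.periodic n"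
  unfolding hpair_def by (rule C'.pairing_periodic) (auto intro: hmap_periodic)

lemma hpair_face:
  assumes "x \<in> chains C (Suc n)" "\<omega> \<in> C'.chainsLS (Suc n)" "i \<le> n"
  shows "cong_mod (C'.null n) (hpair n (C.d (Suc n) i x) (C'.dLS (Suc n) i \<omega>)) (C'.d (Suc n) i (hpair (Suc n) x \<omega>))"
proof -
  have "hpair n (C.d (Suc n) i x) (C'.dLS (Suc n) i \<omega>)
      = C'.pairing n (\<lambda>a. hmap n (skip i a) (C.d (Suc n) i x)) \<omega>"
    unfolding hpair_def by (rule C'.pairing_face_right[OF assms(2,3)])
  also have "\<dots> = C'.pairing n (\<lambda>a. C'.d (Suc n) i (hmap (Suc n) a x)) \<omega>"
    by (rule C'.pairing_eq[OF assms(2)]) (rule hmap_face[OF assms(1,3)])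
  also have "cong_mod (C'.null n) \<dots> (C'.d (Suc n) i (hpair (Suc n) x \<omega>))"
    unfolding hpair_def by (rule C'.null_sym[OF C'.pairing_face_left[OF assms(2) _ assms(3)]]) (rule hmap_chains[OF assms(1)])
  finally show ?thesis .
qed

lemma hpair_tau:
  assumes "x \<in> chains C n" "\<omega> \<in> C'.chainsLS n"
  shows "cong_mod (C'.enull n) (hpair n (C.\<tau> n x) (C'.tauLS n \<omega>)) (C'.\<tau> n (hpair n x \<omega>))"
proof -
  have "cong_mod (C'.enull n) (hpair n (C.\<tau> n x) (C'.tauLS n \<omega>)) (C'.pairing n (\<lambda>a. hmap n (rot a) (C.\<tau> n x)) \<omega>)"
    unfolding hpair_def
    by (rule C'.pairing_cyc[OF closed_cat.cyc_graph_tau[OF closed_cat_LS assms(2)]])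
      (rule hmap_chains[OF C.tau_chains[OF assms(1)]])
  also have "cong_mod (C'.null n) \<dots> (C'.pairing n (\<lambda>a. C'.\<tau> n (hmap n a x)) \<omega>)"
    by (rule C'.pairing_cong[OF assms(2)]) (rule hmap_tau[OF assms(1)])
  also have "cong_mod (C'.null n) \<dots> (C'.\<tau> n (hpair n x \<omega>))"
    unfolding hpair_def by (rule C'.null_sym[OF C'.pairing_tau[OF assms(2)]]) (rule hmap_chains[OF assms(1)])
  finally show ?thesis .
qed

lemma hpair_act:
  assumes "x \<in> chains C n" "\<omega> \<in> C'.chainsLS n"
  shows "cong_mod (C'.null n) (\<Sum>(g, y)\<leftarrow>DR \<H> h. hpair n (C.act n x y) (C'.actLS n \<omega> g)) (C'.act n (hpair n x \<omega>) h)"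
  using C'.pairing_diagonal[OF assms(2), of "\<lambda>a. hmap n a x" n h] hmap_chains[OF assms(1)]
  unfolding hpair_def by (simp only: hmap_act[OF assms(1)])

lemma hpair_balanced:
  assumes "x \<in> chains C n" "\<omega> \<in> C'.chainsLS n"
  shows "cong_mod (C'.null n) (hpair n (C.act n x (sL \<H> l)) \<omega>) (hpair n x (C'.actLS n \<omega> (C'.lam l)))"
  using C'.pairing_lam[OF assms(2), of "\<lambda>a. hmap n a x" n l] hmap_chains[OF assms(1)]
  unfolding hpair_def by (simp only: hmap_act[OF assms(1)])

definition rep :: "'x set \<Rightarrow> 'x" where
  "rep V = (SOME v. v \<in> V)"

lemma rep_mem: "V \<noteq> {} \<Longrightarrow> rep V \<in> V"
  unfolding rep_def by (simp add: some_in_eq)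

text \<open>The value depends on the choice of representatives; by \<open>hval_eq\<close> it does so
  only up to \<open>enull\<close>.\<close>

definition hval :: "nat \<Rightarrow> ('o, 'f, 'm) chain set \<times> (nat, 'l, 'l) chain set \<Rightarrow> ('o1, 'f1, 'm) chain" where
  "hval n = (\<lambda>(U, V). hpair n (rep U) (rep V))"

abbreviation "hsum n \<equiv> frag_extend (hval n)"

lemma rep_cl:
  assumes "U \<in> cmod QC n" shows "rep U \<in> C.periodic n" "U = C.cl n (rep U)"
proof -
  obtain x where x: "x \<in> C.periodic n" "U = C.cl n x" using assms by (auto simp: C.Q_cmod)
  have "rep U \<in> U" unfolding x(2) using coset_self[OF C.add_subgroup_null] by (intro rep_mem) auto
  then have c: "cong_mod (C.null n) (rep U) x" unfolding x(2) by (simp add: coset_mem_iff)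
  then show "U = C.cl n (rep U)" using C.cl_eq_iff C.null_sym x(2) by blast
  have "rep U \<in> chains C n"
    using C.cls_chains[OF C.periodic_chains[OF x(1)], of "rep U" \<H> M] c by (simp add: coset_mem_iff)
  then show "rep U \<in> C.periodic n" using C.periodic_cong[OF x(1) _ c] by blast
qed

lemma rep_good: "C'.good n V \<Longrightarrow> rep V \<in> V"
  by (rule rep_mem) (simp add: C'.good_def)

lemma good_chains: "C'.good n V \<Longrightarrow> \<omega> \<in> V \<Longrightarrow> \<omega> \<in> C'.chainsLS n"
  by (auto simp: C'.good_def)

lemma hval_periodic: "U \<in> cmod QC n \<Longrightarrow> C'.good n V \<Longrightarrow> hval n (U, V) \<in> C'.periodic n"
  unfolding hval_def prod.case by (rule hpair_periodic[OF rep_cl(1) good_chains[OF _ rep_good]])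

lemma hval_eq:
  assumes "x \<in> C.periodic n" "C'.good n V" "\<omega> \<in> V"
  shows "cong_mod (C'.enull n) (hval n (C.cl n x, V)) (hpair n x \<omega>)"
proof -
  have U: "C.cl n x \<in> cmod QC n" using assms(1) by (auto simp: C.Q_cmod)
  have "cong_mod (C.null n) (rep (C.cl n x)) x"
    using rep_cl(2)[OF U] C.cl_eq_iff C.null_sym by blast
  moreover have "C'.pairing_eqv n (rep V) \<omega>" using assms(2,3) rep_good[OF assms(2)] by (auto simp: C'.good_def)
  ultimately show ?thesis
    unfolding hval_def prod.case using assms
    by (intro hpair_cong C.periodic_chains[OF rep_cl(1)[OF U]] good_chains[OF assms(2)] rep_good)
qed

text \<open>The second entries range over all good sets, since this is what the structure maps of
  \<open>CC\<close> are known to produce from classes.\<close>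

definition good_frags :: "nat \<Rightarrow> (('o, 'f, 'm) chain set \<times> (nat, 'l, 'l) chain set \<Rightarrow>\<^sub>0 int) set" where
  "good_frags n = {z. Poly_Mapping.keys z \<subseteq> cmod QC n \<times> {V. C'.good n V}}"

lemma add_subgroup_good_frags: "add_subgroup (good_frags n)"
  unfolding add_subgroup_def good_frags_def by (simp, meson keys_diff Un_least order_trans)

lemma frag_of_good_frags [simp]: "frag_of (U, V) \<in> good_frags n \<longleftrightarrow> U \<in> cmod QC n \<and> C'.good n V"
  by (simp add: good_frags_def)

lemma good_frags_induct [consumes 1, case_names zero one diff]:
  assumes "z \<in> good_frags n" "P 0" "\<And>U V. U \<in> cmod QC n \<Longrightarrow> C'.good n V \<Longrightarrow> P (frag_of (U, V))"
    "\<And>x y. P x \<Longrightarrow> P y \<Longrightarrow> P (x - y)"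
  shows "P z"
  using assms(1)[unfolded good_frags_def, simplified] assms(2) _ assms(4) by (rule frag_induction) (use assms(3) in auto)

lemma hsum_periodic: "z \<in> good_frags n \<Longrightarrow> hsum n z \<in> C'.periodic n"
  by (induction rule: good_frags_induct)
    (use C'.add_subgroup_periodic[of n] hval_periodic in \<open>auto simp: frag_extend_diff add_subgroup_def\<close>)

abbreviation "tens_null \<equiv> cyc_tensor_rel \<H> QC (CC \<H>)"

lemma add_subgroup_tens_null [simp]: "add_subgroup (tens_null n)"
  by (simp add: cyc_tensor_rel_def)

lemma cmod_X_act: "U \<in> cmod QC n \<Longrightarrow> cact QC n U h \<in> cmod QC n"
  by (auto simp: C.Q_cmod C.Q_act intro: C.act_periodic)

lemma cmod_X_plus: "U \<in> cmod QC n \<Longrightarrow> U' \<in> cmod QC n \<Longrightarrow> cplus QC n U U' \<in> cmod QC n"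
  by (auto simp: C.Q_cmod C.Q_plus intro: add_subgroup_add[OF C.add_subgroup_periodic])

lemma CC_cmod_chains: "V \<in> cmod (CC \<H>) n \<Longrightarrow> \<exists>\<omega>. \<omega> \<in> C'.chainsLS n \<and> V = C'.clLS n \<omega>"
  unfolding CC_def by (erule Q_cmodE) blast

lemma CC_plus_good: "V \<in> cmod (CC \<H>) n \<Longrightarrow> V' \<in> cmod (CC \<H>) n \<Longrightarrow> C'.good n (cplus (CC \<H>) n V V')"
  using CC_cmod_chains[of V n] CC_cmod_chains[of V' n] by (auto simp: C'.CC_plus intro!: C'.good_clLS chains_add)

lemma tens_null_good_frags: "z \<in> tens_null n \<Longrightarrow> z \<in> good_frags n"
  unfolding cyc_tensor_rel_def
proof (erule additive_span_least[OF _ add_subgroup_good_frags], safe, goal_cases)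
  case (1 z x x' y)
  then show ?case using add_subgroup_good_frags[of n] C'.CC_good[of y n] cmod_X_plus[of x n x'] unfolding add_subgroup_def
    by (metis frag_of_good_frags)
next
  case (2 z x y y')
  then show ?case using add_subgroup_good_frags[of n] C'.CC_good[of y n] C'.CC_good[of y' n] CC_plus_good[of y n y'] unfolding add_subgroup_def
    by (metis frag_of_good_frags)
next
  case (3 z x y l)
  then show ?case
    using add_subgroup_good_frags[of n] C'.CC_good[of y n] cmod_X_act[of x n] C'.good_act[of n y] unfolding add_subgroup_def
    by (metis frag_of_good_frags)
qed

text \<open>For each generating relation the corresponding identity of \<open>hpair\<close> places
  the difference of the values in \<open>enull\<close>. The values are periodic, hence so is the
  difference, which is therefore null.\<close>

lemma hsum_tens_null: "z \<in> tens_null n \<Longrightarrow> hsum n z \<in> C'.null n"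
  unfolding cyc_tensor_rel_def
proof (erule frag_extend_additive_span_mem[OF _ C'.add_subgroup_null], safe, goal_cases)
  case (1 s U U' V)
  obtain x x' where x: "x \<in> C.periodic n" "U = C.cl n x" "x' \<in> C.periodic n" "U' = C.cl n x'"
    using 1 by (auto simp: C.Q_cmod)
  note V = C'.CC_good[OF 1(3)]
  let ?\<omega> = "rep V"
  have xx: "x + x' \<in> C.periodic n" by (rule add_subgroup_add[OF C.add_subgroup_periodic x(1,3)])
  have "cong_mod (C'.enull n) (hval n (cplus QC n U U', V) - hval n (U, V) - hval n (U', V)) (hpair n (x + x') ?\<omega> - hpair n x ?\<omega> - hpair n x' ?\<omega>)"
    unfolding x C.Q_plus by (intro cong_mod_diff C'.add_subgroup_enull hval_eq x xx V rep_good[OF V])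
  then have "hval n (cplus QC n U U', V) - hval n (U, V) - hval n (U', V) \<in> C'.enull n"
    by (simp add: hpair_add_left good_chains[OF V rep_good[OF V]] cong_mod_zero_iff)
  moreover have "hval n (cplus QC n U U', V) - hval n (U, V) - hval n (U', V) \<in> C'.periodic n"
    using hval_periodic[OF cmod_X_plus[OF 1(1,2)] V] hval_periodic[OF 1(1) V] hval_periodic[OF 1(2) V] C'.add_subgroup_periodic[of n]
    unfolding add_subgroup_def by blast
  ultimately show ?case using C'.periodic_enull_null by (simp add: frag_extend_diff)
next
  case (2 s U V V')
  obtain x where x: "x \<in> C.periodic n" "U = C.cl n x" using 2 by (auto simp: C.Q_cmod)
  obtain \<omega> \<omega>' where \<omega>: "\<omega> \<in> C'.chainsLS n" "V = C'.clLS n \<omega>" "\<omega>' \<in> C'.chainsLS n" "V' = C'.clLS n \<omega>'"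
    using CC_cmod_chains 2 by metis
  have VV: "cplus (CC \<H>) n V V' = C'.clLS n (\<omega> + \<omega>')" unfolding \<omega> by (rule C'.CC_plus)
  have mem: "\<omega> \<in> V" "\<omega>' \<in> V'" "\<omega> + \<omega>' \<in> cplus (CC \<H>) n V V'"
    unfolding VV unfolding \<omega> by (auto intro: coset_self)
  have "cong_mod (C'.enull n) (hval n (U, cplus (CC \<H>) n V V') - hval n (U, V) - hval n (U, V')) (hpair n x (\<omega> + \<omega>') - hpair n x \<omega> - hpair n x \<omega>')"
    unfolding x by (intro cong_mod_diff C'.add_subgroup_enull hval_eq x mem C'.CC_good CC_plus_good 2)
  then have "hval n (U, cplus (CC \<H>) n V V') - hval n (U, V) - hval n (U, V') \<in> C'.enull n"
    by (simp add: hpair_add_right cong_mod_zero_iff)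
  moreover have "hval n (U, cplus (CC \<H>) n V V') - hval n (U, V) - hval n (U, V') \<in> C'.periodic n"
    using hval_periodic[OF 2(1) CC_plus_good[OF 2(2,3)]] hval_periodic[OF 2(1) C'.CC_good[OF 2(2)]] hval_periodic[OF 2(1) C'.CC_good[OF 2(3)]]
      C'.add_subgroup_periodic[of n]
    unfolding add_subgroup_def by blast
  ultimately show ?case using C'.periodic_enull_null by (simp add: frag_extend_diff)
next
  case (3 s U V l)
  obtain x where x: "x \<in> C.periodic n" "U = C.cl n x" using 3 by (auto simp: C.Q_cmod)
  note V = C'.CC_good[OF 3(2)]
  \<comment> \<open>Identifies the scalar acting on the left factor in the definition of the tensor
    product.\<close>
  have g: "tR \<H> (eR \<H> (sL \<H> l)) = sL \<H> l" by (rule C.units)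
  let ?\<omega> = "rep V"
  have \<omega>: "?\<omega> \<in> V" "?\<omega> \<in> C'.chainsLS n" using rep_good[OF V] good_chains[OF V] by auto
  have "cong_mod (C'.enull n) (hval n (cact QC n U (sL \<H> l), V)) (hpair n (C.act n x (sL \<H> l)) ?\<omega>)"
    unfolding x C.Q_act by (intro hval_eq C.act_periodic x V \<omega>)
  also have "cong_mod (C'.null n) \<dots> (hpair n x (C'.actLS n ?\<omega> (C'.lam l)))"
    by (rule hpair_balanced[OF C.periodic_chains[OF x(1)] \<omega>(2)])
  also have "cong_mod (C'.enull n) \<dots> (hval n (U, cact (CC \<H>) n V (C'.lam l)))"
    unfolding x by (rule C'.enull_sym[OF hval_eq[OF x(1) C'.good_act[OF V] C'.CC_mem(1)[OF \<omega>(1)]]])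
  finally have "cong_mod (C'.null n) (hval n (cact QC n U (sL \<H> l), V)) (hval n (U, cact (CC \<H>) n V (C'.lam l)))"
    by (rule C'.periodic_cong_null[OF hval_periodic[OF cmod_X_act[OF 3(1)] V] hval_periodic[OF 3(1) C'.good_act[OF V]]])
  then show ?case by (simp add: frag_extend_diff cong_mod_def g)
qed

section \<open>The induced map and the structure maps\<close>

definition hb :: "nat \<Rightarrow> (('o, 'f, 'm) chain set \<times> (nat, 'l, 'l) chain set \<Rightarrow>\<^sub>0 int) set \<Rightarrow> ('o1, 'f1, 'm) chain set" where
  "hb n = induced (graph_of (hsum n)) (C'.null n)"

abbreviation "QCC \<equiv> cyc_tensor \<H> QC (CC \<H>)"

lemma hsum_coset: "z' \<in> coset (tens_null n) z \<Longrightarrow> cong_mod (C'.null n) (hsum n z') (hsum n z)"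
  unfolding coset_mem_iff[OF add_subgroup_tens_null] cong_mod_def frag_extend_diff[symmetric] by (rule hsum_tens_null)

lemma hb_coset: "hb n (coset (tens_null n) z) = C'.cl n (hsum n z)"
  unfolding hb_def
  by (rule induced_eq_coset[OF C'.add_subgroup_null coset_self[OF add_subgroup_tens_null]]) (auto intro: hsum_coset)

lemma good_frags_coset: "z \<in> good_frags n \<Longrightarrow> z' \<in> coset (tens_null n) z \<Longrightarrow> z' \<in> good_frags n"
  using add_subgroup_add[OF add_subgroup_good_frags tens_null_good_frags, of "z' - z" n z] by (simp add: coset_mem_iff cong_mod_def)

text \<open>The common scheme for faces, rotation and action: \<open>f\<close> describes the
  operation on generators of the source and \<open>op\<close> the one on chains of the target.
  Agreement on generators modulo \<open>enull\<close> is enough, because \<open>op\<close> preserves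
  periodic chains and all values are periodic.\<close>

lemma hb_induced:
  assumes z: "z \<in> good_frags n"
    and f: "\<And>U V. U \<in> cmod QC n \<Longrightarrow> C'.good n V \<Longrightarrow> f (U, V) \<in> good_frags n'"
    and op_diff: "\<And>x y. op (x - y) = op x - op y"
    and op_cong: "\<And>x. x \<in> C'.null n \<Longrightarrow> op x \<in> C'.null n'"
    and op_periodic: "\<And>x. x \<in> C'.periodic n \<Longrightarrow> op x \<in> C'.periodic n'"
    and comm: "\<And>U V. U \<in> cmod QC n \<Longrightarrow> C'.good n V \<Longrightarrow> cong_mod (C'.enull n') (hsum n' (f (U, V))) (op (hval n (U, V)))"
  shows "hb n' (induced (graph_of (frag_extend f)) (tens_null n') (coset (tens_null n) z)) = C'.cl n' (op (hsum n z))"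
proof -
  have op0: "op 0 = 0" using op_diff[of 0 0] by simp
  have fZ: "frag_extend f z \<in> good_frags n'" if "z \<in> good_frags n" for z
    using that by (induction rule: good_frags_induct) (use f add_subgroup_good_frags[of n'] in \<open>auto simp: frag_extend_diff add_subgroup_def\<close>)
  have c: "cong_mod (C'.enull n') (hsum n' (frag_extend f z)) (op (hsum n z))" if "z \<in> good_frags n" for z
    using that by (induction rule: good_frags_induct)
      (use comm in \<open>auto simp: frag_extend_diff op_diff op0 intro: cong_mod_diff\<close>)
  have c': "cong_mod (C'.null n') (hsum n' (frag_extend f z')) (op (hsum n z))" if z': "z' \<in> coset (tens_null n) z" for z'
  proof -
    have zZ: "z' \<in> good_frags n" by (rule good_frags_coset[OF z z'])
    have "cong_mod (C'.null n') (hsum n' (frag_extend f z')) (op (hsum n z'))"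
      by (rule C'.periodic_cong_null[OF hsum_periodic[OF fZ[OF zZ]] op_periodic[OF hsum_periodic[OF zZ]] c[OF zZ]])
    also have "cong_mod (C'.null n') \<dots> (op (hsum n z))"
      using op_cong[of "hsum n z' - hsum n z"] hsum_coset[OF z'] by (simp add: cong_mod_def op_diff)
    finally show ?thesis .
  qed
  show ?thesis
    unfolding hb_def
  proof (rule induced_eq_coset[OF C'.add_subgroup_null])
    show "frag_extend f z \<in> induced (graph_of (frag_extend f)) (tens_null n') (coset (tens_null n) z)"
      by (rule induced_memI[OF coset_self]) auto
    show "(frag_extend f z, hsum n' (frag_extend f z)) \<in> graph_of (hsum n')" by simp
    fix x y assume "x \<in> induced (graph_of (frag_extend f)) (tens_null n') (coset (tens_null n) z)" "(x, y) \<in> graph_of (hsum n')"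
    then obtain z' where z': "z' \<in> coset (tens_null n) z" "cong_mod (tens_null n') x (frag_extend f z')" "y = hsum n' x"
      by (auto elim: induced_memE)
    then have "cong_mod (C'.null n') y (hsum n' (frag_extend f z'))" using hsum_coset by (simp add: coset_mem_iff)
    then show "cong_mod (C'.null n') y (op (hsum n z))" using c'[OF z'(1)] C'.null_trans by blast
  qed
qed

lemma QCC_cmodE:
  assumes "A \<in> cmod QCC n" obtains z where "z \<in> good_frags n" "A = coset (tens_null n) z"
proof -
  obtain z where "Poly_Mapping.keys z \<subseteq> cmod QC n \<times> cmod (CC \<H>) n" "A = coset (tens_null n) z"
    using assms by (auto simp: cyc_tensor_def Let_def)
  then show ?thesis using that C'.CC_good unfolding good_frags_def by blast
qed

lemma hb_face:
  assumes "z \<in> good_frags (Suc n)" "i \<le> Suc n"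
  shows "hb n (cface QCC (Suc n) i (coset (tens_null (Suc n)) z)) = cface QC' (Suc n) i (hb (Suc n) (coset (tens_null (Suc n)) z))"
proof -
  let ?f = "\<lambda>(x, y). frag_of (cface QC (Suc n) i x, cface (CC \<H>) (Suc n) i y)"
  let ?op = "if i \<le> n then C'.d (Suc n) i else (\<lambda>x. C'.d (Suc n) 0 (C'.\<tau> (Suc n) x))"
  have Qf: "cface QC (Suc n) i (C.cl (Suc n) x) = C.cl n (if i \<le> n then C.d (Suc n) i x else C.d (Suc n) 0 (C.\<tau> (Suc n) x))"
    if "x \<in> chains C (Suc n)" for x
    using C.Q_face[OF that, of i] C.Q_last_face[OF that] assms(2) by (auto simp: le_Suc_eq)
  have opp: "x \<in> C.periodic (Suc n) \<Longrightarrow> (if i \<le> n then C.d (Suc n) i x else C.d (Suc n) 0 (C.\<tau> (Suc n) x)) \<in> C.periodic n" for x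
    by (simp add: C.face_periodic C.tau_periodic)
  have "hb n (cface QCC (Suc n) i (coset (tens_null (Suc n)) z)) = hb n (induced (graph_of (frag_extend ?f)) (tens_null n) (coset (tens_null (Suc n)) z))"
    by (simp add: cyc_tensor_def Let_def)
  also have "\<dots> = C'.cl n (?op (hsum (Suc n) z))"
  proof (rule hb_induced[OF assms(1)])
    fix U V assume U: "U \<in> cmod QC (Suc n)" and V: "C'.good (Suc n) V"
    obtain x where x: "x \<in> C.periodic (Suc n)" "U = C.cl (Suc n) x" using U by (auto simp: C.Q_cmod)
    note xc = C.periodic_chains[OF x(1)]
    have U': "cface QC (Suc n) i U \<in> cmod QC n"
      unfolding x Qf[OF xc] C.Q_cmod using opp[OF x(1)] by blast
    then show "?f (U, V) \<in> good_frags n" using C'.good_face[OF V assms(2)] by simp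
    let ?\<omega> = "rep V"
    have \<omega>: "?\<omega> \<in> V" "?\<omega> \<in> C'.chainsLS (Suc n)" using rep_good[OF V] good_chains[OF V] by auto
    let ?x' = "rep U"
    have x': "?x' \<in> C.periodic (Suc n)" "U = C.cl (Suc n) ?x'" by (rule rep_cl[OF U])+
    note x'c = C.periodic_chains[OF x'(1)]
    have e: "hsum n (?f (U, V)) = hval n (C.cl n (if i \<le> n then C.d (Suc n) i ?x' else C.d (Suc n) 0 (C.\<tau> (Suc n) ?x')), cface (CC \<H>) (Suc n) i V)"
      using Qf[OF x'c] x'(2) by simp
    show "cong_mod (C'.enull n) (hsum n (?f (U, V))) (?op (hval (Suc n) (U, V)))"
    proof (cases "i \<le> n")
      case True
      have "cong_mod (C'.enull n) (hsum n (?f (U, V))) (hpair n (C.d (Suc n) i ?x') (C'.dLS (Suc n) i ?\<omega>))"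
        unfolding e using True opp[OF x'(1)]
        by (auto intro!: hval_eq C'.good_face[OF V assms(2)] C'.CC_mem(2)[OF \<omega>(1)])
      also have "cong_mod (C'.null n) \<dots> (C'.d (Suc n) i (hpair (Suc n) ?x' ?\<omega>))"
        by (rule hpair_face[OF x'c \<omega>(2) True])
      finally show ?thesis using True by (simp add: hval_def)
    next
      case False
      then have i: "i = Suc n" using assms(2) by simp
      \<comment> \<open>The last face is \<open>d_0 \<tau>\<close> on both factors, so this case
        combines the one of \<open>d_0\<close> with that of the rotation.\<close>
      have "cong_mod (C'.enull n) (hsum n (?f (U, V)))
         (hpair n (C.d (Suc n) 0 (C.\<tau> (Suc n) ?x')) (C'.dLS (Suc n) 0 (C'.tauLS (Suc n) ?\<omega>)))"
        unfolding e using False opp[OF x'(1)] C'.CC_mem(3)[OF \<omega>] C'.good_face[OF V assms(2)]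
        by (auto intro!: hval_eq simp: i)
      also have "cong_mod (C'.null n) \<dots> (C'.d (Suc n) 0 (hpair (Suc n) (C.\<tau> (Suc n) ?x') (C'.tauLS (Suc n) ?\<omega>)))"
        by (rule hpair_face[OF C.tau_chains[OF x'c] closed_cat.tau_chains[OF closed_cat_LS \<omega>(2)]]) simp
      also have "cong_mod (C'.enull n) \<dots> (C'.d (Suc n) 0 (C'.\<tau> (Suc n) (hpair (Suc n) ?x' ?\<omega>)))"
        by (rule C'.face_enull_cong[OF _ hpair_tau[OF x'c \<omega>(2)]]) simp
      finally show ?thesis using False by (simp add: hval_def)
    qed
  next
    fix x assume "x \<in> C'.null (Suc n)"
    then show "?op x \<in> C'.null n" by (simp add: C'.face_null C'.tau_null)
  next
    fix x assume "x \<in> C'.periodic (Suc n)"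
    then show "?op x \<in> C'.periodic n" by (simp add: C'.face_periodic C'.tau_periodic)
  qed (simp add: C'.d_diff C'.tau_diff)
  also have "\<dots> = cface QC' (Suc n) i (hb (Suc n) (coset (tens_null (Suc n)) z))"
    unfolding hb_coset using C'.Q_face[OF C'.periodic_chains[OF hsum_periodic[OF assms(1)]], of i]
      C'.Q_last_face[OF C'.periodic_chains[OF hsum_periodic[OF assms(1)]]] assms(2) by (auto simp: le_Suc_eq)
  finally show ?thesis .
qed

lemma hb_cyc:
  assumes "z \<in> good_frags n"
  shows "hb n (ccyc QCC n (coset (tens_null n) z)) = ccyc QC' n (hb n (coset (tens_null n) z))"
proof -
  let ?f = "\<lambda>(x, y). frag_of (ccyc QC n x, ccyc (CC \<H>) n y)"
  have "hb n (ccyc QCC n (coset (tens_null n) z)) = hb n (induced (graph_of (frag_extend ?f)) (tens_null n) (coset (tens_null n) z))"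
    by (simp add: cyc_tensor_def Let_def)
  also have "\<dots> = C'.cl n (C'.\<tau> n (hsum n z))"
  proof (rule hb_induced[OF assms])
    fix U V assume U: "U \<in> cmod QC n" and V: "C'.good n V"
    let ?x = "rep U" and ?\<omega> = "rep V"
    have x: "?x \<in> C.periodic n" "U = C.cl n ?x" by (rule rep_cl[OF U])+
    note xc = C.periodic_chains[OF x(1)]
    have \<omega>: "?\<omega> \<in> V" "?\<omega> \<in> C'.chainsLS n" using rep_good[OF V] good_chains[OF V] by auto
    have e: "ccyc QC n U = C.cl n (C.\<tau> n ?x)" using C.Q_cyc[OF xc] x(2) by simp
    then show "?f (U, V) \<in> good_frags n" using C'.good_cyc[OF V] C.tau_periodic[OF x(1)] by (simp add: C.Q_cmod)
    have "cong_mod (C'.enull n) (hsum n (?f (U, V))) (hpair n (C.\<tau> n ?x) (C'.tauLS n ?\<omega>))"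
      using hval_eq[OF C.tau_periodic[OF x(1)] C'.good_cyc[OF V] C'.CC_mem(4)[OF \<omega>]] e by simp
    also have "cong_mod (C'.enull n) \<dots> (C'.\<tau> n (hpair n ?x ?\<omega>))" by (rule hpair_tau[OF xc \<omega>(2)])
    finally show "cong_mod (C'.enull n) (hsum n (?f (U, V))) (C'.\<tau> n (hval n (U, V)))" by (simp add: hval_def)
  qed (simp_all add: C'.tau_diff C'.tau_null C'.tau_periodic)
  also have "\<dots> = ccyc QC' n (hb n (coset (tens_null n) z))"
    unfolding hb_coset by (rule C'.Q_cyc[OF C'.periodic_chains[OF hsum_periodic[OF assms]], symmetric])
  finally show ?thesis .
qed

lemma hb_act:
  assumes "z \<in> good_frags n"
  shows "hb n (cact QCC n (coset (tens_null n) z) h) = cact QC' n (hb n (coset (tens_null n) z)) h"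
proof -
  let ?f = "\<lambda>(x, y). \<Sum>(a, b)\<leftarrow>DR \<H> h. frag_of (cact QC n x b, cact (CC \<H>) n y a)"
  have "hb n (cact QCC n (coset (tens_null n) z) h) = hb n (induced (graph_of (frag_extend ?f)) (tens_null n) (coset (tens_null n) z))"
    by (simp add: cyc_tensor_def Let_def)
  also have "\<dots> = C'.cl n (C'.act n (hsum n z) h)"
  proof (rule hb_induced[OF assms])
    fix U V assume U: "U \<in> cmod QC n" and V: "C'.good n V"
    let ?x = "rep U" and ?\<omega> = "rep V"
    have x: "?x \<in> C.periodic n" "U = C.cl n ?x" by (rule rep_cl[OF U])+
    note xc = C.periodic_chains[OF x(1)]
    have \<omega>: "?\<omega> \<in> V" "?\<omega> \<in> C'.chainsLS n" using rep_good[OF V] good_chains[OF V] by auto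
    show "?f (U, V) \<in> good_frags n"
      by (auto intro!: add_subgroup_sum_list[OF add_subgroup_good_frags] simp: cmod_X_act[OF U] C'.good_act[OF V])
    have e: "cact QC n U b = C.cl n (C.act n ?x b)" for b using C.Q_act[of n ?x b] x(2) by simp
    have "cong_mod (C'.enull n) (hsum n (?f (U, V))) (\<Sum>(g, y)\<leftarrow>DR \<H> h. hpair n (C.act n ?x y) (C'.actLS n ?\<omega> g))"
      unfolding prod.case frag_extend_sum_list case_prod_unfold prod.sel frag_extend_of e
      by (intro cong_mod_sum_list C'.add_subgroup_enull hval_eq C.act_periodic x C'.good_act[OF V] C'.CC_mem(1)[OF \<omega>(1)])
    also have "cong_mod (C'.null n) \<dots> (C'.act n (hpair n ?x ?\<omega>) h)" by (rule hpair_act[OF xc \<omega>(2)])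
    finally show "cong_mod (C'.enull n) (hsum n (?f (U, V))) (C'.act n (hval n (U, V)) h)" by (simp add: hval_def)
  qed (simp_all add: C'.act_diff C'.act_null C'.act_periodic)
  also have "\<dots> = cact QC' n (hb n (coset (tens_null n) z)) h"
    unfolding hb_coset by (rule C'.Q_act[symmetric])
  finally show ?thesis .
qed

lemma hb_semicyclic: "semicyclic_map QCC QC' hb"
  unfolding semicyclic_map_def
proof (intro conjI allI ballI impI)
  fix n A assume "A \<in> cmod QCC n"
  then obtain z where z: "z \<in> good_frags n" "A = coset (tens_null n) z" by (rule QCC_cmodE)
  show "hb n A \<in> cmod QC' n" unfolding z hb_coset C'.Q_cmod using hsum_periodic[OF z(1)] by blast
  show "hb n (cact QCC n A h) = cact QC' n (hb n A) h" for h unfolding z(2) by (rule hb_act[OF z(1)])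
  show "hb n (ccyc QCC n A) = ccyc QC' n (hb n A)" unfolding z(2) by (rule hb_cyc[OF z(1)])
  fix B assume "B \<in> cmod QCC n"
  then obtain z' where z': "z' \<in> good_frags n" "B = coset (tens_null n) z'" by (rule QCC_cmodE)
  have "cplus QCC n A B = coset (tens_null n) (z + z')"
    using coset_plus[OF add_subgroup_tens_null] unfolding z z' by (simp add: cyc_tensor_def Let_def)
  then show "hb n (cplus QCC n A B) = cplus QC' n (hb n A) (hb n B)"
    unfolding z z' hb_coset C'.Q_plus by (simp add: hb_coset frag_extend_add)
next
  fix n i A assume i: "i \<le> Suc n" and "A \<in> cmod QCC (Suc n)"
  then obtain z where z: "z \<in> good_frags (Suc n)" "A = coset (tens_null (Suc n)) z" by (blast elim: QCC_cmodE)
  show "hb n (cface QCC (Suc n) i A) = cface QC' (Suc n) i (hb (Suc n) A)"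
    unfolding z(2) by (rule hb_face[OF z(1) i])
qed

text \<open>In the tuple of identities all labels and the coefficient are \<open>1\<close>, so only
  the action of \<open>sL 1 = 1\<close> on the image over the constant sequence remains.\<close>

lemma hb_eps:
  assumes "i \<in> {0, 1}" "x \<in> C.periodic n"
  shows "hb n (eps \<H> QC i n (C.cl n x)) = C'.cl n (hmap n (replicate (Suc n) i) x)"
proof -
  let ?\<sigma> = "(replicate (Suc n) i, replicate (Suc n) (Idm (LS \<H>) i), 1 :: 'l)"
  have \<sigma>: "frag_of ?\<sigma> \<in> C'.chainsLS n" using assms(1) by (auto simp: tensors_LS)
  have id: "id_tuple \<H> i n = C'.clLS n (frag_of ?\<sigma>)" by (simp add: id_tuple_def)
  have V: "C'.good n (id_tuple \<H> i n)" unfolding id by (rule C'.good_clLS[OF \<sigma>])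
  have U: "C.cl n x \<in> cmod QC n" using assms(2) by (auto simp: C.Q_cmod)
  have one: "prod_list (replicate m (1::'l)) = 1" for m by (induction m) simp_all
  have "hb n (eps \<H> QC i n (C.cl n x)) = C'.cl n (hval n (C.cl n x, id_tuple \<H> i n))"
    unfolding eps_def hb_coset by simp
  also have "\<dots> = C'.cl n (hmap n (replicate (Suc n) i) x)"
  proof (unfold C'.cl_eq_iff, rule C'.periodic_cong_null)
    show "hval n (C.cl n x, id_tuple \<H> i n) \<in> C'.periodic n" by (rule hval_periodic[OF U V])
    show "hmap n (replicate (Suc n) i) x \<in> C'.periodic n" by (rule hmap_periodic[OF assms(2)]) simp
    have "cong_mod (C'.enull n) (hval n (C.cl n x, id_tuple \<H> i n)) (hpair n x (frag_of ?\<sigma>))"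
      by (rule hval_eq[OF assms(2) V]) (simp add: id coset_self)
    also have "hpair n x (frag_of ?\<sigma>) = C'.act n (hmap n (replicate (Suc n) i) x) 1"
      unfolding hpair_def C'.pairing_frag_of LS_simps one by (simp only: mult_1_right C.sL_hom)
    also have "cong_mod (C'.null n) \<dots> (hmap n (replicate (Suc n) i) x)"
      by (rule C'.act_one[OF hmap_chains[OF C.periodic_chains[OF assms(2)]]])
    finally show "cong_mod (C'.enull n) (hval n (C.cl n x, id_tuple \<H> i n)) (hmap n (replicate (Suc n) i) x)" .
  qed
  finally show ?thesis .
qed

lemma rot_replicate: "rot (replicate (Suc n) c) = replicate (Suc n) c"
  by (simp add: replicate_append_same[symmetric] del: replicate_append_same)

lemma skip_replicate: "i \<le> n \<Longrightarrow> skip i (replicate (Suc (Suc n)) c) = replicate (Suc n) c"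
  by (simp add: min_def flip: replicate_Suc replicate_add)

text \<open>A constant index sequence is fixed by \<open>rot\<close> and, up to its length, by
  \<open>skip\<close>; over it the compatibilities of \<open>hmap\<close> with rotations and faces
  involve one and the same map.\<close>

lemma semicyclic_hmap:
  assumes \<phi>: "\<And>n x. x \<in> C.periodic n \<Longrightarrow> \<phi> n (C.cl n x) = C'.cl n (hmap n (replicate (Suc n) c) x)"
  shows "semicyclic_map QC QC' \<phi>"
  unfolding semicyclic_map_def
proof (intro conjI allI ballI impI)
  fix n U assume "U \<in> cmod QC n"
  then obtain x where x: "x \<in> C.periodic n" "U = C.cl n x" by (auto simp: C.Q_cmod)
  note xc = C.periodic_chains[OF x(1)]
  have hp: "hmap n (replicate (Suc n) c) x \<in> C'.periodic n" by (rule hmap_periodic[OF x(1)]) simp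
  show "\<phi> n U \<in> cmod QC' n" unfolding x(2) \<phi>[OF x(1)] C'.Q_cmod using hp by blast
  show "\<phi> n (cact QC n U h) = cact QC' n (\<phi> n U) h" for h
    unfolding x(2) C.Q_act \<phi>[OF x(1)] C'.Q_act \<phi>[OF C.act_periodic[OF x(1)]] hmap_act[OF xc] ..
  show "\<phi> n (ccyc QC n U) = ccyc QC' n (\<phi> n U)"
    unfolding x(2) C.Q_cyc[OF xc] \<phi>[OF x(1)] C'.Q_cyc[OF C'.periodic_chains[OF hp]] \<phi>[OF C.tau_periodic[OF x(1)]] C'.cl_eq_iff
    using hmap_tau[OF xc, of "replicate (Suc n) c"] unfolding rot_replicate by simp
  fix U' assume "U' \<in> cmod QC n"
  then obtain x' where x': "x' \<in> C.periodic n" "U' = C.cl n x'" by (auto simp: C.Q_cmod)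
  show "\<phi> n (cplus QC n U U') = cplus QC' n (\<phi> n U) (\<phi> n U')"
    unfolding x(2) x'(2) C.Q_plus \<phi>[OF x(1)] \<phi>[OF x'(1)] C'.Q_plus
      \<phi>[OF add_subgroup_add[OF C.add_subgroup_periodic x(1) x'(1)]] frag_extend_add ..
next
  fix n i U assume i: "i \<le> Suc n" and "U \<in> cmod QC (Suc n)"
  then obtain x where x: "x \<in> C.periodic (Suc n)" "U = C.cl (Suc n) x" by (auto simp: C.Q_cmod)
  note xc = C.periodic_chains[OF x(1)]
  let ?r = "replicate (Suc n) c" and ?R = "replicate (Suc (Suc n)) c"
  have hp: "hmap (Suc n) ?R x \<in> C'.periodic (Suc n)" by (rule hmap_periodic[OF x(1)]) simp
  have f: "hmap n ?r (C.d (Suc n) j y) = C'.d (Suc n) j (hmap (Suc n) ?R y)" if "j \<le> n" "y \<in> chains C (Suc n)" for j y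
    using hmap_face[OF that(2,1), of ?R] unfolding skip_replicate[OF that(1)] by simp
  show "\<phi> n (cface QC (Suc n) i U) = cface QC' (Suc n) i (\<phi> (Suc n) U)"
  proof (cases "i \<le> n")
    case True
    show ?thesis
      unfolding x(2) C.Q_face[OF xc True] \<phi>[OF x(1)] C'.Q_face[OF C'.periodic_chains[OF hp] True]
        \<phi>[OF C.face_periodic[OF x(1) True]] f[OF True xc] ..
  next
    case False
    then have i: "i = Suc n" using i by simp
    have "cong_mod (C'.null n) (C'.d (Suc n) 0 (hmap (Suc n) ?R (C.\<tau> (Suc n) x))) (C'.d (Suc n) 0 (C'.\<tau> (Suc n) (hmap (Suc n) ?R x)))"
      using hmap_tau[OF xc, of ?R] unfolding rot_replicate by (intro C'.face_cong) auto
    then show ?thesis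
      unfolding i x(2) C.Q_last_face[OF xc] \<phi>[OF x(1)] C'.Q_last_face[OF C'.periodic_chains[OF hp]]
        \<phi>[OF C.face_periodic[OF C.tau_periodic[OF x(1)] le0]] f[OF le0 C.tau_chains[OF xc]] C'.cl_eq_iff .
  qed
qed

lemma special_homotopic_hmap:
  assumes \<phi>: "\<And>n x. x \<in> C.periodic n \<Longrightarrow> \<phi> n (C.cl n x) = C'.cl n (hmap n (replicate (Suc n) 0) x)"
    and \<psi>: "\<And>n x. x \<in> C.periodic n \<Longrightarrow> \<psi> n (C.cl n x) = C'.cl n (hmap n (replicate (Suc n) 1) x)"
  shows "special_homotopic \<H> QC QC' \<phi> \<psi>"
  unfolding special_homotopic_def
  using semicyclic_hmap[OF \<phi>] semicyclic_hmap[OF \<psi>] hb_semicyclic hb_eps \<phi> \<psi>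
  by (auto simp: C.Q_cmod intro!: exI[of _ hb])

lemma Q_map_eq:
  assumes F: "\<And>X. X \<in> Ob C \<Longrightarrow> FOb F X = KO c X"
    "\<And>X Y f. X \<in> Ob C \<Longrightarrow> Y \<in> Ob C \<Longrightarrow> f \<in> Hom C X Y \<Longrightarrow> FMap F X Y f = KM c c X Y f"
    and x: "x \<in> C.periodic n"
  shows "Q_map \<H> C' M F n (C.cl n x) = C'.cl n (hmap n (replicate (Suc n) c) x)"
proof -
  have cm: "chain_map F n y = hmap n (replicate (Suc n) c) y" if "y \<in> chains C n" for y
    unfolding chain_map_def
  proof (rule frag_extend_chains_eq[OF that])
    fix \<sigma> :: "'o list \<times> 'f list \<times> 'm" assume \<sigma>: "\<sigma> \<in> tensors C n"
    obtain Xs fs m where s: "\<sigma> = (Xs, fs, m)" by (cases \<sigma>)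
    have T: "(Xs, fs, m) \<in> tensors C n" using \<sigma> s by simp
    have r: "replicate (Suc n) c ! i = c" "src n (replicate (Suc n) c) i = c" if "i \<le> n" for i
      using that by (simp_all add: src_def less_Suc_eq_le del: replicate.simps)
    have "map (FOb F) Xs = map (\<lambda>i. KO (replicate (Suc n) c ! i) (Xs ! i)) [0..<Suc n]"
      using T F(1) C.tensors_Ob[OF T]
      by (intro nth_equalityI) (auto simp: tensors_def nth_map_upt' r simp del: upt_Suc replicate.simps)
    moreover have "map (\<lambda>i. FMap F (src n Xs i) (Xs ! i) (fs ! i)) [0..<Suc n] =
        map (\<lambda>i. KM (src n (replicate (Suc n) c) i) (replicate (Suc n) c ! i) (src n Xs i) (Xs ! i) (fs ! i)) [0..<Suc n]"
      using F(2) C.tensors_Ob[OF T] C.tensors_hom[OF T]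
      by (intro map_cong refl) (auto simp: r less_Suc_eq_le simp del: upt_Suc replicate.simps)
    ultimately show "(case \<sigma> of (Xs, fs, m) \<Rightarrow> frag_of (map (FOb F) Xs, map (\<lambda>i. FMap F (src n Xs i) (Xs ! i) (fs ! i)) [0..<Suc n], m))
        = (frag_of \<circ> hsimplex n (replicate (Suc n) c)) \<sigma>"
      by (simp only: s prod.case comp_apply hsimplex_def)
  qed
  note xc = C.periodic_chains[OF x]
  show ?thesis
    unfolding Q_map_def
  proof (rule induced_eq_coset[OF C'.add_subgroup_null coset_self[OF C.add_subgroup_null]])
    show "(x, chain_map F n x) \<in> graph_of (chain_map F n)" by simp
    fix x' y assume a: "x' \<in> C.cl n x" "(x', y) \<in> graph_of (chain_map F n)"
    have "y = hmap n (replicate (Suc n) c) x'" using a(2) cm[OF C.cls_chains[OF xc a(1)]] by simp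
    then show "cong_mod (C'.null n) y (hmap n (replicate (Suc n) c) x)"
      using hmap_cong[of n x' x "replicate (Suc n) c"] a(1) by (simp only: coset_mem_iff C.add_subgroup_null length_replicate)
  qed
qed

end

section \<open>The cylinder functor of an equivalence\<close>

context hcat_coeff
begin

lemma Act_sum_list: "X \<in> Ob C \<Longrightarrow> Y \<in> Ob C \<Longrightarrow> g \<in> Hom C X Y \<Longrightarrow>
    Act C X Y (\<Sum>p\<leftarrow>ps. f p) g = (\<Sum>p\<leftarrow>ps. Act C X Y (f p) g)"
proof (induction ps)
  case Nil
  then show ?case using Act_add(2)[of X Y g 0 0] by simp
qed (simp add: Act_add)

lemma Comp_zero: "X \<in> Ob C \<Longrightarrow> Y \<in> Ob C \<Longrightarrow> Z \<in> Ob C \<Longrightarrow> f \<in> Hom C Y Z \<Longrightarrow> Comp C X Y Z f 0 = 0"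
  "X \<in> Ob C \<Longrightarrow> Y \<in> Ob C \<Longrightarrow> Z \<in> Ob C \<Longrightarrow> g \<in> Hom C X Y \<Longrightarrow> Comp C X Y Z 0 g = 0"
  using Comp_add(2)[of X Y Z f 0 0] Comp_add(1)[of X Y Z 0 0 g] Hom_subgroup(1) by simp_all

lemma Hom_sum_list: "X \<in> Ob C \<Longrightarrow> Y \<in> Ob C \<Longrightarrow> (\<And>p. f p \<in> Hom C X Y) \<Longrightarrow> (\<Sum>p\<leftarrow>ps. f p) \<in> Hom C X Y"
  by (induction ps) (auto simp: Hom_subgroup Hom_plus)

lemma Comp_sum_list:
  assumes "X \<in> Ob C" "Y \<in> Ob C" "Z \<in> Ob C"
  shows "f \<in> Hom C Y Z \<Longrightarrow> (\<And>p. g p \<in> Hom C X Y) \<Longrightarrow> Comp C X Y Z f (\<Sum>p\<leftarrow>ps. g p) = (\<Sum>p\<leftarrow>ps. Comp C X Y Z f (g p))"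
    and "(\<And>p. k p \<in> Hom C Y Z) \<Longrightarrow> e \<in> Hom C X Y \<Longrightarrow> Comp C X Y Z (\<Sum>p\<leftarrow>ps. k p) e = (\<Sum>p\<leftarrow>ps. Comp C X Y Z (k p) e)"
  using assms by (induction ps) (simp_all add: Comp_zero Comp_add Hom_sum_list)

text \<open>Invariance replaces the action of the first factor of \<open>DL h\<close> on
  \<open>\<eta>\<close> by that of its \<open>tL\<close>-scalar. Balancedness of the composition
  carries this to the other factor as \<open>sL (eL x) * y\<close>, and these elements sum to
  \<open>h\<close>.\<close>

lemma Act_invariant_Comp:
  assumes ob: "W \<in> Ob C" "X \<in> Ob C" "Y \<in> Ob C" and \<eta>: "\<eta> \<in> Hom C X Y" "h_invariant \<H> C X Y \<eta>"
    and g: "g \<in> Hom C W X"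
  shows "Act C W Y h (Comp C W X Y \<eta> g) = Comp C W X Y \<eta> (Act C W X h g)"
proof -
  have "Act C W Y h (Comp C W X Y \<eta> g) = (\<Sum>p\<leftarrow>DL \<H> h. Comp C W X Y (Act C X Y (fst p) \<eta>) (Act C W X (snd p) g))"
    using Act_Comp[OF ob \<eta>(1) g tens_eq_refl, of h] by (simp add: case_prod_unfold)
  also have "\<dots> = (\<Sum>p\<leftarrow>DL \<H> h. Comp C W X Y \<eta> (Act C W X (sL \<H> (eL \<H> (fst p)) * snd p) g))"
  proof (rule arg_cong[of _ _ sum_list], rule map_cong[OF refl])
    fix p :: "'h \<times> 'h"
    have "Act C X Y (fst p) \<eta> = Act C X Y (tL \<H> (eL \<H> (fst p))) \<eta>" using \<eta>(2) unfolding h_invariant_def by blast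
    then show "Comp C W X Y (Act C X Y (fst p) \<eta>) (Act C W X (snd p) g) = Comp C W X Y \<eta> (Act C W X (sL \<H> (eL \<H> (fst p)) * snd p) g)"
      using ob \<eta> g by (simp add: Comp_balanced Act_Hom Act_mult)
  qed
  also have "\<dots> = Comp C W X Y \<eta> (Act C W X h g)"
    using ob \<eta> g eL_counit(1)[of h] by (simp add: Comp_sum_list(1)[symmetric] Act_sum_list[symmetric] Act_Hom case_prod_unfold)
  finally show ?thesis .
qed

lemma Act_Comp_invariant:
  assumes ob: "X \<in> Ob C" "Y \<in> Ob C" "Z \<in> Ob C" and \<eta>: "\<eta> \<in> Hom C X Y" "h_invariant \<H> C X Y \<eta>"
    and g: "g \<in> Hom C Y Z"
  shows "Act C X Z h (Comp C X Y Z g \<eta>) = Comp C X Y Z (Act C Y Z h g) \<eta>"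
proof -
  have "Act C X Z h (Comp C X Y Z g \<eta>) = (\<Sum>p\<leftarrow>DL \<H> h. Comp C X Y Z (Act C Y Z (fst p) g) (Act C X Y (snd p) \<eta>))"
    using Act_Comp[OF ob g \<eta>(1) tens_eq_refl, of h] by (simp add: case_prod_unfold)
  also have "\<dots> = (\<Sum>p\<leftarrow>DL \<H> h. Comp C X Y Z (Act C Y Z (tL \<H> (eL \<H> (snd p)) * fst p) g) \<eta>)"
  proof (rule arg_cong[of _ _ sum_list], rule map_cong[OF refl])
    fix p :: "'h \<times> 'h"
    have "Act C X Y (snd p) \<eta> = Act C X Y (sL \<H> (eL \<H> (snd p))) \<eta>" using \<eta>(2) unfolding h_invariant_def by blast
    then show "Comp C X Y Z (Act C Y Z (fst p) g) (Act C X Y (snd p) \<eta>) = Comp C X Y Z (Act C Y Z (tL \<H> (eL \<H> (snd p)) * fst p) g) \<eta>"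
      using ob \<eta> g by (simp add: Comp_balanced Act_Hom Act_mult)
  qed
  also have "\<dots> = Comp C X Y Z (Act C Y Z h g) \<eta>"
    using ob \<eta> g eL_counit(2)[of h] by (simp add: Comp_sum_list(2)[symmetric] Act_sum_list[symmetric] Act_Hom case_prod_unfold)
  finally show ?thesis .
qed

text \<open>Equivariance is transferred from \<open>\<eta>\<close> to its inverse by cancellation.
  For \<open>u = g \<theta>\<close> one has \<open>u \<eta> = g\<close>, hence
  \<open>(h u) \<eta> = h g\<close> by \<open>Act_Comp_invariant\<close>; composing with
  \<open>\<theta>\<close> gives \<open>h u = (h g) \<theta>\<close>.\<close>

lemma Act_Comp_inverse:
  assumes ob: "X \<in> Ob C" "Y \<in> Ob C" "Z \<in> Ob C" and \<eta>: "\<eta> \<in> Hom C X Y" "h_invariant \<H> C X Y \<eta>"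
    and \<theta>: "\<theta> \<in> Hom C Y X" "Comp C X Y X \<theta> \<eta> = Idm C X" "Comp C Y X Y \<eta> \<theta> = Idm C Y"
    and g: "g \<in> Hom C X Z"
  shows "Act C Y Z h (Comp C Y X Z g \<theta>) = Comp C Y X Z (Act C X Z h g) \<theta>"
proof -
  let ?u = "Comp C Y X Z g \<theta>"
  have u: "?u \<in> Hom C Y Z" using ob \<theta> g by (intro Comp_Hom)
  have "Act C Y Z h ?u = Comp C Y Y Z (Act C Y Z h ?u) (Comp C Y X Y \<eta> \<theta>)"
    using ob u by (simp add: \<theta> Comp_Id Act_Hom)
  also have "\<dots> = Comp C Y X Z (Comp C X Y Z (Act C Y Z h ?u) \<eta>) \<theta>"
    using ob u \<eta> \<theta> by (simp add: Comp_assoc Act_Hom)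
  also have "Comp C X Y Z (Act C Y Z h ?u) \<eta> = Act C X Z h (Comp C X Y Z ?u \<eta>)"
    by (rule Act_Comp_invariant[OF ob \<eta> u, symmetric])
  also have "Comp C X Y Z ?u \<eta> = g" using ob \<eta> \<theta> g by (simp add: Comp_assoc Comp_Id)
  finally show ?thesis .
qed

end

section \<open>Transport along the natural isomorphism\<close>

locale equivalence =
  C: hcat_coeff \<H> C M + C': hcat_coeff \<H> C' M + F: equivariant_functor C C' F + G: equivariant_functor C C' G
  for \<H> :: "('k::comm_ring_1, 'l::{ring,monoid_mult}, 'r::{ring,monoid_mult},
      'h::{ring,monoid_mult}) hopf_data"
    and C :: "('o, 'f::ab_group_add, 'h) hcat"
    and C' :: "('o1, 'f1::ab_group_add, 'h) hcat"
    and M :: "('r, 'h, 'm::ab_group_add) coeff"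
    and F G :: "('o, 'f, 'o1, 'f1) hfunctor" +
  fixes \<eta> \<theta> :: "'o \<Rightarrow> 'f1"
  assumes \<eta>: "X \<in> Ob C \<Longrightarrow> \<eta> X \<in> Hom C' (FOb F X) (FOb G X)"
      "X \<in> Ob C \<Longrightarrow> h_invariant \<H> C' (FOb F X) (FOb G X) (\<eta> X)"
    and \<theta>: "X \<in> Ob C \<Longrightarrow> \<theta> X \<in> Hom C' (FOb G X) (FOb F X)"
      "X \<in> Ob C \<Longrightarrow> Comp C' (FOb F X) (FOb G X) (FOb F X) (\<theta> X) (\<eta> X) = Idm C' (FOb F X)"
      "X \<in> Ob C \<Longrightarrow> Comp C' (FOb G X) (FOb F X) (FOb G X) (\<eta> X) (\<theta> X) = Idm C' (FOb G X)"
    and natural: "\<lbrakk>X \<in> Ob C; Y \<in> Ob C; f \<in> Hom C X Y\<rbrakk> \<Longrightarrow>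
        Comp C' (FOb F X) (FOb F Y) (FOb G Y) (\<eta> Y) (FMap F X Y f) =
        Comp C' (FOb F X) (FOb G X) (FOb G Y) (FMap G X Y f) (\<eta> X)"
begin

text \<open>Every index other than \<open>0\<close> stands for the object \<open>1\<close> of
  \<open>\<S>\<close>, so that the functor is defined over all sequences of natural numbers, as the
  families in \<open>pairing\<close> are.\<close>

definition "KO a X = (if a = (0::nat) then FOb F X else FOb G X)"
definition "trans_to a X = (if a = (0::nat) then Idm C' (FOb F X) else \<eta> X)"
definition "trans_from a X = (if a = (0::nat) then Idm C' (FOb F X) else \<theta> X)"
text \<open>\<open>F\<close> transported along the isomorphisms from \<open>F X\<close> to the
  object of index \<open>a\<close>: the identity for \<open>0\<close> and \<open>\<eta> X\<close>
  otherwise. Functoriality is cancellation of an inverse pair in the middle, and for indices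
  \<open>1\<close>, \<open>1\<close> naturality turns \<open>\<eta> F(f) \<theta>\<close> into
  \<open>G(f)\<close>.\<close>

definition "KM b a X Y f = Comp C' (KO b X) (FOb F Y) (KO a Y) (trans_to a Y)
  (Comp C' (KO b X) (FOb F X) (FOb F Y) (FMap F X Y f) (trans_from b X))"

lemma KO_in [simp]: "X \<in> Ob C \<Longrightarrow> KO a X \<in> Ob C'"
  by (simp add: KO_def F.FOb G.FOb)

lemma trans_in:
  assumes "X \<in> Ob C"
  shows "trans_to a X \<in> Hom C' (FOb F X) (KO a X)" "trans_from a X \<in> Hom C' (KO a X) (FOb F X)"
    "h_invariant \<H> C' (FOb F X) (KO a X) (trans_to a X)"
    "Comp C' (FOb F X) (KO a X) (FOb F X) (trans_from a X) (trans_to a X) = Idm C' (FOb F X)"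
    "Comp C' (KO a X) (FOb F X) (KO a X) (trans_to a X) (trans_from a X) = Idm C' (KO a X)"
proof -
  have ob: "FOb F X \<in> Ob C'" using assms by (rule F.FOb)
  note id = C'.Id_Hom[OF ob]
  have inv: "h_invariant \<H> C' (FOb F X) (FOb F X) (Idm C' (FOb F X))"
    unfolding h_invariant_def using C'.Act_Id[OF ob] by blast
  show "trans_to a X \<in> Hom C' (FOb F X) (KO a X)" "trans_from a X \<in> Hom C' (KO a X) (FOb F X)"
    "h_invariant \<H> C' (FOb F X) (KO a X) (trans_to a X)"
    "Comp C' (FOb F X) (KO a X) (FOb F X) (trans_from a X) (trans_to a X) = Idm C' (FOb F X)"
    "Comp C' (KO a X) (FOb F X) (KO a X) (trans_to a X) (trans_from a X) = Idm C' (KO a X)"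
    unfolding KO_def trans_to_def trans_from_def
    using id inv C'.Comp_Id(1)[OF ob ob id] \<eta>[OF assms] \<theta>[OF assms] by (cases "a = 0"; simp)+
qed

sublocale cylinder_functor \<H> C C' M KO KM
proof
  fix X Y f a b assume X: "X \<in> Ob C" and Y: "Y \<in> Ob C" and f: "f \<in> Hom C X Y"
  note tX = trans_in[OF X] and tY = trans_in[OF Y] and Ff = F.FMap_Hom[OF X Y f]
  have ob: "FOb F X \<in> Ob C'" "FOb F Y \<in> Ob C'" "KO a Y \<in> Ob C'" "KO b X \<in> Ob C'" using X Y F.FOb by auto
  note c = C'.Comp_Hom[OF ob(4,1,2) Ff tX(2)]
  show "KM b a X Y f \<in> Hom C' (KO b X) (KO a Y)"
    unfolding KM_def by (rule C'.Comp_Hom[OF ob(4,2,3) tY(1) c])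
  show "KM b a X Y (Act C X Y h f) = Act C' (KO b X) (KO a Y) h (KM b a X Y f)" for h
    unfolding KM_def F.FMap_Act[OF X Y f] C'.Act_invariant_Comp[OF ob(4,2,3) tY(1,3) c]
      C'.Act_Comp_inverse[OF ob(1,4,2) tX(1,3,2,4,5) Ff] ..
  fix g assume g: "g \<in> Hom C X Y"
  show "KM b a X Y (f + g) = KM b a X Y f + KM b a X Y g"
    unfolding KM_def F.FMap_add[OF X Y f g] C'.Comp_add(1)[OF ob(4,1,2) Ff F.FMap_Hom[OF X Y g] tX(2)]
    by (rule C'.Comp_add(2)[OF ob(4,2,3) tY(1) c C'.Comp_Hom[OF ob(4,1,2) F.FMap_Hom[OF X Y g] tX(2)]])
next
  fix X Y Z f g a b c assume X: "X \<in> Ob C" and Y: "Y \<in> Ob C" and Z: "Z \<in> Ob C"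
    and f: "f \<in> Hom C Y Z" and g: "g \<in> Hom C X Y"
  note tX = trans_in[OF X] and tY = trans_in[OF Y] and tZ = trans_in[OF Z]
  have ob: "FOb F X \<in> Ob C'" "FOb F Y \<in> Ob C'" "FOb F Z \<in> Ob C'" "KO c X \<in> Ob C'" "KO b Y \<in> Ob C'" "KO a Z \<in> Ob C'"
    using X Y Z F.FOb by auto
  note Ff = F.FMap_Hom[OF Y Z f] and Fg = F.FMap_Hom[OF X Y g]
  note hom = C'.Comp_Hom ob tX(1,2) tY(1,2) tZ(1,2) Ff Fg
  let ?v = "Comp C' (KO c X) (FOb F X) (FOb F Y) (FMap F X Y g) (trans_from c X)"
  have v: "?v \<in> Hom C' (KO c X) (FOb F Y)" by (intro hom)
  have "Comp C' (KO c X) (KO b Y) (FOb F Y) (trans_from b Y) (Comp C' (KO c X) (FOb F Y) (KO b Y) (trans_to b Y) ?v) = ?v"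
    using C'.Comp_assoc[OF ob(4,2,5,2) tY(2,1) v] tY(4) C'.Comp_Id(2)[OF ob(4,2) v] by simp
  moreover have "Comp C' (KO c X) (KO b Y) (FOb F Z) (Comp C' (KO b Y) (FOb F Y) (FOb F Z) (FMap F Y Z f) (trans_from b Y))
      (Comp C' (KO c X) (FOb F Y) (KO b Y) (trans_to b Y) ?v)
    = Comp C' (KO c X) (FOb F Y) (FOb F Z) (FMap F Y Z f)
      (Comp C' (KO c X) (KO b Y) (FOb F Y) (trans_from b Y) (Comp C' (KO c X) (FOb F Y) (KO b Y) (trans_to b Y) ?v))"
    by (rule C'.Comp_assoc[OF ob(4,5,2,3)]) (intro hom v)+
  moreover have "Comp C' (KO c X) (KO b Y) (KO a Z) (KM b a Y Z f) (KM c b X Y g)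
    = Comp C' (KO c X) (FOb F Z) (KO a Z) (trans_to a Z)
      (Comp C' (KO c X) (KO b Y) (FOb F Z) (Comp C' (KO b Y) (FOb F Y) (FOb F Z) (FMap F Y Z f) (trans_from b Y))
        (Comp C' (KO c X) (FOb F Y) (KO b Y) (trans_to b Y) ?v))"
    unfolding KM_def by (rule C'.Comp_assoc[OF ob(4,5,3,6)]) (intro hom v)+
  moreover have "KM c a X Z (Comp C X Y Z f g) = Comp C' (KO c X) (FOb F Z) (KO a Z) (trans_to a Z)
      (Comp C' (KO c X) (FOb F Y) (FOb F Z) (FMap F Y Z f) ?v)"
    unfolding KM_def F.FMap_Comp[OF X Y Z f g] using C'.Comp_assoc[OF ob(4,1,2,3) Ff Fg tX(2)] by simp
  ultimately show "KM c a X Z (Comp C X Y Z f g) = Comp C' (KO c X) (KO b Y) (KO a Z) (KM b a Y Z f) (KM c b X Y g)" by simp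
qed (simp add: KO_def F.FOb G.FOb)

lemma KM_ends:
  assumes X: "X \<in> Ob C" and Y: "Y \<in> Ob C" and f: "f \<in> Hom C X Y"
  shows "FMap F X Y f = KM 0 0 X Y f" "FMap G X Y f = KM 1 1 X Y f"
proof -
  have ob: "FOb F X \<in> Ob C'" "FOb F Y \<in> Ob C'" "FOb G X \<in> Ob C'" "FOb G Y \<in> Ob C'" using X Y F.FOb G.FOb by auto
  note Ff = F.FMap_Hom[OF X Y f] and Gf = G.FMap_Hom[OF X Y f]
  show "FMap F X Y f = KM 0 0 X Y f"
    by (simp add: KM_def KO_def trans_to_def trans_from_def C'.Comp_Id[OF ob(1,2) Ff])
  have "KM 1 1 X Y f = Comp C' (FOb G X) (FOb F Y) (FOb G Y) (\<eta> Y) (Comp C' (FOb G X) (FOb F X) (FOb F Y) (FMap F X Y f) (\<theta> X))"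
    by (simp add: KM_def KO_def trans_to_def trans_from_def)
  also have "\<dots> = Comp C' (FOb G X) (FOb F X) (FOb G Y) (Comp C' (FOb F X) (FOb G X) (FOb G Y) (FMap G X Y f) (\<eta> X)) (\<theta> X)"
    using C'.Comp_assoc[OF ob(3,1,2,4) \<eta>(1)[OF Y] Ff \<theta>(1)[OF X]] natural[OF X Y f] by simp
  also have "\<dots> = FMap G X Y f"
    using C'.Comp_assoc[OF ob(3,1,3,4) Gf \<eta>(1)[OF X] \<theta>(1)[OF X]] \<theta>(3)[OF X] C'.Comp_Id(1)[OF ob(3,4) Gf] by simp
  finally show "FMap G X Y f = KM 1 1 X Y f" by simp
qed

lemma special_homotopic_Q_map:
  "special_homotopic \<H> (cyclic_Q \<H> C M) (cyclic_Q \<H> C' M) (Q_map \<H> C' M F) (Q_map \<H> C' M G)"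
  by (rule special_homotopic_hmap; rule Q_map_eq) (simp_all add: KM_ends KO_def)

end

theorem proposition3p16:
  fixes \<H> :: "('k::comm_ring_1, 'l::{ring,monoid_mult}, 'r::{ring,monoid_mult},
      'h::{ring,monoid_mult}) hopf_data"
    and C :: "('o, 'f::ab_group_add, 'h) hcat"
    and C' :: "('o1, 'f1::ab_group_add, 'h) hcat"
    and F G :: "('o, 'f, 'o1, 'f1) hfunctor"
    and M :: "('r, 'h, 'm::ab_group_add) coeff"
  assumes "hopf_algebroid \<H>" and "bij (anti \<H>)"
    and "h_category \<H> C" and "h_category \<H> C'"
    and "equivariant_functor C C' F" and "equivariant_functor C C' G"
    and "equivalent_functors \<H> C C' F G"
    and "module_comodule \<H> M" and "is_stable \<H> M"
  shows "special_homotopic \<H> (cyclic_Q \<H> C M) (cyclic_Q \<H> C' M) (Q_map \<H> C' M F) (Q_map \<H> C' M G)"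
proof -
  obtain \<eta> where \<eta>: "\<forall>X\<in>Ob C. \<eta> X \<in> Hom C' (FOb F X) (FOb G X) \<and>
        h_invariant \<H> C' (FOb F X) (FOb G X) (\<eta> X) \<and>
        (\<exists>\<theta>\<in>Hom C' (FOb G X) (FOb F X).
           Comp C' (FOb F X) (FOb G X) (FOb F X) \<theta> (\<eta> X) = Idm C' (FOb F X) \<and>
           Comp C' (FOb G X) (FOb F X) (FOb G X) (\<eta> X) \<theta> = Idm C' (FOb G X))"
    "\<forall>X\<in>Ob C. \<forall>Y\<in>Ob C. \<forall>f\<in>Hom C X Y.
        Comp C' (FOb F X) (FOb F Y) (FOb G Y) (\<eta> Y) (FMap F X Y f) =
        Comp C' (FOb F X) (FOb G X) (FOb G Y) (FMap G X Y f) (\<eta> X)"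
    using assms(7) unfolding equivalent_functors_def by blast
  then obtain \<theta> where \<theta>: "\<forall>X\<in>Ob C. \<theta> X \<in> Hom C' (FOb G X) (FOb F X) \<and>
           Comp C' (FOb F X) (FOb G X) (FOb F X) (\<theta> X) (\<eta> X) = Idm C' (FOb F X) \<and>
           Comp C' (FOb G X) (FOb F X) (FOb G X) (\<eta> X) (\<theta> X) = Idm C' (FOb G X)"
    by metis
  have hopf: "bijective_hopf_algebroid \<H>"
    using assms(1,2) by (simp add: bijective_hopf_algebroid_def bijective_hopf_algebroid_axioms_def)
  have "hcat_coeff \<H> C M" "hcat_coeff \<H> C' M"
    using hopf assms by (simp_all add: hcat_coeff_def)
  then have "equivalence \<H> C C' M F G \<eta> \<theta>"
    using assms(5,6) \<eta> \<theta> by (simp add: equivalence_def equivalence_axioms_def)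
  then show ?thesis by (rule equivalence.special_homotopic_Q_map)
qed

end
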